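(* Let $N\ge3$, $k>0$, $2<p<2^\ast$, $Q\in L^\infty_c(\mathbb{R}^N,\mathbb{R})\setminus\{0\}$ and $\varphi\in L^\infty(\mathbb{R}^N)$. Assume that (Q1) $Q\le0$ a.e. in $\mathbb{R}^N$, and (Q2) $\operatorname{diam}(\operatorname{supp}Q)\le\frac{\mathbf{z}(N)}{k}$, where $\mathbf{z}(N)$ denotes the first positive zero of the Bessel function $Y_{\frac{N-2}{2}}$ of the second kind of order $\frac{N-2}{2}$. Then there exist a constant $C=C(N,k,p,\|Q\|_\infty,|\operatorname{supp}Q|)>0$ (depending only on the listed quantities) and $m=m(N,k,p)\in\mathbb{N}$ (depending only on $N,k,p$) such that for any solution $u\in L^\infty(\mathbb{R}^N)$ of $$u=\mathcal{R}_k\big(Q|u|^{p-2}u\big)+\varphi$$ we have $$\|u\|_\infty\le C\Big(1+\|\varphi\|_\infty^{(p-1)^m}\Big).$$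
   Context: $L^\infty(\mathbb{R}^N)$ consists of complex-valued functions; $L^\infty_c(\mathbb{R}^N,\mathbb{R})$ is the set of real-valued functions in $L^\infty(\mathbb{R}^N)$ with compact support; $|A|$ denotes the Lebesgue measure of a set $A$. $2^\ast=\frac{2N}{N-2}$ is the critical Sobolev exponent. The outgoing fundamental solution is $$\Phi_k(x)=\frac{i}{4}\Big(\frac{k}{2\pi|x|}\Big)^{\frac{N-2}{2}}H^{(1)}_{\frac{N-2}{2}}(k|x|),\qquad x\in\mathbb{R}^N\setminus\{0\},$$ where $H^{(1)}_\nu$ is the Hankel function of the first kind of order $\nu$, and $\mathcal{R}_kf=\Phi_k*f$. *)

theory Defs
  imports "HOL-Probability.Essential_Supremum"
begin

text \<open>
  Bessel functions of real order, for positive real argument. As \<^const>\<open>rGamma\<close> is the entire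
  function \<open>1/\<Gamma>\<close>, the series for \<open>J\<^sub>\<nu>\<close> is meaningful for every real \<open>\<nu>\<close>, negative integers included.
\<close>

definition bessel_J :: "real \<Rightarrow> real \<Rightarrow> real" where
  "bessel_J \<nu> x =
     (\<Sum>m. (-1) ^ m * rGamma (real m + \<nu> + 1) / fact m * (x / 2) powr (2 * real m + \<nu>))"

text \<open>
  At integer order the defining quotient is \<open>0/0\<close> and is replaced by its limit in the order.
  In \<^const>\<open>Lim\<close> only orders different from \<open>\<nu>\<close>, hence eventually only non-integers, matter.
\<close>

definition bessel_Y :: "real \<Rightarrow> real \<Rightarrow> real" where
  "bessel_Y \<nu> x =
     (let q = (\<lambda>\<mu>. (bessel_J \<mu> x * cos (\<mu> * pi) - bessel_J (- \<mu>) x) / sin (\<mu> * pi))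
      in if \<nu> \<in> \<int> then Lim (at \<nu>) q else q \<nu>)"

definition hankel1 :: "real \<Rightarrow> real \<Rightarrow> complex" where
  "hankel1 \<nu> x = Complex (bessel_J \<nu> x) (bessel_Y \<nu> x)"

definition bessel_Y_first_zero :: "real \<Rightarrow> real" where
  "bessel_Y_first_zero \<nu> = (LEAST x. 0 < x \<and> bessel_Y \<nu> x = 0)"

text \<open>
  The outgoing fundamental solution of the Helmholtz equation, with \<open>N = CARD('n)\<close>.
  Its value at the origin is a dummy, irrelevant under the integral.
\<close>

definition helmholtz_Phi :: "real \<Rightarrow> real ^ 'n \<Rightarrow> complex" where
  "helmholtz_Phi k x =
     (let \<nu> = (real CARD('n) - 2) / 2
      in \<i> / 4 * of_real ((k / (2 * pi * norm x)) powr \<nu>) * hankel1 \<nu> (k * norm x))"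

definition helmholtz_R :: "real \<Rightarrow> (real ^ 'n \<Rightarrow> complex) \<Rightarrow> real ^ 'n \<Rightarrow> complex" where
  "helmholtz_R k f x = (LINT y|lebesgue. helmholtz_Phi k (x - y) * f y)"

text \<open>Elements of \<open>L\<^sup>\<infinity>\<close> are represented by functions, equal when they agree almost everywhere.\<close>

definition Linf :: "('a::euclidean_space \<Rightarrow> 'b::real_normed_vector) set" where
  "Linf = {f \<in> borel_measurable lebesgue. esssup lebesgue (\<lambda>x. ereal (norm (f x))) < \<infinity>}"

definition Linf_norm :: "('a::euclidean_space \<Rightarrow> 'b::real_normed_vector) \<Rightarrow> real" where
  "Linf_norm f = real_of_ereal (esssup lebesgue (\<lambda>x. ereal (norm (f x))))"

text \<open>
  The support of a class of functions modulo null sets: the complement of the largest open set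
  on which the function vanishes almost everywhere.
\<close>

definition ess_support :: "('a::euclidean_space \<Rightarrow> 'b::zero) \<Rightarrow> 'a set" where
  "ess_support f = - \<Union> {U. open U \<and> (AE x in lebesgue. x \<in> U \<longrightarrow> f x = 0)}"

end

(*
Multiply the equation by the conjugate of f = Q|u|^(p-2)u and integrate. The point is that the
real part of the pairing of f with R_k f is nonnegative: supp Q has diameter at most
R = z(N)/k, so only the values of Re Phi_k on the ball of radius R matter, and Re Phi_k
restricted to that ball is a positive definite kernel. As Q <= 0, this bounds int |Q||u|^p by
int |Q||u|^(p-1)|phi|, hence by a multiple of ||phi||^p. Inserting this into the equation and
splitting Phi_k |u|^(p-1) <= ||u||^(p/q-1) (|Phi_k|^q + |u|^p) with p/2 < q < N/(N-2) bounds
||u|| by a power of itself smaller than one, so no bootstrap is needed.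

Positive definiteness: writing the radial kernel as a superposition of balls, its Fourier
transform at |xi| = s is, by Lommel's integral, a positive multiple of
(1 - j(sR)/j(z)) / (s^2 - k^2), where j(x) = x^(-nu) J_nu(x), nu = (N-2)/2 and z = kR is the first
zero of Y_nu. Its sign reduces to j(x) <= j(z) for x >= z and j(x) >= j(z) for x <= z. The first
inequality compares the amplitudes of J_nu and Y_nu through the energy of the oscillator equation
for sqrt(x) J_nu(x), the Wronskian and Sturm's lower bound for the gap between zeros. The order
nu is an integer or half-integer, and Y_nu at integers is the derivative of the series in the order.
*)
theory Submission
  imports Defs "HOL-Probability.Distributions"
begin

section \<open>Bessel functions of real order\<close>

text \<open>Without truncation Re \<Phi>_k has, formally, a positive multiple of 1 / (s^2 - k^2) as
  transform, which is negative for s < k. Cutting at R = z/k repairs this for two reasons. As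
  Y_\<nu> vanishes at z, the cut kernel decreases to 0 without a jump, so the balls get nonnegative
  weights; and the numerator 1 - j(sR)/j(z) vanishes at s = k together with the denominator.

  The hard case is s > k, where the inequality must survive all later oscillations of J_\<nu>. A
  violation at a point t > z lies beyond a full negative arc of J_\<nu>, of length at least \<pi> /
  sqrt V, with V the oscillator potential at t. The energy bound at t loses the factor V; the decay
  of x^(-\<nu>) across the arc wins it back. For odd N the limiting energies are exactly 2/\<pi> and
  the argument closes without margin; for even N they are bounded numerically from order 0, at the
  cost of a factor 3/2.

  The exponent q exceeds p/2 to make the power p/q - 1 of ||u|| smaller than one and stays below
  N/(N-2) to make |\<Phi>_k|^q locally integrable; such q exist exactly for subcritical p.\<close>

definition exp_transform :: "(nat \<Rightarrow> real) \<Rightarrow> real \<Rightarrow> real" where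
  "exp_transform c t = (\<Sum>m. c m * (- t) ^ m / fact m)"

lemma exp_transform_summable_bound:
  fixes c :: "nat \<Rightarrow> real"
  assumes "\<And>m. \<bar>c m\<bar> \<le> K" "\<bar>t\<bar> \<le> T"
  shows "\<bar>c m * (- t) ^ m / fact m\<bar> \<le> K * (T ^ m / fact m)"
proof -
  have "\<bar>c m\<bar> * (\<bar>t\<bar> ^ m / fact m) \<le> K * (T ^ m / fact m)"
    using assms(1)[of m] assms(2)
    by (intro mult_mono divide_right_mono power_mono) auto
  then show ?thesis by (simp add: abs_mult power_abs)
qed

lemma exp_transform_summable:
  fixes c :: "nat \<Rightarrow> real"
  assumes "\<And>m. \<bar>c m\<bar> \<le> K"
  shows "summable (\<lambda>m. c m * (- t) ^ m / fact m)"
proof (rule summable_comparison_test)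
  have "norm (c m * (- t) ^ m / fact m) \<le> K * (\<bar>t\<bar> ^ m / fact m)" for m
    using exp_transform_summable_bound[of c K t "\<bar>t\<bar>" m] assms by simp
  then show "\<exists>N. \<forall>m\<ge>N. norm (c m * (- t) ^ m / fact m) \<le> K * (\<bar>t\<bar> ^ m / fact m)" by blast
  show "summable (\<lambda>m. K * (\<bar>t\<bar> ^ m / fact m))"
    using summable_exp_generic[of "\<bar>t\<bar>"] by (intro summable_mult) (simp add: divide_inverse mult.commute)
qed

text \<open>Division by \<open>fact m\<close> turns differentiation into a shift of the
  coefficients, up to sign. For the coefficients 1/\<Gamma>(m + \<mu> + 1) the shift raises \<mu> by
  one, so the next Bessel order is a derivative of the entire factor.\<close>

lemma exp_transform_deriv:
  fixes c :: "nat \<Rightarrow> real"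
  assumes "\<And>m. \<bar>c m\<bar> \<le> K"
  shows "(exp_transform c has_real_derivative - exp_transform (\<lambda>m. c (Suc m)) t) (at t)"
proof -
  define a where "a m = (-1) ^ m * c m / fact m" for m
  have s: "summable (\<lambda>m. a m * x ^ m)" for x
    using exp_transform_summable[of c K x, OF assms]
    by (rule back_subst[of summable]) (auto simp: a_def fun_eq_iff power_minus[of x])
  have "((\<lambda>x. \<Sum>m. a m * x ^ m) has_real_derivative (\<Sum>m. diffs a m * t ^ m)) (at t)"
    by (rule termdiffs_strong[of _ "\<bar>t\<bar> + 1"]) (auto simp: s)
  moreover have "(\<Sum>m. a m * x ^ m) = exp_transform c x" for x
    by (auto simp: exp_transform_def a_def power_minus[of x] intro!: suminf_cong)
  moreover have "(\<Sum>m. diffs a m * t ^ m) = - exp_transform (\<lambda>m. c (Suc m)) t"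
  proof -
    have "diffs a m * t ^ m = - (c (Suc m) * (- t) ^ m / fact m)" for m
      by (simp add: diffs_def a_def power_minus[of t] divide_simps del: of_nat_Suc)
    then show ?thesis
      using exp_transform_summable[of "\<lambda>m. c (Suc m)" K t] assms
      by (simp add: exp_transform_def suminf_minus)
  qed
  ultimately show ?thesis by simp
qed

lemma exp_transform_0: "exp_transform c 0 = c 0"
proof -
  have "(\<lambda>m. c m * (- 0) ^ m / fact m) sums (\<Sum>m\<in>{0}. c m * (- 0) ^ m / fact m)"
    by (rule sums_finite) auto
  then show ?thesis by (simp add: exp_transform_def sums_iff)
qed

text \<open>The hypothesis is the step of a recurrence such as \<open>1/\<Gamma>(s+1) = 1/(s \<Gamma>(s))\<close>.\<close>

lemma bounded_by_recurrence:
  fixes g :: "real \<Rightarrow> real"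
  assumes "continuous_on UNIV g" and step: "\<And>s. s \<ge> 2 \<Longrightarrow> \<bar>g (s + 1)\<bar> \<le> \<bar>g s\<bar> / 2 + C"
  obtains K where "\<And>s. s \<ge> a \<Longrightarrow> \<bar>g s\<bar> \<le> K"
proof -
  have "compact (g ` {min a 2..3})"
    by (intro compact_continuous_image continuous_on_subset[OF assms(1)]) auto
  then have "bounded (g ` {min a 2..3})" by (rule compact_imp_bounded)
  then obtain B where "\<forall>x\<in>{min a 2..3}. \<bar>g x\<bar> \<le> B" by (auto simp: bounded_iff)
  then have B: "\<And>s. min a 2 \<le> s \<Longrightarrow> s \<le> 3 \<Longrightarrow> \<bar>g s\<bar> \<le> B" by auto
  define K where "K = max B (2 * \<bar>C\<bar>)"
  have "\<bar>g s\<bar> \<le> K" if "min a 2 \<le> s" "s \<le> 3 + real n" for s n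
    using that
  proof (induction n arbitrary: s)
    case 0 then show ?case using B[of s] by (auto simp: K_def)
  next
    case (Suc n)
    show ?case
    proof (cases "s \<le> 3")
      case True
      then show ?thesis using B[of s] Suc.prems by (auto simp: K_def)
    next
      case False
      then have "\<bar>g (s - 1)\<bar> \<le> K" using Suc by auto
      moreover have "\<bar>g s\<bar> \<le> \<bar>g (s - 1)\<bar> / 2 + C" using step[of "s - 1"] False by simp
      moreover have "2 * \<bar>C\<bar> \<le> K" by (simp add: K_def)
      ultimately show ?thesis by linarith
    qed
  qed
  then have "\<bar>g s\<bar> \<le> K" if "s \<ge> a" for s
    using that real_arch_simple[of "s - 3"] by (metis add.commute diff_le_eq min.coboundedI1)
  then show thesis using that by blast
qed

section \<open>The reciprocal Gamma function and its derivative\<close>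

definition deriv_rGamma :: "real \<Rightarrow> real" where
  "deriv_rGamma = deriv rGamma"

lemma rGamma_has_deriv: "(rGamma has_real_derivative deriv_rGamma s) (at s)"
  unfolding deriv_rGamma_def by (metis DERIV_imp_deriv has_field_derivative_rGamma)

lemma rGamma_step: "s * rGamma (s + 1) = rGamma (s::real)"
  by (rule rGamma_plus1)

lemma deriv_rGamma_step: "s * deriv_rGamma (s + 1) + rGamma (s + 1) = deriv_rGamma s"
proof -
  have "((\<lambda>s. s * rGamma (s + 1)) has_real_derivative (rGamma (s + 1) + s * deriv_rGamma (s + 1))) (at s)"
    using DERIV_mult[OF DERIV_ident DERIV_shift[of rGamma _ s 1, THEN iffD1, OF rGamma_has_deriv]]
    by (simp add: mult.commute)
  then have "(rGamma has_real_derivative (rGamma (s + 1) + s * deriv_rGamma (s + 1))) (at s)"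
    by (simp add: rGamma_step)
  then show ?thesis using DERIV_unique[OF _ rGamma_has_deriv] by fastforce
qed

lemma rGamma_bounded:
  fixes a :: real
  obtains K where "\<And>s. s \<ge> a \<Longrightarrow> \<bar>rGamma s\<bar> \<le> K"
proof (rule bounded_by_recurrence[of "rGamma :: real \<Rightarrow> real" 0 a])
  show "continuous_on UNIV (rGamma :: real \<Rightarrow> real)" by (rule continuous_on_rGamma)
  show "\<bar>rGamma (s + 1)\<bar> \<le> \<bar>rGamma s\<bar> / 2 + 0" if "s \<ge> 2" for s :: real
  proof -
    have "2 * \<bar>rGamma (s + 1)\<bar> \<le> s * \<bar>rGamma (s + 1)\<bar>" using that by (intro mult_right_mono) auto
    then show ?thesis using that by (simp add: rGamma_step[of s, symmetric] abs_mult)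
  qed
qed (use that in blast)

text \<open>Induction to the left: on the positive axis the derivative is -\<psi>/\<Gamma> with the
  continuous digamma function \<psi>, and the differentiated functional equation extends continuity
  by one unit at a time. This bypasses the poles of \<psi>, where (1/\<Gamma>)' stays
  finite.\<close>

lemma continuous_on_deriv_rGamma: "continuous_on A deriv_rGamma"
proof -
  have "continuous_on {- real n<..} deriv_rGamma" for n
  proof (induction n)
    case 0
    have pos: "s \<notin> \<int>\<^sub>\<le>\<^sub>0" if "s > 0" for s :: real using that by (auto elim!: nonpos_Ints_cases)
    have "deriv_rGamma s = - rGamma s * Digamma s" if "s > 0" for s
      using DERIV_unique[OF rGamma_has_deriv has_field_derivative_rGamma_no_nonpos_int[OF pos[OF that]]] .
    moreover have "continuous_on {0<..} (\<lambda>s::real. - rGamma s * Digamma s)"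
      by (intro continuous_intros continuous_on_Polygamma) (auto dest: pos)
    ultimately show ?case
      using continuous_on_cong[of "{0<..}" "{0<..}" deriv_rGamma "\<lambda>s. - rGamma s * Digamma s"] by simp
  next
    case (Suc n)
    have "continuous_on {- real (Suc n)<..} (\<lambda>s. s * deriv_rGamma (s + 1) + rGamma (s + 1))"
      by (intro continuous_intros continuous_on_compose2[OF Suc]
          continuous_on_compose2[OF continuous_on_rGamma[of UNIV]]) auto
    then show ?case by (simp add: deriv_rGamma_step)
  qed
  then have "isCont deriv_rGamma s" for s
  proof -
    obtain n :: nat where "- s < real n" using reals_Archimedean2 by blast
    then show ?thesis
      using \<open>continuous_on {- real n<..} deriv_rGamma\<close>
      by (auto simp: continuous_on_eq_continuous_at)
  qed
  then show ?thesis by (simp add: continuous_at_imp_continuous_on)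
qed

text \<open>The inhomogeneous term of the recurrence is a value of 1/\<Gamma>, which is already
  bounded; the division by s \<ge> 2 contracts the rest.\<close>

lemma deriv_rGamma_bounded:
  fixes a :: real
  obtains K where "\<And>s. s \<ge> a \<Longrightarrow> \<bar>deriv_rGamma s\<bar> \<le> K"
proof -
  obtain C where C: "\<And>s. s \<ge> (2::real) \<Longrightarrow> \<bar>rGamma s\<bar> \<le> C" using rGamma_bounded by blast
  have "\<bar>deriv_rGamma (s + 1)\<bar> \<le> \<bar>deriv_rGamma s\<bar> / 2 + C" if "s \<ge> 2" for s
  proof -
    have "2 * \<bar>deriv_rGamma (s + 1)\<bar> \<le> s * \<bar>deriv_rGamma (s + 1)\<bar>"
      using that by (intro mult_right_mono) auto
    also have "\<dots> = \<bar>deriv_rGamma s - rGamma (s + 1)\<bar>"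
      using that by (simp add: deriv_rGamma_step[of s, symmetric] abs_mult)
    also have "\<dots> \<le> \<bar>deriv_rGamma s\<bar> + C" using C[of "s + 1"] that by linarith
    finally show ?thesis using C[of 2] by linarith
  qed
  with bounded_by_recurrence[OF continuous_on_deriv_rGamma, of C a] that show thesis by blast
qed

section \<open>The entire factor of J and its derivative in the order\<close>

text \<open>The Bessel-Clifford function at -t: J_\<nu>(x) is (x/2)^\<nu> times its value at t =
  x^2/4. It is differentiable in the order also at negative integers, which the limit defining Y_n
  requires.\<close>

definition bessel_entire :: "real \<Rightarrow> real \<Rightarrow> real" where
  "bessel_entire \<mu> = exp_transform (\<lambda>m. rGamma (real m + \<mu> + 1))"

text \<open>The derivative of \<open>bessel_entire\<close> in the order, written termwise;
  \<open>bessel_entire_deriv_order\<close> justifies it.\<close>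

definition bessel_entire_order :: "real \<Rightarrow> real \<Rightarrow> real" where
  "bessel_entire_order \<mu> = exp_transform (\<lambda>m. deriv_rGamma (real m + \<mu> + 1))"

lemma rGamma_coeff_bounded: "\<exists>K. \<forall>m. \<bar>rGamma (real m + \<mu> + 1)\<bar> \<le> K"
proof -
  obtain K where "\<And>s. s \<ge> \<mu> + 1 \<Longrightarrow> \<bar>rGamma s\<bar> \<le> K" using rGamma_bounded by blast
  then show ?thesis by (intro exI[of _ K]) auto
qed

lemma deriv_rGamma_coeff_bounded: "\<exists>K. \<forall>m. \<bar>deriv_rGamma (real m + \<mu> + 1)\<bar> \<le> K"
proof -
  obtain K where "\<And>s. s \<ge> \<mu> + 1 \<Longrightarrow> \<bar>deriv_rGamma s\<bar> \<le> K" using deriv_rGamma_bounded by blast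
  then show ?thesis by (intro exI[of _ K]) auto
qed

lemma bessel_entire_summable:
  "summable (\<lambda>m. rGamma (real m + \<mu> + 1) * (- t) ^ m / fact m)"
proof -
  obtain K where "\<And>m. \<bar>rGamma (real m + \<mu> + 1)\<bar> \<le> K" using rGamma_coeff_bounded by blast
  then show ?thesis by (rule exp_transform_summable)
qed

lemma bessel_entire_order_summable:
  "summable (\<lambda>m. deriv_rGamma (real m + \<mu> + 1) * (- t) ^ m / fact m)"
proof -
  obtain K where "\<And>m. \<bar>deriv_rGamma (real m + \<mu> + 1)\<bar> \<le> K" using deriv_rGamma_coeff_bounded by blast
  then show ?thesis by (rule exp_transform_summable)
qed

lemma bessel_entire_deriv:
  "(bessel_entire \<mu> has_real_derivative - bessel_entire (\<mu> + 1) t) (at t)"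
proof -
  obtain K where "\<And>m. \<bar>rGamma (real m + \<mu> + 1)\<bar> \<le> K" using rGamma_coeff_bounded by blast
  from exp_transform_deriv[of "\<lambda>m. rGamma (real m + \<mu> + 1)", OF this]
  show ?thesis by (simp add: bessel_entire_def add_ac)
qed

lemma bessel_entire_order_deriv:
  "(bessel_entire_order \<mu> has_real_derivative - bessel_entire_order (\<mu> + 1) t) (at t)"
proof -
  obtain K where "\<And>m. \<bar>deriv_rGamma (real m + \<mu> + 1)\<bar> \<le> K" using deriv_rGamma_coeff_bounded by blast
  from exp_transform_deriv[of "\<lambda>m. deriv_rGamma (real m + \<mu> + 1)", OF this]
  show ?thesis by (simp add: bessel_entire_order_def add_ac)
qed

text \<open>Multiplication by -t is the reverse shift: the coefficient of (-t)^m / m! becomes m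
  c_{m-1}. It converts the part of a coefficient that is linear in m into a term of the next
  order.\<close>

lemma exp_transform_mult_arg:
  assumes "\<And>m. \<bar>c m\<bar> \<le> K"
  shows "(\<lambda>m. real m * (if m = 0 then 0 else c (m - 1)) * (- t) ^ m / fact m) sums (- t * exp_transform c t)"
proof -
  have s: "(\<lambda>m. c m * (- t) ^ m / fact m) sums exp_transform c t"
    using exp_transform_summable[of c K t, OF assms] by (simp add: exp_transform_def summable_sums)
  have "(\<lambda>m. real (Suc m) * c m * (- t) ^ Suc m / fact (Suc m)) sums (- t * exp_transform c t)"
    using sums_mult[OF s, of "- t"] by (simp add: divide_simps del: of_nat_Suc) (simp add: mult_ac)
  then have "(\<lambda>m. real (Suc m) * (if Suc m = 0 then 0 else c (Suc m - 1)) * (- t) ^ Suc m / fact (Suc m))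
      sums (- t * exp_transform c t)" by simp
  from sums_Suc[OF this] show ?thesis by simp
qed

lemma shifted_coeff:
  "real m * (if m = 0 then 0 else g (real (m - 1) + (\<mu> + 1) + 1)) = real m * g (real m + \<mu> + (1::real))"
  by (cases m) (auto simp: add_ac)

text \<open>Coefficientwise this is (m + \<mu>)/\<Gamma>(m + \<mu> + 1) = 1/\<Gamma>(m + \<mu>): the
  summand \<mu> stays at order \<mu>, the summand m gives order \<mu> + 1 by the reverse
  shift.\<close>

lemma bessel_entire_recurrence:
  "bessel_entire (\<mu> - 1) t = \<mu> * bessel_entire \<mu> t - t * bessel_entire (\<mu> + 1) t"
proof -
  obtain K where K: "\<And>m. \<bar>rGamma (real m + (\<mu> + 1) + 1)\<bar> \<le> K" using rGamma_coeff_bounded by blast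
  have "(\<lambda>m. \<mu> * (rGamma (real m + \<mu> + 1) * (- t) ^ m / fact m) +
           real m * (if m = 0 then 0 else rGamma (real (m - 1) + (\<mu> + 1) + 1)) * (- t) ^ m / fact m)
         sums (\<mu> * bessel_entire \<mu> t + (- t * bessel_entire (\<mu> + 1) t))"
    unfolding bessel_entire_def
    by (intro sums_add sums_mult exp_transform_mult_arg[of _ K] K)
       (use bessel_entire_summable in \<open>simp add: exp_transform_def summable_sums\<close>)
  moreover have "\<mu> * (rGamma (real m + \<mu> + 1) * (- t) ^ m / fact m) +
           real m * (if m = 0 then 0 else rGamma (real (m - 1) + (\<mu> + 1) + 1)) * (- t) ^ m / fact m
         = rGamma (real m + (\<mu> - 1) + 1) * (- t) ^ m / fact m" for m
    using rGamma_step[of "real m + \<mu>"]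
    by (simp only: shifted_coeff) (simp add: add_divide_distrib[symmetric] ring_distribs[symmetric] mult.assoc[symmetric] add_ac)
  ultimately have "(\<lambda>m. rGamma (real m + (\<mu> - 1) + 1) * (- t) ^ m / fact m)
         sums (\<mu> * bessel_entire \<mu> t - t * bessel_entire (\<mu> + 1) t)" by simp
  then show ?thesis by (simp add: bessel_entire_def exp_transform_def sums_iff)
qed

text \<open>The derivative of the preceding recurrence in \<mu>, obtained on the coefficients; the
  product rule contributes the extra \<open>bessel_entire \<mu> t\<close>.\<close>

lemma bessel_entire_order_recurrence:
  "bessel_entire_order (\<mu> - 1) t
     = bessel_entire \<mu> t + \<mu> * bessel_entire_order \<mu> t - t * bessel_entire_order (\<mu> + 1) t"
proof -
  obtain K where K: "\<And>m. \<bar>deriv_rGamma (real m + (\<mu> + 1) + 1)\<bar> \<le> K" using deriv_rGamma_coeff_bounded by blast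
  have "(\<lambda>m. rGamma (real m + \<mu> + 1) * (- t) ^ m / fact m +
           \<mu> * (deriv_rGamma (real m + \<mu> + 1) * (- t) ^ m / fact m) +
           real m * (if m = 0 then 0 else deriv_rGamma (real (m - 1) + (\<mu> + 1) + 1)) * (- t) ^ m / fact m)
         sums (bessel_entire \<mu> t + \<mu> * bessel_entire_order \<mu> t + (- t * bessel_entire_order (\<mu> + 1) t))"
    unfolding bessel_entire_def bessel_entire_order_def
    by (intro sums_add sums_mult exp_transform_mult_arg[of _ K] K)
       (use bessel_entire_summable bessel_entire_order_summable in \<open>simp_all add: exp_transform_def summable_sums\<close>)
  moreover have "rGamma (real m + \<mu> + 1) * (- t) ^ m / fact m +
           \<mu> * (deriv_rGamma (real m + \<mu> + 1) * (- t) ^ m / fact m) +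
           real m * (if m = 0 then 0 else deriv_rGamma (real (m - 1) + (\<mu> + 1) + 1)) * (- t) ^ m / fact m
         = deriv_rGamma (real m + (\<mu> - 1) + 1) * (- t) ^ m / fact m" for m
    using deriv_rGamma_step[of "real m + \<mu>"]
    by (simp only: shifted_coeff) (simp add: add_divide_distrib[symmetric] ring_distribs[symmetric] mult.assoc[symmetric] add_ac)
  ultimately have "(\<lambda>m. deriv_rGamma (real m + (\<mu> - 1) + 1) * (- t) ^ m / fact m)
         sums (bessel_entire \<mu> t + \<mu> * bessel_entire_order \<mu> t - t * bessel_entire_order (\<mu> + 1) t)" by simp
  then show ?thesis by (simp add: bessel_entire_order_def exp_transform_def sums_iff)
qed

lemma bessel_entire_0: "bessel_entire \<mu> 0 = rGamma (\<mu> + 1)"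
  by (simp add: bessel_entire_def exp_transform_0)

lemma bessel_entire_order_0: "bessel_entire_order \<mu> 0 = deriv_rGamma (\<mu> + 1)"
  by (simp add: bessel_entire_order_def exp_transform_0)

lemma bessel_entire_deriv_order:
  "((\<lambda>\<mu>. bessel_entire \<mu> t) has_real_derivative bessel_entire_order \<mu> t) (at \<mu>)"
proof -
  define f where "f m s = rGamma (real m + s + 1) * (- t) ^ m / fact m" for m and s :: real
  define f' where "f' m s = deriv_rGamma (real m + s + 1) * (- t) ^ m / fact m" for m and s :: real
  \<comment> \<open>For s > \<mu> - 1 every argument m + s + 1 exceeds \<mu>, so one bound on
    [\<mu>, \<infinity>) serves all terms and all nearby orders, as the Weierstrass test
    demands.\<close>
  obtain K where K: "\<And>s. s \<ge> \<mu> \<Longrightarrow> \<bar>deriv_rGamma s\<bar> \<le> K" using deriv_rGamma_bounded by blast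
  have "\<exists>g. \<forall>s\<in>{\<mu> - 1<..<\<mu> + 1}. (\<lambda>m. f m s) sums g s \<and>
        (g has_real_derivative (\<Sum>m. f' m s)) (at s within {\<mu> - 1<..<\<mu> + 1})"
  proof (rule has_field_derivative_series)
    show "convex {\<mu> - 1<..<\<mu> + 1}" by simp
    show "(f m has_real_derivative f' m s) (at s within {\<mu> - 1<..<\<mu> + 1})" for m s
    proof -
      have "((\<lambda>x. rGamma (x + (real m + 1))) has_real_derivative deriv_rGamma (s + (real m + 1))) (at s)"
        using rGamma_has_deriv[of "s + (real m + 1)"] by (simp add: DERIV_shift)
      then have "(f m has_real_derivative f' m s) (at s)"
        using DERIV_cmult_right[where c = "(- t) ^ m / fact m"] by (fastforce simp: f_def [abs_def] f'_def add_ac)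
      then show ?thesis by (rule DERIV_subset) simp
    qed
    show "uniform_limit {\<mu> - 1<..<\<mu> + 1} (\<lambda>n s. \<Sum>i<n. f' i s) (\<lambda>s. \<Sum>m. f' m s) sequentially"
    proof (rule Weierstrass_m_test)
      show "norm (f' m s) \<le> K * (\<bar>t\<bar> ^ m / fact m)" if "s \<in> {\<mu> - 1<..<\<mu> + 1}" for m s
      proof -
        have "\<bar>deriv_rGamma (real m + s + 1)\<bar> * (\<bar>t\<bar> ^ m / fact m) \<le> K * (\<bar>t\<bar> ^ m / fact m)"
          using K[of "real m + s + 1"] that by (intro mult_right_mono) auto
        then show ?thesis by (simp add: f'_def abs_mult power_abs)
      qed
      show "summable (\<lambda>m. K * (\<bar>t\<bar> ^ m / fact m))"
        using summable_exp_generic[of "\<bar>t\<bar>"]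
        by (intro summable_mult) (simp add: divide_inverse mult.commute)
    qed
    show "\<mu> \<in> {\<mu> - 1<..<\<mu> + 1}" by simp
    show "summable (\<lambda>m. f m \<mu>)" unfolding f_def by (rule bessel_entire_summable)
  qed
  then obtain g where g: "\<And>s. s \<in> {\<mu> - 1<..<\<mu> + 1} \<Longrightarrow> (\<lambda>m. f m s) sums g s"
      "\<And>s. s \<in> {\<mu> - 1<..<\<mu> + 1} \<Longrightarrow>
        (g has_real_derivative (\<Sum>m. f' m s)) (at s within {\<mu> - 1<..<\<mu> + 1})" by blast
  have g1: "(g has_real_derivative bessel_entire_order \<mu> t) (at \<mu>)"
    using g(2)[of \<mu>] at_within_open[of \<mu> "{\<mu> - 1<..<\<mu> + 1}"]
    by (simp add: f'_def bessel_entire_order_def exp_transform_def)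
  have g2: "g s = bessel_entire s t" if "s \<in> {\<mu> - 1<..<\<mu> + 1}" for s
    using g(1)[OF that] by (simp add: f_def bessel_entire_def exp_transform_def sums_iff)
  show ?thesis
    by (rule has_field_derivative_transform_within_open[OF g1, of "{\<mu> - 1<..<\<mu> + 1}"]) (auto intro: g2)
qed

section \<open>Differentiation rules and recurrences of J and Y\<close>

text \<open>The derivative of J in its order; the logarithm comes from (x/2)^\<mu>.\<close>

definition bessel_J_order :: "real \<Rightarrow> real \<Rightarrow> real" where
  "bessel_J_order \<mu> x =
     (x / 2) powr \<mu> * (ln (x / 2) * bessel_entire \<mu> (x\<^sup>2 / 4) + bessel_entire_order \<mu> (x\<^sup>2 / 4))"

lemma bessel_J_eq:
  assumes "x > 0"
  shows "bessel_J \<nu> x = (x / 2) powr \<nu> * bessel_entire \<nu> (x\<^sup>2 / 4)"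
proof -
  have "(-1) ^ m * rGamma (real m + \<nu> + 1) / fact m * (x / 2) powr (2 * real m + \<nu>)
      = (x / 2) powr \<nu> * (rGamma (real m + \<nu> + 1) * (- (x\<^sup>2 / 4)) ^ m / fact m)" for m
  proof -
    have "(x / 2) powr (2 * real m) = (x\<^sup>2 / 4) ^ m"
      using assms powr_realpow[of "x / 2" "2 * m"] by (simp add: power_mult power_divide)
    then have "(x / 2) powr (2 * real m + \<nu>) = (x\<^sup>2 / 4) ^ m * (x / 2) powr \<nu>"
      by (simp add: powr_add)
    then show ?thesis by (simp add: power_minus[of "x\<^sup>2 / 4"])
  qed
  then have "bessel_J \<nu> x = (\<Sum>m. (x / 2) powr \<nu> * (rGamma (real m + \<nu> + 1) * (- (x\<^sup>2 / 4)) ^ m / fact m))"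
    unfolding bessel_J_def by (intro suminf_cong)
  also have "\<dots> = (x / 2) powr \<nu> * bessel_entire \<nu> (x\<^sup>2 / 4)"
    unfolding bessel_entire_def exp_transform_def by (rule suminf_mult[OF bessel_entire_summable])
  finally show ?thesis .
qed

lemma half_powr_deriv:
  assumes "x > 0"
  shows "((\<lambda>x. (x / 2) powr \<mu>) has_real_derivative (\<mu> / x) * (x / 2) powr \<mu>) (at x)"
proof -
  have "((\<lambda>x. (x / 2) powr \<mu>) has_real_derivative (\<mu> * (x / 2) powr (\<mu> - 1) * (1 / 2))) (at x)"
    using assms by (auto intro!: derivative_eq_intros)
  then show ?thesis using assms by (simp add: powr_diff field_simps)
qed

lemma half_powr_add1: "x > 0 \<Longrightarrow> (x / 2) powr (\<mu> + 1) = (x / 2) * (x / 2) powr \<mu>"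
  and half_powr_diff1: "x > 0 \<Longrightarrow> (x / 2) powr (\<mu> - 1) = (2 / x) * (x / 2) powr \<mu>" for x :: real
  by (simp_all add: powr_add powr_diff)

lemma bessel_entire_square_deriv:
  "((\<lambda>x. bessel_entire \<mu> (x\<^sup>2 / 4)) has_real_derivative - bessel_entire (\<mu> + 1) (x\<^sup>2 / 4) * (x / 2)) (at x)"
  by (rule DERIV_chain2[OF bessel_entire_deriv]) (auto intro!: derivative_eq_intros)

lemma bessel_J_deriv:
  assumes "x > 0"
  shows "(bessel_J \<nu> has_real_derivative (\<nu> / x * bessel_J \<nu> x - bessel_J (\<nu> + 1) x)) (at x)"
proof -
  from DERIV_mult[OF half_powr_deriv[OF assms] bessel_entire_square_deriv[of \<nu>]]
  have "((\<lambda>x. (x / 2) powr \<nu> * bessel_entire \<nu> (x\<^sup>2 / 4)) has_real_derivative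
      (\<nu> / x * bessel_J \<nu> x - bessel_J (\<nu> + 1) x)) (at x)"
    by (simp add: assms bessel_J_eq half_powr_add1) (simp add: algebra_simps)
  then show ?thesis
    by (rule has_field_derivative_transform_within_open[of _ _ _ "{0<..}"])
      (use assms in \<open>auto simp: bessel_J_eq\<close>)
qed

lemma bessel_J_recurrence:
  assumes "x > 0"
  shows "bessel_J (\<nu> - 1) x + bessel_J (\<nu> + 1) x = 2 * \<nu> / x * bessel_J \<nu> x"
  using assms bessel_entire_recurrence[of \<nu> "x\<^sup>2 / 4"]
  by (simp add: bessel_J_eq half_powr_add1 half_powr_diff1) (simp add: field_simps power2_eq_square)

lemma bessel_J_order_deriv:
  assumes "x > 0"
  shows "(bessel_J_order \<mu> has_real_derivative
     (\<mu> / x * bessel_J_order \<mu> x + bessel_J \<mu> x / x - bessel_J_order (\<mu> + 1) x)) (at x)"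
proof -
  have t: "((\<lambda>x. x\<^sup>2 / 4) has_real_derivative x / 2) (at x)" by (auto intro!: derivative_eq_intros)
  have l: "((\<lambda>x. ln (x / 2)) has_real_derivative 1 / x) (at x)"
    using assms by (auto intro!: derivative_eq_intros)
  show ?thesis
    unfolding bessel_J_order_def[abs_def]
    using DERIV_mult[OF half_powr_deriv[OF assms, of \<mu>] DERIV_add[OF
        DERIV_mult[OF l DERIV_chain2[OF bessel_entire_deriv[of \<mu>] t]]
        DERIV_chain2[OF bessel_entire_order_deriv[of \<mu>] t]]]
    by (rule back_subst[of "\<lambda>d. (_ has_real_derivative d) _"])
      (use assms in \<open>simp add: bessel_J_eq half_powr_add1, simp add: algebra_simps\<close>)
qed

lemma bessel_J_order_recurrence:
  assumes "x > 0"
  shows "bessel_J_order (\<mu> - 1) x + bessel_J_order (\<mu> + 1) x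
     = 2 / x * bessel_J \<mu> x + 2 * \<mu> / x * bessel_J_order \<mu> x"
  using assms
  by (simp add: bessel_J_order_def bessel_J_eq half_powr_add1 half_powr_diff1
      bessel_entire_recurrence[of \<mu>] bessel_entire_order_recurrence[of \<mu>])
    (simp add: field_simps power2_eq_square)

lemma bessel_J_deriv_order:
  assumes "x > 0"
  shows "((\<lambda>\<mu>. bessel_J \<mu> x) has_real_derivative bessel_J_order \<mu> x) (at \<mu>)"
proof -
  have "((\<lambda>\<mu>. (x / 2) powr \<mu>) has_real_derivative (x / 2) powr \<mu> * ln (x / 2)) (at \<mu>)"
    using assms by (auto intro!: derivative_eq_intros)
  from DERIV_mult[OF this bessel_entire_deriv_order[of "x\<^sup>2 / 4" \<mu>]] show ?thesis
    using assms by (simp add: bessel_J_eq bessel_J_order_def algebra_simps)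
qed

text \<open>Both sides satisfy the same three-term recurrence in n, and at order 0 this recurrence
  reads J_{-1} = -J_1.\<close>

lemma bessel_J_neg_nat:
  assumes "x > 0"
  shows "bessel_J (- real n) x = (-1) ^ n * bessel_J (real n) x"
proof (induction n rule: induct_nat_012)
  case 1
  show ?case using bessel_J_recurrence[OF assms, of 0] by simp
next
  case (ge2 n)
  define q where "q = 2 * real (Suc n) / x"
  have "- real (Suc n) - 1 = - real (Suc (Suc n))" "- real (Suc n) + 1 = - real n"
    "real (Suc n) - 1 = real n" "real (Suc n) + 1 = real (Suc (Suc n))" by simp_all
  then have "bessel_J (- real (Suc (Suc n))) x + bessel_J (- real n) x = - q * bessel_J (- real (Suc n)) x"
    "bessel_J (real n) x + bessel_J (real (Suc (Suc n))) x = q * bessel_J (real (Suc n)) x"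
    using bessel_J_recurrence[OF assms, of "- real (Suc n)"] bessel_J_recurrence[OF assms, of "real (Suc n)"]
    by (simp_all only: q_def)
  then have "bessel_J (- real (Suc (Suc n))) x = - q * bessel_J (- real (Suc n)) x - bessel_J (- real n) x"
    "bessel_J (real (Suc (Suc n))) x = q * bessel_J (real (Suc n)) x - bessel_J (real n) x" by linarith+
  then show ?case by (simp only: ge2) (simp add: algebra_simps)
qed simp

lemma cos_sin_nat_pi: "cos (real n * pi) = (-1) ^ n" "sin (real n * pi) = 0"
  by (simp_all add: cos_npi sin_npi)

text \<open>L'Hospital's rule in the order: numerator and denominator of the defining quotient
  vanish at n, and their difference quotients converge. As the derivative of cos(\<mu>\<pi>)
  vanishes at integers, only the two order derivatives of J remain.\<close>

lemma bessel_Y_nat: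
  assumes "x > 0"
  shows "bessel_Y (real n) x = (bessel_J_order (real n) x + (-1) ^ n * bessel_J_order (- real n) x) / pi"
proof -
  define F where "F \<mu> = bessel_J \<mu> x * cos (\<mu> * pi) - bessel_J (- \<mu>) x" for \<mu>
  define S where "S \<mu> = sin (\<mu> * pi)" for \<mu> :: real
  define d where "d = (-1) ^ n * bessel_J_order (real n) x + bessel_J_order (- real n) x"
  have "((\<lambda>\<mu>. bessel_J (- \<mu>) x) has_real_derivative - bessel_J_order (- real n) x) (at (real n))"
    using DERIV_chain2[OF bessel_J_deriv_order[OF assms] DERIV_minus[OF DERIV_ident]] by simp
  moreover have "((\<lambda>\<mu>. cos (\<mu> * pi)) has_real_derivative 0) (at (real n))"
    by (auto intro!: derivative_eq_intros simp: cos_sin_nat_pi)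
  ultimately have "(F has_real_derivative d) (at (real n))"
    unfolding F_def[abs_def] d_def
    using DERIV_diff[OF DERIV_mult[OF bessel_J_deriv_order[OF assms]]] cos_sin_nat_pi(1)[of n]
    by (fastforce simp: mult.commute)
  moreover have "F (real n) = 0" by (simp add: F_def cos_sin_nat_pi bessel_J_neg_nat[OF assms])
  ultimately have F: "((\<lambda>\<mu>. F \<mu> / (\<mu> - real n)) \<longlongrightarrow> d) (at (real n))"
    by (simp add: has_field_derivative_iff)
  have "(S has_real_derivative (-1) ^ n * pi) (at (real n))"
    unfolding S_def[abs_def] by (auto intro!: derivative_eq_intros simp: cos_sin_nat_pi)
  then have S: "((\<lambda>\<mu>. S \<mu> / (\<mu> - real n)) \<longlongrightarrow> (-1) ^ n * pi) (at (real n))"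
    using cos_sin_nat_pi[of n] by (simp add: has_field_derivative_iff S_def)
  have "((\<lambda>\<mu>. (F \<mu> / (\<mu> - real n)) / (S \<mu> / (\<mu> - real n))) \<longlongrightarrow> d / ((-1) ^ n * pi)) (at (real n))"
    by (rule tendsto_divide[OF F S]) auto
  moreover have "\<forall>\<^sub>F \<mu> in at (real n). (F \<mu> / (\<mu> - real n)) / (S \<mu> / (\<mu> - real n)) = F \<mu> / S \<mu>"
    by (auto simp: eventually_at intro!: exI[of _ 1])
  ultimately have "((\<lambda>\<mu>. F \<mu> / S \<mu>) \<longlongrightarrow> d / ((-1) ^ n * pi)) (at (real n))"
    by (rule Lim_transform_eventually)
  then have "Lim (at (real n)) (\<lambda>\<mu>. F \<mu> / S \<mu>) = d / ((-1) ^ n * pi)"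
    by (intro tendsto_Lim) auto
  then show ?thesis
    by (cases "even n") (simp_all add: bessel_Y_def F_def S_def d_def Let_def divide_simps)
qed

text \<open>At half-integers the cosine vanishes and the sine is 1 or -1, so Y is J of the opposite
  order up to sign.\<close>

lemma bessel_Y_nat_half:
  "bessel_Y (real n + 1 / 2) x = - ((-1) ^ n * bessel_J (- (real n + 1 / 2)) x)"
proof -
  have "real n + 1 / 2 \<notin> \<int>"
  proof
    assume "real n + 1 / 2 \<in> \<int>"
    then obtain k :: int where "real n + 1 / 2 = of_int k" by (auto elim: Ints_cases)
    then have "of_int (2 * k) = (of_int (2 * int n + 1) :: real)" by simp
    then have "2 * k = 2 * int n + 1" by (simp only: of_int_eq_iff)
    then show False by presburger
  qed
  moreover have "cos ((real n + 1 / 2) * pi) = 0" "sin ((real n + 1 / 2) * pi) = (-1) ^ n"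
    using cos_sin_nat_pi[of n] by (simp_all add: distrib_right cos_add sin_add)
  ultimately show ?thesis by (cases "even n") (simp_all add: bessel_Y_def)
qed

lemma half_nat_cases:
  obtains m where "real n / 2 = real m" | m where "real n / 2 = real m + 1 / 2"
proof (cases "even n")
  case True
  then show thesis using that(1)[of "n div 2"] by (auto elim: evenE)
next
  case False
  then show thesis using that(2)[of "n div 2"] by (auto elim!: oddE)
qed

text \<open>The rule for J at order -\<nu> leads to order -\<nu> + 1; the recurrence replaces this
  by -\<nu> - 1, which belongs to Y of order \<nu> + 1. At integer orders the same is done with the
  order derivatives, whose extra terms J/x cancel.\<close>

lemma bessel_Y_deriv:
  assumes "x > 0" and \<nu>: "\<nu> = real n / 2"
  shows "(bessel_Y \<nu> has_real_derivative (\<nu> / x * bessel_Y \<nu> x - bessel_Y (\<nu> + 1) x)) (at x)"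
proof (cases rule: half_nat_cases[of n])
  case (1 m)
  define G where "G x = (bessel_J_order (real m) x + (-1) ^ m * bessel_J_order (- real m) x) / pi" for x
  have minus_one: "bessel_J_order (- real m - 1) x = bessel_J_order (- real (Suc m)) x"
    by (rule arg_cong[where f = "\<lambda>a. bessel_J_order a x"]) simp
  have e: "2 / x * J = J / x + J / x" "2 * - real m / x * K = - 2 * (real m / x * K)"
      "- real m / x * K = - (real m / x * K)" for J K by (simp_all add: add_divide_distrib[symmetric])
  have "(bessel_J_order (- real m) has_real_derivative
      (real m / x * bessel_J_order (- real m) x - bessel_J (- real m) x / x + bessel_J_order (- real (Suc m)) x)) (at x)"
    using bessel_J_order_deriv[OF assms(1), of "- real m"]
    by (rule back_subst[of "\<lambda>d. (_ has_real_derivative d) _"])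
      (use bessel_J_order_recurrence[OF assms(1), of "- real m"] minus_one e(1)[of "bessel_J (- real m) x"] e(2,3)[of "bessel_J_order (- real m) x"]
        in linarith)
  from DERIV_cdivide[OF DERIV_add[OF bessel_J_order_deriv[OF assms(1), of "real m"] DERIV_cmult[OF this, of "(-1) ^ m"]], of pi]
  have "(G has_real_derivative (real m / x * G x - bessel_Y (real (Suc m)) x)) (at x)"
    unfolding G_def[abs_def] bessel_Y_nat[OF assms(1)]
    by (rule back_subst[of "\<lambda>d. (_ has_real_derivative d) _"])
      (use assms(1) in \<open>simp add: bessel_J_neg_nat add_ac field_simps flip: power_mult_distrib\<close>)
  then have "(bessel_Y (real m) has_real_derivative (real m / x * G x - bessel_Y (real (Suc m)) x)) (at x)"
    by (rule has_field_derivative_transform_within_open[of _ _ _ "{0<..}"])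
      (use assms in \<open>auto simp: bessel_Y_nat G_def\<close>)
  then show ?thesis using 1 assms by (simp add: bessel_Y_nat G_def add.commute)
next
  case (2 m)
  have "(bessel_J (- (real m + 1 / 2)) has_real_derivative
      ((real m + 1 / 2) / x * bessel_J (- (real m + 1 / 2)) x + bessel_J (- (real m + 1 / 2) - 1) x)) (at x)"
    using bessel_J_deriv[OF assms(1), of "- (real m + 1 / 2)"]
    by (rule back_subst[of "\<lambda>d. (_ has_real_derivative d) _"])
      (use bessel_J_recurrence[OF assms(1), of "- (real m + 1 / 2)"] assms(1) in \<open>simp add: field_simps\<close>)
  from DERIV_minus[OF DERIV_cmult[OF this, of "(-1) ^ m"]]
  have "(bessel_Y (real m + 1 / 2) has_real_derivative
      ((real m + 1 / 2) / x * bessel_Y (real m + 1 / 2) x - bessel_Y (real (Suc m) + 1 / 2) x)) (at x)"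
    unfolding bessel_Y_nat_half[abs_def]
    by (rule back_subst[of "\<lambda>d. (_ has_real_derivative d) _"]) (simp add: algebra_simps)
  then show ?thesis unfolding \<nu> 2 by (simp add: add_ac)
qed

lemma bessel_Y_recurrence:
  assumes "x > 0" and \<nu>: "\<nu> = real n / 2"
  shows "bessel_Y \<nu> x + bessel_Y (\<nu> + 2) x = 2 * (\<nu> + 1) / x * bessel_Y (\<nu> + 1) x"
proof (cases rule: half_nat_cases[of n])
  case (1 m)
  define q where "q = 2 * real (m + 1) / x"
  have "- real (m + 1) - 1 = - real (m + 2)" "- real (m + 1) + 1 = - real m"
    "real (m + 1) - 1 = real m" "real (m + 1) + 1 = real (m + 2)" by simp_all
  then have "bessel_J_order (- real (m + 2)) x + bessel_J_order (- real m) x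
      = 2 / x * bessel_J (- real (m + 1)) x - q * bessel_J_order (- real (m + 1)) x"
    "bessel_J_order (real m) x + bessel_J_order (real (m + 2)) x
      = 2 / x * bessel_J (real (m + 1)) x + q * bessel_J_order (real (m + 1)) x"
    using bessel_J_order_recurrence[OF assms(1), of "- real (m + 1)"]
      bessel_J_order_recurrence[OF assms(1), of "real (m + 1)"]
    by (simp_all only: q_def)
  then have "bessel_J_order (- real (m + 2)) x
      = 2 / x * bessel_J (- real (m + 1)) x - q * bessel_J_order (- real (m + 1)) x - bessel_J_order (- real m) x"
    "bessel_J_order (real (m + 2)) x
      = 2 / x * bessel_J (real (m + 1)) x + q * bessel_J_order (real (m + 1)) x - bessel_J_order (real m) x"
    by linarith+
  then have "bessel_Y (real m) x + bessel_Y (real (m + 2)) x = q * bessel_Y (real (m + 1)) x"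
    unfolding bessel_Y_nat[OF assms(1)] bessel_J_neg_nat[OF assms(1)]
    by (simp only:) (simp add: add_divide_distrib diff_divide_distrib algebra_simps)
  then have "bessel_Y (real m) x + bessel_Y (real (m + 2)) x = 2 * real (m + 1) / x * bessel_Y (real (m + 1)) x"
    by (simp only: q_def)
  then show ?thesis using 1 \<nu> by (simp add: add_ac)
next
  case (2 m)
  have "bessel_J (- (real m + 1 / 2)) x + bessel_J (- (real (m + 2) + 1 / 2)) x
      = - (2 * (real (m + 1) + 1 / 2) / x) * bessel_J (- (real (m + 1) + 1 / 2)) x"
  proof -
    have "- (real (m + 1) + 1 / 2) - 1 = - (real (m + 2) + 1 / 2)"
      "- (real (m + 1) + 1 / 2) + 1 = - (real m + 1 / 2)" by simp_all
    with bessel_J_recurrence[OF assms(1), of "- (real (m + 1) + 1 / 2)"] show ?thesis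
      by (simp only: add.commute mult_minus_right minus_divide_left mult_minus_left)
  qed
  then have "bessel_Y (real m + 1 / 2) x + bessel_Y (real (m + 2) + 1 / 2) x
      = 2 * (real (m + 1) + 1 / 2) / x * bessel_Y (real (m + 1) + 1 / 2) x"
    unfolding bessel_Y_nat_half by (cases "even m") (simp_all add: algebra_simps)
  then show ?thesis unfolding \<nu> 2 by (simp add: add_ac)
qed

section \<open>The Wronskian of J and Y\<close>

text \<open>This is x (J Y' - J' Y), with the derivatives eliminated by the differentiation
  rules.\<close>

definition bessel_wronskian :: "real \<Rightarrow> real \<Rightarrow> real" where
  "bessel_wronskian \<nu> x = x * (bessel_J (\<nu> + 1) x * bessel_Y \<nu> x - bessel_J \<nu> x * bessel_Y (\<nu> + 1) x)"

lemma bessel_J_deriv':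
  assumes "x > 0"
  shows "(bessel_J (\<nu> + 1) has_real_derivative (bessel_J \<nu> x - (\<nu> + 1) / x * bessel_J (\<nu> + 1) x)) (at x)"
  using bessel_J_deriv[OF assms, of "\<nu> + 1"]
  by (rule back_subst[of "\<lambda>d. (_ has_real_derivative d) _"])
    (use bessel_J_recurrence[OF assms, of "\<nu> + 1"] in \<open>simp add: algebra_simps add_divide_distrib\<close>)

lemma bessel_Y_deriv':
  assumes "x > 0" and \<nu>: "\<nu> = real n / 2"
  shows "(bessel_Y (\<nu> + 1) has_real_derivative (bessel_Y \<nu> x - (\<nu> + 1) / x * bessel_Y (\<nu> + 1) x)) (at x)"
proof -
  have "\<nu> + 1 = real (n + 2) / 2" using \<nu> by simp
  from bessel_Y_deriv[OF assms(1) this] show ?thesis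
    by (rule back_subst[of "\<lambda>d. (_ has_real_derivative d) _"])
      (use bessel_Y_recurrence[OF assms] in \<open>simp add: algebra_simps add_divide_distrib\<close>)
qed

text \<open>The three-term recurrence leaves the expression invariant, so its value has to be
  computed for the orders 0 and 1/2 only.\<close>

lemma bessel_wronskian_Suc:
  assumes "x > 0" and "\<nu> = real n / 2"
  shows "bessel_wronskian (\<nu> + 1) x = bessel_wronskian \<nu> x"
proof -
  have "bessel_J (\<nu> + 1 + 1) x = 2 * (\<nu> + 1) / x * bessel_J (\<nu> + 1) x - bessel_J \<nu> x"
    using bessel_J_recurrence[OF assms(1), of "\<nu> + 1"] by (simp add: algebra_simps)
  moreover have "bessel_Y (\<nu> + 1 + 1) x = 2 * (\<nu> + 1) / x * bessel_Y (\<nu> + 1) x - bessel_Y \<nu> x"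
    using bessel_Y_recurrence[OF assms] by (simp add: algebra_simps)
  ultimately show ?thesis
    unfolding bessel_wronskian_def by (simp only:) (simp add: algebra_simps)
qed

lemma bessel_wronskian_const:
  assumes "x > 0" "y > 0" and \<nu>: "\<nu> = real n / 2"
  shows "bessel_wronskian \<nu> x = bessel_wronskian \<nu> y"
proof -
  have "(bessel_wronskian \<nu> has_real_derivative 0) (at x within {0<..})" if "x \<in> {0<..}" for x
  proof -
    have "0 < x" using that by simp
    note d = bessel_J_deriv[OF this, of \<nu>] bessel_J_deriv'[OF this, of \<nu>]
      bessel_Y_deriv[OF this \<nu>] bessel_Y_deriv'[OF this \<nu>]
    have "(bessel_wronskian \<nu> has_real_derivative 0) (at x)"
      unfolding bessel_wronskian_def[abs_def]
      using DERIV_mult[OF DERIV_ident DERIV_diff[OF DERIV_mult[OF d(2,3)] DERIV_mult[OF d(1,4)]]]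
      by (rule back_subst[of "\<lambda>d. (_ has_real_derivative d) _"])
        (use \<open>0 < x\<close> in \<open>simp add: field_simps\<close>)
    then show ?thesis by (rule DERIV_subset) simp
  qed
  from has_field_derivative_zero_constant[OF _ this] obtain c where "\<forall>x\<in>{0<..}. bessel_wronskian \<nu> x = c"
    by auto
  then show ?thesis using assms(1,2) by simp
qed

lemma tendsto_bessel_entire_0:
  "((\<lambda>x. bessel_entire \<mu> (x\<^sup>2 / 4)) \<longlongrightarrow> rGamma (\<mu> + 1)) (at_right 0)"
proof -
  have "isCont (\<lambda>x. bessel_entire \<mu> (x\<^sup>2 / 4)) 0"
    by (intro isCont_o2[OF _ DERIV_isCont[OF bessel_entire_deriv]] continuous_intros) simp
  then show ?thesis
    using filterlim_mono[OF _ order_refl at_le[of "{0<..}" UNIV]]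
    by (fastforce simp: isCont_def bessel_entire_0)
qed

lemma tendsto_bessel_entire_order_0:
  "((\<lambda>x. bessel_entire_order \<mu> (x\<^sup>2 / 4)) \<longlongrightarrow> deriv_rGamma (\<mu> + 1)) (at_right 0)"
proof -
  have "isCont (\<lambda>x. bessel_entire_order \<mu> (x\<^sup>2 / 4)) 0"
    by (intro isCont_o2[OF _ DERIV_isCont[OF bessel_entire_order_deriv]] continuous_intros) simp
  then show ?thesis
    using filterlim_mono[OF _ order_refl at_le[of "{0<..}" UNIV]]
    by (fastforce simp: isCont_def bessel_entire_order_0)
qed

lemma tendsto_square_ln_half: "((\<lambda>x::real. x\<^sup>2 * ln (x / 2)) \<longlongrightarrow> 0) (at_right 0)"
proof (rule Lim_null_comparison)
  show "\<forall>\<^sub>F x in at_right 0. norm (x\<^sup>2 * ln (x / 2)) \<le> 2 * (x::real)"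
  proof -
    have "norm (x\<^sup>2 * ln (x / 2)) \<le> 2 * x" if "0 < x" "x < 2" for x :: real
    proof -
      have "ln (2 / x) \<le> 2 / x" using ln_bound[of "2 / x"] that by simp
      moreover have "ln (2 / x) = - ln (x / 2)" using that by (simp add: ln_div)
      moreover have "ln (x / 2) \<le> 0" using that by simp
      ultimately have "\<bar>ln (x / 2)\<bar> \<le> 2 / x" by linarith
      then have "x\<^sup>2 * \<bar>ln (x / 2)\<bar> \<le> x\<^sup>2 * (2 / x)" by (intro mult_left_mono) auto
      then show ?thesis using that by (simp add: abs_mult power2_eq_square)
    qed
    then show ?thesis by (auto simp: eventually_at_right_field intro!: exI[of _ 2])
  qed
qed (auto intro!: tendsto_eq_intros)

lemma bessel_J_at_0:
  "((\<lambda>x. x powr - \<mu> * bessel_J \<mu> x) \<longlongrightarrow> 2 powr - \<mu> * rGamma (\<mu> + 1)) (at_right 0)"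
proof (rule Lim_transform_eventually)
  show "((\<lambda>x. 2 powr - \<mu> * bessel_entire \<mu> (x\<^sup>2 / 4)) \<longlongrightarrow> 2 powr - \<mu> * rGamma (\<mu> + 1)) (at_right 0)"
    by (intro tendsto_intros tendsto_bessel_entire_0)
  show "\<forall>\<^sub>F x in at_right 0. 2 powr - \<mu> * bessel_entire \<mu> (x\<^sup>2 / 4) = x powr - \<mu> * bessel_J \<mu> x"
    by (auto simp: eventually_at_right_field bessel_J_eq powr_divide powr_minus field_simps intro!: exI[of _ 1])
qed

lemma bessel_Y_0_eq: "x > 0 \<Longrightarrow> bessel_Y 0 x = 2 / pi * bessel_J_order 0 x"
  using bessel_Y_nat[of x 0] by simp

text \<open>The constant is found in the limit x \<rightarrow> 0. In \<open>eq\<close> every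
  logarithm carries a factor x^2, and the surviving term is \<open>bessel_entire_order (- 1)\<close>
  at 0, that is (1/\<Gamma>)'(0) = 1.\<close>

lemma bessel_wronskian_0:
  assumes "x > 0"
  shows "bessel_wronskian 0 x = 2 / pi"
proof -
  let ?E = "\<lambda>\<mu> x. bessel_entire \<mu> (x\<^sup>2 / 4)" and ?D = "\<lambda>\<mu> x. bessel_entire_order \<mu> (x\<^sup>2 / 4)"
  have eq: "bessel_wronskian 0 x =
      ?E 1 x / pi * ((x\<^sup>2 * ln (x / 2)) * ?E 0 x + x\<^sup>2 * ?D 0 x)
      - ?E 0 x / pi * (((x\<^sup>2 * ln (x / 2)) * ?E 1 x + x\<^sup>2 * ?D 1 x) / 2
          - 2 * (- ((x\<^sup>2 * ln (x / 2)) * ?E 1 x / 4) + ?D (- 1) x))" if "x > 0" for x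
  proof -
    have p: "(x / 2) powr (- 1) = 2 / x" using that by (simp add: powr_minus_divide)
    \<comment> \<open>Since 1/\<Gamma>(0) = 0, the entire factor of order -1 is divisible by its
      argument; this turns the logarithm over x into x times a logarithm.\<close>
    have m: "bessel_entire (- 1) (x\<^sup>2 / 4) = - (x\<^sup>2 / 4) * ?E 1 x"
      using bessel_entire_recurrence[of 0 "x\<^sup>2 / 4"] by simp
    have "bessel_Y 1 x = (x / 2 * (ln (x / 2) * ?E 1 x + ?D 1 x)
        - 2 / x * (ln (x / 2) * (- (x\<^sup>2 / 4) * ?E 1 x) + ?D (- 1) x)) / pi"
      using bessel_Y_nat[OF that, of 1] that unfolding bessel_J_order_def of_nat_1 p m
      by (simp add: field_simps)
    moreover have "bessel_Y 0 x = 2 / pi * (ln (x / 2) * ?E 0 x + ?D 0 x)" "bessel_J 0 x = ?E 0 x"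
      "bessel_J 1 x = x / 2 * ?E 1 x"
      using that by (simp_all add: bessel_Y_0_eq bessel_J_order_def bessel_J_eq)
    ultimately have "bessel_wronskian 0 x = x * (x / 2 * ?E 1 x * (2 / pi * (ln (x / 2) * ?E 0 x + ?D 0 x)) -
       ?E 0 x * ((x / 2 * (ln (x / 2) * ?E 1 x + ?D 1 x)
        - 2 / x * (ln (x / 2) * (- (x\<^sup>2 / 4) * ?E 1 x) + ?D (- 1) x)) / pi))"
      by (simp only: bessel_wronskian_def add_0)
    then show ?thesis using that by (simp only:) (simp add: field_simps power2_eq_square)
  qed
  have x2: "((\<lambda>x::real. x\<^sup>2) \<longlongrightarrow> 0) (at_right 0)" by (auto intro!: tendsto_eq_intros)
  have "((\<lambda>x. ?E 1 x / pi * ((x\<^sup>2 * ln (x / 2)) * ?E 0 x + x\<^sup>2 * ?D 0 x)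
      - ?E 0 x / pi * (((x\<^sup>2 * ln (x / 2)) * ?E 1 x + x\<^sup>2 * ?D 1 x) / 2
          - 2 * (- ((x\<^sup>2 * ln (x / 2)) * ?E 1 x / 4) + ?D (- 1) x)))
      \<longlongrightarrow> rGamma (1 + 1) / pi * (0 * rGamma (0 + 1) + 0 * deriv_rGamma (0 + 1))
      - rGamma (0 + 1) / pi * ((0 * rGamma (1 + 1) + 0 * deriv_rGamma (1 + 1)) / 2
          - 2 * (- (0 * rGamma (1 + 1) / 4) + deriv_rGamma (- 1 + 1)))) (at_right 0)"
    by (intro tendsto_intros tendsto_bessel_entire_0 tendsto_bessel_entire_order_0 tendsto_square_ln_half x2) auto
  moreover have "deriv_rGamma 0 = 1" using deriv_rGamma_step[of 0] by simp
  ultimately have "((\<lambda>x. ?E 1 x / pi * ((x\<^sup>2 * ln (x / 2)) * ?E 0 x + x\<^sup>2 * ?D 0 x)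
      - ?E 0 x / pi * (((x\<^sup>2 * ln (x / 2)) * ?E 1 x + x\<^sup>2 * ?D 1 x) / 2
          - 2 * (- ((x\<^sup>2 * ln (x / 2)) * ?E 1 x / 4) + ?D (- 1) x))) \<longlongrightarrow> 2 / pi) (at_right 0)"
    by simp
  moreover have "\<forall>\<^sub>F y in at_right 0. ?E 1 y / pi * ((y\<^sup>2 * ln (y / 2)) * ?E 0 y + y\<^sup>2 * ?D 0 y)
      - ?E 0 y / pi * (((y\<^sup>2 * ln (y / 2)) * ?E 1 y + y\<^sup>2 * ?D 1 y) / 2
          - 2 * (- ((y\<^sup>2 * ln (y / 2)) * ?E 1 y / 4) + ?D (- 1) y)) = bessel_wronskian 0 x"
    unfolding eventually_at_right_field
    using eq bessel_wronskian_const[OF _ assms, of _ 0 0] by (intro exI[of _ 1]) auto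
  ultimately have "((\<lambda>_. bessel_wronskian 0 x) \<longlongrightarrow> 2 / pi) (at_right (0::real))"
    by (rule Lim_transform_eventually)
  then show ?thesis by (simp add: tendsto_const_iff)
qed

lemma interchange: "(a * b) * (c * d) = (a * c) * (b * d)" for a b c d :: real
  by simp

text \<open>Y is expressed through J of negative half-integer order, so the powers of x/2 combine to
  integer powers, and the limit x \<rightarrow> 0 is -2 / (\<Gamma>(3/2) \<Gamma>(-1/2)).\<close>

lemma bessel_wronskian_half:
  assumes "x > 0"
  shows "bessel_wronskian (1 / 2) x = 2 / pi"
proof -
  let ?E = "\<lambda>\<mu> x. bessel_entire \<mu> (x\<^sup>2 / 4)"
  have eq: "bessel_wronskian (1 / 2) x = - (x\<^sup>2 / 2) * ?E (3 / 2) x * ?E (- (1 / 2)) x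
      - 2 * ?E (1 / 2) x * ?E (- (3 / 2)) x" if "x > 0" for x
  proof -
    have "(x / 2) powr (3 / 2 + - (1 / 2)) = x / 2" "(x / 2) powr (1 / 2 + - (3 / 2)) = 2 / x"
      using that by (simp_all add: powr_minus_divide)
    then have "(x / 2) powr (3 / 2) * (x / 2) powr (- (1 / 2)) = x / 2"
      "(x / 2) powr (1 / 2) * (x / 2) powr (- (3 / 2)) = 2 / x" by (simp_all only: powr_add)
    then have "bessel_J (3 / 2) x * bessel_J (- (1 / 2)) x = x / 2 * (?E (3 / 2) x * ?E (- (1 / 2)) x)"
       "bessel_J (1 / 2) x * bessel_J (- (3 / 2)) x = 2 / x * (?E (1 / 2) x * ?E (- (3 / 2)) x)"
      unfolding bessel_J_eq[OF that] interchange by simp_all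
    then show ?thesis
      using that bessel_Y_nat_half[of 0 x] bessel_Y_nat_half[of 1 x]
      by (simp add: bessel_wronskian_def algebra_simps power2_eq_square)
  qed
  have x2: "((\<lambda>x::real. x\<^sup>2) \<longlongrightarrow> 0) (at_right 0)" by (auto intro!: tendsto_eq_intros)
  have "((\<lambda>x. - (x\<^sup>2 / 2) * ?E (3 / 2) x * ?E (- (1 / 2)) x - 2 * ?E (1 / 2) x * ?E (- (3 / 2)) x)
      \<longlongrightarrow> - (0 / 2) * rGamma (3 / 2 + 1) * rGamma (- (1 / 2) + 1)
        - 2 * rGamma (1 / 2 + 1) * rGamma (- (3 / 2) + 1)) (at_right 0)"
    by (intro tendsto_intros tendsto_bessel_entire_0 x2) auto
  moreover have "\<forall>\<^sub>F y in at_right 0. - (y\<^sup>2 / 2) * ?E (3 / 2) y * ?E (- (1 / 2)) y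
      - 2 * ?E (1 / 2) y * ?E (- (3 / 2)) y = bessel_wronskian (1 / 2) x"
    unfolding eventually_at_right_field
    using eq bessel_wronskian_const[OF _ assms, of _ "1 / 2" 1] by (intro exI[of _ 1]) auto
  ultimately have "((\<lambda>_. bessel_wronskian (1 / 2) x) \<longlongrightarrow> - (0 / 2) * rGamma (3 / 2 + 1) * rGamma (- (1 / 2) + 1)
        - 2 * rGamma (1 / 2 + 1) * rGamma (- (3 / 2) + 1)) (at_right (0::real))"
    by (rule Lim_transform_eventually)
  then have "bessel_wronskian (1 / 2) x = - 2 * rGamma (3 / 2) * rGamma (- (1 / 2))"
    by (simp add: tendsto_const_iff)
  also have "\<dots> = 2 / pi"
  proof -
    have "rGamma (1 / 2 :: real) = 1 / sqrt pi"
      by (simp add: rGamma_inverse_Gamma Gamma_one_half_real inverse_eq_divide)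
    moreover have "rGamma (3 / 2 :: real) = 2 * rGamma (1 / 2)" "rGamma (- (1 / 2) :: real) = - (1 / 2) * rGamma (1 / 2)"
      using rGamma_step[of "1 / 2"] rGamma_step[of "- (1 / 2)"] by simp_all
    ultimately show ?thesis by simp
  qed
  finally show ?thesis .
qed

lemma bessel_wronskian_eq:
  assumes "x > 0" and "\<nu> = real n / 2"
  shows "bessel_wronskian \<nu> x = 2 / pi"
  using assms(2)
proof (induction n arbitrary: \<nu> rule: induct_nat_012)
  case (ge2 n)
  have "\<nu> = real n / 2 + 1" using ge2(3) by simp
  then show ?case using bessel_wronskian_Suc[OF assms(1) refl, of n] ge2(1)[OF refl] by simp
qed (use bessel_wronskian_0[OF assms(1)] bessel_wronskian_half[OF assms(1)] in \<open>simp_all only: of_nat_0 of_nat_Suc\<close>, simp_all)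

section \<open>Behaviour of Y at the origin\<close>

text \<open>The Wronskian solved for Y_{\<nu>+1} asks only that x^(\<nu>+2) Y_\<nu> tend to 0 and
  then yields the exact leading term of Y_{\<nu>+1}, which implies the weak statement one order
  higher. The weak form also fits order 0, where Y is logarithmic.\<close>

lemma bessel_Y_at_0_weak:
  assumes "\<nu> = real n / 2"
  shows "((\<lambda>x. x powr (\<nu> + 2) * bessel_Y \<nu> x) \<longlongrightarrow> 0) (at_right 0)"
    and "((\<lambda>x. x powr (\<nu> + 1) * bessel_Y (\<nu> + 1) x) \<longlongrightarrow> - (2 / pi * 2 powr \<nu> * Gamma (\<nu> + 1))) (at_right 0)"
proof -
  have x2: "((\<lambda>x::real. x\<^sup>2) \<longlongrightarrow> 0) (at_right 0)" by (auto intro!: tendsto_eq_intros)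
  have step: "((\<lambda>x. x powr (\<nu> + 1) * bessel_Y (\<nu> + 1) x) \<longlongrightarrow> - (2 / pi * 2 powr \<nu> * Gamma (\<nu> + 1))) (at_right 0)"
    if "((\<lambda>x. x powr (\<nu> + 2) * bessel_Y \<nu> x) \<longlongrightarrow> 0) (at_right 0)" and \<nu>: "\<nu> = real n / 2" for \<nu> n
  proof -
    have r: "rGamma (\<nu> + 1) = 1 / Gamma (\<nu> + 1)" "Gamma (\<nu> + 1) > 0"
      using \<nu> by (simp_all add: rGamma_inverse_Gamma inverse_eq_divide Gamma_real_pos)
    have "((\<lambda>x. ((x powr - (\<nu> + 1) * bessel_J (\<nu> + 1) x) * (x powr (\<nu> + 2) * bessel_Y \<nu> x) - 2 / pi)
        / (x powr - \<nu> * bessel_J \<nu> x)) \<longlongrightarrow>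
        ((2 powr - (\<nu> + 1) * rGamma (\<nu> + 1 + 1)) * 0 - 2 / pi) / (2 powr - \<nu> * rGamma (\<nu> + 1))) (at_right 0)"
      by (intro tendsto_intros bessel_J_at_0 that) (use r in auto)
    moreover have "((2 powr - (\<nu> + 1) * rGamma (\<nu> + 1 + 1)) * 0 - 2 / pi) / (2 powr - \<nu> * rGamma (\<nu> + 1))
        = - (2 / pi * 2 powr \<nu> * Gamma (\<nu> + 1))"
      unfolding r(1) using r(2) by (simp add: powr_minus field_simps)
    moreover have "\<forall>\<^sub>F x in at_right 0. ((x powr - (\<nu> + 1) * bessel_J (\<nu> + 1) x) * (x powr (\<nu> + 2) * bessel_Y \<nu> x) - 2 / pi)
        / (x powr - \<nu> * bessel_J \<nu> x) = x powr (\<nu> + 1) * bessel_Y (\<nu> + 1) x"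
    proof -
      have "\<forall>\<^sub>F x in at_right 0. x powr - \<nu> * bessel_J \<nu> x > 0"
        using order_tendstoD(1)[OF bessel_J_at_0[of \<nu>], of 0] r by simp
      moreover have "\<forall>\<^sub>F x in at_right 0. x > (0::real)" by (simp add: eventually_at_right_less)
      ultimately show ?thesis
      proof eventually_elim
        case (elim x)
        have "x powr - (\<nu> + 1) * x powr (\<nu> + 2) = x" "x powr (\<nu> + 1) * x powr - \<nu> = x"
          using elim(2) by (simp_all add: powr_add[symmetric])
        moreover have "x * (bessel_J (\<nu> + 1) x * bessel_Y \<nu> x) - 2 / pi = x * (bessel_J \<nu> x * bessel_Y (\<nu> + 1) x)"
          using bessel_wronskian_eq[OF elim(2) \<nu>] by (simp add: bessel_wronskian_def algebra_simps)
        ultimately have "(x powr - (\<nu> + 1) * bessel_J (\<nu> + 1) x) * (x powr (\<nu> + 2) * bessel_Y \<nu> x) - 2 / pi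
           = (x powr (\<nu> + 1) * bessel_Y (\<nu> + 1) x) * (x powr - \<nu> * bessel_J \<nu> x)"
          unfolding interchange[of "x powr - (\<nu> + 1)" "bessel_J (\<nu> + 1) x" "x powr (\<nu> + 2)" "bessel_Y \<nu> x"]
            interchange[of "x powr (\<nu> + 1)" "bessel_Y (\<nu> + 1) x" "x powr - \<nu>" "bessel_J \<nu> x"]
          by (simp only: mult.commute)
        moreover have "x powr - \<nu> * bessel_J \<nu> x \<noteq> 0" using elim(1) by (metis less_irrefl)
        ultimately show ?case by (metis nonzero_divide_eq_eq)
      qed
    qed
    ultimately show ?thesis by (simp add: Lim_transform_eventually)
  qed
  have weak: "((\<lambda>x. x powr (\<nu> + 2) * bessel_Y \<nu> x) \<longlongrightarrow> 0) (at_right 0)" if "\<nu> = real n / 2" for \<nu> n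
    using that
  proof (induction n arbitrary: \<nu> rule: induct_nat_012)
    case 0
    have "((\<lambda>x. 2 / pi * ((x\<^sup>2 * ln (x / 2)) * bessel_entire 0 (x\<^sup>2 / 4) + x\<^sup>2 * bessel_entire_order 0 (x\<^sup>2 / 4)))
        \<longlongrightarrow> 2 / pi * (0 * rGamma (0 + 1) + 0 * deriv_rGamma (0 + 1))) (at_right 0)"
      by (intro tendsto_intros tendsto_bessel_entire_0 tendsto_bessel_entire_order_0 tendsto_square_ln_half x2)
    moreover have "\<forall>\<^sub>F x in at_right 0. 2 / pi * ((x\<^sup>2 * ln (x / 2)) * bessel_entire 0 (x\<^sup>2 / 4)
        + x\<^sup>2 * bessel_entire_order 0 (x\<^sup>2 / 4)) = x powr (\<nu> + 2) * bessel_Y \<nu> x"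
      using 0 by (auto simp: eventually_at_right_field bessel_Y_0_eq bessel_J_order_def algebra_simps intro!: exI[of _ 1])
    ultimately show ?case by (simp add: Lim_transform_eventually)
  next
    case 1
    have "((\<lambda>x. - (x\<^sup>2 * (2 powr (1 / 2) * bessel_entire (- (1 / 2)) (x\<^sup>2 / 4))))
        \<longlongrightarrow> - (0 * (2 powr (1 / 2) * rGamma (- (1 / 2) + 1)))) (at_right 0)"
      by (intro tendsto_intros tendsto_bessel_entire_0 x2)
    moreover have "\<forall>\<^sub>F x in at_right 0. - (x\<^sup>2 * (2 powr (1 / 2) * bessel_entire (- (1 / 2)) (x\<^sup>2 / 4)))
         = x powr (\<nu> + 2) * bessel_Y \<nu> x"
    proof -
      have "x powr (5 / 2) * (x / 2) powr (- (1 / 2)) = x\<^sup>2 * 2 powr (1 / 2)" if "x > 0" for x :: real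
      proof -
        have "x powr (5 / 2) * (x / 2) powr (- (1 / 2)) = x powr (5 / 2 + - (1 / 2)) * 2 powr (1 / 2)"
          using that by (simp only: powr_add) (simp add: powr_divide powr_minus field_simps)
        then show ?thesis using that by simp
      qed
      then show ?thesis
        unfolding 1 using bessel_Y_nat_half[of 0]
        by (auto simp: eventually_at_right_field bessel_J_eq intro!: exI[of _ 1])
    qed
    ultimately show ?case by (simp add: Lim_transform_eventually)
  next
    case (ge2 n)
    have "((\<lambda>x. x\<^sup>2 * (x powr (real n / 2 + 1) * bessel_Y (real n / 2 + 1) x)) \<longlongrightarrow>
        0 * - (2 / pi * 2 powr (real n / 2) * Gamma (real n / 2 + 1))) (at_right 0)"
      by (intro tendsto_intros x2 step[OF ge2(1)[OF refl] refl])
    moreover have "\<forall>\<^sub>F x in at_right 0. x\<^sup>2 * (x powr (real n / 2 + 1) * bessel_Y (real n / 2 + 1) x)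
        = x powr (\<nu> + 2) * bessel_Y \<nu> x"
    proof -
      have "x\<^sup>2 * x powr (real n / 2 + 1) = x powr (\<nu> + 2)" "\<nu> = real n / 2 + 1" if "x > 0" for x :: real
        using that powr_add[of x "real n / 2 + 1" 2] ge2(3) by (simp_all add: add_ac add_divide_distrib)
      then show ?thesis
        by (auto simp: eventually_at_right_field mult.assoc[symmetric] intro!: exI[of _ 1])
    qed
    ultimately show ?case by (simp add: Lim_transform_eventually)
  qed
  show "((\<lambda>x. x powr (\<nu> + 2) * bessel_Y \<nu> x) \<longlongrightarrow> 0) (at_right 0)" by (rule weak[OF assms])
  show "((\<lambda>x. x powr (\<nu> + 1) * bessel_Y (\<nu> + 1) x) \<longlongrightarrow> - (2 / pi * 2 powr \<nu> * Gamma (\<nu> + 1))) (at_right 0)"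
    by (rule step[OF weak[OF assms] assms])
qed

text \<open>Order 1/2 is read off from J_{-1/2}; from order 1 on, the leading term is the one
  produced by order \<nu> - 1.\<close>

lemma bessel_Y_at_0:
  assumes "\<nu> = real n / 2" "n \<ge> 1"
  obtains c where "c > 0" "((\<lambda>x. x powr \<nu> * bessel_Y \<nu> x) \<longlongrightarrow> - c) (at_right 0)"
proof (cases "n = 1")
  case True
  have "((\<lambda>x. - (2 powr (1 / 2) * bessel_entire (- (1 / 2)) (x\<^sup>2 / 4)))
        \<longlongrightarrow> - (2 powr (1 / 2) * rGamma (- (1 / 2) + 1))) (at_right 0)"
    by (intro tendsto_intros tendsto_bessel_entire_0)
  moreover have "\<forall>\<^sub>F x in at_right 0. - (2 powr (1 / 2) * bessel_entire (- (1 / 2)) (x\<^sup>2 / 4))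
         = x powr \<nu> * bessel_Y \<nu> x"
  proof -
    have "x powr (1 / 2) * (x / 2) powr (- (1 / 2)) = 2 powr (1 / 2)" if "x > 0" for x :: real
      using that by (simp add: powr_divide powr_minus field_simps)
    then show ?thesis
      unfolding assms(1) True using bessel_Y_nat_half[of 0]
      by (auto simp: eventually_at_right_field bessel_J_eq intro!: exI[of _ 1])
  qed
  ultimately have "((\<lambda>x. x powr \<nu> * bessel_Y \<nu> x) \<longlongrightarrow> - (2 powr (1 / 2) * rGamma (- (1 / 2) + 1))) (at_right 0)"
    by (rule Lim_transform_eventually)
  moreover have "rGamma (1 / 2 :: real) > 0"
    by (simp add: rGamma_inverse_Gamma Gamma_one_half_real)
  ultimately show thesis using that[of "2 powr (1 / 2) * rGamma (- (1 / 2) + 1)"] by simp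
next
  case False
  define \<mu> where "\<mu> = real (n - 2) / 2"
  have "\<nu> = \<mu> + 1" using assms False by (simp add: \<mu>_def of_nat_diff diff_divide_distrib)
  then show thesis
    using that[of "2 / pi * 2 powr \<mu> * Gamma (\<mu> + 1)"] bessel_Y_at_0_weak(2)[OF \<mu>_def]
    by (simp add: \<mu>_def)
qed

section \<open>Energy of the oscillator equation\<close>

text \<open>The pair of first-order relations shared by J and Y, so that the energy argument is
  carried out once for both. It is confined to the orders n/2, for which the rules for Y have been
  derived.\<close>

definition cylinder :: "(real \<Rightarrow> real \<Rightarrow> real) \<Rightarrow> bool" where
  "cylinder C \<longleftrightarrow> (\<forall>n::nat. \<forall>x>0. let \<nu> = real n / 2 in
     (C \<nu> has_real_derivative (\<nu> / x * C \<nu> x - C (\<nu> + 1) x)) (at x) \<and>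
     (C (\<nu> + 1) has_real_derivative (C \<nu> x - (\<nu> + 1) / x * C (\<nu> + 1) x)) (at x))"

lemma cylinderD:
  assumes "cylinder C" "\<nu> = real n / 2" "x > 0"
  shows "(C \<nu> has_real_derivative (\<nu> / x * C \<nu> x - C (\<nu> + 1) x)) (at x)"
    and "(C (\<nu> + 1) has_real_derivative (C \<nu> x - (\<nu> + 1) / x * C (\<nu> + 1) x)) (at x)"
  using assms(1,3) unfolding assms(2) cylinder_def Let_def by blast+

lemma cylinder_bessel_J: "cylinder bessel_J"
  using bessel_J_deriv bessel_J_deriv' by (simp add: cylinder_def Let_def)

lemma cylinder_bessel_Y: "cylinder bessel_Y"
  using bessel_Y_deriv[OF _ refl] bessel_Y_deriv'[OF _ refl] by (simp add: cylinder_def Let_def)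

definition osc :: "(real \<Rightarrow> real \<Rightarrow> real) \<Rightarrow> real \<Rightarrow> real \<Rightarrow> real" where
  "osc C \<nu> x = sqrt x * C \<nu> x"

text \<open>The derivative of \<open>osc C \<nu>\<close> (see \<open>osc_has_deriv\<close>),
  expressed through the next order so that energies of neighbouring orders can be compared.\<close>

definition osc_deriv :: "(real \<Rightarrow> real \<Rightarrow> real) \<Rightarrow> real \<Rightarrow> real \<Rightarrow> real" where
  "osc_deriv C \<nu> x = (\<nu> + 1 / 2) / x * osc C \<nu> x - osc C (\<nu> + 1) x"

definition osc_potential :: "real \<Rightarrow> real \<Rightarrow> real" where
  "osc_potential \<nu> x = 1 - (\<nu>\<^sup>2 - 1 / 4) / x\<^sup>2"

text \<open>For v'' + V v = 0 the quantity v'^2 + V v^2 has derivative V' v^2, and V' has the sign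
  of \<nu>^2 - 1/4. Hence the energy is nondecreasing for \<nu> \<ge> 1/2, constant at \<nu> = 1/2
  and nonincreasing at \<nu> = 0.\<close>

definition osc_energy :: "(real \<Rightarrow> real \<Rightarrow> real) \<Rightarrow> real \<Rightarrow> real \<Rightarrow> real" where
  "osc_energy C \<nu> x = (osc_deriv C \<nu> x)\<^sup>2 + osc_potential \<nu> x * (osc C \<nu> x)\<^sup>2"

lemma sqrt_mult_deriv:
  assumes "(f has_real_derivative d) (at x)" "x > 0"
  shows "((\<lambda>x. sqrt x * f x) has_real_derivative (sqrt x * (f x / (2 * x) + d))) (at x)"
proof -
  have "1 / (2 * sqrt x) = sqrt x / (2 * x)"
    using assms(2) real_sqrt_mult_self[of x] by (simp add: field_simps)
  moreover have "((\<lambda>x. sqrt x * f x) has_real_derivative (1 / (2 * sqrt x) * f x + d * sqrt x)) (at x)"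
    using assms by (auto intro!: derivative_eq_intros simp: field_simps)
  ultimately show ?thesis by (simp add: algebra_simps)
qed

lemma osc_has_deriv:
  assumes "cylinder C" "\<nu> = real n / 2" "x > 0"
  shows "(osc C \<nu> has_real_derivative osc_deriv C \<nu> x) (at x)"
  using sqrt_mult_deriv[OF cylinderD(1)[OF assms] assms(3)]
  unfolding osc_def[abs_def] osc_deriv_def by (simp add: algebra_simps add_divide_distrib)

lemma osc_Suc_has_deriv:
  assumes "cylinder C" "\<nu> = real n / 2" "x > 0"
  shows "(osc C (\<nu> + 1) has_real_derivative (osc C \<nu> x - (\<nu> + 1 / 2) / x * osc C (\<nu> + 1) x)) (at x)"
  using sqrt_mult_deriv[OF cylinderD(2)[OF assms] assms(3)]
  unfolding osc_def[abs_def] osc_deriv_def by (simp add: algebra_simps add_divide_distrib)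

lemma osc_deriv_has_deriv:
  assumes "cylinder C" "\<nu> = real n / 2" "x > 0"
  shows "(osc_deriv C \<nu> has_real_derivative - (osc_potential \<nu> x * osc C \<nu> x)) (at x)"
proof -
  have "((\<lambda>x. (\<nu> + 1 / 2) / x) has_real_derivative - (\<nu> + 1 / 2) / x\<^sup>2) (at x)"
    using assms(3) by (auto intro!: derivative_eq_intros simp: power2_eq_square)
  from DERIV_diff[OF DERIV_mult[OF this osc_has_deriv[OF assms]] osc_Suc_has_deriv[OF assms]]
  show ?thesis
    unfolding osc_deriv_def[abs_def]
    by (rule back_subst[of "\<lambda>d. (_ has_real_derivative d) _"])
      (use assms(3) in \<open>simp add: osc_potential_def field_simps power2_eq_square\<close>)
qed

lemma osc_energy_has_deriv:
  assumes "cylinder C" "\<nu> = real n / 2" "x > 0"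
  shows "(osc_energy C \<nu> has_real_derivative 2 * (\<nu>\<^sup>2 - 1 / 4) / x ^ 3 * (osc C \<nu> x)\<^sup>2) (at x)"
proof -
  have "(osc_potential \<nu> has_real_derivative 2 * (\<nu>\<^sup>2 - 1 / 4) / x ^ 3) (at x)"
    unfolding osc_potential_def[abs_def] using assms(3)
    by (auto intro!: derivative_eq_intros simp: field_simps power2_eq_square power3_eq_cube)
  from DERIV_add[OF DERIV_power[OF osc_deriv_has_deriv[OF assms], of 2]
      DERIV_mult[OF this DERIV_power[OF osc_has_deriv[OF assms], of 2]]]
  show ?thesis
    unfolding osc_energy_def[abs_def]
    by (rule back_subst[of "\<lambda>d. (_ has_real_derivative d) _"]) (simp add: algebra_simps)
qed

lemma osc_energy_eq:
  assumes "x > 0"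
  shows "osc_energy C \<nu> x = (osc C \<nu> x)\<^sup>2 + (osc C (\<nu> + 1) x)\<^sup>2
     - (2 * \<nu> + 1) * (osc C \<nu> x * osc C (\<nu> + 1) x / x) + (\<nu> + 1 / 2) * ((osc C \<nu> x)\<^sup>2 / x / x)"
  using assms by (simp add: osc_energy_def osc_deriv_def osc_potential_def field_simps power2_eq_square)

text \<open>The derivative at order \<nu> + 1 has two expressions, one through order \<nu> and one
  through order \<nu> + 2; they must agree.\<close>

lemma cylinder_recurrence:
  assumes "cylinder C" "\<nu> = real n / 2" "x > 0"
  shows "C (\<nu> + 2) x = 2 * (\<nu> + 1) / x * C (\<nu> + 1) x - C \<nu> x"
proof -
  have "\<nu> + 1 = real (n + 2) / 2" using assms by simp
  then have "(C (\<nu> + 1) has_real_derivative ((\<nu> + 1) / x * C (\<nu> + 1) x - C (\<nu> + 1 + 1) x)) (at x)"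
    using cylinderD(1)[OF assms(1) _ assms(3)] by blast
  moreover have "(C (\<nu> + 1) has_real_derivative (C \<nu> x - (\<nu> + 1) / x * C (\<nu> + 1) x)) (at x)"
    by (rule cylinderD(2)[OF assms])
  ultimately have "(\<nu> + 1) / x * C (\<nu> + 1) x - C (\<nu> + 1 + 1) x = C \<nu> x - (\<nu> + 1) / x * C (\<nu> + 1) x"
    by (rule DERIV_unique)
  moreover have "2 * (\<nu> + 1) / x * C (\<nu> + 1) x = (\<nu> + 1) / x * C (\<nu> + 1) x + (\<nu> + 1) / x * C (\<nu> + 1) x"
    by (simp add: add_divide_distrib[symmetric])
  ultimately have "C (\<nu> + 1 + 1) x = 2 * (\<nu> + 1) / x * C (\<nu> + 1) x - C \<nu> x" by linarith
  then show ?thesis by (simp only: add.assoc one_add_one)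
qed

text \<open>Far out the potential is at least 1/2, so the energy controls v and v', and through v'
  the next order.\<close>

lemma osc_bounded_of_energy:
  assumes "eventually (\<lambda>x. osc_energy C \<nu> x \<le> E) at_top"
  obtains K where "eventually (\<lambda>x. \<bar>osc C \<nu> x\<bar> \<le> K \<and> \<bar>osc C (\<nu> + 1) x\<bar> \<le> K) at_top"
proof -
  define M where "M = sqrt (2 * \<bar>E\<bar>)"
  have "((\<lambda>x. 1 - (\<nu>\<^sup>2 - 1 / 4) * inverse x * inverse x) \<longlongrightarrow> 1 - (\<nu>\<^sup>2 - 1 / 4) * 0 * 0) at_top"
    by (intro tendsto_intros tendsto_inverse_0_at_top filterlim_ident)
  then have "eventually (\<lambda>x. 1 / 2 < 1 - (\<nu>\<^sup>2 - 1 / 4) * inverse x * inverse x) at_top"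
    by (rule order_tendstoD(1)) simp
  then have "eventually (\<lambda>x. \<bar>osc C \<nu> x\<bar> \<le> M \<and> \<bar>osc C (\<nu> + 1) x\<bar> \<le> \<bar>\<nu> + 1 / 2\<bar> * M + M) at_top"
    using assms eventually_ge_at_top[of 1]
  proof eventually_elim
    case (elim x)
    have q: "osc_potential \<nu> x \<ge> 1 / 2"
      using elim by (simp add: osc_potential_def power2_eq_square field_simps)
    have "1 / 2 * (osc C \<nu> x)\<^sup>2 \<le> osc_potential \<nu> x * (osc C \<nu> x)\<^sup>2"
      using q by (intro mult_right_mono) auto
    moreover have "(osc_deriv C \<nu> x)\<^sup>2 \<ge> 0" "(osc C \<nu> x)\<^sup>2 \<ge> 0" by auto
    ultimately have "(osc C \<nu> x)\<^sup>2 \<le> 2 * \<bar>E\<bar>" "(osc_deriv C \<nu> x)\<^sup>2 \<le> 2 * \<bar>E\<bar>"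
      using elim(2) unfolding osc_energy_def by linarith+
    then have v: "\<bar>osc C \<nu> x\<bar> \<le> M" "\<bar>osc_deriv C \<nu> x\<bar> \<le> M"
      unfolding M_def by (simp_all add: real_le_rsqrt)
    have "osc C (\<nu> + 1) x = (\<nu> + 1 / 2) / x * osc C \<nu> x - osc_deriv C \<nu> x" by (simp add: osc_deriv_def)
    then have "\<bar>osc C (\<nu> + 1) x\<bar> \<le> \<bar>(\<nu> + 1 / 2) / x * osc C \<nu> x\<bar> + \<bar>osc_deriv C \<nu> x\<bar>" by linarith
    also have "\<bar>(\<nu> + 1 / 2) / x * osc C \<nu> x\<bar> \<le> \<bar>\<nu> + 1 / 2\<bar> * M"
    proof -
      have "\<bar>\<nu> + 1 / 2\<bar> / x \<le> \<bar>\<nu> + 1 / 2\<bar> / 1" using elim(3) by (intro divide_left_mono) auto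
      then show ?thesis unfolding abs_mult using v elim(3) by (intro mult_mono) auto
    qed
    finally show ?case using v by linarith
  qed
  moreover have "M \<ge> 0" by (simp add: M_def)
  ultimately have "eventually (\<lambda>x. \<bar>osc C \<nu> x\<bar> \<le> \<bar>\<nu> + 1 / 2\<bar> * M + M \<and> \<bar>osc C (\<nu> + 1) x\<bar> \<le> \<bar>\<nu> + 1 / 2\<bar> * M + M) at_top"
    by (auto elim!: eventually_mono intro: order_trans)
  then show thesis by (rule that)
qed

text \<open>In the limit only \<open>osc\<^sub>\<nu>\<^sup>2 + osc\<^sub>\<nu>\<^sub>+\<^sub>1\<^sup>2\<close> survives, and \<open>osc\<^sub>\<nu>\<^sub>+\<^sub>2\<close> becomes \<open>- osc\<^sub>\<nu>\<close>.\<close>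

lemma osc_energy_limit_Suc:
  assumes "cylinder C" "\<nu> = real n / 2" and lim: "(osc_energy C \<nu> \<longlongrightarrow> L) at_top"
  shows "(osc_energy C (\<nu> + 1) \<longlongrightarrow> L) at_top"
proof -
  have "eventually (\<lambda>x. osc_energy C \<nu> x \<le> L + 1) at_top"
    using order_tendstoD(2)[OF lim, of "L + 1"] by (auto elim!: eventually_mono)
  then obtain K where K: "eventually (\<lambda>x. \<bar>osc C \<nu> x\<bar> \<le> K \<and> \<bar>osc C (\<nu> + 1) x\<bar> \<le> K) at_top"
    by (rule osc_bounded_of_energy)
  let ?v = "osc C \<nu>" and ?w = "osc C (\<nu> + 1)"
  have inv: "((\<lambda>x::real. 1 / x) \<longlongrightarrow> 0) at_top"
    using tendsto_inverse_0_at_top[OF filterlim_ident] by (simp add: inverse_eq_divide)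
  have small: "((\<lambda>x. f x * g x / x) \<longlongrightarrow> 0) at_top"
    if "eventually (\<lambda>x. \<bar>f x\<bar> \<le> K \<and> \<bar>g x\<bar> \<le> K) at_top" for f g :: "real \<Rightarrow> real"
  proof (rule Lim_null_comparison)
    show "eventually (\<lambda>x. norm (f x * g x / x) \<le> K * K * (1 / x)) at_top"
      using that eventually_gt_at_top[of 0]
    proof eventually_elim
      case (elim x)
      then have "\<bar>f x\<bar> * \<bar>g x\<bar> \<le> K * K" by (intro mult_mono) auto
      then show ?case using elim by (simp add: abs_mult divide_right_mono)
    qed
    show "((\<lambda>x. K * K * (1 / x)) \<longlongrightarrow> 0) at_top" by (rule tendsto_mult_right_zero[OF inv])
  qed
  have vw: "((\<lambda>x. ?v x * ?w x / x) \<longlongrightarrow> 0) at_top" by (rule small[OF K])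
  have vv: "((\<lambda>x. ?v x * ?v x / x * (1 / x)) \<longlongrightarrow> 0) at_top"
    by (rule tendsto_mult_zero[OF small inv]) (use K in \<open>auto elim!: eventually_mono\<close>)
  have ww: "((\<lambda>x. ?w x * ?w x / x * (1 / x)) \<longlongrightarrow> 0) at_top"
    by (rule tendsto_mult_zero[OF small inv]) (use K in \<open>auto elim!: eventually_mono\<close>)
  have ww3: "((\<lambda>x. ?w x * ?w x / x * (1 / x) * (1 / x)) \<longlongrightarrow> 0) at_top"
    by (rule tendsto_mult_zero[OF ww inv])
  define b where "b = \<nu> + 1 / 2"
  have "((\<lambda>x. osc_energy C \<nu> x - b * (?v x * ?v x / x * (1 / x)) + 2 * b * (?v x * ?w x / x)
      - (4 * b + 2) * (?v x * ?w x / x) + (2 * b + 1)\<^sup>2 * (?w x * ?w x / x * (1 / x))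
      - 2 * (b + 1) * (2 * b + 1) * (?w x * ?w x / x * (1 / x)) + 2 * (b + 1) * (?v x * ?w x / x)
      + (b + 1) * (?w x * ?w x / x * (1 / x)))
      \<longlongrightarrow> L - b * 0 + 2 * b * 0 - (4 * b + 2) * 0 + (2 * b + 1)\<^sup>2 * 0 - 2 * (b + 1) * (2 * b + 1) * 0
        + 2 * (b + 1) * 0 + (b + 1) * 0) at_top"
    by (intro tendsto_intros lim vw vv ww)
  moreover have "eventually (\<lambda>x. osc_energy C \<nu> x - b * (?v x * ?v x / x * (1 / x)) + 2 * b * (?v x * ?w x / x)
      - (4 * b + 2) * (?v x * ?w x / x) + (2 * b + 1)\<^sup>2 * (?w x * ?w x / x * (1 / x))
      - 2 * (b + 1) * (2 * b + 1) * (?w x * ?w x / x * (1 / x)) + 2 * (b + 1) * (?v x * ?w x / x)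
      + (b + 1) * (?w x * ?w x / x * (1 / x)) = osc_energy C (\<nu> + 1) x) at_top"
    using eventually_gt_at_top[of 0]
  proof eventually_elim
    case (elim x)
    have "C (\<nu> + 1 + 1) x = 2 * (\<nu> + 1) / x * C (\<nu> + 1) x - C \<nu> x"
      using cylinder_recurrence[OF assms(1,2) elim] by (simp only: add.assoc one_add_one)
    then have "osc C (\<nu> + 1 + 1) x = (2 * b + 1) / x * ?w x - ?v x"
      unfolding osc_def by (simp only:) (simp add: b_def algebra_simps)
    moreover have "osc_energy C \<nu> x = (?v x)\<^sup>2 + (?w x)\<^sup>2 - 2 * b * (?v x * ?w x / x) + b * ((?v x)\<^sup>2 / x / x)"
      using osc_energy_eq[OF elim, of C \<nu>] by (simp add: b_def algebra_simps)
    moreover have "osc_energy C (\<nu> + 1) x = (?w x)\<^sup>2 + (osc C (\<nu> + 1 + 1) x)\<^sup>2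
       - 2 * (b + 1) * (?w x * osc C (\<nu> + 1 + 1) x / x) + (b + 1) * ((?w x)\<^sup>2 / x / x)"
      using osc_energy_eq[OF elim, of C "\<nu> + 1"] by (simp add: b_def algebra_simps)
    ultimately show ?case using elim
      by (simp only:) (simp add: field_simps power2_eq_square)
  qed
  ultimately show ?thesis by (simp add: Lim_transform_eventually)
qed

lemma osc_energy_limit_add:
  assumes "cylinder C" "\<nu> = real n / 2" "(osc_energy C \<nu> \<longlongrightarrow> L) at_top"
  shows "(osc_energy C (\<nu> + real m) \<longlongrightarrow> L) at_top"
proof (induction m)
  case (Suc m)
  have "\<nu> + real m = real (n + 2 * m) / 2" using assms(2) by simp
  from osc_energy_limit_Suc[OF assms(1) this Suc] show ?case by (simp add: add_ac)
qed (use assms in simp)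

text \<open>For \<nu> \<ge> 1/2 the energy is nondecreasing, so its limit at infinity dominates it
  everywhere.\<close>

lemma osc_energy_le_limit:
  assumes "cylinder C" "\<nu> = real n / 2" "n \<ge> 1" "(osc_energy C \<nu> \<longlongrightarrow> L) at_top" "x > 0"
  shows "osc_energy C \<nu> x \<le> L"
proof (rule tendsto_lowerbound[OF assms(4)])
  have "\<nu> \<ge> 1 / 2" using assms(2,3) by simp
  then have "\<nu>\<^sup>2 \<ge> 1 / 4" using power_mono[of "1 / 2" \<nu> 2] by (simp add: power2_eq_square)
  have "osc_energy C \<nu> x \<le> osc_energy C \<nu> y" if "x \<le> y" for y
  proof (rule DERIV_nonneg_imp_nondecreasing[OF that])
    fix t assume "x \<le> t" "t \<le> y"
    then show "\<exists>d. (osc_energy C \<nu> has_real_derivative d) (at t) \<and> 0 \<le> d"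
      using osc_energy_has_deriv[OF assms(1,2), of t] assms(5) \<open>\<nu>\<^sup>2 \<ge> 1 / 4\<close>
      by (intro exI conjI) auto
  qed
  then show "eventually (\<lambda>y. osc_energy C \<nu> x \<le> osc_energy C \<nu> y) at_top"
    by (auto intro: eventually_mono[OF eventually_ge_at_top[of x]])
qed simp

lemma osc_energy_limit_half:
  assumes "cylinder C"
  obtains L where "(osc_energy C (1 / 2) \<longlongrightarrow> L) at_top" "(osc_energy C (1 / 2) \<longlongrightarrow> L) (at_right 0)"
proof -
  have "(osc_energy C (1 / 2) has_real_derivative 0) (at x within {0<..})" if "x \<in> {0<..}" for x
    using osc_energy_has_deriv[OF assms, of "1 / 2" 1 x] that
    by (auto simp: power2_eq_square intro: DERIV_subset)
  from has_field_derivative_zero_constant[OF _ this] obtain c where c: "\<forall>x\<in>{0<..}. osc_energy C (1 / 2) x = c"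
    by auto
  have "(osc_energy C (1 / 2) \<longlongrightarrow> c) at_top"
    by (rule Lim_transform_eventually[OF tendsto_const])
      (use c in \<open>auto intro: eventually_mono[OF eventually_gt_at_top[of 0]]\<close>)
  moreover have "(osc_energy C (1 / 2) \<longlongrightarrow> c) (at_right 0)"
    by (rule Lim_transform_eventually[OF tendsto_const])
      (use c in \<open>auto simp: eventually_at_right_field intro!: exI[of _ 1]\<close>)
  ultimately show thesis by (rule that)
qed

text \<open>At order 0 the energy is nonincreasing and nonnegative, so it converges and each of its
  values bounds the limit. The point 2 is convenient because the series are then evaluated at x^2/4
  = 1.\<close>

lemma osc_energy_limit_0:
  assumes "cylinder C"
  obtains L where "(osc_energy C 0 \<longlongrightarrow> L) at_top" "0 \<le> L" "L \<le> osc_energy C 0 2"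
proof -
  let ?e = "osc_energy C 0"
  have anti: "?e y \<le> ?e x" if "x \<le> y" "0 < x" for x y
  proof (rule DERIV_nonpos_imp_nonincreasing[OF that(1)])
    fix t assume "x \<le> t" "t \<le> y"
    then show "\<exists>d. (?e has_real_derivative d) (at t) \<and> d \<le> 0"
      using osc_energy_has_deriv[OF assms, of 0 0 t] that(2) by (intro exI conjI) auto
  qed
  have nonneg: "?e x \<ge> 0" if "x > 0" for x
    using that by (simp add: osc_energy_def osc_potential_def)
  define L where "L = Inf (?e ` {2..})"
  have bdd: "bdd_below (?e ` {2..})" using nonneg by (intro bdd_belowI[of _ 0]) auto
  have "(?e \<longlongrightarrow> L) at_top"
  proof (rule order_tendstoI)
    fix a assume "a < L"
    then have "a < ?e x" if "x \<ge> 2" for x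
      using cInf_lower[OF _ bdd, of "?e x"] that by (auto simp: L_def)
    then show "eventually (\<lambda>x. a < ?e x) at_top"
      by (auto intro: eventually_mono[OF eventually_ge_at_top[of 2]])
  next
    fix a assume "L < a"
    then obtain x where x: "x \<ge> 2" "?e x < a"
      using cInf_lessD[of "?e ` {2..}" a] by (auto simp: L_def)
    then have "?e y < a" if "y \<ge> x" for y using anti[of x y] that by auto
    then show "eventually (\<lambda>x. ?e x < a) at_top"
      by (auto intro: eventually_mono[OF eventually_ge_at_top[of x]])
  qed
  moreover have "0 \<le> L" unfolding L_def using nonneg by (intro cInf_greatest) auto
  moreover have "L \<le> ?e 2" unfolding L_def by (rule cInf_lower[OF _ bdd]) auto
  ultimately show thesis by (rule that)
qed

section \<open>Numerical bounds at the point 2\<close>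

text \<open>Coefficients of modulus at most 1 make the tail at most that of the series of e; after
  six terms this is e - 163/60, below 1/250 because e < 2.72.\<close>

lemma exp_transform_at_1:
  assumes "\<And>m. \<bar>c m\<bar> \<le> 1"
  shows "\<bar>exp_transform c 1 - (\<Sum>m<6. c m * (- 1) ^ m / fact m)\<bar> \<le> 1 / 250"
proof -
  let ?f = "\<lambda>m. c m * (- 1) ^ m / fact m" and ?g = "\<lambda>m. 1 / fact m :: real"
  have g: "summable ?g" "suminf ?g = exp 1"
    using summable_exp_generic[of "1::real"] by (simp_all add: exp_def inverse_eq_divide)
  have fg: "\<bar>?f m\<bar> \<le> ?g m" for m
    using exp_transform_summable_bound[of c 1 1 1 m, OF assms] by simp
  have f: "summable ?f" by (rule exp_transform_summable[of c 1, OF assms])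
  have "exp_transform c 1 - (\<Sum>m<6. ?f m) = (\<Sum>m. ?f (m + 6))"
    using suminf_minus_initial_segment[OF f, of 6] by (simp add: exp_transform_def)
  also have "\<bar>\<dots>\<bar> \<le> (\<Sum>m. \<bar>?f (m + 6)\<bar>)"
    by (rule summable_rabs, rule summable_comparison_test[OF _ summable_ignore_initial_segment[OF g(1), of 6]])
      (use fg in auto)
  also have "\<dots> \<le> (\<Sum>m. ?g (m + 6))"
    by (rule suminf_le[OF fg _ summable_ignore_initial_segment[OF g(1)]],
        rule summable_comparison_test[OF _ summable_ignore_initial_segment[OF g(1), of 6]])
      (use fg in auto)
  also have "\<dots> = exp 1 - (\<Sum>m<6. ?g m)"
    using suminf_minus_initial_segment[OF g(1), of 6] g(2) by simp
  also have "(\<Sum>m<6. ?g m) = 163 / 60" by (simp add: eval_nat_numeral)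
  also have "exp 1 - 163 / 60 \<le> (1 / 250 :: real)" using e_less_272 by simp
  finally show ?thesis .
qed

lemma rGamma_Suc: "rGamma (real m + 1) = 1 / fact m"
  using Gamma_fact[of m, where 'a = real] by (simp add: rGamma_inverse_Gamma inverse_eq_divide add.commute)

lemma deriv_rGamma_Suc:
  "deriv_rGamma (real m + 2) = (deriv_rGamma (real m + 1) - 1 / fact (Suc m)) / (real m + 1)"
  using deriv_rGamma_step[of "real m + 1"] rGamma_Suc[of "Suc m"] by (simp add: field_simps)

lemma deriv_rGamma_1: "deriv_rGamma 1 = euler_mascheroni"
proof -
  have "(1::real) \<notin> \<int>\<^sub>\<le>\<^sub>0" by simp
  from DERIV_unique[OF rGamma_has_deriv has_field_derivative_rGamma_no_nonpos_int[OF this]]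
  show ?thesis by simp
qed

text \<open>The tail estimate at argument 1 asks for the bound 1. From m = 1 on the recurrence
  divides a numerator of modulus at most 2 by m + 1 \<ge> 2; the first values need bounds on Euler's
  constant.\<close>

lemma abs_deriv_rGamma_le_1: "\<bar>deriv_rGamma (real m + 1)\<bar> \<le> 1"
proof (induction m)
  case 0
  then show ?case
    using euler_mascheroni_gt_19_over_33 euler_mascheroni_less_13_over_22 by (simp add: deriv_rGamma_1)
next
  case (Suc m)
  have eq: "deriv_rGamma (real (Suc m) + 1) = (deriv_rGamma (real m + 1) - 1 / fact (Suc m)) / (real m + 1)"
    using deriv_rGamma_Suc[of m] by (simp add: add_ac)
  show ?case
  proof (cases "m = 0")
    case True
    then show ?thesis
      using eq euler_mascheroni_gt_19_over_33 euler_mascheroni_less_13_over_22 by (simp add: deriv_rGamma_1)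
  next
    case False
    have f: "(1::real) / fact (Suc m) \<le> 1" by (simp add: field_simps fact_ge_1 del: fact_Suc)
    have "(1::real) / fact (Suc m) \<ge> 0" by simp
    with f Suc have "\<bar>deriv_rGamma (real m + 1) - 1 / fact (Suc m)\<bar> \<le> 2" by linarith
    moreover have "2 \<le> real m + 1" using False by simp
    ultimately show ?thesis unfolding eq abs_divide by (subst divide_le_eq_1_pos) auto
  qed
qed

text \<open>The recurrence started at (1/\<Gamma>)'(1) = \<gamma>, with denominators cleared for
  linear arithmetic.\<close>

lemma deriv_rGamma_values:
  "deriv_rGamma 2 = euler_mascheroni - 1"
  "4 * deriv_rGamma 3 = 2 * euler_mascheroni - 3"
  "18 * deriv_rGamma 4 = 6 * deriv_rGamma 3 - 1"
  "96 * deriv_rGamma 5 = 24 * deriv_rGamma 4 - 1"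
  "600 * deriv_rGamma 6 = 120 * deriv_rGamma 5 - 1"
  "4320 * deriv_rGamma 7 = 720 * deriv_rGamma 6 - 1"
  using deriv_rGamma_Suc[of 0] deriv_rGamma_Suc[of 1] deriv_rGamma_Suc[of 2] deriv_rGamma_Suc[of 3]
    deriv_rGamma_Suc[of 4] deriv_rGamma_Suc[of 5]
  by (simp_all add: deriv_rGamma_1 fact_numeral field_simps)

text \<open>At x = 2 these four numbers determine J_0, J_1, Y_0 and Y_1. The margins cover the tail
  1/250, rounding and, for the order derivatives, the uncertainty of \<gamma>.\<close>

lemma bessel_entire_values:
  "\<bar>bessel_entire 0 1 - 224 / 1000\<bar> \<le> 5 / 1000" "\<bar>bessel_entire 1 1 - 577 / 1000\<bar> \<le> 5 / 1000"
  "\<bar>bessel_entire_order 0 1 - 802 / 1000\<bar> \<le> 10 / 1000" "\<bar>bessel_entire_order 1 1 + 56 / 1000\<bar> \<le> 15 / 1000"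
proof -
  have r: "\<bar>rGamma (real m + 1)\<bar> \<le> 1" for m
    unfolding rGamma_Suc by (simp add: field_simps fact_ge_1)
  have s6: "(\<Sum>m<6. f m) = f 0 + f 1 + f 2 + f 3 + f 4 + f (5::nat)" for f :: "nat \<Rightarrow> real"
    by (simp add: eval_nat_numeral)
  have rv: "rGamma 1 = (1::real)" "rGamma 2 = (1::real)" "rGamma 3 = (1/2::real)" "rGamma 4 = (1/6::real)"
     "rGamma 5 = (1/24::real)" "rGamma 6 = (1/120::real)" "rGamma 7 = (1/720::real)"
    using rGamma_Suc[of 0] rGamma_Suc[of 1] rGamma_Suc[of 2] rGamma_Suc[of 3] rGamma_Suc[of 4]
      rGamma_Suc[of 5] rGamma_Suc[of 6] by (simp_all add: fact_numeral)
  have bounds: "exp_transform c 1 \<le> c 0 - c 1 + c 2 / 2 - c 3 / 6 + c 4 / 24 - c 5 / 120 + 1 / 250"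
    "exp_transform c 1 \<ge> c 0 - c 1 + c 2 / 2 - c 3 / 6 + c 4 / 24 - c 5 / 120 - 1 / 250"
    if "\<And>m. \<bar>c m\<bar> \<le> 1" for c
  proof -
    have "(\<Sum>m<6. c m * (- 1) ^ m / fact m) = c 0 - c 1 + c 2 / 2 - c 3 / 6 + c 4 / 24 - c 5 / 120"
      unfolding s6 by (simp add: fact_numeral)
    then show "exp_transform c 1 \<le> c 0 - c 1 + c 2 / 2 - c 3 / 6 + c 4 / 24 - c 5 / 120 + 1 / 250"
      "exp_transform c 1 \<ge> c 0 - c 1 + c 2 / 2 - c 3 / 6 + c 4 / 24 - c 5 / 120 - 1 / 250"
      using exp_transform_at_1[of c, OF that] by linarith+
  qed
  have r': "\<bar>rGamma (real m + 1 + 1)\<bar> \<le> 1" "\<bar>deriv_rGamma (real m + 1 + 1)\<bar> \<le> 1" for m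
    using r[of "Suc m"] abs_deriv_rGamma_le_1[of "Suc m"] by (simp_all add: add_ac)
  note \<gamma> = euler_mascheroni_gt_19_over_33 euler_mascheroni_less_13_over_22
  note vals = rv
  have "219 / 1000 \<le> bessel_entire 0 1 \<and> bessel_entire 0 1 \<le> 229 / 1000"
    using bounds[of "\<lambda>m. rGamma (real m + 1)", OF r] by (simp add: bessel_entire_def vals)
  then show "\<bar>bessel_entire 0 1 - 224 / 1000\<bar> \<le> 5 / 1000" by linarith
  have "572 / 1000 \<le> bessel_entire 1 1 \<and> bessel_entire 1 1 \<le> 582 / 1000"
    using bounds[of "\<lambda>m. rGamma (real m + 1 + 1)", OF r'(1)] by (simp add: bessel_entire_def vals)
  then show "\<bar>bessel_entire 1 1 - 577 / 1000\<bar> \<le> 5 / 1000" by linarith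
  have "bessel_entire_order 0 1 \<le> deriv_rGamma 1 - deriv_rGamma 2 + deriv_rGamma 3 / 2 - deriv_rGamma 4 / 6
      + deriv_rGamma 5 / 24 - deriv_rGamma 6 / 120 + 1 / 250"
    "bessel_entire_order 0 1 \<ge> deriv_rGamma 1 - deriv_rGamma 2 + deriv_rGamma 3 / 2 - deriv_rGamma 4 / 6
      + deriv_rGamma 5 / 24 - deriv_rGamma 6 / 120 - 1 / 250"
    using bounds[of "\<lambda>m. deriv_rGamma (real m + 1)", OF abs_deriv_rGamma_le_1] by (simp_all add: bessel_entire_order_def)
  then have "792 / 1000 \<le> bessel_entire_order 0 1" "bessel_entire_order 0 1 \<le> 812 / 1000"
    using deriv_rGamma_values deriv_rGamma_1 \<gamma> by linarith+
  then show "\<bar>bessel_entire_order 0 1 - 802 / 1000\<bar> \<le> 10 / 1000" by linarith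
  have "bessel_entire_order 1 1 \<le> deriv_rGamma 2 - deriv_rGamma 3 + deriv_rGamma 4 / 2 - deriv_rGamma 5 / 6
      + deriv_rGamma 6 / 24 - deriv_rGamma 7 / 120 + 1 / 250"
    "bessel_entire_order 1 1 \<ge> deriv_rGamma 2 - deriv_rGamma 3 + deriv_rGamma 4 / 2 - deriv_rGamma 5 / 6
      + deriv_rGamma 6 / 24 - deriv_rGamma 7 / 120 - 1 / 250"
    using bounds[of "\<lambda>m. deriv_rGamma (real m + 1 + 1)", OF r'(2)] by (simp_all add: bessel_entire_order_def)
  then have "- 71 / 1000 \<le> bessel_entire_order 1 1" "bessel_entire_order 1 1 \<le> - 41 / 1000"
    using deriv_rGamma_values \<gamma> by linarith+
  then show "\<bar>bessel_entire_order 1 1 + 56 / 1000\<bar> \<le> 15 / 1000" by linarith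
qed

lemma osc_energy_0_2: "osc_energy C 0 2 = 9 / 4 * (C 0 2)\<^sup>2 + 2 * (C 1 2)\<^sup>2 - C 0 2 * C 1 2"
  by (subst osc_energy_eq) (simp_all add: osc_def power_mult_distrib)

lemma osc_energy_J_0_2: "osc_energy bessel_J 0 2 \<le> 3 / 4"
proof -
  have "bessel_J 0 2 = bessel_entire 0 1" "bessel_J 1 2 = bessel_entire 1 1" by (simp_all add: bessel_J_eq)
  then have b: "219 / 1000 \<le> bessel_J 0 2" "bessel_J 0 2 \<le> 229 / 1000"
    "572 / 1000 \<le> bessel_J 1 2" "bessel_J 1 2 \<le> 582 / 1000"
    using bessel_entire_values(1,2) by linarith+
  have "(bessel_J 0 2)\<^sup>2 \<le> (229 / 1000)\<^sup>2" "(bessel_J 1 2)\<^sup>2 \<le> (582 / 1000)\<^sup>2"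
    using b by (auto intro!: power_mono)
  moreover have "0 \<le> bessel_J 0 2 * bessel_J 1 2" using b by (intro mult_nonneg_nonneg) auto
  moreover have "219 / 1000 * (572 / 1000) \<le> bessel_J 0 2 * bessel_J 1 2" using b by (intro mult_mono) auto
  ultimately show ?thesis unfolding osc_energy_0_2 by (simp add: power2_eq_square)
qed

text \<open>The bound 8 and the bound 3/4 for J have product 6, against the value 4 given by the
  exact limits; the excess 3/2 is made up for by \<open>power_ratio_final\<close>.\<close>

lemma osc_energy_Y_0_2: "pi\<^sup>2 * osc_energy bessel_Y 0 2 \<le> 8"
proof -
  have y0: "pi * bessel_Y 0 2 = 2 * bessel_entire_order 0 1"
    by (simp add: bessel_Y_0_eq bessel_J_order_def)
  have y1: "pi * bessel_Y 1 2 = 2 * bessel_entire_order 1 1 - bessel_entire 0 1"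
    using bessel_Y_nat[of 2 1] bessel_entire_order_recurrence[of 0 1] by (simp add: bessel_J_order_def)
  define a b where "a = pi * bessel_Y 0 2" and "b = - (pi * bessel_Y 1 2)"
  have bounds: "0 \<le> a" "a \<le> 163 / 100" "0 \<le> b" "b \<le> 38 / 100"
    using bessel_entire_values unfolding a_def b_def y0 y1 by linarith+
  have "a\<^sup>2 \<le> (163 / 100)\<^sup>2" "b\<^sup>2 \<le> (38 / 100)\<^sup>2" "a * b \<le> 163 / 100 * (38 / 100)"
    using bounds by (auto intro!: power_mono mult_mono simp del: times_divide_eq_right times_divide_eq_left)
  then have "9 / 4 * a\<^sup>2 + 2 * b\<^sup>2 + a * b \<le> 8" by (simp add: power2_eq_square)
  moreover have "9 / 4 * a\<^sup>2 + 2 * b\<^sup>2 + a * b = pi\<^sup>2 * osc_energy bessel_Y 0 2"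
    unfolding osc_energy_0_2 a_def b_def by (simp add: power2_eq_square algebra_simps)
  ultimately show ?thesis by simp
qed

section \<open>The energies of order 1/2\<close>

lemma osc_potential_half: "osc_potential (1 / 2) x = 1"
  by (simp add: osc_potential_def power2_eq_square)

text \<open>At order 1/2 the energy is constant, so its limit at infinity can be read off at 0, from
  an expression \<open>f\<close> that is differentiable across 0.\<close>

lemma osc_energy_half_tendsto:
  assumes C: "cylinder C" and eq: "\<And>x. x > 0 \<Longrightarrow> osc C (1 / 2) x = f x"
    and f: "\<And>x. (f has_real_derivative f' x) (at x)"
    and lim: "((\<lambda>x. (f' x)\<^sup>2 + (f x)\<^sup>2) \<longlongrightarrow> L) (at_right 0)"
  shows "(osc_energy C (1 / 2) \<longlongrightarrow> L) at_top"
proof -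
  have "osc_energy C (1 / 2) x = (f' x)\<^sup>2 + (f x)\<^sup>2" if "x > 0" for x
  proof -
    have "(osc C (1 / 2) has_real_derivative f' x) (at x)"
      by (rule has_field_derivative_transform_within_open[OF f, of "{0<..}"]) (use that eq in auto)
    then have "osc_deriv C (1 / 2) x = f' x"
      using DERIV_unique osc_has_deriv[OF C, of "1 / 2" 1, OF _ that] by fastforce
    then show ?thesis by (simp add: osc_energy_def osc_potential_half eq that)
  qed
  then have "\<forall>\<^sub>F x in at_right 0. (f' x)\<^sup>2 + (f x)\<^sup>2 = osc_energy C (1 / 2) x"
    by (auto simp: eventually_at_right_field intro!: exI[of _ 1])
  from Lim_transform_eventually[OF lim this] have "(osc_energy C (1 / 2) \<longlongrightarrow> L) (at_right 0)" .
  moreover obtain L' where L': "(osc_energy C (1 / 2) \<longlongrightarrow> L') at_top" "(osc_energy C (1 / 2) \<longlongrightarrow> L') (at_right 0)"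
    using osc_energy_limit_half[OF C] by blast
  ultimately have "L = L'" using tendsto_unique[OF trivial_limit_at_right_real] by blast
  then show ?thesis using L' by simp
qed

lemma rGamma_half_values: "(rGamma (1 / 2 :: real))\<^sup>2 = 1 / pi" "(rGamma (3 / 2 :: real))\<^sup>2 = 4 / pi"
proof -
  show h: "(rGamma (1 / 2 :: real))\<^sup>2 = 1 / pi"
    by (simp add: rGamma_inverse_Gamma Gamma_one_half_real inverse_eq_divide power_divide)
  have "rGamma (3 / 2 :: real) = 2 * rGamma (1 / 2)" using rGamma_step[of "1 / 2"] by simp
  then show "(rGamma (3 / 2 :: real))\<^sup>2 = 4 / pi" by (simp add: power_mult_distrib h)
qed

text \<open>\<open>?f\<close> is sqrt(2/\<pi>) sin x in disguise; only its value and slope at 0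
  enter.\<close>

lemma osc_energy_J_half: "(osc_energy bessel_J (1 / 2) \<longlongrightarrow> 2 / pi) at_top"
proof (rule osc_energy_half_tendsto[OF cylinder_bessel_J])
  let ?f = "\<lambda>x. x / sqrt 2 * bessel_entire (1 / 2) (x\<^sup>2 / 4)"
  let ?f' = "\<lambda>x. 1 / sqrt 2 * bessel_entire (1 / 2) (x\<^sup>2 / 4)
      + x / sqrt 2 * (- bessel_entire (1 / 2 + 1) (x\<^sup>2 / 4) * (x / 2))"
  show "osc bessel_J (1 / 2) x = ?f x" if "x > 0" for x
    using that real_sqrt_mult_self[of x] by (simp add: osc_def bessel_J_eq powr_half_sqrt real_sqrt_divide field_simps)
  show "(?f has_real_derivative ?f' x) (at x)" for x
    using DERIV_mult[OF DERIV_cdivide[OF DERIV_ident, of "sqrt 2"] bessel_entire_square_deriv[of "1 / 2"]]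
    by (simp add: mult.commute)
  have i: "((\<lambda>x::real. x) \<longlongrightarrow> 0) (at_right 0)" by simp
  have "((\<lambda>x. (?f' x)\<^sup>2 + (?f x)\<^sup>2) \<longlongrightarrow>
     (1 / sqrt 2 * rGamma (1 / 2 + 1) + 0 / sqrt 2 * (- rGamma (1 / 2 + 1 + 1) * (0 / 2)))\<^sup>2
       + (0 / sqrt 2 * rGamma (1 / 2 + 1))\<^sup>2) (at_right 0)"
    by (intro tendsto_intros tendsto_bessel_entire_0 i) auto
  then show "((\<lambda>x. (?f' x)\<^sup>2 + (?f x)\<^sup>2) \<longlongrightarrow> 2 / pi) (at_right 0)"
    using rGamma_half_values by (simp add: power_mult_distrib power_divide)
qed

text \<open>\<open>?f\<close> is -sqrt(2/\<pi>) cos x in disguise.\<close>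

lemma osc_energy_Y_half: "(osc_energy bessel_Y (1 / 2) \<longlongrightarrow> 2 / pi) at_top"
proof (rule osc_energy_half_tendsto[OF cylinder_bessel_Y])
  let ?f = "\<lambda>x. - sqrt 2 * bessel_entire (- (1 / 2)) (x\<^sup>2 / 4)"
  let ?f' = "\<lambda>x. - sqrt 2 * (- bessel_entire (- (1 / 2) + 1) (x\<^sup>2 / 4) * (x / 2))"
  show "osc bessel_Y (1 / 2) x = ?f x" if "x > 0" for x
    using that bessel_Y_nat_half[of 0 x]
    by (simp add: osc_def bessel_J_eq powr_half_sqrt powr_minus real_sqrt_divide field_simps)
  show "(?f has_real_derivative ?f' x) (at x)" for x
    by (rule DERIV_cmult[OF bessel_entire_square_deriv])
  have i: "((\<lambda>x::real. x) \<longlongrightarrow> 0) (at_right 0)" by simp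
  have "((\<lambda>x. (?f' x)\<^sup>2 + (?f x)\<^sup>2) \<longlongrightarrow>
     (- sqrt 2 * (- rGamma (- (1 / 2) + 1 + 1) * (0 / 2)))\<^sup>2 + (- sqrt 2 * rGamma (- (1 / 2) + 1))\<^sup>2) (at_right 0)"
    by (intro tendsto_intros tendsto_bessel_entire_0 i) auto
  then show "((\<lambda>x. (?f' x)\<^sup>2 + (?f x)\<^sup>2) \<longlongrightarrow> 2 / pi) (at_right 0)"
    using rGamma_half_values by (simp add: power_mult_distrib)
qed

text \<open>
  At infinity the phases of \<open>J\<close> and \<open>Y\<close> differ by a quarter period and \<open>A = B = 2/\<pi>\<close>. For even \<open>n\<close>
  the crude bound obtained by evaluating the energies of order 0 at 2 is enough for the sequel.
\<close>

lemma osc_energy_bounds: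
  assumes "\<nu> = real n / 2" "n \<ge> 1"
  obtains A B where "0 \<le> A" "0 \<le> B" "\<And>x. x > 0 \<Longrightarrow> osc_energy bessel_J \<nu> x \<le> A"
    "\<And>x. x > 0 \<Longrightarrow> osc_energy bessel_Y \<nu> x \<le> B" "A * B * pi\<^sup>2 \<le> (if odd n then 4 else 6)"
proof (cases "odd n")
  case True
  then obtain m where "n = 2 * m + 1" by (auto elim: oddE)
  then have \<nu>: "\<nu> = 1 / 2 + real m" using assms(1) by simp
  have "(osc_energy bessel_J \<nu> \<longlongrightarrow> 2 / pi) at_top" "(osc_energy bessel_Y \<nu> \<longlongrightarrow> 2 / pi) at_top"
    unfolding \<nu>
    using osc_energy_limit_add[OF cylinder_bessel_J _ osc_energy_J_half, of 1]
      osc_energy_limit_add[OF cylinder_bessel_Y _ osc_energy_Y_half, of 1] by simp_all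
  with that[of "2 / pi" "2 / pi"] osc_energy_le_limit[OF cylinder_bessel_J assms]
    osc_energy_le_limit[OF cylinder_bessel_Y assms] True
  show thesis by (simp add: power2_eq_square)
next
  case False
  then obtain m where "n = 2 * m" by auto
  then have \<nu>: "\<nu> = 0 + real m" using assms(1) by simp
  obtain A where A: "(osc_energy bessel_J 0 \<longlongrightarrow> A) at_top" "0 \<le> A" "A \<le> osc_energy bessel_J 0 2"
    using osc_energy_limit_0[OF cylinder_bessel_J] .
  obtain B where B: "(osc_energy bessel_Y 0 \<longlongrightarrow> B) at_top" "0 \<le> B" "B \<le> osc_energy bessel_Y 0 2"
    using osc_energy_limit_0[OF cylinder_bessel_Y] .
  have "(osc_energy bessel_J \<nu> \<longlongrightarrow> A) at_top" "(osc_energy bessel_Y \<nu> \<longlongrightarrow> B) at_top"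
    unfolding \<nu>
    using osc_energy_limit_add[OF cylinder_bessel_J _ A(1), of 0]
      osc_energy_limit_add[OF cylinder_bessel_Y _ B(1), of 0] by simp_all
  moreover have "A * (pi\<^sup>2 * B) \<le> 3 / 4 * 8"
    using A B osc_energy_J_0_2 order_trans[OF mult_left_mono[OF B(3), of "pi\<^sup>2"] osc_energy_Y_0_2]
    by (intro mult_mono) auto
  ultimately show thesis
    using that[of A B] A(2) B(2) osc_energy_le_limit[OF cylinder_bessel_J assms]
      osc_energy_le_limit[OF cylinder_bessel_Y assms] False
    by (simp add: mult_ac)
qed

section \<open>Zeros of cylinder functions\<close>

text \<open>Sturm comparison with \<open>sin (\<omega> (x - a))\<close>, through the Wronskian of the two functions.\<close>

lemma sturm_wronskian_deriv:
  fixes \<omega> a :: real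
  assumes "(v has_real_derivative v' x) (at x)" "(v' has_real_derivative - (q x * v x)) (at x)"
  shows "((\<lambda>x. v' x * sin (\<omega> * (x - a)) - \<omega> * v x * cos (\<omega> * (x - a)))
     has_real_derivative (\<omega>\<^sup>2 - q x) * v x * sin (\<omega> * (x - a))) (at x)"
proof -
  have "((\<lambda>x. sin (\<omega> * (x - a))) has_real_derivative cos (\<omega> * (x - a)) * \<omega>) (at x)"
    "((\<lambda>x. cos (\<omega> * (x - a))) has_real_derivative - sin (\<omega> * (x - a)) * \<omega>) (at x)"
    by (auto intro!: derivative_eq_intros)
  from DERIV_diff[OF DERIV_mult[OF assms(2) this(1)] DERIV_mult[OF DERIV_cmult[OF assms(1), of \<omega>] this(2)]]
  show ?thesis
    by (rule back_subst[of "\<lambda>d. (_ has_real_derivative d) _"]) (simp add: algebra_simps power2_eq_square)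
qed

lemma sin_nonneg_scaled:
  fixes \<omega> :: real
  assumes "\<omega> > 0" "a \<le> x" "x \<le> a + pi / \<omega>"
  shows "sin (\<omega> * (x - a)) \<ge> 0"
proof (rule sin_ge_zero)
  have "\<omega> * (x - a) \<le> \<omega> * (pi / \<omega>)" using assms by (intro mult_left_mono) auto
  then show "\<omega> * (x - a) \<le> pi" using assms by simp
qed (use assms in simp)

text \<open>If c - a were smaller than \<pi>/\<omega>, the sine would be positive on (a, c]; the
  Wronskian is then nonincreasing, starts at 0 because v(a) = 0, and yet ends at v'(c)
  sin(\<omega>(c - a)) > 0.\<close>

lemma sturm_gap:
  fixes \<omega> :: real
  assumes "a < c" "\<omega> > 0"
    and v: "\<And>x. a \<le> x \<Longrightarrow> x \<le> c \<Longrightarrow> (v has_real_derivative v' x) (at x)"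
    and v': "\<And>x. a \<le> x \<Longrightarrow> x \<le> c \<Longrightarrow> (v' has_real_derivative - (q x * v x)) (at x)"
    and q: "\<And>x. a \<le> x \<Longrightarrow> x \<le> c \<Longrightarrow> q x \<le> \<omega>\<^sup>2"
    and neg: "\<And>x. a \<le> x \<Longrightarrow> x \<le> c \<Longrightarrow> v x \<le> 0" and "v a = 0" "v c = 0" "v' c > 0"
  shows "pi / \<omega> \<le> c - a"
proof (rule ccontr)
  assume "\<not> ?thesis"
  then have lt: "c < a + pi / \<omega>" by simp
  let ?D = "\<lambda>x. v' x * sin (\<omega> * (x - a)) - \<omega> * v x * cos (\<omega> * (x - a))"
  have "?D c \<le> ?D a"
  proof (rule DERIV_nonpos_imp_nonincreasing[of a c ?D])
    fix x assume x: "a \<le> x" "x \<le> c"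
    have "(\<omega>\<^sup>2 - q x) * v x * sin (\<omega> * (x - a)) \<le> 0"
      using q[OF x] neg[OF x] sin_nonneg_scaled[OF assms(2) x(1)] x lt
      by (intro mult_nonpos_nonneg mult_nonneg_nonpos) auto
    then show "\<exists>y. (?D has_real_derivative y) (at x) \<and> y \<le> 0"
      using sturm_wronskian_deriv[of v v' x q \<omega> a, OF v[OF x] v'[OF x]] by blast
  qed (use assms(1) in simp)
  moreover have "?D a = 0" "?D c = v' c * sin (\<omega> * (c - a))" using assms by simp_all
  moreover have "sin (\<omega> * (c - a)) > 0"
  proof (rule sin_gt_zero)
    show "0 < \<omega> * (c - a)" using assms by simp
    have "\<omega> * (c - a) < \<omega> * (pi / \<omega>)" using assms lt by (intro mult_strict_left_mono) auto
    then show "\<omega> * (c - a) < pi" using assms by simp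
  qed
  ultimately show False using assms by (simp add: mult_le_0_iff)
qed

text \<open>If v were negative on the whole interval, the Wronskian would be nondecreasing, although
  it starts at -\<omega> v(a) > 0 and ends at \<omega> v(a + \<pi>/\<omega>) < 0.\<close>

lemma sturm_zero:
  fixes \<omega> :: real
  assumes "\<omega> > 0"
    and v: "\<And>x. a \<le> x \<Longrightarrow> x \<le> a + pi / \<omega> \<Longrightarrow> (v has_real_derivative v' x) (at x)"
    and v': "\<And>x. a \<le> x \<Longrightarrow> x \<le> a + pi / \<omega> \<Longrightarrow> (v' has_real_derivative - (q x * v x)) (at x)"
    and q: "\<And>x. a \<le> x \<Longrightarrow> x \<le> a + pi / \<omega> \<Longrightarrow> q x \<ge> \<omega>\<^sup>2"
  obtains x where "a \<le> x" "x \<le> a + pi / \<omega>" "v x \<ge> 0"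
proof (rule ccontr)
  assume "\<not> thesis"
  then have neg: "v x < 0" if "a \<le> x" "x \<le> a + pi / \<omega>" for x
    using \<open>\<And>x. a \<le> x \<Longrightarrow> x \<le> a + pi / \<omega> \<Longrightarrow> 0 \<le> v x \<Longrightarrow> thesis\<close> that by force
  let ?D = "\<lambda>x. v' x * sin (\<omega> * (x - a)) - \<omega> * v x * cos (\<omega> * (x - a))"
  let ?c = "a + pi / \<omega>"
  have "?D a \<le> ?D ?c"
  proof (rule DERIV_nonneg_imp_nondecreasing[of a ?c ?D])
    fix x assume x: "a \<le> x" "x \<le> ?c"
    have "(q x - \<omega>\<^sup>2) * (- v x) * sin (\<omega> * (x - a)) \<ge> 0"
      using q[OF x] neg[OF x] sin_nonneg_scaled[OF assms(1) x]
      by (intro mult_nonneg_nonneg) auto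
    then show "\<exists>y. (?D has_real_derivative y) (at x) \<and> 0 \<le> y"
      using sturm_wronskian_deriv[of v v' x q \<omega> a, OF v[OF x] v'[OF x]]
      by (intro exI[of _ "(\<omega>\<^sup>2 - q x) * v x * sin (\<omega> * (x - a))"]) (simp add: left_diff_distrib)
  qed (use assms(1) in simp)
  moreover have "?D a = - (\<omega> * v a)" "?D ?c = \<omega> * v ?c" using assms(1) by simp_all
  moreover have "\<omega> * v a < 0" "\<omega> * v ?c < 0" using neg[of a] neg[of ?c] assms(1) by (simp_all add: mult_less_0_iff)
  ultimately show False by linarith
qed

section \<open>Neighbouring zeros and the first zero of Y\<close>

lemma last_zero_before:
  fixes f :: "real \<Rightarrow> real"
  assumes "continuous_on {l..y} f" "l < y" "f l \<ge> 0" "f y < 0"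
  obtains a where "l \<le> a" "a < y" "f a = 0" "\<And>x. a < x \<Longrightarrow> x \<le> y \<Longrightarrow> f x < 0"
proof -
  define S where "S = {x \<in> {l..y}. f x \<in> {0..}}"
  have "compact S"
    unfolding S_def compact_eq_bounded_closed
    using continuous_closed_preimage[OF assms(1), of "{0..}"]
    by (auto simp: vimage_def Int_def intro: bounded_subset[OF bounded_closed_interval[of l y]])
  moreover have "l \<in> S" using assms by (simp add: S_def)
  ultimately obtain a where a: "a \<in> S" "\<And>x. x \<in> S \<Longrightarrow> x \<le> a"
    using compact_attains_sup[of S] by blast
  have "a < y" using a(1) assms(4) by (cases "a = y") (auto simp: S_def)
  have neg: "f x < 0" if "a < x" "x \<le> y" for x
    using a(2)[of x] a(1) that by (force simp: S_def)
  have "f a = 0"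
  proof (rule ccontr)
    assume "f a \<noteq> 0"
    then have "f a > 0" using a(1) by (auto simp: S_def)
    moreover have "continuous_on {a..y} f" using assms(1) by (rule continuous_on_subset) (use a(1) in \<open>auto simp: S_def\<close>)
    ultimately obtain x where "a \<le> x" "x \<le> y" "f x = 0"
      using IVT2'[of f y 0 a] assms(4) \<open>a < y\<close> by auto
    then show False using neg[of x] \<open>f a > 0\<close> by (cases "x = a") auto
  qed
  then show thesis using that[of a] a(1) \<open>a < y\<close> neg by (auto simp: S_def)
qed

lemma first_zero_after:
  fixes f :: "real \<Rightarrow> real"
  assumes "continuous_on {y..r} f" "y < r" "f r \<ge> 0" "f y < 0"
  obtains c where "y < c" "c \<le> r" "f c = 0" "\<And>x. y \<le> x \<Longrightarrow> x < c \<Longrightarrow> f x < 0"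
proof -
  have "continuous_on {- r.. - y} (\<lambda>x. f (- x))"
    by (intro continuous_on_compose2[OF assms(1)] continuous_intros) auto
  from last_zero_before[OF this] assms obtain a where
    a: "- r \<le> a" "a < - y" "f (- a) = 0" "\<And>x. a < x \<Longrightarrow> x \<le> - y \<Longrightarrow> f (- x) < 0" by auto
  show thesis
  proof (rule that[of "- a"])
    show "f x < 0" if "y \<le> x" "x < - a" for x using a(4)[of "- x"] that by simp
  qed (use a in auto)
qed

lemma first_positive_zero:
  fixes f :: "real \<Rightarrow> real"
  assumes "continuous_on {0<..} f" "\<forall>\<^sub>F x in at_right 0. f x < 0" "x > 0" "f x \<ge> 0"
  obtains z where "0 < z" "z \<le> x" "f z = 0" "\<And>t. 0 < t \<Longrightarrow> t < z \<Longrightarrow> f t < 0"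
proof -
  obtain \<delta> where \<delta>: "\<delta> > 0" "\<And>t. 0 < t \<Longrightarrow> t < \<delta> \<Longrightarrow> f t < 0"
    using assms(2) by (auto simp: eventually_at_right_field)
  define y where "y = \<delta> / 2"
  have y: "0 < y" "y < \<delta>" using \<delta>(1) by (simp_all add: y_def)
  then have "y < x" using \<delta>(2)[of x] assms(3,4) by force
  have "continuous_on {y..x} f" by (rule continuous_on_subset[OF assms(1)]) (use y in auto)
  from first_zero_after[OF this \<open>y < x\<close> assms(4)] \<delta>(2)[of y] y
  obtain c where c: "y < c" "c \<le> x" "f c = 0" "\<And>t. y \<le> t \<Longrightarrow> t < c \<Longrightarrow> f t < 0" by auto
  show thesis
  proof (rule that[of c])
    show "f t < 0" if "0 < t" "t < c" for t using c(4)[of t] \<delta>(2)[of t] that y by (cases "t < y") auto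
  qed (use c y in auto)
qed

lemma bessel_Y_continuous: "\<nu> = real n / 2 \<Longrightarrow> continuous_on {0<..} (bessel_Y \<nu>)"
  by (rule DERIV_continuous_on) (auto intro: DERIV_subset[OF bessel_Y_deriv])

lemma bessel_J_continuous: "continuous_on {0<..} (bessel_J \<nu>)"
  by (rule DERIV_continuous_on) (auto intro: DERIV_subset[OF bessel_J_deriv])

lemma bessel_Y_neg_near_0:
  assumes "\<nu> = real n / 2" "n \<ge> 1"
  shows "\<forall>\<^sub>F x in at_right 0. bessel_Y \<nu> x < 0"
proof -
  obtain c where "c > 0" "((\<lambda>x. x powr \<nu> * bessel_Y \<nu> x) \<longlongrightarrow> - c) (at_right 0)" using bessel_Y_at_0[OF assms] .
  then have "\<forall>\<^sub>F x in at_right 0. x powr \<nu> * bessel_Y \<nu> x < 0" by (intro order_tendstoD(2)) auto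
  then show ?thesis by (rule eventually_mono) (auto simp: mult_less_0_iff)
qed

lemma bessel_J_pos_near_0:
  assumes "\<nu> \<ge> 0"
  shows "\<forall>\<^sub>F x in at_right 0. bessel_J \<nu> x > 0"
proof -
  have "2 powr - \<nu> * rGamma (\<nu> + 1) > 0" using assms by (simp add: rGamma_inverse_Gamma Gamma_real_pos)
  then have "\<forall>\<^sub>F x in at_right 0. x powr - \<nu> * bessel_J \<nu> x > 0"
    using order_tendstoD(1)[OF bessel_J_at_0] by blast
  then show ?thesis by (rule eventually_mono) (auto simp: zero_less_mult_iff)
qed

text \<open>\<open>LEAST\<close> over the reals is meaningful here because Y is negative near 0,
  Sturm comparison with a sine of frequency 1/2 produces a point where Y \<ge> 0, and continuity
  then gives a first zero.\<close>

lemma bessel_Y_first_zero: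
  assumes \<nu>: "\<nu> = real n / 2" and n: "n \<ge> 1"
  shows "bessel_Y_first_zero \<nu> > 0" "bessel_Y \<nu> (bessel_Y_first_zero \<nu>) = 0"
    "\<And>t. 0 < t \<Longrightarrow> t < bessel_Y_first_zero \<nu> \<Longrightarrow> bessel_Y \<nu> t < 0"
    "bessel_Y_first_zero \<nu> \<le> 7 / 6 * \<nu> + 1 + 2 * pi"
proof -
  \<comment> \<open>The square 49/36 of 7/6 exceeds 4/3, so from X on the potential is at least 1/4,
    the square of the frequency 1/2; an interval of length 2\<pi> then suffices.\<close>
  define X where "X = 7 / 6 * \<nu> + 1"
  have X: "X \<ge> 1" using \<nu> by (simp add: X_def)
  have q: "osc_potential \<nu> x \<ge> (1 / 2)\<^sup>2" if "x \<ge> X" for x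
  proof -
    have "X\<^sup>2 \<ge> (7 / 6 * \<nu>)\<^sup>2" using \<nu> unfolding X_def by (intro power_mono) auto
    then have "X\<^sup>2 \<ge> 49 / 36 * \<nu>\<^sup>2" by (simp add: power_mult_distrib power_divide)
    moreover have "x\<^sup>2 \<ge> X\<^sup>2" using that X by (intro power_mono) auto
    moreover have "\<nu>\<^sup>2 \<ge> 0" by simp
    ultimately have "3 / 4 * x\<^sup>2 \<ge> \<nu>\<^sup>2 - 1 / 4" by linarith
    then have "(\<nu>\<^sup>2 - 1 / 4) / x\<^sup>2 \<le> 3 / 4" using that X by (subst divide_le_eq) auto
    then show ?thesis by (simp add: osc_potential_def power2_eq_square)
  qed
  obtain x where x: "X \<le> x" "x \<le> X + pi / (1 / 2)" "osc bessel_Y \<nu> x \<ge> 0"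
    using sturm_zero[of "1 / 2" X "osc bessel_Y \<nu>" "osc_deriv bessel_Y \<nu>" "osc_potential \<nu>"]
      osc_has_deriv[OF cylinder_bessel_Y \<nu>] osc_deriv_has_deriv[OF cylinder_bessel_Y \<nu>] q X by auto
  then have "bessel_Y \<nu> x \<ge> 0" using X by (simp add: osc_def zero_le_mult_iff)
  then obtain z where z: "0 < z" "z \<le> x" "bessel_Y \<nu> z = 0" "\<And>t. 0 < t \<Longrightarrow> t < z \<Longrightarrow> bessel_Y \<nu> t < 0"
    using first_positive_zero[OF bessel_Y_continuous[OF \<nu>] bessel_Y_neg_near_0[OF \<nu> n], of x] x X by auto
  have "bessel_Y_first_zero \<nu> = z"
    unfolding bessel_Y_first_zero_def
  proof (rule Least_equality)
    fix y assume "0 < y \<and> bessel_Y \<nu> y = 0"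
    then show "z \<le> y" using z(4)[of y] by force
  qed (use z in simp)
  then show "bessel_Y_first_zero \<nu> > 0" "bessel_Y \<nu> (bessel_Y_first_zero \<nu>) = 0"
    "\<And>t. 0 < t \<Longrightarrow> t < bessel_Y_first_zero \<nu> \<Longrightarrow> bessel_Y \<nu> t < 0"
    "bessel_Y_first_zero \<nu> \<le> 7 / 6 * \<nu> + 1 + 2 * pi"
    using z x by (auto simp: X_def)
qed

text \<open>At a zero of one function the Wronskian reduces to a single product. At a zero of J its
  sign excludes a double zero and ties Y to the slope of J; at a zero of Y its value links J to
  Y_{\<nu>+1}.\<close>

lemma wronskian_at_zero:
  assumes "x > 0" "\<nu> = real n / 2"
  shows "bessel_J \<nu> x = 0 \<Longrightarrow> bessel_J (\<nu> + 1) x * bessel_Y \<nu> x > 0"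
    and "bessel_Y \<nu> x = 0 \<Longrightarrow> bessel_J \<nu> x * bessel_Y (\<nu> + 1) x * x = - 2 / pi"
proof -
  have W: "x * (bessel_J (\<nu> + 1) x * bessel_Y \<nu> x - bessel_J \<nu> x * bessel_Y (\<nu> + 1) x) = 2 / pi"
    using bessel_wronskian_eq[OF assms] by (simp add: bessel_wronskian_def)
  show "bessel_J (\<nu> + 1) x * bessel_Y \<nu> x > 0" if "bessel_J \<nu> x = 0"
  proof -
    have "x * (bessel_J (\<nu> + 1) x * bessel_Y \<nu> x) > 0" using W that by simp
    then show ?thesis using assms(1) by (simp only: zero_less_mult_pos)
  qed
  show "bessel_J \<nu> x * bessel_Y (\<nu> + 1) x * x = - 2 / pi" if "bessel_Y \<nu> x = 0"
    using W that by (simp add: mult_ac)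
qed

lemma bessel_J_deriv_at_zero:
  assumes "x > 0" "bessel_J \<nu> x = 0"
  shows "(bessel_J \<nu> has_real_derivative - bessel_J (\<nu> + 1) x) (at x)"
  using bessel_J_deriv[OF assms(1), of \<nu>] assms(2) by simp

text \<open>J comes down to its first zero from positive values, so J' = -J_{\<nu>+1} is not
  positive there, and it does not vanish; the Wronskian then forces Y to be positive.\<close>

lemma bessel_J_first_zero_sign:
  assumes "\<nu> = real n / 2" "j > 0" "bessel_J \<nu> j = 0" "\<And>t. 0 < t \<Longrightarrow> t < j \<Longrightarrow> bessel_J \<nu> t > 0"
  shows "bessel_J (\<nu> + 1) j > 0" "bessel_Y \<nu> j > 0"
proof -
  have "bessel_J (\<nu> + 1) j \<noteq> 0" using wronskian_at_zero(1)[OF assms(2,1,3)] by auto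
  moreover have "bessel_J (\<nu> + 1) j \<ge> 0"
  proof (rule ccontr)
    assume "\<not> ?thesis"
    then have "- bessel_J (\<nu> + 1) j > 0" by simp
    from DERIV_pos_inc_left[OF bessel_J_deriv_at_zero[OF assms(2,3)] this]
    obtain d where "d > 0" "\<And>h. 0 < h \<Longrightarrow> h < d \<Longrightarrow> bessel_J \<nu> (j - h) < 0" using assms(3) by auto
    then have "bessel_J \<nu> (j - min (d / 2) (j / 2)) < 0" using assms(2) by auto
    moreover have "bessel_J \<nu> (j - min (d / 2) (j / 2)) > 0"
      using \<open>d > 0\<close> assms(2) by (intro assms(4)) (auto simp: min_def)
    ultimately show False by simp
  qed
  ultimately show "bessel_J (\<nu> + 1) j > 0" by simp
  then show "bessel_Y \<nu> j > 0"
    using wronskian_at_zero(1)[OF assms(2,1,3)] by (simp add: zero_less_mult_iff)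
qed

text \<open>Y is positive at the first zero of J, but at most 0 up to its own first zero; hence the
  first zero of Y comes earlier.\<close>

lemma bessel_J_pos_before_Y_zero:
  assumes "\<nu> = real n / 2" "n \<ge> 1" "0 < x" "x \<le> bessel_Y_first_zero \<nu>"
  shows "bessel_J \<nu> x > 0"
proof (rule ccontr)
  assume "\<not> ?thesis"
  then have x: "- bessel_J \<nu> x \<ge> 0" by simp
  have "continuous_on {0<..} (\<lambda>x. - bessel_J \<nu> x)" by (intro continuous_intros bessel_J_continuous)
  moreover have "\<forall>\<^sub>F x in at_right 0. - bessel_J \<nu> x < 0" using bessel_J_pos_near_0[of \<nu>] unfolding assms(1) by simp
  ultimately obtain j where j: "0 < j" "j \<le> x" "bessel_J \<nu> j = 0" "\<And>t. 0 < t \<Longrightarrow> t < j \<Longrightarrow> bessel_J \<nu> t > 0"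
    using first_positive_zero[of "\<lambda>x. - bessel_J \<nu> x" x] x assms(3) by auto
  then have "bessel_Y \<nu> j > 0" using bessel_J_first_zero_sign[OF assms(1)] by blast
  moreover have "bessel_Y \<nu> j \<le> 0"
    using bessel_Y_first_zero(2,3)[OF assms(1,2)] j assms(4) by (cases "j = bessel_Y_first_zero \<nu>") (auto intro: less_imp_le)
  ultimately show False by simp
qed

section \<open>Comparison of x^(-\<nu>) J_\<nu>(x) with its value at the zero of Y\<close>

lemma powr_bessel_J_deriv:
  assumes "x > 0"
  shows "((\<lambda>x. x powr - \<nu> * bessel_J \<nu> x) has_real_derivative - (x powr - \<nu> * bessel_J (\<nu> + 1) x)) (at x)"
    "((\<lambda>x. x powr (\<nu> + 1) * bessel_J (\<nu> + 1) x) has_real_derivative x powr (\<nu> + 1) * bessel_J \<nu> x) (at x)"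
proof -
  have p: "((\<lambda>x. x powr a) has_real_derivative a / x * x powr a) (at x)" for a
    using assms by (auto intro!: derivative_eq_intros simp: powr_diff)
  show "((\<lambda>x. x powr - \<nu> * bessel_J \<nu> x) has_real_derivative - (x powr - \<nu> * bessel_J (\<nu> + 1) x)) (at x)"
    using DERIV_mult[OF p bessel_J_deriv[OF assms]]
    by (rule back_subst[of "\<lambda>d. (_ has_real_derivative d) _"]) (simp add: algebra_simps)
  show "((\<lambda>x. x powr (\<nu> + 1) * bessel_J (\<nu> + 1) x) has_real_derivative x powr (\<nu> + 1) * bessel_J \<nu> x) (at x)"
    using DERIV_mult[OF p bessel_J_deriv'[OF assms]]
    by (rule back_subst[of "\<lambda>d. (_ has_real_derivative d) _"]) (simp add: algebra_simps)
qed

text \<open>x^(\<nu>+1) J_{\<nu>+1} starts from 0 and increases as long as J_\<nu> is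
  positive.\<close>

lemma bessel_J_Suc_nonneg:
  assumes "\<nu> \<ge> 0" "s > 0" "\<And>t. 0 < t \<Longrightarrow> t < s \<Longrightarrow> bessel_J \<nu> t > 0"
  shows "bessel_J (\<nu> + 1) s \<ge> 0"
proof -
  let ?f = "\<lambda>x. x powr (\<nu> + 1) * bessel_J (\<nu> + 1) x"
  have mono: "?f x \<le> ?f s" if "0 < x" "x < s" for x
  proof (rule DERIV_nonneg_imp_increasing_open[OF less_imp_le[OF that(2)]])
    show "\<exists>y. (?f has_real_derivative y) (at t) \<and> 0 \<le> y" if "x < t" "t < s" for t
      using powr_bessel_J_deriv(2)[of t \<nu>] assms(3)[of t] that \<open>0 < x\<close> by (intro exI conjI) auto
    show "continuous_on {x..s} ?f"
      by (rule DERIV_continuous_on) (use \<open>0 < x\<close> in \<open>auto intro: DERIV_subset[OF powr_bessel_J_deriv(2)]\<close>)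
  qed
  have "((\<lambda>x::real. x powr (2 * (\<nu> + 1))) \<longlongrightarrow> 0 powr (2 * (\<nu> + 1))) (at_right 0)"
    using assms(1) by (intro tendsto_powr' tendsto_intros) (auto intro: eventually_mono[OF eventually_at_right_less])
  then have "((\<lambda>x::real. x powr (2 * (\<nu> + 1))) \<longlongrightarrow> 0) (at_right 0)" by simp
  from tendsto_mult[OF this bessel_J_at_0[of "\<nu> + 1"]]
  have "((\<lambda>x. x powr (2 * (\<nu> + 1)) * (x powr - (\<nu> + 1) * bessel_J (\<nu> + 1) x))
      \<longlongrightarrow> 0 * (2 powr - (\<nu> + 1) * rGamma (\<nu> + 1 + 1))) (at_right 0)" .
  moreover have "\<forall>\<^sub>F x in at_right 0. x powr (2 * (\<nu> + 1)) * (x powr - (\<nu> + 1) * bessel_J (\<nu> + 1) x) = ?f x"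
    by (auto simp: eventually_at_right_field mult.assoc[symmetric] powr_add[symmetric] intro!: exI[of _ 1])
  ultimately have "(?f \<longlongrightarrow> 0) (at_right 0)" by (simp add: Lim_transform_eventually)
  moreover have "\<forall>\<^sub>F x in at_right 0. ?f x \<le> ?f s"
    using mono assms(2) by (auto simp: eventually_at_right_field intro!: exI[of _ s])
  ultimately have "0 \<le> ?f s" by (rule tendsto_upperbound) simp
  then show ?thesis using assms(2) by (simp add: zero_le_mult_iff)
qed

text \<open>The derivative is -x^(-\<nu>) J_{\<nu>+1}. This settles the comparison below z, and
  above z it forces any violation to lie beyond a zero of J_\<nu>.\<close>

lemma bessel_J_quotient_decreasing:
  assumes "\<nu> \<ge> 0" "0 < r" "r \<le> t" "\<And>x. 0 < x \<Longrightarrow> x < t \<Longrightarrow> bessel_J \<nu> x > 0"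
  shows "t powr - \<nu> * bessel_J \<nu> t \<le> r powr - \<nu> * bessel_J \<nu> r"
proof (rule DERIV_nonpos_imp_nonincreasing[OF assms(3)])
  fix x assume x: "r \<le> x" "x \<le> t"
  then have "bessel_J (\<nu> + 1) x \<ge> 0" using bessel_J_Suc_nonneg[OF assms(1), of x] assms(2,4) by auto
  then show "\<exists>y. ((\<lambda>x. x powr - \<nu> * bessel_J \<nu> x) has_real_derivative y) (at x) \<and> y \<le> 0"
    using powr_bessel_J_deriv(1)[of x \<nu>] x assms(2) by (intro exI conjI) auto
qed

lemma exp_ge_quadratic: "0 \<le> x \<Longrightarrow> 1 + x + x\<^sup>2 / 2 \<le> exp (x::real)"
  using exp_lower_Taylor_quadratic[of x] by simp

text \<open>The hypothesis on n says that (n+1)/s is at least 2 sqrt(1-q). Hence (n+1) ln(s/z) \<ge>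
  (n+1)(s-z)/s \<ge> 2\<pi> y, and the exponential is bounded below by its quadratic Taylor
  polynomial.\<close>

lemma power_ratio_bound:
  fixes s z q :: real
  assumes "0 < z" "0 < q" "q \<le> 1" "n \<ge> 1" and gap: "s - z \<ge> pi / sqrt q"
    and s: "(real n + 1)\<^sup>2 \<ge> 4 * (1 - q) * s\<^sup>2"
    and y: "y = sqrt ((1 - q) / q)"
  shows "(s / z) ^ (n + 1) \<ge> 1 + 2 * pi * y + 2 * pi\<^sup>2 * y\<^sup>2"
proof -
  have "pi / sqrt q > 0" using assms(2) by simp
  then have "s > z" using gap by linarith
  then have "s > 0" using assms(1) by simp
  have y0: "y \<ge> 0" using assms(2,3) y by simp
  have "2 * sqrt (1 - q) * s \<le> real n + 1"
  proof (rule power2_le_imp_le)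
    show "(2 * sqrt (1 - q) * s)\<^sup>2 \<le> (real n + 1)\<^sup>2" using s assms(3) by (simp add: power_mult_distrib)
  qed simp
  then have *: "2 * sqrt (1 - q) \<le> (real n + 1) / s" using \<open>s > 0\<close> by (simp add: field_simps)
  have "2 * pi * y = 2 * sqrt (1 - q) * (pi / sqrt q)" by (simp add: y real_sqrt_divide)
  also have "\<dots> \<le> (real n + 1) / s * (s - z)"
    using * gap assms(2,3) by (intro mult_mono) (auto simp: \<open>pi / sqrt q > 0\<close> less_imp_le \<open>s > 0\<close>)
  also have "\<dots> = (real n + 1) * (1 - z / s)" using \<open>s > 0\<close> by (simp add: field_simps)
  also have "\<dots> \<le> (real n + 1) * ln (s / z)"
  proof (rule mult_left_mono)
    have "ln (z / s) \<le> z / s - 1" using assms(1) \<open>s > 0\<close> by (intro ln_le_minus_one) simp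
    moreover have "ln (z / s) = - ln (s / z)" using assms(1) \<open>s > 0\<close> by (simp add: ln_div)
    ultimately show "1 - z / s \<le> ln (s / z)" by linarith
  qed simp
  finally have "exp (2 * pi * y) \<le> exp (ln (s / z) * (real n + 1))" by (simp add: mult.commute)
  also have "\<dots> = (s / z) powr (real (n + 1))" using assms(1) \<open>s > 0\<close> by (simp add: powr_def mult.commute add.commute)
  also have "\<dots> = (s / z) ^ (n + 1)" using assms(1) \<open>s > 0\<close> by (subst powr_realpow) auto
  finally have "exp (2 * pi * y) \<le> (s / z) ^ (n + 1)" .
  moreover have "1 + 2 * pi * y + (2 * pi * y)\<^sup>2 / 2 \<le> exp (2 * pi * y)"
    using y0 by (intro exp_ge_quadratic) simp
  ultimately show ?thesis by (simp add: power_mult_distrib)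
qed

text \<open>
  For odd \<open>n\<close> the exponential gain over the gap compensates the factor \<open>q\<close>, with nothing to spare
  as \<open>q\<close> tends to 1; for even \<open>n\<close> and \<open>q\<close> close to 1, Bernoulli's inequality provides the factor \<open>3/2\<close>.
\<close>

lemma power_ratio_final:
  fixes s z q :: real
  assumes "0 < z" "0 < q" "q \<le> 1" "n \<ge> 1" and gap: "s - z \<ge> pi / sqrt q"
    and s: "(real n + 1)\<^sup>2 \<ge> 4 * (1 - q) * s\<^sup>2"
    and z: "z \<le> 7 / 12 * real n + 1 + 2 * pi"
  shows "q * (s / z) ^ (n + 1) \<ge> (if odd n then 1 else 3 / 2)"
proof -
  define y where "y = sqrt ((1 - q) / q)"
  have y0: "y \<ge> 0" using assms(2,3) by (simp add: y_def)
  have "y\<^sup>2 = (1 - q) / q" using assms(2,3) by (simp add: y_def)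
  \<comment> \<open>This identity reduces the claim to (s/z)^(n+1) \<ge> K (1 + y^2) with K = 1 or K
    = 3/2.\<close>
  then have q: "q * (1 + y\<^sup>2) = 1" using assms(2) by (simp add: field_simps)
  have main: "1 + 2 * pi * y + 2 * pi\<^sup>2 * y\<^sup>2 \<le> (s / z) ^ (n + 1)"
    by (rule power_ratio_bound[OF assms(1-6) y_def])
  have pi: "pi > 3" by (rule pi_gt3)
  then have "pi\<^sup>2 \<ge> 9" using power_mono[of 3 pi 2] by simp
  then have y1: "2 * pi\<^sup>2 * y\<^sup>2 \<ge> 18 * y\<^sup>2" by (intro mult_right_mono) auto
  have y2: "2 * pi * y \<ge> 6 * y" using pi y0 by (intro mult_right_mono) auto
  have concl: ?thesis if "(s / z) ^ (n + 1) \<ge> K * (1 + y\<^sup>2)" "K = (if odd n then 1 else 3 / 2)" for K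
  proof -
    have "q * (K * (1 + y\<^sup>2)) \<le> q * (s / z) ^ (n + 1)" using that assms(2) by (intro mult_left_mono) auto
    moreover have "q * (K * (1 + y\<^sup>2)) = K" using q by (metis mult.left_commute mult.right_neutral)
    ultimately have "K \<le> q * (s / z) ^ (n + 1)" by (simp only:)
    then show ?thesis unfolding that(2) .
  qed
  show ?thesis
  proof (cases "odd n")
    case True
    have "y\<^sup>2 \<ge> 0" by simp
    then have "1 + y\<^sup>2 \<le> (s / z) ^ (n + 1)" using main y1 y2 y0 by linarith
    then show ?thesis using concl[of 1] True by simp
  next
    case False
    then have n2: "n \<ge> 2" using assms(4) by (cases "n = 1") auto
    show ?thesis
    \<comment> \<open>For y \<ge> 1/10 the linear term, at least 6 y, covers the surplus 1/2 of K
      over 1. For smaller y one has 3/2 (1 + y^2) \<le> 1.515, so the value 1.52 is aimed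
      at.\<close>
    proof (cases "y \<ge> 1 / 10")
      case True
      have "3 / 2 * (1 + Y) \<le> P"
        if "1 + a + b \<le> P" "18 * Y \<le> b" "6 * y \<le> a" "0 \<le> Y" for a b Y P :: real
        using that True by simp
      from this[OF main y1 y2] have "3 / 2 * (1 + y\<^sup>2) \<le> (s / z) ^ (n + 1)" by simp
      then show ?thesis using concl[of "3 / 2"] False by simp
    next
      case small: False
      have "y\<^sup>2 \<le> (1 / 10)\<^sup>2" using small y0 by (intro power_mono) auto
      then have "3 / 2 * (1 + y\<^sup>2) \<le> 152 / 100" by (simp add: power2_eq_square)
      also have "\<dots> \<le> (s / z) ^ (n + 1)"
      proof -
        have "pi < 22 / 7" using pi_less_4 pi_approx by simp
        have "1 \<le> 1 / sqrt q" using assms(2,3) by simp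
        then have "pi * 1 \<le> pi * (1 / sqrt q)" by (intro mult_left_mono) auto
        then have sz: "s - z \<ge> pi" using gap by simp
        have "1 + real (n + 1) * (s / z - 1) \<le> (1 + (s / z - 1)) ^ (n + 1)"
          by (rule Bernoulli_inequality) (use assms(1) sz pi in \<open>simp add: field_simps\<close>)
        moreover have "52 / 100 \<le> real (n + 1) * (s / z - 1)"
        proof -
          \<comment> \<open>With n \<ge> 2 and \<pi> < 22/7 the upper bound on z is below 3.1 (n +
            1), while s - z exceeds 3.\<close>
          have "z \<le> 31 / 10 * real (n + 1)"
            using z \<open>pi < 22 / 7\<close> n2 by simp
          then have "52 / 100 * z \<le> real (n + 1) * 3" by simp
          also have "\<dots> \<le> real (n + 1) * (s - z)" using sz pi by (intro mult_left_mono) auto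
          finally show ?thesis using assms(1) by (simp add: field_simps)
        qed
        ultimately have "1 + 52 / 100 \<le> (1 + (s / z - 1)) ^ (n + 1)" by linarith
        then show ?thesis by simp
      qed
      finally show ?thesis using concl[of "3 / 2"] False by simp
    qed
  qed
qed

text \<open>Since x^(-\<nu>) J_\<nu> decreases while J is positive, a larger value at s requires J
  to vanish after z, turn negative and come back. The negative arc through \<open>y\<close> lies
  between two zeros in (z, s], where the potential, nondecreasing for \<nu> \<ge> 1/2, is at most
  its value at s.\<close>

lemma bessel_J_zero_gap:
  assumes \<nu>: "\<nu> = real n / 2" and n: "n \<ge> 1" and z: "z = bessel_Y_first_zero \<nu>" and s: "s > z"
    and gt: "s powr - \<nu> * bessel_J \<nu> s > z powr - \<nu> * bessel_J \<nu> z"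
    and \<omega>: "\<omega> > 0" "osc_potential \<nu> s \<le> \<omega>\<^sup>2"
  shows "pi / \<omega> \<le> s - z"
proof -
  have nu0: "\<nu> \<ge> 0" unfolding \<nu> by simp
  have z0: "z > 0" using bessel_Y_first_zero(1)[OF \<nu> n] z by simp
  have Jpos: "bessel_J \<nu> x > 0" if "0 < x" "x \<le> z" for x
    using bessel_J_pos_before_Y_zero[OF \<nu> n] that z by simp
  have "s powr - \<nu> * bessel_J \<nu> s > 0"
    using gt Jpos[OF z0] z0 by (smt (verit) mult_nonneg_nonneg powr_ge_zero)
  then have Js: "bessel_J \<nu> s > 0" by (simp add: zero_less_mult_iff)
  have "\<exists>x. 0 < x \<and> x < s \<and> bessel_J \<nu> x \<le> 0"
    using bessel_J_quotient_decreasing[OF nu0 z0, of s] s gt by force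
  then obtain x where x: "0 < x" "x < s" "- bessel_J \<nu> x \<ge> 0" by auto
  have "continuous_on {0<..} (\<lambda>x. - bessel_J \<nu> x)" by (intro continuous_intros bessel_J_continuous)
  moreover have "\<forall>\<^sub>F x in at_right 0. - bessel_J \<nu> x < 0" using bessel_J_pos_near_0[OF nu0] by simp
  ultimately obtain j where j: "0 < j" "j \<le> x" "bessel_J \<nu> j = 0" "\<And>t. 0 < t \<Longrightarrow> t < j \<Longrightarrow> bessel_J \<nu> t > 0"
    using first_positive_zero[of "\<lambda>x. - bessel_J \<nu> x" x] x by auto
  have "z < j" using Jpos[of j] j by force
  have "- bessel_J (\<nu> + 1) j < 0" using bessel_J_first_zero_sign(1)[OF \<nu> j(1,3,4)] by simp
  from DERIV_neg_dec_right[OF bessel_J_deriv_at_zero[OF j(1,3)] this]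
  obtain d where d: "d > 0" "\<And>h. 0 < h \<Longrightarrow> h < d \<Longrightarrow> bessel_J \<nu> (j + h) < 0" using j(3) by auto
  \<comment> \<open>A point just behind the first zero, where J is strictly negative; the halves
    keep it inside the range given by the derivative and before s.\<close>
  define y where "y = j + min (d / 2) ((s - j) / 2)"
  have "min (d / 2) ((s - j) / 2) > 0" "min (d / 2) ((s - j) / 2) < d" "min (d / 2) ((s - j) / 2) < s - j"
    using d(1) j(2) x(2) by (auto simp: min_def)
  then have y: "j < y" "y < s" "bessel_J \<nu> y < 0" using d(2) by (simp_all add: y_def)
  have cont: "continuous_on {j..y} (bessel_J \<nu>)" "continuous_on {y..s} (bessel_J \<nu>)"
    using j(1) y(1) by (auto intro!: continuous_on_subset[OF bessel_J_continuous])
  obtain a where a: "j \<le> a" "a < y" "bessel_J \<nu> a = 0" "\<And>x. a < x \<Longrightarrow> x \<le> y \<Longrightarrow> bessel_J \<nu> x < 0"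
    using last_zero_before[OF cont(1) y(1)] j(3) y(3) by auto
  obtain c where c: "y < c" "c \<le> s" "bessel_J \<nu> c = 0" "\<And>x. y \<le> x \<Longrightarrow> x < c \<Longrightarrow> bessel_J \<nu> x < 0"
    using first_zero_after[OF cont(2) y(2)] Js y(3) by auto
  have "a > 0" using a(1) j(1) by simp
  have neg: "bessel_J \<nu> x \<le> 0" if "a \<le> x" "x \<le> c" for x
  proof -
    have "x = a \<or> x = c \<or> a < x \<and> x \<le> y \<or> y \<le> x \<and> x < c" using that by linarith
    then show ?thesis using a(3,4) c(3,4) by (auto intro: less_imp_le)
  qed
  have "pi / \<omega> \<le> c - a"
  proof (rule sturm_gap[where v = "osc bessel_J \<nu>" and v' = "osc_deriv bessel_J \<nu>" and q = "osc_potential \<nu>"])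
    show "(osc bessel_J \<nu> has_real_derivative osc_deriv bessel_J \<nu> x) (at x)"
      "(osc_deriv bessel_J \<nu> has_real_derivative - (osc_potential \<nu> x * osc bessel_J \<nu> x)) (at x)"
      if "a \<le> x" for x
      using that \<open>a > 0\<close> by (auto intro!: osc_has_deriv osc_deriv_has_deriv cylinder_bessel_J \<nu>)
    show "osc_potential \<nu> x \<le> \<omega>\<^sup>2" if "a \<le> x" "x \<le> c" for x
    proof -
      have "(1 / 2)\<^sup>2 \<le> \<nu>\<^sup>2" using \<nu> n by (intro power_mono) auto
      moreover have "x\<^sup>2 \<le> s\<^sup>2" using that c(2) \<open>a > 0\<close> by (intro power_mono) auto
      ultimately have "(\<nu>\<^sup>2 - 1 / 4) / s\<^sup>2 \<le> (\<nu>\<^sup>2 - 1 / 4) / x\<^sup>2"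
        using that \<open>a > 0\<close> c by (intro divide_left_mono) (auto simp: power_divide)
      then show ?thesis using \<omega>(2) by (simp add: osc_potential_def)
    qed
    show "osc bessel_J \<nu> x \<le> 0" if "a \<le> x" "x \<le> c" for x
      using neg[OF that] that \<open>a > 0\<close> by (simp add: osc_def mult_nonneg_nonpos)
    show "osc_deriv bessel_J \<nu> c > 0"
    proof -
      have "c > 0" using \<open>a > 0\<close> a c by simp
      have "bessel_J (\<nu> + 1) c \<noteq> 0" using wronskian_at_zero(1)[OF \<open>c > 0\<close> \<nu> c(3)] by auto
      moreover have "bessel_J (\<nu> + 1) c \<le> 0"
      proof (rule ccontr)
        assume "\<not> ?thesis"
        then have "- bessel_J (\<nu> + 1) c < 0" by simp
        from DERIV_neg_dec_left[OF bessel_J_deriv_at_zero[OF \<open>c > 0\<close> c(3)] this]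
        obtain e where e: "e > 0" "\<And>h. 0 < h \<Longrightarrow> h < e \<Longrightarrow> bessel_J \<nu> (c - h) > 0" using c(3) by auto
        have "min (e / 2) ((c - y) / 2) > 0" "min (e / 2) ((c - y) / 2) < e" "min (e / 2) ((c - y) / 2) < c - y"
          using e(1) c(1) by (auto simp: min_def)
        then show False using e(2)[of "min (e / 2) ((c - y) / 2)"] c(4)[of "c - min (e / 2) ((c - y) / 2)"] by simp
      qed
      ultimately show ?thesis using \<open>c > 0\<close> c(3) by (simp add: osc_deriv_def osc_def mult_pos_neg)
    qed
  qed (use a c \<omega> in \<open>auto simp: osc_def\<close>)
  then show ?thesis using \<open>z < j\<close> a c by linarith
qed

text \<open>A violation at s means vz^2 (s/z)^(n+1) < vs^2 for the values \<open>vs\<close>,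
  \<open>vz\<close> of sqrt x J_\<nu>(x). The energy of J bounds q vs^2 by A; the energy of Y at z
  and the Wronskian give vz^2 \<ge> 4 / (\<pi>^2 B). Together with the gain over the gap, A B
  \<pi>^2 would exceed 4 for odd n and 6 for even n.\<close>

theorem bessel_J_quotient_le_at_Y_zero:
  assumes \<nu>: "\<nu> = real n / 2" and n: "n \<ge> 1" and z: "z = bessel_Y_first_zero \<nu>" and s: "s \<ge> z"
  shows "s powr - \<nu> * bessel_J \<nu> s \<le> z powr - \<nu> * bessel_J \<nu> z"
proof (rule ccontr)
  assume "\<not> ?thesis"
  then have gt: "s powr - \<nu> * bessel_J \<nu> s > z powr - \<nu> * bessel_J \<nu> z" by simp
  then have "s > z" using s by (cases "s = z") auto
  note gap = bessel_J_zero_gap[OF \<nu> n z \<open>s > z\<close> gt]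
  have z0: "z > 0" using bessel_Y_first_zero(1)[OF \<nu> n] z by simp
  have s0: "s > 0" using z0 \<open>s > z\<close> by simp
  have Jz: "bessel_J \<nu> z > 0" using bessel_J_pos_before_Y_zero[OF \<nu> n z0] z by simp
  define q where "q = osc_potential \<nu> s"
  have nu: "(1 / 2)\<^sup>2 \<le> \<nu>\<^sup>2" using \<nu> n by (intro power_mono) auto
  then have "(\<nu>\<^sup>2 - 1 / 4) / s\<^sup>2 \<ge> 0" by (simp add: power_divide)
  then have q1: "q \<le> 1" by (simp add: q_def osc_potential_def)
  have q0: "q > 0"
  proof (rule ccontr)
    assume "\<not> q > 0"
    \<comment> \<open>If the potential at s were not positive, every frequency would be admissible;
      this one demands a gap of 2 (s - z).\<close>
    moreover define \<omega> where "\<omega> = pi / (2 * (s - z))"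
    have "\<omega> > 0" using \<open>s > z\<close> by (simp add: \<omega>_def)
    ultimately have "pi / \<omega> \<le> s - z" by (intro gap) (auto simp: q_def[symmetric] intro: order_trans[of _ 0])
    then show False using \<open>s > z\<close> by (simp add: \<omega>_def)
  qed
  have gapq: "pi / sqrt q \<le> s - z" using q0 by (intro gap) (auto simp: q_def[symmetric])
  have sq: "(real n + 1)\<^sup>2 \<ge> 4 * (1 - q) * s\<^sup>2"
  proof -
    have "4 * (1 - q) * s\<^sup>2 = 4 * \<nu>\<^sup>2 - 1" using s0 by (simp add: q_def osc_potential_def)
    also have "4 * \<nu>\<^sup>2 = (real n)\<^sup>2" by (simp add: \<nu> power_divide)
    finally show ?thesis by (simp add: power2_eq_square algebra_simps)
  qed
  have zb: "z \<le> 7 / 12 * real n + 1 + 2 * pi" using bessel_Y_first_zero(4)[OF \<nu> n] unfolding z \<nu> by simp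
  have lower: "q * (s / z) ^ (n + 1) \<ge> (if odd n then 1 else 3 / 2)"
    by (rule power_ratio_final[OF z0 q0 q1 n gapq sq zb])
  obtain A B where AB: "0 \<le> A" "0 \<le> B" "osc_energy bessel_J \<nu> s \<le> A"
    "osc_energy bessel_Y \<nu> z \<le> B" "A * B * pi\<^sup>2 \<le> (if odd n then 4 else 6)"
    using osc_energy_bounds[OF \<nu> n] s0 z0 by metis
  define vs vz where "vs = osc bessel_J \<nu> s" and "vz = osc bessel_J \<nu> z"
  have "q * vs\<^sup>2 \<le> osc_energy bessel_J \<nu> s" by (simp add: osc_energy_def q_def vs_def)
  then have vs: "q * vs\<^sup>2 \<le> A" using AB by simp
  have "bessel_Y \<nu> z = 0" using bessel_Y_first_zero(2)[OF \<nu> n] z by simp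
  \<comment> \<open>At a zero of Y only the derivative contributes to the energy, and it equals
    -sqrt z Y_{\<nu>+1}(z).\<close>
  then have "osc_energy bessel_Y \<nu> z = (sqrt z * bessel_Y (\<nu> + 1) z)\<^sup>2"
    by (simp add: osc_energy_def osc_deriv_def osc_def)
  moreover have "(vz * (sqrt z * bessel_Y (\<nu> + 1) z)) = - 2 / pi"
  proof -
    have "vz * (sqrt z * bessel_Y (\<nu> + 1) z) = (sqrt z * sqrt z) * (bessel_J \<nu> z * bessel_Y (\<nu> + 1) z)"
      by (simp add: vz_def osc_def)
    also have "sqrt z * sqrt z = z" using z0 by simp
    finally have "vz * (sqrt z * bessel_Y (\<nu> + 1) z) = bessel_J \<nu> z * bessel_Y (\<nu> + 1) z * z"
      by (simp only: mult.commute)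
    then show ?thesis
      using wronskian_at_zero(2)[OF z0 \<nu> \<open>bessel_Y \<nu> z = 0\<close>] by (simp only:)
  qed
  ultimately have "vz\<^sup>2 * osc_energy bessel_Y \<nu> z = (2 / pi)\<^sup>2"
    by (metis power_mult_distrib power2_minus minus_divide_left)
  then have vz: "4 \<le> vz\<^sup>2 * B * pi\<^sup>2"
  proof -
    have "(2 / pi)\<^sup>2 \<le> vz\<^sup>2 * B"
      using \<open>vz\<^sup>2 * osc_energy bessel_Y \<nu> z = (2 / pi)\<^sup>2\<close> AB(4) mult_left_mono[of _ B "vz\<^sup>2"] by fastforce
    then show ?thesis by (simp add: power_divide divide_le_eq mult.commute)
  qed
  have "(s powr - \<nu> * bessel_J \<nu> s)\<^sup>2 > (z powr - \<nu> * bessel_J \<nu> z)\<^sup>2"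
    using gt Jz z0 by (intro power_strict_mono) auto
  moreover have "(x powr - \<nu> * bessel_J \<nu> x)\<^sup>2 = (osc bessel_J \<nu> x)\<^sup>2 / x ^ (n + 1)" if "x > 0" for x
  proof -
    have "(x powr - \<nu>)\<^sup>2 = x powr - real n" using that by (simp add: powr_realpow[symmetric] powr_powr \<nu> powr_power)
    also have "\<dots> = 1 / x ^ n" using that by (simp add: powr_minus powr_realpow inverse_eq_divide)
    finally show ?thesis using that by (simp add: osc_def power_mult_distrib)
  qed
  ultimately have "vz\<^sup>2 / z ^ (n + 1) < vs\<^sup>2 / s ^ (n + 1)" using s0 z0 by (simp add: vs_def vz_def)
  then have "vz\<^sup>2 * (s / z) ^ (n + 1) < vs\<^sup>2" using s0 z0 by (simp add: power_divide field_simps)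
  then have "q * (vz\<^sup>2 * (s / z) ^ (n + 1)) < q * vs\<^sup>2" using q0 by (rule mult_strict_left_mono)
  then have "vz\<^sup>2 * (q * (s / z) ^ (n + 1)) < A" using vs by (simp only: mult.left_commute)
  moreover have "vz\<^sup>2 * (if odd n then 1 else 3 / 2) \<le> vz\<^sup>2 * (q * (s / z) ^ (n + 1))"
    using lower by (intro mult_left_mono) auto
  ultimately have "vz\<^sup>2 * (if odd n then 1 else 3 / 2) < A" by linarith
  moreover have "B * pi\<^sup>2 > 0" using vz AB(2) by (cases "B = 0") auto
  ultimately have "vz\<^sup>2 * (if odd n then 1 else 3 / 2) * (B * pi\<^sup>2) < A * (B * pi\<^sup>2)"
    by (rule mult_strict_right_mono)
  then show False using vz AB(5) by (auto simp: mult_ac split: if_splits)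
qed

section \<open>Fourier transforms of Gaussians and balls\<close>

lemma powser_zero_shift:
  fixes c :: "nat \<Rightarrow> real"
  assumes "\<And>t. (\<lambda>m. c m * t ^ m) sums 0"
  shows "c 0 = 0" "(\<lambda>m. c (Suc m) * t ^ m) sums 0"
proof -
  show c0: "c 0 = 0" using assms[of 0] powser_sums_zero[of c] sums_unique2 by blast
  have nz: "(\<lambda>m. c (Suc m) * t ^ m) sums 0" if "t \<noteq> 0" for t
  proof -
    have "(\<lambda>m. c (Suc m) * t ^ Suc m) sums 0" using assms[of t] c0 sums_Suc_iff[of "\<lambda>m. c m * t ^ m" 0] by simp
    from sums_mult2[OF this, of "1 / t"] show ?thesis using that by simp
  qed
  have "isCont (\<lambda>t. \<Sum>m. c (Suc m) * t ^ m) 0"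
    by (rule isCont_powser[of _ 1]) (use nz[of 1] in \<open>auto intro: sums_summable\<close>)
  then have "((\<lambda>t. \<Sum>m. c (Suc m) * t ^ m) \<longlongrightarrow> c (Suc 0)) (at 0)" by (simp add: isCont_def)
  moreover have "((\<lambda>t. \<Sum>m. c (Suc m) * t ^ m) \<longlongrightarrow> 0) (at 0)"
    by (rule Lim_transform_eventually[OF tendsto_const]) (use nz in \<open>auto simp: eventually_at sums_iff intro!: exI[of _ 1]\<close>)
  ultimately have "c (Suc 0) = 0" using LIM_unique by blast
  then show "(\<lambda>m. c (Suc m) * t ^ m) sums 0"
    using nz[of t] powser_sums_zero[of "\<lambda>m. c (Suc m)"] by (cases "t = 0") auto
qed

text \<open>Coefficients are stripped off one at a time by continuity at 0. This serves to read
  moments off a generating function.\<close>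

lemma powser_unique:
  fixes a b :: "nat \<Rightarrow> real"
  assumes "\<And>t. (\<lambda>m. a m * t ^ m) sums f t" "\<And>t. (\<lambda>m. b m * t ^ m) sums f t"
  shows "a m = b m"
proof -
  have "(\<lambda>m. (a (n + m) - b (n + m)) * t ^ m) sums 0" for n t
  proof (induction n arbitrary: t)
    case 0
    show ?case using sums_diff[OF assms(1)[of t] assms(2)[of t]] by (simp add: left_diff_distrib)
  next
    case (Suc n)
    then show ?case using powser_zero_shift(2)[of "\<lambda>m. a (n + m) - b (n + m)" t] by simp
  qed
  then show ?thesis using powser_zero_shift(1)[of "\<lambda>k. a (m + k) - b (m + k)"] by simp
qed

text \<open>One Gamma value covers both parities; the even case rests on the factorial formula for
  \<Gamma>(k + 1/2), proved by induction.\<close>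

lemma half_gauss_moment:
  "has_bochner_integral lborel (\<lambda>x::real. indicator {0..} x *\<^sub>R (exp (- x\<^sup>2) * x ^ p)) (Gamma ((real p + 1) / 2) / 2)"
proof (cases "even p")
  case True
  then obtain k where p: "p = 2 * k" by auto
  have "Gamma (real k + 1 / 2) = sqrt pi * (fact (2 * k) / (2 ^ (2 * k) * fact k))"
  proof (induction k)
    case (Suc k)
    have "real k + 1 / 2 \<notin> \<int>\<^sub>\<le>\<^sub>0" by (auto elim!: nonpos_Ints_cases)
    then have "Gamma (real (Suc k) + 1 / 2) = (real k + 1 / 2) * Gamma (real k + 1 / 2)"
      using Gamma_plus1[of "real k + 1 / 2"] by (simp add: add_ac)
    also have "\<dots> = (real k + 1 / 2) * (sqrt pi * (fact (2 * k) / (2 ^ (2 * k) * fact k)))" by (simp only: Suc)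
    also have "\<dots> = sqrt pi * (fact (2 * Suc k) / (2 ^ (2 * Suc k) * fact (Suc k)))"
    proof -
      have "(2 * c) * (2 * x) * F / (4 * P * (c * G)) = x * (F / (P * G))" if "c \<noteq> 0" for c x F P G :: real
        using that by simp
      from this[of "real k + 1" "real k + 1 / 2" "fact (2 * k)" "2 ^ (2 * k)" "fact k"] show ?thesis
        by (simp add: algebra_simps)
    qed
    finally show ?case .
  qed (simp add: Gamma_one_half_real)
  then show ?thesis using gaussian_moment_even_pos[of k] by (simp add: p add_divide_distrib mult.commute[of _ 2])
next
  case False
  then obtain k where p: "p = 2 * k + 1" by (auto elim: oddE)
  have "Gamma ((real p + 1) / 2) = fact k"
    using Gamma_fact[of k, where 'a = real] by (simp add: p add_divide_distrib add.commute)
  then show ?thesis using gaussian_moment_odd_pos[of k] by (simp only: p)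
qed

lemma nn_integral_gauss_exp_real:
  "(\<integral>\<^sup>+t. ennreal (exp (- t\<^sup>2 + c * t)) \<partial>lborel) = ennreal (sqrt pi * exp (c\<^sup>2 / 4))" for c :: real
proof -
  have "has_bochner_integral lborel (\<lambda>t::real. exp (- t\<^sup>2)) (sqrt pi)"
    using has_bochner_integral_even_function[OF gaussian_moment_0] by simp
  then have g: "(\<integral>\<^sup>+t. ennreal (exp (- t\<^sup>2)) \<partial>(lborel :: real measure)) = ennreal (sqrt pi)"
    by (subst nn_integral_eq_integral) (auto simp: has_bochner_integral_iff)
  have "(\<integral>\<^sup>+t. ennreal (exp (- t\<^sup>2 + c * t)) \<partial>lborel)
      = (\<integral>\<^sup>+t. ennreal (exp (- (c / 2 + 1 * t)\<^sup>2 + c * (c / 2 + 1 * t))) \<partial>lborel)"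
    by (subst nn_integral_real_affine[of _ 1 "c / 2"]) auto
  also have "\<dots> = (\<integral>\<^sup>+t. ennreal (exp (c\<^sup>2 / 4)) * ennreal (exp (- t\<^sup>2)) \<partial>lborel)"
  proof (rule nn_integral_cong)
    fix t :: real
    have "- (c / 2 + 1 * t)\<^sup>2 + c * (c / 2 + 1 * t) = c\<^sup>2 / 4 + - t\<^sup>2"
      by (simp add: power2_eq_square algebra_simps)
    then show "ennreal (exp (- (c / 2 + 1 * t)\<^sup>2 + c * (c / 2 + 1 * t))) = ennreal (exp (c\<^sup>2 / 4)) * ennreal (exp (- t\<^sup>2))"
      by (simp only: exp_add) (simp add: ennreal_mult)
  qed
  also have "\<dots> = ennreal (sqrt pi * exp (c\<^sup>2 / 4))"
    by (subst nn_integral_cmult) (auto simp: g ennreal_mult mult.commute)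
  finally show ?thesis .
qed

text \<open>A real exponential in place of a character keeps the integrand nonnegative, so the
  integral factorises over the coordinates. With t \<xi> in place of \<xi> it generates the
  moments.\<close>

lemma gauss_exp_integral:
  fixes \<xi> :: "'a::euclidean_space"
  shows "has_bochner_integral lborel (\<lambda>x::'a. exp (x \<bullet> \<xi>) * exp (- (norm x)\<^sup>2)) (sqrt pi ^ DIM('a) * exp ((norm \<xi>)\<^sup>2 / 4))"
proof (rule has_bochner_integral_nn_integral)
  have n2: "(norm y)\<^sup>2 = (\<Sum>b\<in>Basis. (y \<bullet> b)\<^sup>2)" for y :: 'a
    unfolding power2_norm_eq_inner by (subst euclidean_inner) (simp add: power2_eq_square)
  have "exp (x \<bullet> \<xi>) * exp (- (norm x)\<^sup>2) = (\<Prod>b\<in>Basis. exp (- (x \<bullet> b)\<^sup>2 + (\<xi> \<bullet> b) * (x \<bullet> b)))" for x :: 'a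
  proof -
    have "x \<bullet> \<xi> + - (norm x)\<^sup>2 = (\<Sum>b\<in>Basis. - (x \<bullet> b)\<^sup>2 + (\<xi> \<bullet> b) * (x \<bullet> b))"
      unfolding n2 by (subst euclidean_inner[of x \<xi>]) (simp add: sum_subtractf mult.commute)
    then show ?thesis by (simp add: exp_add[symmetric] exp_sum)
  qed
  then have "(\<integral>\<^sup>+x. ennreal (exp (x \<bullet> \<xi>) * exp (- (norm x)\<^sup>2)) \<partial>(lborel :: 'a measure))
     = (\<integral>\<^sup>+x. (\<Prod>b\<in>Basis. ennreal (exp (- (x \<bullet> b)\<^sup>2 + (\<xi> \<bullet> b) * (x \<bullet> b)))) \<partial>(lborel :: 'a measure))"
    by (simp add: prod_ennreal)
  also have "\<dots> = (\<Prod>b\<in>Basis. (\<integral>\<^sup>+t. ennreal (exp (- t\<^sup>2 + (\<xi> \<bullet> b) * t)) \<partial>lborel))"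
    by (rule nn_integral_lborel_prod) auto
  also have "\<dots> = ennreal (sqrt pi ^ DIM('a) * exp ((norm \<xi>)\<^sup>2 / 4))"
    unfolding nn_integral_gauss_exp_real by (simp add: prod_ennreal prod.distrib n2 sum_divide_distrib exp_sum)
  finally show "(\<integral>\<^sup>+x. ennreal (exp (x \<bullet> \<xi>) * exp (- (norm x)\<^sup>2)) \<partial>(lborel :: 'a measure))
     = ennreal (sqrt pi ^ DIM('a) * exp ((norm \<xi>)\<^sup>2 / 4))" .
qed auto

text \<open>The sum of the two exponentials dominates exp |x \<bullet> \<xi>|, hence all absolute
  partial sums of the exponential series.\<close>

lemma gauss_cosh_integrable:
  fixes \<xi> :: "'a::euclidean_space"
  shows "integrable lborel (\<lambda>x::'a. (exp (x \<bullet> \<xi>) + exp (- (x \<bullet> \<xi>))) * exp (- (norm x)\<^sup>2))"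
proof -
  have "integrable lborel (\<lambda>x::'a. exp (x \<bullet> \<xi>) * exp (- (norm x)\<^sup>2))"
    "integrable lborel (\<lambda>x::'a. exp (x \<bullet> (- \<xi>)) * exp (- (norm x)\<^sup>2))"
    using gauss_exp_integral[of \<xi>] gauss_exp_integral[of "- \<xi>"] by (auto simp: has_bochner_integral_iff)
  from Bochner_Integration.integrable_add[OF this] show ?thesis by (simp add: distrib_right)
qed

lemma exp_abs_le_cosh: "exp \<bar>t\<bar> \<le> exp t + exp (- t)" for t :: real
  by (cases "t \<ge> 0") auto

lemma exp_series_partial_le:
  fixes t :: real
  shows "(\<Sum>m<n. \<bar>t ^ m / fact m\<bar>) \<le> exp t + exp (- t)"
proof -
  have "(\<Sum>m<n. \<bar>t\<bar> ^ m / fact m) \<le> exp \<bar>t\<bar>"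
    unfolding exp_def using summable_exp_generic[of "\<bar>t\<bar>"]
    by (simp add: divide_inverse mult.commute) (intro sum_le_suminf, auto)
  then show ?thesis using exp_abs_le_cosh[of t] by (simp add: power_abs)
qed

lemma exp_sums: "(\<lambda>m. t ^ m / fact m) sums exp t" for t :: real
  using exp_converges[of t] by (simp add: divide_inverse mult.commute)

lemma exp_series_norm_summable: "summable (\<lambda>m. norm (y ^ m / fact m * E))" for y E :: real
  using summable_mult2[OF summable_norm_exp[of y], of "norm E"]
  by (simp add: abs_mult divide_inverse mult_ac)

lemma cos_series_norm_summable: "summable (\<lambda>m. norm (y ^ (2 * m) / fact (2 * m) * E))" for y E :: real
proof -
  have "summable ((\<lambda>m. norm (y ^ m / fact m * E)) \<circ> (\<lambda>m. 2 * m))"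
    by (rule summable_reindex[OF exp_series_norm_summable]) (auto simp: inj_def)
  then show ?thesis by (simp only: comp_def)
qed

lemma cos_sums: "(\<lambda>m. (- 1) ^ m * (y ^ (2 * m) / fact (2 * m) * E)) sums (cos y * E)" for y E :: real
  using sums_mult2[OF cos_paired[of y], of E]
  by (rule back_subst[of "\<lambda>f. f sums _"]) (simp add: fun_eq_iff)

lemma gauss_moment_term:
  fixes \<xi> :: "'a::euclidean_space"
  shows "integrable lborel (\<lambda>x::'a. (x \<bullet> \<xi>) ^ m / fact m * exp (- (norm x)\<^sup>2))" (is "integrable _ (?f m)")
    and "summable (\<lambda>m. \<integral>x. norm ((x \<bullet> \<xi>) ^ m / fact m * exp (- (norm x)\<^sup>2)) \<partial>(lborel :: 'a measure))"
proof -
  let ?c = "\<lambda>x::'a. (exp (x \<bullet> \<xi>) + exp (- (x \<bullet> \<xi>))) * exp (- (norm x)\<^sup>2)"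
  have part: "(\<Sum>m<n. norm ((x \<bullet> \<xi>) ^ m / fact m * exp (- (norm x)\<^sup>2))) \<le> ?c x" for n and x :: 'a
    using mult_right_mono[OF exp_series_partial_le[of "x \<bullet> \<xi>" n], of "exp (- (norm x)\<^sup>2)"]
    by (simp add: abs_mult sum_distrib_right)
  have int: "integrable lborel (\<lambda>x::'a. (x \<bullet> \<xi>) ^ m / fact m * exp (- (norm x)\<^sup>2))" for m
  proof (rule Bochner_Integration.integrable_bound[OF gauss_cosh_integrable[of \<xi>]])
    have "norm ((x \<bullet> \<xi>) ^ m / fact m * exp (- (norm x)\<^sup>2)) \<le> ?c x" for x :: 'a
      by (rule order_trans[OF _ part[of x "Suc m"]]) (simp add: sum_nonneg)
    then show "AE x::'a in lborel. norm ((x \<bullet> \<xi>) ^ m / fact m * exp (- (norm x)\<^sup>2)) \<le> norm (?c x)"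
      by (auto intro!: AE_I2 intro: order_trans)
  qed measurable
  show "integrable lborel (?f m)" by (rule int)
  show "summable (\<lambda>m. \<integral>x. norm ((x \<bullet> \<xi>) ^ m / fact m * exp (- (norm x)\<^sup>2)) \<partial>(lborel :: 'a measure))"
  proof (rule summableI_nonneg_bounded)
    fix n
    have "(\<Sum>m<n. \<integral>x. norm ((x \<bullet> \<xi>) ^ m / fact m * exp (- (norm x)\<^sup>2)) \<partial>(lborel :: 'a measure))
        = (\<integral>x. (\<Sum>m<n. norm ((x \<bullet> \<xi>) ^ m / fact m * exp (- (norm x)\<^sup>2))) \<partial>(lborel :: 'a measure))"
      by (rule Bochner_Integration.integral_sum[symmetric]) (intro integrable_norm int)
    also have "\<dots> \<le> (\<integral>x. ?c x \<partial>lborel)"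
      by (intro integral_mono gauss_cosh_integrable Bochner_Integration.integrable_sum integrable_norm int part)
    finally show "(\<Sum>m<n. \<integral>x. norm ((x \<bullet> \<xi>) ^ m / fact m * exp (- (norm x)\<^sup>2)) \<partial>(lborel :: 'a measure))
        \<le> (\<integral>x. ?c x \<partial>lborel)" .
  qed auto
qed

text \<open>Two expansions in t of the Gaussian integral of exp(t x \<bullet> \<xi>) are compared:
  termwise integration gives the moments, and the closed form is an exponential series in
  t^2.\<close>

lemma gauss_moment_even:
  fixes \<xi> :: "'a::euclidean_space"
  shows "(\<integral>x. (x \<bullet> \<xi>) ^ (2 * k) * exp (- (norm x)\<^sup>2) \<partial>(lborel :: 'a measure))
     = sqrt pi ^ DIM('a) * (fact (2 * k) * ((norm \<xi>)\<^sup>2 / 4) ^ k / fact k)"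
proof -
  define a where "a m = (\<integral>x. (x \<bullet> \<xi>) ^ m / fact m * exp (- (norm x)\<^sup>2) \<partial>(lborel :: 'a measure))" for m
  define b where "b m = sqrt pi ^ DIM('a) * (if even m then ((norm \<xi>)\<^sup>2 / 4) ^ (m div 2) / fact (m div 2) else 0)" for m
  have "a m = b m" for m
  proof (rule powser_unique)
    fix t :: real
    have "(\<lambda>m. \<integral>x. (x \<bullet> (t *\<^sub>R \<xi>)) ^ m / fact m * exp (- (norm x)\<^sup>2) \<partial>(lborel :: 'a measure)) sums
        (\<integral>x. (\<Sum>m. (x \<bullet> (t *\<^sub>R \<xi>)) ^ m / fact m * exp (- (norm x)\<^sup>2)) \<partial>(lborel :: 'a measure))"
      by (rule sums_integral[OF gauss_moment_term(1) _ gauss_moment_term(2)])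
        (simp only: exp_series_norm_summable AE_I2)
    also have "(\<lambda>m. \<integral>x. (x \<bullet> (t *\<^sub>R \<xi>)) ^ m / fact m * exp (- (norm x)\<^sup>2) \<partial>(lborel :: 'a measure)) = (\<lambda>m. a m * t ^ m)"
    proof
      fix m
      have "(\<lambda>x::'a. (x \<bullet> (t *\<^sub>R \<xi>)) ^ m / fact m * exp (- (norm x)\<^sup>2)) = (\<lambda>x. ((x \<bullet> \<xi>) ^ m / fact m * exp (- (norm x)\<^sup>2)) * t ^ m)"
        by (simp add: fun_eq_iff power_mult_distrib)
      then show "(\<integral>x. (x \<bullet> (t *\<^sub>R \<xi>)) ^ m / fact m * exp (- (norm x)\<^sup>2) \<partial>(lborel :: 'a measure)) = a m * t ^ m"
        by (simp only: a_def integral_mult_left_zero)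
    qed
    also have "(\<lambda>x::'a. (\<Sum>m. (x \<bullet> (t *\<^sub>R \<xi>)) ^ m / fact m * exp (- (norm x)\<^sup>2))) = (\<lambda>x. exp (x \<bullet> (t *\<^sub>R \<xi>)) * exp (- (norm x)\<^sup>2))"
    proof
      fix x :: 'a
      from sums_mult2[OF exp_sums[of "x \<bullet> (t *\<^sub>R \<xi>)"], of "exp (- (norm x)\<^sup>2)"]
      show "(\<Sum>m. (x \<bullet> (t *\<^sub>R \<xi>)) ^ m / fact m * exp (- (norm x)\<^sup>2)) = exp (x \<bullet> (t *\<^sub>R \<xi>)) * exp (- (norm x)\<^sup>2)"
        by (simp add: sums_iff)
    qed
    also have "(\<integral>x. exp (x \<bullet> (t *\<^sub>R \<xi>)) * exp (- (norm x)\<^sup>2) \<partial>(lborel :: 'a measure))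
        = sqrt pi ^ DIM('a) * exp ((norm (t *\<^sub>R \<xi>))\<^sup>2 / 4)"
      using gauss_exp_integral[of "t *\<^sub>R \<xi>"] by (simp add: has_bochner_integral_iff)
    finally show "(\<lambda>m. a m * t ^ m) sums (sqrt pi ^ DIM('a) * exp ((norm (t *\<^sub>R \<xi>))\<^sup>2 / 4))" .
  next
    fix t :: real
    have "(\<lambda>k. sqrt pi ^ DIM('a) * (((norm (t *\<^sub>R \<xi>))\<^sup>2 / 4) ^ k / fact k)) sums (sqrt pi ^ DIM('a) * exp ((norm (t *\<^sub>R \<xi>))\<^sup>2 / 4))"
      by (intro sums_mult exp_sums)
    also have "(\<lambda>k. sqrt pi ^ DIM('a) * (((norm (t *\<^sub>R \<xi>))\<^sup>2 / 4) ^ k / fact k)) = (\<lambda>k. b (2 * k) * t ^ (2 * k))"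
      by (simp add: fun_eq_iff b_def power_mult power_mult_distrib power_divide)
    finally show "(\<lambda>m. b m * t ^ m) sums (sqrt pi ^ DIM('a) * exp ((norm (t *\<^sub>R \<xi>))\<^sup>2 / 4))"
      by (subst (asm) sums_mono_reindex[of "\<lambda>k. 2 * k" "\<lambda>m. b m * t ^ m"])
        (auto simp: strict_mono_def b_def image_iff elim!: evenE)
  qed
  then have "a (2 * k) = b (2 * k)" by simp
  moreover have "(\<integral>x. (x \<bullet> \<xi>) ^ (2 * k) * exp (- (norm x)\<^sup>2) \<partial>(lborel :: 'a measure)) = a (2 * k) * fact (2 * k)"
  proof -
    have "(\<lambda>x::'a. (x \<bullet> \<xi>) ^ (2 * k) * exp (- (norm x)\<^sup>2)) = (\<lambda>x. ((x \<bullet> \<xi>) ^ (2 * k) / fact (2 * k) * exp (- (norm x)\<^sup>2)) * fact (2 * k))"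
      by (simp add: fun_eq_iff)
    then show ?thesis by (simp only: a_def integral_mult_left_zero)
  qed
  ultimately show ?thesis by (simp add: b_def)
qed

section \<open>Superpositions of balls\<close>

text \<open>A radial function obtained by integrating w over r \<ge> |x| is the superposition of the
  balls of radius r with weight w; in the nonnegative setting Tonelli's theorem performs the
  exchange.\<close>

lemma layer_cake_nn:
  fixes F :: "'a::euclidean_space \<Rightarrow> ennreal" and w :: "real \<Rightarrow> ennreal"
  assumes [measurable]: "F \<in> borel_measurable borel" "w \<in> borel_measurable borel"
  shows "(\<integral>\<^sup>+x. F x * (\<integral>\<^sup>+r. w r * indicator {norm x..} r \<partial>lborel) \<partial>lborel)
       = (\<integral>\<^sup>+r. w r * (\<integral>\<^sup>+x. F x * indicator (cball 0 r) x \<partial>lborel) \<partial>lborel)"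
proof -
  have ind: "indicator {norm x..} r = (indicator {0..} (r - norm x) :: ennreal)"
    "indicator (cball 0 r) x = (indicator {0..} (r - norm x) :: ennreal)" for x :: 'a and r :: real
    by (auto simp: indicator_def)
  have "(\<integral>\<^sup>+x. F x * (\<integral>\<^sup>+r. w r * indicator {norm x..} r \<partial>lborel) \<partial>lborel)
     = (\<integral>\<^sup>+x. (\<integral>\<^sup>+r. F x * (w r * indicator {0..} (r - norm x)) \<partial>lborel) \<partial>lborel)"
    unfolding ind by (subst nn_integral_cmult) auto
  also have "\<dots> = (\<integral>\<^sup>+r. (\<integral>\<^sup>+x. F x * (w r * indicator {0..} (r - norm x)) \<partial>lborel) \<partial>lborel)"
    by (rule lborel_pair.Fubini'[symmetric]) measurable
  also have "\<dots> = (\<integral>\<^sup>+r. w r * (\<integral>\<^sup>+x. F x * indicator (cball 0 r) x \<partial>lborel) \<partial>lborel)"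
    unfolding ind by (subst nn_integral_cmult[symmetric]) (auto simp: mult_ac)
  finally show ?thesis .
qed

text \<open>The weight 2 t exp(-t^2) represents the Gaussian as a superposition of balls.\<close>

lemma gauss_tail:
  assumes "r \<ge> 0"
  shows "(\<integral>\<^sup>+t. ennreal (2 * t * exp (- t\<^sup>2)) * indicator {r..} t \<partial>lborel) = ennreal (exp (- r\<^sup>2))"
proof -
  have "((\<lambda>t::real. - exp (- t\<^sup>2)) \<longlongrightarrow> - 0) at_top"
    by (intro tendsto_minus filterlim_compose[OF exp_at_bot] filterlim_uminus_at_bot_at_top[THEN filterlim_compose]
        filterlim_pow_at_top filterlim_ident) auto
  moreover have "((\<lambda>t. - exp (- t\<^sup>2)) has_real_derivative 2 * t * exp (- t\<^sup>2)) (at t)" for t :: real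
    by (auto intro!: derivative_eq_intros)
  ultimately show ?thesis
    using nn_integral_FTC_atLeast[of "\<lambda>t. 2 * t * exp (- t\<^sup>2)" r "\<lambda>t. - exp (- t\<^sup>2)" "- 0"] assms by simp
qed

lemma nn_integral_scaleR:
  fixes f :: "'a::euclidean_space \<Rightarrow> ennreal"
  assumes [measurable]: "f \<in> borel_measurable borel" and "r > 0"
  shows "(\<integral>\<^sup>+x. f x \<partial>lborel) = ennreal (r ^ DIM('a)) * (\<integral>\<^sup>+x. f (r *\<^sub>R x) \<partial>lborel)"
proof -
  let ?D = "distr lborel borel (\<lambda>x::'a. 0 + r *\<^sub>R x)"
  have "(\<integral>\<^sup>+x. f x \<partial>lborel) = (\<integral>\<^sup>+x. f x \<partial>density ?D (\<lambda>_. ennreal (\<bar>r\<bar> ^ DIM('a))))"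
    using arg_cong[OF lborel_affine[of r "0 :: 'a"], of "\<lambda>M. nn_integral M f"] assms(2) by simp
  also have "\<dots> = (\<integral>\<^sup>+x. ennreal (\<bar>r\<bar> ^ DIM('a)) * f x \<partial>?D)"
    by (rule nn_integral_density) measurable
  also have "\<dots> = ennreal (\<bar>r\<bar> ^ DIM('a)) * (\<integral>\<^sup>+x. f x \<partial>?D)" by (rule nn_integral_cmult) measurable
  also have "(\<integral>\<^sup>+x. f x \<partial>?D) = (\<integral>\<^sup>+x. f (0 + r *\<^sub>R x) \<partial>lborel)" by (rule nn_integral_distr) measurable
  finally show ?thesis using assms(2) by simp
qed

lemma nn_integral_ball_scale:
  fixes \<xi> :: "'a::euclidean_space"
  assumes "r > 0"
  shows "(\<integral>\<^sup>+x. ennreal ((x \<bullet> \<xi>) ^ (2 * m)) * indicator (cball 0 r) x \<partial>(lborel :: 'a measure))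
    = ennreal (r ^ (DIM('a) + 2 * m)) * (\<integral>\<^sup>+x. ennreal ((x \<bullet> \<xi>) ^ (2 * m)) * indicator (cball 0 1) x \<partial>(lborel :: 'a measure))"
proof -
  have [measurable]: "cball (0::'a) t \<in> sets borel" for t by (simp add: borel_closed)
  have "(\<integral>\<^sup>+x. ennreal ((x \<bullet> \<xi>) ^ (2 * m)) * indicator (cball 0 r) x \<partial>(lborel :: 'a measure))
     = (\<integral>\<^sup>+x. ennreal (r ^ DIM('a)) * (ennreal (((r *\<^sub>R x) \<bullet> \<xi>) ^ (2 * m)) * indicator (cball 0 r) (r *\<^sub>R x)) \<partial>(lborel :: 'a measure))"
    by (subst nn_integral_scaleR[OF _ assms], measurable) (subst nn_integral_cmult, measurable)
  also have "\<dots> = (\<integral>\<^sup>+x. ennreal (r ^ (DIM('a) + 2 * m)) * (ennreal ((x \<bullet> \<xi>) ^ (2 * m)) * indicator (cball 0 1) x) \<partial>(lborel :: 'a measure))"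
  proof (rule nn_integral_cong)
    fix x :: 'a
    have "indicator (cball 0 r) (r *\<^sub>R x) = (indicator (cball 0 1) x :: ennreal)"
      using assms by (auto simp: indicator_def)
    moreover have "ennreal (((r *\<^sub>R x) \<bullet> \<xi>) ^ (2 * m)) = ennreal (r ^ (2 * m)) * ennreal ((x \<bullet> \<xi>) ^ (2 * m))"
      using assms by (simp add: power_mult_distrib ennreal_mult)
    moreover have "ennreal (r ^ (DIM('a) + 2 * m)) = ennreal (r ^ DIM('a)) * ennreal (r ^ (2 * m))"
      using assms by (simp add: power_add ennreal_mult)
    ultimately show "ennreal (r ^ DIM('a)) * (ennreal (((r *\<^sub>R x) \<bullet> \<xi>) ^ (2 * m)) * indicator (cball 0 r) (r *\<^sub>R x))
       = ennreal (r ^ (DIM('a) + 2 * m)) * (ennreal ((x \<bullet> \<xi>) ^ (2 * m)) * indicator (cball 0 1) x)"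
      by (simp only: mult_ac)
  qed
  also have "\<dots> = ennreal (r ^ (DIM('a) + 2 * m)) * (\<integral>\<^sup>+x. ennreal ((x \<bullet> \<xi>) ^ (2 * m)) * indicator (cball 0 1) x \<partial>(lborel :: 'a measure))"
    by (rule nn_integral_cmult) measurable
  finally show ?thesis .
qed

text \<open>The moments of balls are read off from those of the Gaussian, a superposition of balls.\<close>

lemma nn_integral_ball_moment:
  fixes \<xi> :: "'a::euclidean_space"
  assumes "r > 0"
  shows "(\<integral>\<^sup>+x. ennreal ((x \<bullet> \<xi>) ^ (2 * m)) * indicator (cball 0 r) x \<partial>(lborel :: 'a measure))
    = ennreal (r ^ (DIM('a) + 2 * m) * (sqrt pi ^ DIM('a) * (fact (2 * m) * ((norm \<xi>)\<^sup>2 / 4) ^ m / fact m)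
        * rGamma (real m + real DIM('a) / 2 + 1)))"
proof -
  define M where "M = (\<integral>\<^sup>+x. ennreal ((x \<bullet> \<xi>) ^ (2 * m)) * indicator (cball 0 1) x \<partial>(lborel :: 'a measure))"
  define g where "g = sqrt pi ^ DIM('a) * (fact (2 * m) * ((norm \<xi>)\<^sup>2 / 4) ^ m / fact m)"
  define G where "G = Gamma (real m + real DIM('a) / 2 + 1)"
  have g0: "g \<ge> 0" by (simp add: g_def)
  have G0: "G > 0" by (simp add: G_def Gamma_real_pos add_nonneg_pos)
  have int: "integrable lborel (\<lambda>x::'a. (x \<bullet> \<xi>) ^ (2 * m) * exp (- (norm x)\<^sup>2))"
    using integrable_mult_right[OF gauss_moment_term(1)[of \<xi> "2 * m"], of "fact (2 * m)"] by simp
  have "ennreal g = (\<integral>\<^sup>+x. ennreal ((x \<bullet> \<xi>) ^ (2 * m) * exp (- (norm x)\<^sup>2)) \<partial>(lborel :: 'a measure))"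
    using nn_integral_eq_integral[OF int] by (simp add: g_def gauss_moment_even zero_le_even_power)
  also have "\<dots> = (\<integral>\<^sup>+x. ennreal ((x \<bullet> \<xi>) ^ (2 * m)) * (\<integral>\<^sup>+t. ennreal (2 * t * exp (- t\<^sup>2)) * indicator {norm x..} t \<partial>lborel)
      \<partial>(lborel :: 'a measure))"
    by (intro nn_integral_cong) (simp add: gauss_tail ennreal_mult zero_le_even_power)
  also have "\<dots> = (\<integral>\<^sup>+t. ennreal (2 * t * exp (- t\<^sup>2)) * (\<integral>\<^sup>+x. ennreal ((x \<bullet> \<xi>) ^ (2 * m)) * indicator (cball 0 t) x
      \<partial>(lborel :: 'a measure)) \<partial>lborel)"
    by (rule layer_cake_nn) auto
  also have "\<dots> = (\<integral>\<^sup>+t. ennreal (2 * (indicator {0..} t *\<^sub>R (exp (- t\<^sup>2) * t ^ (DIM('a) + 2 * m + 1)))) * M \<partial>lborel)"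
  proof (rule nn_integral_cong)
    fix t :: real
    show "ennreal (2 * t * exp (- t\<^sup>2)) * (\<integral>\<^sup>+x. ennreal ((x \<bullet> \<xi>) ^ (2 * m)) * indicator (cball 0 t) x \<partial>(lborel :: 'a measure))
      = ennreal (2 * (indicator {0..} t *\<^sub>R (exp (- t\<^sup>2) * t ^ (DIM('a) + 2 * m + 1)))) * M"
    proof (cases "t > 0")
      case True
      then have "ennreal (2 * (indicator {0..} t *\<^sub>R (exp (- t\<^sup>2) * t ^ (DIM('a) + 2 * m + 1))))
          = ennreal (2 * t * exp (- t\<^sup>2)) * ennreal (t ^ (DIM('a) + 2 * m))"
        by (simp add: ennreal_mult[symmetric] mult_ac)
      then show ?thesis unfolding nn_integral_ball_scale[OF True] by (simp add: M_def mult.assoc)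
    next
      case False
      then have "ennreal (2 * t * exp (- t\<^sup>2)) = 0" by (simp add: ennreal_neg mult_nonpos_nonneg)
      moreover have "ennreal (2 * (indicator {0..} t *\<^sub>R (exp (- t\<^sup>2) * t ^ (DIM('a) + 2 * m + 1)))) = 0"
        using False by (cases "t = 0") auto
      ultimately show ?thesis by (simp only: mult_zero_left)
    qed
  qed
  also have "\<dots> = (\<integral>\<^sup>+t. ennreal (2 * (indicator {0..} t *\<^sub>R (exp (- t\<^sup>2) * t ^ (DIM('a) + 2 * m + 1)))) \<partial>lborel) * M"
    by (rule nn_integral_multc) measurable
  also have "(\<integral>\<^sup>+t. ennreal (2 * (indicator {0..} t *\<^sub>R (exp (- t\<^sup>2) * t ^ (DIM('a) + 2 * m + 1)))) \<partial>lborel) = ennreal G"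
  proof -
    have "has_bochner_integral lborel (\<lambda>t::real. 2 * (indicator {0..} t *\<^sub>R (exp (- t\<^sup>2) * t ^ (DIM('a) + 2 * m + 1))))
        (2 * (Gamma ((real (DIM('a) + 2 * m + 1) + 1) / 2) / 2))"
      by (rule has_bochner_integral_mult_right) (rule half_gauss_moment)
    moreover have "(real (DIM('a) + 2 * m + 1) + 1) / 2 = real m + real DIM('a) / 2 + 1" by (simp add: field_simps)
    ultimately have "has_bochner_integral lborel (\<lambda>t::real. 2 * (indicator {0..} t *\<^sub>R (exp (- t\<^sup>2) * t ^ (DIM('a) + 2 * m + 1)))) G"
      by (simp only: G_def) simp
    then show ?thesis
      by (subst nn_integral_eq_integral) (auto simp: has_bochner_integral_iff indicator_def)
  qed
  finally have gm: "ennreal g = ennreal G * M" .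
  have "M = ennreal (1 / G) * (ennreal G * M)"
    using G0 by (simp add: mult.assoc[symmetric] ennreal_mult[symmetric])
  also have "\<dots> = ennreal (g * rGamma (real m + real DIM('a) / 2 + 1))"
    unfolding gm[symmetric] using G0 g0 by (simp add: ennreal_mult[symmetric] G_def rGamma_inverse_Gamma inverse_eq_divide)
  finally have M: "M = ennreal (g * rGamma (real m + real DIM('a) / 2 + 1))" .
  show ?thesis
    unfolding nn_integral_ball_scale[OF assms] M_def[symmetric] M g_def[symmetric]
    using assms by (simp add: ennreal_mult')
qed

lemma ball_moment:
  fixes \<xi> :: "'a::euclidean_space"
  assumes "r > 0"
  shows "has_bochner_integral lborel (\<lambda>x::'a. indicator (cball 0 r) x * (x \<bullet> \<xi>) ^ (2 * m))
    (r ^ (DIM('a) + 2 * m) * (sqrt pi ^ DIM('a) * (fact (2 * m) * ((norm \<xi>)\<^sup>2 / 4) ^ m / fact m)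
        * rGamma (real m + real DIM('a) / 2 + 1)))"
proof (rule has_bochner_integral_nn_integral)
  have "rGamma (real m + real DIM('a) / 2 + 1) \<ge> 0"
    using Gamma_real_pos[of "real m + real DIM('a) / 2 + 1"] by (simp add: rGamma_inverse_Gamma add_nonneg_pos)
  then show "0 \<le> r ^ (DIM('a) + 2 * m) * (sqrt pi ^ DIM('a) * (fact (2 * m) * ((norm \<xi>)\<^sup>2 / 4) ^ m / fact m)
        * rGamma (real m + real DIM('a) / 2 + 1))" using assms by simp
  have "(\<integral>\<^sup>+x. ennreal (indicator (cball 0 r) x * (x \<bullet> \<xi>) ^ (2 * m)) \<partial>(lborel :: 'a measure))
     = (\<integral>\<^sup>+x. ennreal ((x \<bullet> \<xi>) ^ (2 * m)) * indicator (cball 0 r) x \<partial>(lborel :: 'a measure))"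
    by (intro nn_integral_cong) (auto simp: indicator_def)
  then show "(\<integral>\<^sup>+x. ennreal (indicator (cball 0 r) x * (x \<bullet> \<xi>) ^ (2 * m)) \<partial>(lborel :: 'a measure))
     = ennreal (r ^ (DIM('a) + 2 * m) * (sqrt pi ^ DIM('a) * (fact (2 * m) * ((norm \<xi>)\<^sup>2 / 4) ^ m / fact m)
        * rGamma (real m + real DIM('a) / 2 + 1)))"
    unfolding nn_integral_ball_moment[OF assms] .
qed (auto simp: zero_le_even_power intro!: borel_measurable_times borel_measurable_indicator borel_closed borel_measurable_power)

text \<open>The classical transform (2\<pi>r/|\<xi>|)^(N/2) J_{N/2}(r|\<xi>|) of a ball, in a form
  regular at \<xi> = 0. The cosine series is integrated termwise; even moments are nonnegative, so
  the norms add up to the same Bessel series at the negative argument.\<close>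

lemma ball_fourier:
  fixes \<xi> :: "'a::euclidean_space"
  assumes "r > 0"
  shows "(\<integral>x. indicator (cball 0 r) x * cos (x \<bullet> \<xi>) \<partial>(lborel :: 'a measure))
    = sqrt pi ^ DIM('a) * (r ^ DIM('a) * bessel_entire (real DIM('a) / 2) ((r * norm \<xi>)\<^sup>2 / 4))"
proof -
  let ?f = "\<lambda>m x::'a. (- 1) ^ m / fact (2 * m) * (indicator (cball 0 r) x * (x \<bullet> \<xi>) ^ (2 * m)) :: real"
  let ?t = "(r * norm \<xi>)\<^sup>2 / 4"
  let ?c = "\<lambda>m. rGamma (real m + real DIM('a) / 2 + 1)"
  let ?K = "sqrt pi ^ DIM('a) * r ^ DIM('a)"
  have pow: "r ^ (DIM('a) + 2 * m) * ((norm \<xi>)\<^sup>2 / 4) ^ m = r ^ DIM('a) * ?t ^ m" for m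
    by (simp add: power_add power_mult power_mult_distrib power_divide)
  have int: "integrable lborel (?f m)" for m
    using ball_moment[OF assms, of \<xi> m] by (intro integrable_mult_right) (simp add: has_bochner_integral_iff)
  have val: "(\<integral>x. indicator (cball 0 r) x * (x \<bullet> \<xi>) ^ (2 * m) \<partial>(lborel :: 'a measure)) = fact (2 * m) * (?K * (?c m * ?t ^ m / fact m))" for m
  proof -
    have "(\<integral>x. indicator (cball 0 r) x * (x \<bullet> \<xi>) ^ (2 * m) \<partial>(lborel :: 'a measure))
       = sqrt pi ^ DIM('a) * fact (2 * m) * (r ^ (DIM('a) + 2 * m) * ((norm \<xi>)\<^sup>2 / 4) ^ m) / fact m * ?c m"
      using ball_moment[OF assms, of \<xi> m] by (simp add: has_bochner_integral_iff)
    then show ?thesis unfolding pow by simp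
  qed
  have norm_val: "(\<integral>x. norm (?f m x) \<partial>lborel) = ?K * (?c m * (- (- ?t)) ^ m / fact m)" for m
  proof -
    have "norm (?f m x) = 1 / fact (2 * m) * (indicator (cball 0 r) x * (x \<bullet> \<xi>) ^ (2 * m))" for x :: 'a
      by (simp add: abs_mult zero_le_even_power)
    then have "(\<integral>x. norm (?f m x) \<partial>lborel)
       = 1 / fact (2 * m) * (\<integral>x. indicator (cball 0 r) x * (x \<bullet> \<xi>) ^ (2 * m) \<partial>(lborel :: 'a measure))"
      by (simp only: integral_mult_right_zero)
    then show ?thesis unfolding val by simp
  qed
  have ptw: "(\<lambda>m. ?f m x) sums (indicator (cball 0 r) x * cos (x \<bullet> \<xi>))" for x :: 'a
    using cos_sums[of "x \<bullet> \<xi>" "indicator (cball 0 r) x"] by (simp add: mult_ac)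
  have "(\<lambda>m. \<integral>x. ?f m x \<partial>lborel) sums (\<integral>x. (\<Sum>m. ?f m x) \<partial>lborel)"
  proof (rule sums_integral[OF int])
    show "AE x::'a in lborel. summable (\<lambda>m. norm (?f m x))"
    proof (rule AE_I2)
      fix x :: 'a
      show "summable (\<lambda>m. norm (?f m x))"
        using cos_series_norm_summable[of "x \<bullet> \<xi>" "indicator (cball 0 r) x"]
        by (rule back_subst[of summable]) (simp add: fun_eq_iff abs_mult)
    qed
    show "summable (\<lambda>m. \<integral>x. norm (?f m x) \<partial>lborel)"
      unfolding norm_val by (intro summable_mult bessel_entire_summable)
  qed
  also have "(\<lambda>x. \<Sum>m. ?f m x) = (\<lambda>x. indicator (cball 0 r) x * cos (x \<bullet> \<xi>))"
    using ptw by (simp add: sums_iff fun_eq_iff)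
  also have "(\<lambda>m. \<integral>x. ?f m x \<partial>lborel) = (\<lambda>m. ?K * (?c m * (- ?t) ^ m / fact m))"
    by (simp only: integral_mult_right_zero val) (simp add: power_minus[of ?t] fun_eq_iff mult_ac)
  finally have "(\<lambda>m. ?K * (?c m * (- ?t) ^ m / fact m)) sums (\<integral>x. indicator (cball 0 r) x * cos (x \<bullet> \<xi>) \<partial>(lborel :: 'a measure))" .
  moreover have "(\<lambda>m. ?K * (?c m * (- ?t) ^ m / fact m)) sums (?K * bessel_entire (real DIM('a) / 2) ?t)"
    unfolding bessel_entire_def exp_transform_def by (intro sums_mult summable_sums bessel_entire_summable)
  ultimately show ?thesis using sums_unique2 by (simp add: mult.assoc)
qed

text \<open>The cosine series is integrated termwise; its norms form the even subseries of those
  already summed for the exponential.\<close>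

lemma gauss_fourier:
  fixes \<xi> :: "'a::euclidean_space"
  shows "(\<integral>x. cos (x \<bullet> \<xi>) * exp (- (norm x)\<^sup>2) \<partial>(lborel :: 'a measure)) = sqrt pi ^ DIM('a) * exp (- (norm \<xi>)\<^sup>2 / 4)"
proof -
  let ?f = "\<lambda>m x::'a. (- 1) ^ m * ((x \<bullet> \<xi>) ^ (2 * m) / fact (2 * m) * exp (- (norm x)\<^sup>2)) :: real"
  have inj: "inj (\<lambda>m::nat. 2 * m)" by (simp add: inj_def)
  have "(\<lambda>m. \<integral>x. ?f m x \<partial>lborel) sums (\<integral>x. (\<Sum>m. ?f m x) \<partial>lborel)"
  proof (rule sums_integral)
    show "integrable lborel (?f m)" for m by (intro integrable_mult_right gauss_moment_term)
    show "AE x::'a in lborel. summable (\<lambda>m. norm (?f m x))"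
    proof (rule AE_I2)
      fix x :: 'a
      show "summable (\<lambda>m. norm (?f m x))"
        using cos_series_norm_summable[of "x \<bullet> \<xi>" "exp (- (norm x)\<^sup>2)"] by (simp add: abs_mult)
    qed
    show "summable (\<lambda>m. \<integral>x. norm (?f m x) \<partial>lborel)"
      using summable_reindex[OF gauss_moment_term(2)[of \<xi>] inj] by (auto simp: comp_def abs_mult)
  qed
  also have "(\<lambda>x. \<Sum>m. ?f m x) = (\<lambda>x. cos (x \<bullet> \<xi>) * exp (- (norm x)\<^sup>2))"
  proof
    fix x :: 'a
    show "(\<Sum>m. ?f m x) = cos (x \<bullet> \<xi>) * exp (- (norm x)\<^sup>2)"
      using cos_sums[of "x \<bullet> \<xi>" "exp (- (norm x)\<^sup>2)"] by (simp only: sums_iff)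
  qed
  also have "(\<lambda>m. \<integral>x. ?f m x \<partial>lborel) = (\<lambda>m. sqrt pi ^ DIM('a) * ((- (norm \<xi>)\<^sup>2 / 4) ^ m / fact m))"
  proof
    fix m
    have "(\<integral>x. ?f m x \<partial>lborel) = (- 1) ^ m * (1 / fact (2 * m)) * (\<integral>x. (x \<bullet> \<xi>) ^ (2 * m) * exp (- (norm x)\<^sup>2) \<partial>(lborel :: 'a measure))"
      by (simp flip: integral_mult_right_zero add: mult_ac)
    then show "(\<integral>x. ?f m x \<partial>lborel) = sqrt pi ^ DIM('a) * ((- (norm \<xi>)\<^sup>2 / 4) ^ m / fact m)"
      unfolding gauss_moment_even by (simp add: power_minus[of "(norm \<xi>)\<^sup>2 / 4"])
  qed
  finally have "(\<lambda>m. sqrt pi ^ DIM('a) * ((- (norm \<xi>)\<^sup>2 / 4) ^ m / fact m)) sums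
     (\<integral>x. cos (x \<bullet> \<xi>) * exp (- (norm x)\<^sup>2) \<partial>(lborel :: 'a measure))" .
  moreover have "(\<lambda>m. sqrt pi ^ DIM('a) * ((- (norm \<xi>)\<^sup>2 / 4) ^ m / fact m)) sums (sqrt pi ^ DIM('a) * exp (- (norm \<xi>)\<^sup>2 / 4))"
    by (intro sums_mult exp_sums)
  ultimately show ?thesis using sums_unique2 by blast
qed

section \<open>The truncated Helmholtz kernel\<close>

lemma continuous_on_extend_0:
  fixes f :: "real \<Rightarrow> real"
  assumes "continuous_on {0<..} f" "(f \<longlongrightarrow> c) (at_right 0)"
  shows "continuous_on {0..} (\<lambda>x. if x = 0 then c else f x)"
proof -
  have "isCont (\<lambda>x. if x = 0 then c else f x) x" if "x > 0" for x
  proof -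
    have "isCont f x" using assms(1) that by (simp add: continuous_on_eq_continuous_at)
    moreover have "\<forall>\<^sub>F y in nhds x. (if y = 0 then c else f y) = f y"
      using that by (intro eventually_nhds_in_open[of "{0<..}", THEN eventually_mono]) auto
    ultimately show ?thesis by (simp add: isCont_cong)
  qed
  moreover have "continuous (at 0 within {0..}) (\<lambda>x. if x = 0 then c else f x)"
  proof -
    have "at (0::real) within {0..} = at_right 0"
      by (rule at_within_nhd[of _ UNIV]) auto
    moreover have "((\<lambda>x. if x = 0 then c else f x) \<longlongrightarrow> c) (at_right 0)"
      by (rule Lim_transform_eventually[OF assms(2)]) (auto simp: eventually_at_right_field intro!: exI[of _ 1])
    ultimately show ?thesis by (simp add: continuous_within)
  qed
  ultimately show ?thesis
    unfolding continuous_on_eq_continuous_within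
    by (metis atLeast_iff continuous_at_imp_continuous_at_within order_le_less)
qed

lemma powr_bessel_Y_deriv:
  assumes "x > 0" "\<nu> = real n / 2"
  shows "((\<lambda>x. x powr - \<nu> * bessel_Y \<nu> x) has_real_derivative - (x powr - \<nu> * bessel_Y (\<nu> + 1) x)) (at x)"
    "((\<lambda>x. x powr (\<nu> + 1) * bessel_Y (\<nu> + 1) x) has_real_derivative x powr (\<nu> + 1) * bessel_Y \<nu> x) (at x)"
proof -
  have p: "((\<lambda>x. x powr a) has_real_derivative a / x * x powr a) (at x)" for a
    using assms by (auto intro!: derivative_eq_intros simp: powr_diff)
  show "((\<lambda>x. x powr - \<nu> * bessel_Y \<nu> x) has_real_derivative - (x powr - \<nu> * bessel_Y (\<nu> + 1) x)) (at x)"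
    using DERIV_mult[OF p bessel_Y_deriv[OF assms]]
    by (rule back_subst[of "\<lambda>d. (_ has_real_derivative d) _"]) (simp add: algebra_simps)
  show "((\<lambda>x. x powr (\<nu> + 1) * bessel_Y (\<nu> + 1) x) has_real_derivative x powr (\<nu> + 1) * bessel_Y \<nu> x) (at x)"
    using DERIV_mult[OF p bessel_Y_deriv'[OF assms]]
    by (rule back_subst[of "\<lambda>d. (_ has_real_derivative d) _"]) (simp add: algebra_simps)
qed

text \<open>x^(\<nu>+1) Y_{\<nu>+1} has a negative limit at 0 and the derivative x^(\<nu>+1)
  Y_\<nu>, which is at most 0 up to the first zero. This is why the cut kernel is
  nonincreasing.\<close>

lemma bessel_Y_Suc_nonpos:
  assumes \<nu>: "\<nu> = real n / 2" and n: "n \<ge> 1" and x: "0 < x" "x \<le> bessel_Y_first_zero \<nu>"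
  shows "bessel_Y (\<nu> + 1) x \<le> 0"
proof -
  let ?f = "\<lambda>x. x powr (\<nu> + 1) * bessel_Y (\<nu> + 1) x"
  have Yle: "bessel_Y \<nu> t \<le> 0" if "0 < t" "t \<le> x" for t
    using bessel_Y_first_zero(2,3)[OF \<nu> n] that x(2) by (cases "t = bessel_Y_first_zero \<nu>") (auto intro: less_imp_le)
  have mono: "?f x \<le> ?f t" if "0 < t" "t \<le> x" for t
  proof (rule DERIV_nonpos_imp_nonincreasing[OF that(2)])
    fix u assume u: "t \<le> u" "u \<le> x"
    then show "\<exists>y. (?f has_real_derivative y) (at u) \<and> y \<le> 0"
      using powr_bessel_Y_deriv(2)[OF _ \<nu>, of u] Yle[of u] that(1)
      by (intro exI[of _ "u powr (\<nu> + 1) * bessel_Y \<nu> u"]) (auto intro: mult_nonneg_nonpos)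
  qed
  have "?f x \<le> - (2 / pi * 2 powr \<nu> * Gamma (\<nu> + 1))"
    by (rule tendsto_lowerbound[OF bessel_Y_at_0_weak(2)[OF \<nu>]])
      (use mono x in \<open>auto simp: eventually_at_right_field intro!: exI[of _ x]\<close>)
  also have "\<dots> \<le> 0" using \<nu> Gamma_real_pos[of "\<nu> + 1"] by simp
  finally show ?thesis using x(1) by (simp add: mult_le_0_iff)
qed

text \<open>Lommel's antiderivative for a product of cylinder functions of the arguments kx and sx.
  The order \<nu> + 1 on the right is that of the transform of a ball in dimension 2\<nu> +
  2.\<close>

lemma lommel_deriv:
  assumes "x > 0" "k > 0" "s > 0" "\<nu> = real n / 2"
  shows "((\<lambda>x. x * (k * bessel_Y \<nu> (k * x) * bessel_J (\<nu> + 1) (s * x) - s * bessel_Y (\<nu> + 1) (k * x) * bessel_J \<nu> (s * x)))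
     has_real_derivative (s\<^sup>2 - k\<^sup>2) * (x * (bessel_Y (\<nu> + 1) (k * x) * bessel_J (\<nu> + 1) (s * x)))) (at x)"
proof -
  have kx: "((\<lambda>x. k * x) has_real_derivative k) (at x)" and sx: "((\<lambda>x. s * x) has_real_derivative s) (at x)"
    by (auto intro!: derivative_eq_intros)
  have pos: "k * x > 0" "s * x > 0" using assms by simp_all
  note a = DERIV_chain2[OF bessel_Y_deriv[OF pos(1) assms(4)] kx]
  note b = DERIV_chain2[OF bessel_Y_deriv'[OF pos(1) assms(4)] kx]
  note al = DERIV_chain2[OF bessel_J_deriv[OF pos(2), of \<nu>] sx]
  note be = DERIV_chain2[OF bessel_J_deriv'[OF pos(2), of \<nu>] sx]
  from DERIV_mult[OF DERIV_ident DERIV_diff[OF DERIV_mult[OF DERIV_cmult[OF a, of k] be] DERIV_mult[OF DERIV_cmult[OF b, of s] al]]]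
  show ?thesis
    by (rule back_subst[of "\<lambda>d. (_ has_real_derivative d) _"])
      (use assms in \<open>simp add: field_simps power2_eq_square\<close>)
qed

lemma one_plus_cos_nonneg: "0 \<le> 1 + cos (t :: real)"
  using cos_ge_minus_one[of t] by linarith

section \<open>The cut radial kernel and the sign of its transform\<close>

text \<open>Here n stands for N - 2, so that the order is n/2 and the condition N \<ge> 3 becomes n
  \<ge> 1.\<close>

locale helmholtz_kernel =
  fixes n :: nat and k :: real
  assumes n: "n \<ge> 1" and k: "k > 0"
begin

definition \<nu> :: real where "\<nu> = real n / 2"
definition z :: real where "z = bessel_Y_first_zero \<nu>"
definition R :: real where "R = z / k"

text \<open>Up to the factor (k/(2\<pi>))^\<nu> / 4 this is Re \<Phi>_k at |x| = r, cut where
  Y_\<nu>(kr) first vanishes.\<close>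

definition profile :: "real \<Rightarrow> real" where
  "profile r = (if 0 < r \<and> r < R then - (r powr - \<nu> * bessel_Y \<nu> (k * r)) else 0)"

text \<open>Minus the derivative of \<open>profile\<close> on (0, R), that is, the weight of the
  ball of radius r.\<close>

definition slope :: "real \<Rightarrow> real" where
  "slope r = - (k * (r powr - \<nu> * bessel_Y (\<nu> + 1) (k * r)))"

text \<open>The value at 0 is the limit, which makes the integrand of the transform continuous on
  the closed interval.\<close>

definition reduced :: "real \<Rightarrow> real" where
  "reduced r = (if r = 0 then - (2 / pi * 2 powr \<nu> * Gamma (\<nu> + 1))
     else (k * r) powr (\<nu> + 1) * bessel_Y (\<nu> + 1) (k * r))"

lemma z_pos: "z > 0" and Y_z: "bessel_Y \<nu> z = 0" and Y_neg: "0 < t \<Longrightarrow> t < z \<Longrightarrow> bessel_Y \<nu> t < 0"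
  using bessel_Y_first_zero(1-3)[OF \<nu>_def n] unfolding z_def by blast+

lemma R_pos: "R > 0" and kR: "k * R = z"
  using z_pos k by (simp_all add: R_def)

lemma \<nu>_pos: "\<nu> > 0"
  using n by (simp add: \<nu>_def)

lemma kr_less_z: "r < R \<Longrightarrow> k * r < z"
  using k by (simp add: R_def field_simps)

lemma profile_nonneg: "profile r \<ge> 0"
  using Y_neg[of "k * r"] k kr_less_z[of r] by (auto simp: profile_def mult_nonneg_nonpos less_imp_le)

lemma slope_nonneg: "0 < r \<Longrightarrow> r \<le> R \<Longrightarrow> slope r \<ge> 0"
  using bessel_Y_Suc_nonpos[OF \<nu>_def n, of "k * r"] k
  by (auto simp: slope_def mult_nonneg_nonpos R_def z_def field_simps)

lemma at_right_0_scale: "filterlim (\<lambda>x. c * x) (at_right 0) (at_right (0::real))" if "c > 0"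
proof -
  have "((\<lambda>x. c * x) \<longlongrightarrow> 0) (at_right (0::real))" by (auto intro!: tendsto_eq_intros)
  then show ?thesis
    using that by (intro filterlim_atI[THEN filterlim_mono[OF _ order_refl order_refl]] filterlim_at_withinI)
      (auto simp: eventually_at_right_field intro!: exI[of _ 1])
qed

lemma continuous_bessel_Y_Suc: "continuous_on {0<..} (bessel_Y (\<nu> + 1))"
  by (rule bessel_Y_continuous[of _ "n + 2"]) (simp add: \<nu>_def)

lemma reduced_continuous: "continuous_on {0..} reduced"
  unfolding reduced_def[abs_def]
proof (rule continuous_on_extend_0)
  show "continuous_on {0<..} (\<lambda>r. (k * r) powr (\<nu> + 1) * bessel_Y (\<nu> + 1) (k * r))"
    using k by (intro continuous_intros continuous_on_compose2[OF continuous_bessel_Y_Suc]) auto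
  show "((\<lambda>r. (k * r) powr (\<nu> + 1) * bessel_Y (\<nu> + 1) (k * r)) \<longlongrightarrow> - (2 / pi * 2 powr \<nu> * Gamma (\<nu> + 1))) (at_right 0)"
    by (rule filterlim_compose[OF bessel_Y_at_0_weak(2)[OF \<nu>_def] at_right_0_scale[OF k]])
qed

lemma slope_continuous: "continuous_on {0<..} slope"
  unfolding slope_def[abs_def]
  using k by (intro continuous_intros continuous_on_compose2[OF continuous_bessel_Y_Suc]) auto

text \<open>The fundamental theorem of calculus from r to R; the boundary term at R vanishes because
  kR is a zero of Y_\<nu>.\<close>

lemma slope_integral:
  assumes "r > 0"
  shows "(\<integral>\<^sup>+t. ennreal (indicator {0<..<R} t * slope t) * indicator {r..} t \<partial>lborel) = ennreal (profile r)"
proof (cases "r < R")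
  case False
  have "(\<integral>\<^sup>+t. ennreal (indicator {0<..<R} t * slope t) * indicator {r..} t \<partial>lborel) = (\<integral>\<^sup>+t. 0 \<partial>(lborel :: real measure))"
    using False by (intro nn_integral_cong) (auto simp: indicator_def)
  then show ?thesis using False by (simp add: profile_def)
next
  case True
  let ?F = "\<lambda>t. t powr - \<nu> * bessel_Y \<nu> (k * t)"
  have d: "(?F has_real_derivative slope t) (at t)" if "t > 0" for t
  proof -
    have p: "((\<lambda>x. x powr - \<nu>) has_real_derivative - \<nu> / t * t powr - \<nu>) (at t)"
      using that by (auto intro!: derivative_eq_intros simp: powr_diff)
    have "((\<lambda>x. k * x) has_real_derivative k) (at t)" by (auto intro!: derivative_eq_intros)
    from DERIV_mult[OF p DERIV_chain2[OF bessel_Y_deriv[OF _ \<nu>_def] this]] show ?thesis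
      unfolding slope_def
      by (rule back_subst[of "\<lambda>d. (_ has_real_derivative d) _"]) (use that k in \<open>simp_all add: field_simps\<close>)
  qed
  define f where "f t = indicator {r..R} t * slope t" for t
  have m: "f \<in> borel_measurable borel"
  proof -
    have "continuous_on {r..R} slope"
      by (rule continuous_on_subset[OF slope_continuous]) (use assms in auto)
    from borel_measurable_continuous_on_indicator[OF _ this] show ?thesis by (simp add: f_def[abs_def])
  qed
  have "(\<integral>\<^sup>+t. ennreal (indicator {0<..<R} t * slope t) * indicator {r..} t \<partial>lborel)
     = (\<integral>\<^sup>+t. ennreal (f t) * indicator {r..R} t \<partial>lborel)"
    by (rule nn_integral_cong_AE, rule eventually_mono[OF AE_lborel_singleton[of R]])
      (use assms in \<open>auto simp: indicator_def f_def\<close>)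
  also have "\<dots> = ennreal (?F R - ?F r)"
    by (rule nn_integral_FTC_Icc[OF m])
      (use assms True slope_nonneg d in \<open>auto simp: f_def intro: DERIV_subset\<close>)
  also have "?F R - ?F r = profile r" using assms True by (simp add: profile_def kR Y_z)
  finally show ?thesis .
qed

text \<open>\<open>slope\<close> times the transform at |\<xi>| = s of the ball of radius r, without
  the constant \<pi>^(N/2) k^(-\<nu>).\<close>

definition ft_integrand :: "real \<Rightarrow> real \<Rightarrow> real" where
  "ft_integrand s r = - (r * reduced r * bessel_entire (\<nu> + 1) ((r * s)\<^sup>2 / 4))"

lemma bessel_entire_continuous: "continuous_on A (bessel_entire \<mu>)"
  by (rule DERIV_continuous_on) (rule DERIV_subset[OF bessel_entire_deriv], simp)

lemma ft_integrand_continuous: "continuous_on {0..R} (ft_integrand s)"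
  unfolding ft_integrand_def[abs_def]
  by (intro continuous_intros continuous_on_subset[OF reduced_continuous]
      continuous_on_compose2[OF bessel_entire_continuous[of UNIV]]) auto

lemma ft_integrand_integral:
  "integrable lborel (\<lambda>r. indicator {0..R} r * ft_integrand s r)"
  "(\<integral>r. indicator {0..R} r * ft_integrand s r \<partial>lborel) = integral {0..R} (ft_integrand s)"
proof -
  have "set_integrable lborel {0..R} (ft_integrand s)"
    unfolding set_integrable_def by (rule borel_integrable_compact) (auto intro: ft_integrand_continuous)
  then show "integrable lborel (\<lambda>r. indicator {0..R} r * ft_integrand s r)"
    "(\<integral>r. indicator {0..R} r * ft_integrand s r \<partial>lborel) = integral {0..R} (ft_integrand s)"
    using set_borel_integral_eq_integral(2)[of "{0..R}" "ft_integrand s"]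
    by (simp_all add: set_integrable_def set_lebesgue_integral_def)
qed

text \<open>Lommel's antiderivative \<open>G\<close> gives (s^2 - k^2) D I = g0 - G(R) for the
  integral I. At R the term with Y_\<nu> drops out and the Wronskian evaluates the other, so g0 -
  G(R) has the sign of j(z) - j(sR) with j(x) = x^(-\<nu>) J_\<nu>(x), which agrees with that of s -
  k unless it is 0.\<close>

lemma ft_integrand_sign:
  assumes s: "s > 0" "s \<noteq> k"
  shows "integral {0..R} (ft_integrand s) \<ge> 0"
proof -
  define G where "G r = r * (k * bessel_Y \<nu> (k * r) * bessel_J (\<nu> + 1) (s * r) - s * bessel_Y (\<nu> + 1) (k * r) * bessel_J \<nu> (s * r))" for r
  \<comment> \<open>The limit of \<open>G\<close> at 0: only the product of the singular Y_{\<nu>+1}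
    with J_\<nu> survives.\<close>
  define g0 where "g0 = 2 / pi * (s / k) powr (\<nu> + 1)"
  \<comment> \<open>The ratio of (sr/2)^(\<nu>+1), the prefactor of J_{\<nu>+1}(sr), to the power
    (kr)^(\<nu>+1) contained in \<open>reduced\<close>.\<close>
  define D where "D = (s / (2 * k)) powr (\<nu> + 1)"
  have D: "D > 0" using s k by (simp add: D_def)
  have lim: "(G \<longlongrightarrow> g0) (at_right 0)"
  proof -
    let ?A = "\<lambda>x. x powr (\<nu> + 2) * bessel_Y \<nu> x" and ?B = "\<lambda>x. x powr (\<nu> + 1) * bessel_Y (\<nu> + 1) x"
      and ?J = "\<lambda>\<mu> x. x powr - \<mu> * bessel_J \<mu> x"
    have "((\<lambda>r. (s / k) powr (\<nu> + 1) * (?A (k * r) * ?J (\<nu> + 1) (s * r)) - (s / k) powr (\<nu> + 1) * (?B (k * r) * ?J \<nu> (s * r))) \<longlongrightarrow>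
       (s / k) powr (\<nu> + 1) * (0 * (2 powr - (\<nu> + 1) * rGamma (\<nu> + 1 + 1)))
       - (s / k) powr (\<nu> + 1) * (- (2 / pi * 2 powr \<nu> * Gamma (\<nu> + 1)) * (2 powr - \<nu> * rGamma (\<nu> + 1)))) (at_right 0)"
      by (intro tendsto_diff tendsto_mult tendsto_const
          filterlim_compose[OF bessel_Y_at_0_weak(1)[OF \<nu>_def] at_right_0_scale[OF k]]
          filterlim_compose[OF bessel_Y_at_0_weak(2)[OF \<nu>_def] at_right_0_scale[OF k]]
          filterlim_compose[OF bessel_J_at_0 at_right_0_scale[OF s(1)]])
    also have "(s / k) powr (\<nu> + 1) * (0 * (2 powr - (\<nu> + 1) * rGamma (\<nu> + 1 + 1)))
       - (s / k) powr (\<nu> + 1) * (- (2 / pi * 2 powr \<nu> * Gamma (\<nu> + 1)) * (2 powr - \<nu> * rGamma (\<nu> + 1))) = g0"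
    proof -
      have "Gamma (\<nu> + 1) > 0" using \<nu>_pos by (intro Gamma_real_pos) simp
      moreover have "2 powr \<nu> * 2 powr - \<nu> = (1::real)" by (simp add: powr_add[symmetric])
      ultimately have "(2 powr \<nu> * 2 powr - \<nu>) * (Gamma (\<nu> + 1) * rGamma (\<nu> + 1)) = 1" by (simp add: rGamma_inverse_Gamma)
      then show ?thesis unfolding g0_def by (simp add: mult_ac)
    qed
    finally have "((\<lambda>r. (s / k) powr (\<nu> + 1) * (?A (k * r) * ?J (\<nu> + 1) (s * r)) - (s / k) powr (\<nu> + 1) * (?B (k * r) * ?J \<nu> (s * r))) \<longlongrightarrow> g0) (at_right 0)" .
    moreover have "\<forall>\<^sub>F r in at_right 0. (s / k) powr (\<nu> + 1) * (?A (k * r) * ?J (\<nu> + 1) (s * r))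
        - (s / k) powr (\<nu> + 1) * (?B (k * r) * ?J \<nu> (s * r)) = G r"
    proof -
      have "(s / k) powr (\<nu> + 1) * (?A (k * r) * ?J (\<nu> + 1) (s * r))
        - (s / k) powr (\<nu> + 1) * (?B (k * r) * ?J \<nu> (s * r)) = G r" if "r > 0" for r
      proof -
        have i: "c * ((P * y) * (Q * j)) = (c * (P * Q)) * (y * j)" for c P Q y j :: real by simp
        have "(s / k) powr (\<nu> + 1) * ((k * r) powr (\<nu> + 2) * (s * r) powr - (\<nu> + 1)) = r * k"
          "(s / k) powr (\<nu> + 1) * ((k * r) powr (\<nu> + 1) * (s * r) powr - \<nu>) = r * s"
        proof -
          have p: "(s / k) powr (\<nu> + 1) * (k * r) powr (\<nu> + 1) = (s * r) powr (\<nu> + 1)"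
            using that s k by (simp add: powr_mult[symmetric])
          have e: "(s * r) powr (\<nu> + 1) * (s * r) powr - (\<nu> + 1) = 1" "(s * r) powr (\<nu> + 1) * (s * r) powr - \<nu> = s * r"
            "(k * r) powr (\<nu> + 2) = (k * r) * (k * r) powr (\<nu> + 1)"
            using that s k powr_add[of "s * r" "\<nu> + 1" "- (\<nu> + 1)"] powr_add[of "s * r" "\<nu> + 1" "- \<nu>"]
              powr_add[of "k * r" 1 "\<nu> + 1"] by (simp_all add: add_ac)
          have "(s / k) powr (\<nu> + 1) * ((k * r) powr (\<nu> + 2) * (s * r) powr - (\<nu> + 1))
             = (k * r) * (((s / k) powr (\<nu> + 1) * (k * r) powr (\<nu> + 1)) * (s * r) powr - (\<nu> + 1))"
            unfolding e(3) by (simp only: mult_ac)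
          then show "(s / k) powr (\<nu> + 1) * ((k * r) powr (\<nu> + 2) * (s * r) powr - (\<nu> + 1)) = r * k"
            unfolding p e(1) by simp
          have "(s / k) powr (\<nu> + 1) * ((k * r) powr (\<nu> + 1) * (s * r) powr - \<nu>)
             = ((s / k) powr (\<nu> + 1) * (k * r) powr (\<nu> + 1)) * (s * r) powr - \<nu>" by (simp only: mult_ac)
          then show "(s / k) powr (\<nu> + 1) * ((k * r) powr (\<nu> + 1) * (s * r) powr - \<nu>) = r * s"
            unfolding p e(2) by simp
        qed
        then have "(s / k) powr (\<nu> + 1) * (?A (k * r) * ?J (\<nu> + 1) (s * r)) = (r * k) * (bessel_Y \<nu> (k * r) * bessel_J (\<nu> + 1) (s * r))"
          "(s / k) powr (\<nu> + 1) * (?B (k * r) * ?J \<nu> (s * r)) = (r * s) * (bessel_Y (\<nu> + 1) (k * r) * bessel_J \<nu> (s * r))"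
          by (simp_all only: i)
        note e = this
        show ?thesis unfolding e by (simp add: G_def algebra_simps)
      qed
      then show ?thesis by (auto simp: eventually_at_right_field intro!: exI[of _ 1])
    qed
    ultimately show ?thesis by (rule Lim_transform_eventually)
  qed
  have ft: "(s\<^sup>2 - k\<^sup>2) * (r * (bessel_Y (\<nu> + 1) (k * r) * bessel_J (\<nu> + 1) (s * r))) = - (s\<^sup>2 - k\<^sup>2) * D * ft_integrand s r" if "r > 0" for r
  proof -
    have "(s * r / 2) powr (\<nu> + 1) = D * (k * r) powr (\<nu> + 1)"
      using that s k by (simp add: D_def powr_mult[symmetric])
    moreover have "bessel_J (\<nu> + 1) (s * r) = (s * r / 2) powr (\<nu> + 1) * bessel_entire (\<nu> + 1) ((r * s)\<^sup>2 / 4)"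
      using that s by (simp add: bessel_J_eq mult.commute)
    ultimately show ?thesis
      using that k by (simp only: ft_integrand_def reduced_def) (simp add: algebra_simps)
  qed
  have Gd: "(G has_real_derivative - (s\<^sup>2 - k\<^sup>2) * D * ft_integrand s r) (at r)" if "r > 0" for r
    using lommel_deriv[OF that k s(1) \<nu>_def] ft[OF that] unfolding G_def[abs_def] by simp
  have "((\<lambda>r. - (s\<^sup>2 - k\<^sup>2) * D * ft_integrand s r) has_integral (if R = 0 then g0 else G R) - (if (0::real) = 0 then g0 else G 0)) {0..R}"
  proof (rule fundamental_theorem_of_calculus_interior)
    have "continuous_on {0<..} G" by (rule DERIV_continuous_on) (use Gd in \<open>auto intro: DERIV_subset\<close>)
    from continuous_on_subset[OF continuous_on_extend_0[OF this lim], of "{0..R}"]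
    show "continuous_on {0..R} (\<lambda>r. if r = 0 then g0 else G r)" by simp
    show "((\<lambda>r. if r = 0 then g0 else G r) has_vector_derivative - (s\<^sup>2 - k\<^sup>2) * D * ft_integrand s r) (at r)"
      if "r \<in> {0<..<R}" for r
      unfolding has_real_derivative_iff_has_vector_derivative[symmetric]
      by (rule has_field_derivative_transform_within_open[OF Gd, of _ "{0<..}"]) (use that in auto)
  qed (use R_pos in simp)
  then have I: "integral {0..R} (\<lambda>r. - (s\<^sup>2 - k\<^sup>2) * D * ft_integrand s r) = G R - g0"
    using R_pos by (subst integral_unique) auto
  then have I': "(s\<^sup>2 - k\<^sup>2) * (D * integral {0..R} (ft_integrand s)) = g0 - G R"
    by (simp add: mult.assoc) (simp add: left_diff_distrib)
  have Jz: "bessel_J \<nu> z > 0" using bessel_J_pos_before_Y_zero[OF \<nu>_def n z_pos] by (simp add: z_def)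
  have "bessel_Y (\<nu> + 1) z = - 2 / pi / (z * bessel_J \<nu> z)"
    using wronskian_at_zero(2)[OF z_pos \<nu>_def Y_z] Jz z_pos by (simp add: field_simps)
  then have GR: "G R = 2 / pi * (s / k) * (bessel_J \<nu> (s * R) / bessel_J \<nu> z)"
    using Jz z_pos k by (simp add: G_def kR Y_z) (simp add: R_def field_simps)
  have sR: "s * R = (s / k) * z" "s * R > 0"
    by (simp add: R_def, rule mult_pos_pos[OF s(1) R_pos])
  have q: "(s * R) powr - \<nu> = z powr - \<nu> / (s / k) powr \<nu>"
    unfolding sR(1) using s k z_pos by (simp add: powr_mult powr_minus divide_inverse)
  have sk: "(s / k) powr \<nu> > 0" "z powr - \<nu> > 0" using s k z_pos by simp_all
  have "(s\<^sup>2 - k\<^sup>2) * (g0 - G R) \<ge> 0"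
  proof -
    have gG: "g0 - G R = 2 / pi * (s / k) / bessel_J \<nu> z * ((s / k) powr \<nu> * bessel_J \<nu> z - bessel_J \<nu> (s * R))"
      using Jz s k by (simp add: g0_def GR powr_add field_simps)
    have pos: "2 / pi * (s / k) / bessel_J \<nu> z > 0" using Jz s k by simp
    show ?thesis
    proof (cases "s > k")
      case True
      have "s * R \<ge> z" unfolding sR(1) using True k z_pos by (simp add: field_simps)
      then have "(s * R) powr - \<nu> * bessel_J \<nu> (s * R) \<le> z powr - \<nu> * bessel_J \<nu> z"
        by (rule bessel_J_quotient_le_at_Y_zero[OF \<nu>_def n z_def])
      then have "z powr - \<nu> * bessel_J \<nu> (s * R) \<le> z powr - \<nu> * ((s / k) powr \<nu> * bessel_J \<nu> z)"
        unfolding q using sk by (simp add: divide_le_eq mult_ac)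
      then have "bessel_J \<nu> (s * R) \<le> (s / k) powr \<nu> * bessel_J \<nu> z" using sk by simp
      moreover have "s\<^sup>2 - k\<^sup>2 \<ge> 0" using True k by (simp add: power_mono)
      ultimately show ?thesis unfolding gG using pos by (intro mult_nonneg_nonneg) auto
    next
      case False
      have "s * R \<le> z" unfolding sR(1) using False k z_pos by (simp add: field_simps)
      then have "z powr - \<nu> * bessel_J \<nu> z \<le> (s * R) powr - \<nu> * bessel_J \<nu> (s * R)"
        using bessel_J_quotient_decreasing[of \<nu> "s * R" z] sR(2) \<nu>_pos bessel_J_pos_before_Y_zero[OF \<nu>_def n]
        by (simp add: z_def)
      then have "z powr - \<nu> * ((s / k) powr \<nu> * bessel_J \<nu> z) \<le> z powr - \<nu> * bessel_J \<nu> (s * R)"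
        unfolding q using sk by (simp add: le_divide_eq mult_ac)
      then have "(s / k) powr \<nu> * bessel_J \<nu> z \<le> bessel_J \<nu> (s * R)" using sk by simp
      moreover have "s\<^sup>2 - k\<^sup>2 \<le> 0" using False s by (simp add: power_mono)
      ultimately show ?thesis unfolding gG using pos by (intro mult_nonpos_nonpos mult_nonneg_nonpos) auto
    qed
  qed
  then have "(s\<^sup>2 - k\<^sup>2)\<^sup>2 * (D * integral {0..R} (ft_integrand s)) \<ge> 0"
    unfolding I'[symmetric] by (simp add: power2_eq_square mult.assoc)
  moreover have "(s\<^sup>2 - k\<^sup>2)\<^sup>2 > 0" using s k by (simp add: power2_eq_iff_nonneg)
  ultimately show ?thesis using D by (simp add: zero_le_mult_iff)
qed

lemma profile_measurable [measurable]: "profile \<in> borel_measurable borel"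
proof -
  have "continuous_on {0<..<R} (\<lambda>r. - (r powr - \<nu> * bessel_Y \<nu> (k * r)))"
    using k by (intro continuous_intros continuous_on_compose2[OF bessel_Y_continuous[OF \<nu>_def]]) auto
  from borel_measurable_continuous_on_indicator[OF _ this]
  have "(\<lambda>r. indicator {0<..<R} r * - (r powr - \<nu> * bessel_Y \<nu> (k * r))) \<in> borel_measurable borel" by simp
  also have "(\<lambda>r. indicator {0<..<R} r * - (r powr - \<nu> * bessel_Y \<nu> (k * r))) = profile"
    by (auto simp: profile_def fun_eq_iff)
  finally show ?thesis .
qed

lemma slope_measurable: "(\<lambda>r. indicator {0<..<R} r * slope r) \<in> borel_measurable borel"
proof -
  have "continuous_on {0<..<R} slope" by (rule continuous_on_subset[OF slope_continuous]) auto
  from borel_measurable_continuous_on_indicator[OF _ this] show ?thesis by simp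
qed

section \<open>The transform of the cut kernel in dimension n + 2\<close>

context
  fixes \<xi> :: "'a::euclidean_space"
  assumes dim: "DIM('a) = n + 2"
begin

text \<open>As 1 + cos is nonnegative, Tonelli's theorem applies to the superposition before the
  kernel is known to be integrable. The constant 1 is treated as the cosine at frequency 0, whence
  the argument \<open>r * 0\<close>.\<close>

lemma ball_integral_one_plus_cos:
  assumes "r > 0"
  shows "(\<integral>\<^sup>+x. ennreal (1 + cos (x \<bullet> \<xi>)) * indicator (cball 0 r) x \<partial>(lborel :: 'a measure))
     = ennreal (sqrt pi ^ DIM('a) * r ^ DIM('a) * (bessel_entire (\<nu> + 1) ((r * 0)\<^sup>2 / 4) + bessel_entire (\<nu> + 1) ((r * norm \<xi>)\<^sup>2 / 4)))"
    and "sqrt pi ^ DIM('a) * r ^ DIM('a) * (bessel_entire (\<nu> + 1) ((r * 0)\<^sup>2 / 4) + bessel_entire (\<nu> + 1) ((r * norm \<xi>)\<^sup>2 / 4)) \<ge> 0"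
proof -
  have nu: "real DIM('a) / 2 = \<nu> + 1" by (simp add: dim \<nu>_def)
  have int: "integrable lborel (\<lambda>x::'a. indicator (cball 0 r) x * cos (x \<bullet> \<zeta>))" for \<zeta>
    using borel_integrable_compact[of "cball (0::'a) r" "\<lambda>x. cos (x \<bullet> \<zeta>)"] by (simp add: continuous_intros)
  have int2: "integrable lborel (\<lambda>x::'a. indicator (cball 0 r) x * cos (x \<bullet> 0) + indicator (cball 0 r) x * cos (x \<bullet> \<xi>))"
    by (rule Bochner_Integration.integrable_add[OF int int])
  have eq: "(\<lambda>x::'a. indicator (cball 0 r) x * cos (x \<bullet> 0) + indicator (cball 0 r) x * cos (x \<bullet> \<xi>))
      = (\<lambda>x. (1 + cos (x \<bullet> \<xi>)) * indicator (cball 0 r) x)" by (simp add: fun_eq_iff algebra_simps)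
  have val: "(\<integral>x. (1 + cos (x \<bullet> \<xi>)) * indicator (cball 0 r) x \<partial>(lborel :: 'a measure))
     = sqrt pi ^ DIM('a) * r ^ DIM('a) * (bessel_entire (\<nu> + 1) ((r * 0)\<^sup>2 / 4) + bessel_entire (\<nu> + 1) ((r * norm \<xi>)\<^sup>2 / 4))"
    unfolding eq[symmetric] Bochner_Integration.integral_add[OF int int] ball_fourier[OF assms] nu
    by (simp add: algebra_simps)
  have pos: "(1 + cos (x \<bullet> \<xi>)) * indicator (cball 0 r) x \<ge> 0" for x :: 'a
    using one_plus_cos_nonneg[of "x \<bullet> \<xi>"] by (simp add: indicator_def)
  have "(\<integral>\<^sup>+x. ennreal (1 + cos (x \<bullet> \<xi>)) * indicator (cball 0 r) x \<partial>(lborel :: 'a measure))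
     = (\<integral>\<^sup>+x. ennreal ((1 + cos (x \<bullet> \<xi>)) * indicator (cball 0 r) x) \<partial>(lborel :: 'a measure))"
    by (intro nn_integral_cong) (auto simp: indicator_def)
  also have "\<dots> = ennreal (\<integral>x. (1 + cos (x \<bullet> \<xi>)) * indicator (cball 0 r) x \<partial>(lborel :: 'a measure))"
    by (rule nn_integral_eq_integral[OF int2[unfolded eq]]) (use pos in simp)
  finally show "(\<integral>\<^sup>+x. ennreal (1 + cos (x \<bullet> \<xi>)) * indicator (cball 0 r) x \<partial>(lborel :: 'a measure))
     = ennreal (sqrt pi ^ DIM('a) * r ^ DIM('a) * (bessel_entire (\<nu> + 1) ((r * 0)\<^sup>2 / 4) + bessel_entire (\<nu> + 1) ((r * norm \<xi>)\<^sup>2 / 4)))"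
    unfolding val .
  show "sqrt pi ^ DIM('a) * r ^ DIM('a) * (bessel_entire (\<nu> + 1) ((r * 0)\<^sup>2 / 4) + bessel_entire (\<nu> + 1) ((r * norm \<xi>)\<^sup>2 / 4)) \<ge> 0"
    unfolding val[symmetric] by (rule integral_nonneg_AE) (use pos in simp)
qed

text \<open>Bookkeeping of powers: r^N = r^(2\<nu>+2) compensates the factor r^(-\<nu>) of
  \<open>slope\<close> and supplies the power r^(\<nu>+1) that tames Y_{\<nu>+1}.\<close>

lemma slope_ball_ft:
  assumes "r > 0"
  shows "slope r * (sqrt pi ^ DIM('a) * r ^ DIM('a) * (bessel_entire (\<nu> + 1) ((r * 0)\<^sup>2 / 4) + bessel_entire (\<nu> + 1) ((r * norm \<xi>)\<^sup>2 / 4)))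
    = sqrt pi ^ DIM('a) * k powr - \<nu> * (ft_integrand 0 r + ft_integrand (norm \<xi>) r)"
proof -
  have "r ^ DIM('a) = r powr (\<nu> + ((\<nu> + 1) + 1))"
    using powr_realpow[OF assms, of "n + 2"] by (simp add: dim \<nu>_def add_ac)
  also have "\<dots> = r powr \<nu> * (r powr (\<nu> + 1) * r)"
    using assms by (simp only: powr_add powr_one)
  finally have rN: "r ^ DIM('a) = r powr \<nu> * (r powr (\<nu> + 1) * r)" .
  have e: "r powr - \<nu> * r powr \<nu> = 1" "k powr - \<nu> * k powr (\<nu> + 1) = k" "(k * r) powr (\<nu> + 1) = k powr (\<nu> + 1) * r powr (\<nu> + 1)"
    using assms k powr_add[of r "- \<nu>" \<nu>] powr_add[of k "- \<nu>" "\<nu> + 1"] by (simp_all add: powr_mult)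
  have "k * r powr - \<nu> * r ^ DIM('a) = (r powr - \<nu> * r powr \<nu>) * (k * (r powr (\<nu> + 1) * r))"
    unfolding rN by (simp only: mult_ac)
  also have "\<dots> = (k powr - \<nu> * k powr (\<nu> + 1)) * (r powr (\<nu> + 1) * r)" unfolding e(1,2) by simp
  also have "\<dots> = k powr - \<nu> * (r * (k * r) powr (\<nu> + 1))" unfolding e(3) by (simp only: mult_ac)
  finally have "k * r powr - \<nu> * r ^ DIM('a) = k powr - \<nu> * (r * (k * r) powr (\<nu> + 1))" .
  then have "k * r powr - \<nu> * r ^ DIM('a) * bessel_Y (\<nu> + 1) (k * r) = k powr - \<nu> * (r * reduced r)"
    using assms by (simp add: reduced_def)
  then have "slope r * r ^ DIM('a) = - (k powr - \<nu> * (r * reduced r))" by (simp add: slope_def mult_ac)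
  then have "slope r * r ^ DIM('a) * (sqrt pi ^ DIM('a) * (bessel_entire (\<nu> + 1) ((r * 0)\<^sup>2 / 4) + bessel_entire (\<nu> + 1) ((r * norm \<xi>)\<^sup>2 / 4)))
    = - (k powr - \<nu> * (r * reduced r)) * (sqrt pi ^ DIM('a) * (bessel_entire (\<nu> + 1) ((r * 0)\<^sup>2 / 4) + bessel_entire (\<nu> + 1) ((r * norm \<xi>)\<^sup>2 / 4)))"
    by (simp only:)
  then show ?thesis unfolding ft_integrand_def by (simp add: algebra_simps)
qed

text \<open>The superposition is integrated ball by ball. Putting \<xi> = 0 then yields
  integrability and total mass of the kernel, and subtracting the mass yields its cosine
  transform.\<close>

lemma kernel_one_plus_cos:
  "has_bochner_integral lborel (\<lambda>x::'a. (1 + cos (x \<bullet> \<xi>)) * profile (norm x))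
     (sqrt pi ^ DIM('a) * k powr - \<nu> * (integral {0..R} (ft_integrand 0) + integral {0..R} (ft_integrand (norm \<xi>))))"
proof (rule has_bochner_integral_nn_integral)
  define c where "c = sqrt pi ^ DIM('a) * k powr - \<nu>"
  let ?h = "\<lambda>r. indicator {0..R} r * ft_integrand 0 r + indicator {0..R} r * ft_integrand (norm \<xi>) r"
  let ?W = "\<lambda>r. ennreal (indicator {0<..<R} r * slope r)"
  have [measurable]: "?W \<in> borel_measurable borel" using slope_measurable by measurable
  have c: "c > 0" using k by (simp add: c_def)
  have h_eq: "c * ?h r = slope r * (sqrt pi ^ DIM('a) * r ^ DIM('a) * (bessel_entire (\<nu> + 1) ((r * 0)\<^sup>2 / 4) + bessel_entire (\<nu> + 1) ((r * norm \<xi>)\<^sup>2 / 4)))"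
    if "0 < r" "r \<le> R" for r
    unfolding slope_ball_ft[OF that(1)] using that by (simp add: c_def algebra_simps)
  have h_nonneg: "c * ?h r \<ge> 0" for r
  proof (cases "0 < r \<and> r \<le> R")
    case True
    then have r: "0 < r" "r \<le> R" by auto
    show ?thesis unfolding h_eq[OF r] by (rule mult_nonneg_nonneg[OF slope_nonneg[OF r] ball_integral_one_plus_cos(2)[OF r(1)]])
  next
    case False
    then show ?thesis by (cases "r = 0") (auto simp: ft_integrand_def indicator_def)
  qed
  have int: "integrable lborel (\<lambda>r. c * ?h r)"
    by (intro integrable_mult_right Bochner_Integration.integrable_add ft_integrand_integral)
  have hval: "(\<integral>r. c * ?h r \<partial>lborel) = c * (integral {0..R} (ft_integrand 0) + integral {0..R} (ft_integrand (norm \<xi>)))"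
    by (simp add: Bochner_Integration.integral_add[OF ft_integrand_integral(1) ft_integrand_integral(1)] ft_integrand_integral(2))
  have "(\<integral>\<^sup>+x. ennreal ((1 + cos (x \<bullet> \<xi>)) * profile (norm x)) \<partial>(lborel :: 'a measure))
      = (\<integral>\<^sup>+x. ennreal (1 + cos (x \<bullet> \<xi>)) * (\<integral>\<^sup>+r. ?W r * indicator {norm x..} r \<partial>lborel) \<partial>(lborel :: 'a measure))"
  proof (rule nn_integral_cong_AE, rule eventually_mono[OF AE_lborel_singleton[of 0]])
    fix x :: 'a assume "x \<noteq> 0"
    then have "(\<integral>\<^sup>+r. ?W r * indicator {norm x..} r \<partial>lborel) = ennreal (profile (norm x))"
      by (intro slope_integral) simp
    then show "ennreal ((1 + cos (x \<bullet> \<xi>)) * profile (norm x))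
       = ennreal (1 + cos (x \<bullet> \<xi>)) * (\<integral>\<^sup>+r. ?W r * indicator {norm x..} r \<partial>lborel)"
      using one_plus_cos_nonneg[of "x \<bullet> \<xi>"] by (simp add: ennreal_mult profile_nonneg)
  qed
  also have "\<dots> = (\<integral>\<^sup>+r. ?W r * (\<integral>\<^sup>+x. ennreal (1 + cos (x \<bullet> \<xi>)) * indicator (cball 0 r) x \<partial>(lborel :: 'a measure)) \<partial>lborel)"
    by (rule layer_cake_nn) measurable
  also have "\<dots> = (\<integral>\<^sup>+r. ennreal (c * ?h r) \<partial>lborel)"
  \<comment> \<open>The weight is cut to r < R, the integrand of the transform to r \<le> R; they
    may disagree at R alone.\<close>
  proof (rule nn_integral_cong_AE, rule eventually_mono[OF AE_lborel_singleton[of R]])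
    fix r assume "r \<noteq> R"
    show "?W r * (\<integral>\<^sup>+x. ennreal (1 + cos (x \<bullet> \<xi>)) * indicator (cball 0 r) x \<partial>(lborel :: 'a measure)) = ennreal (c * ?h r)"
    proof (cases "0 < r \<and> r \<le> R")
      case True
      then have r: "0 < r" "r \<le> R" by auto
      show ?thesis
        unfolding ball_integral_one_plus_cos(1)[OF r(1)] h_eq[OF r]
        using r \<open>r \<noteq> R\<close> slope_nonneg[OF r] ball_integral_one_plus_cos(2)[OF r(1)]
        by (subst ennreal_mult[symmetric]) auto
    next
      case False
      then show ?thesis by (cases "r = 0") (auto simp: ft_integrand_def indicator_def)
    qed
  qed
  also have "\<dots> = ennreal (c * (integral {0..R} (ft_integrand 0) + integral {0..R} (ft_integrand (norm \<xi>))))"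
    unfolding hval[symmetric] by (rule nn_integral_eq_integral[OF int]) (use h_nonneg in simp)
  finally show "(\<integral>\<^sup>+x. ennreal ((1 + cos (x \<bullet> \<xi>)) * profile (norm x)) \<partial>(lborel :: 'a measure))
     = ennreal (sqrt pi ^ DIM('a) * k powr - \<nu> * (integral {0..R} (ft_integrand 0) + integral {0..R} (ft_integrand (norm \<xi>))))"
    by (simp add: c_def mult.assoc)
  have "(\<integral>r. c * ?h r \<partial>lborel) \<ge> 0" by (rule integral_nonneg_AE) (use h_nonneg in simp)
  then show "0 \<le> sqrt pi ^ DIM('a) * k powr - \<nu> * (integral {0..R} (ft_integrand 0) + integral {0..R} (ft_integrand (norm \<xi>)))"
    by (simp only: hval) (simp only: c_def)
  show "AE x::'a in lborel. 0 \<le> (1 + cos (x \<bullet> \<xi>)) * profile (norm x)"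
    by (intro AE_I2 mult_nonneg_nonneg profile_nonneg one_plus_cos_nonneg)
qed measurable

end

lemma kernel_integrable:
  assumes "DIM('a::euclidean_space) = n + 2"
  shows "integrable lborel (\<lambda>x::'a. profile (norm x))"
    and "(\<integral>x. profile (norm x) \<partial>(lborel :: 'a measure)) = sqrt pi ^ DIM('a) * k powr - \<nu> * integral {0..R} (ft_integrand 0)"
proof -
  have "has_bochner_integral lborel (\<lambda>x::'a. (1 + cos (x \<bullet> 0)) * profile (norm x))
     (sqrt pi ^ DIM('a) * k powr - \<nu> * (integral {0..R} (ft_integrand 0) + integral {0..R} (ft_integrand (norm (0::'a)))))"
    by (rule kernel_one_plus_cos[OF assms])
  from has_bochner_integral_mult_right[OF this, of "1 / 2"]
  show "integrable lborel (\<lambda>x::'a. profile (norm x))"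
    "(\<integral>x. profile (norm x) \<partial>(lborel :: 'a measure)) = sqrt pi ^ DIM('a) * k powr - \<nu> * integral {0..R} (ft_integrand 0)"
    by (simp_all add: has_bochner_integral_iff)
qed

lemma kernel_fourier:
  fixes \<xi> :: "'a::euclidean_space"
  assumes dim: "DIM('a) = n + 2"
  shows "(\<integral>x. profile (norm x) * cos (x \<bullet> \<xi>) \<partial>(lborel :: 'a measure)) = sqrt pi ^ DIM('a) * k powr - \<nu> * integral {0..R} (ft_integrand (norm \<xi>))"
proof -
  have 1: "integrable lborel (\<lambda>x::'a. (1 + cos (x \<bullet> \<xi>)) * profile (norm x))"
    "(\<integral>x. (1 + cos (x \<bullet> \<xi>)) * profile (norm x) \<partial>(lborel :: 'a measure))
     = sqrt pi ^ DIM('a) * k powr - \<nu> * (integral {0..R} (ft_integrand 0) + integral {0..R} (ft_integrand (norm \<xi>)))"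
    using kernel_one_plus_cos[OF dim, of \<xi>] by (auto simp: has_bochner_integral_iff)
  have "(\<integral>x. profile (norm x) * cos (x \<bullet> \<xi>) \<partial>(lborel :: 'a measure))
     = (\<integral>x. (1 + cos (x \<bullet> \<xi>)) * profile (norm x) - profile (norm x) \<partial>(lborel :: 'a measure))"
    by (simp add: algebra_simps)
  also have "\<dots> = (\<integral>x. (1 + cos (x \<bullet> \<xi>)) * profile (norm x) \<partial>(lborel :: 'a measure)) - (\<integral>x. profile (norm x) \<partial>(lborel :: 'a measure))"
    by (rule Bochner_Integration.integral_diff[OF 1(1) kernel_integrable(1)[OF dim]])
  finally show ?thesis unfolding 1(2) kernel_integrable(2)[OF dim] by (simp add: algebra_simps)
qed

lemma kernel_fourier_nonneg:
  fixes \<xi> :: "'a::euclidean_space"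
  assumes "DIM('a) = n + 2" "\<xi> \<noteq> 0" "norm \<xi> \<noteq> k"
  shows "(\<integral>x. profile (norm x) * cos (x \<bullet> \<xi>) \<partial>(lborel :: 'a measure)) \<ge> 0"
  unfolding kernel_fourier[OF assms(1)] using ft_integrand_sign[of "norm \<xi>"] assms(2,3) by simp

end

section \<open>Positive definite kernels\<close>

lemma norm_mult_le_bound: "\<bar>b\<bar> \<le> B \<Longrightarrow> norm (a * b) \<le> B * \<bar>a\<bar>" for a b B :: real
  using mult_left_mono[of "\<bar>b\<bar>" B "\<bar>a\<bar>"] by (simp add: abs_mult mult.commute)

lemma lborel_integral_affine:
  fixes f :: "'a::euclidean_space \<Rightarrow> real"
  assumes [measurable]: "f \<in> borel_measurable borel" and c: "c \<noteq> 0"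
  shows "(\<integral>x. f x \<partial>lborel) = \<bar>c\<bar> ^ DIM('a) * (\<integral>x. f (t + c *\<^sub>R x) \<partial>lborel)"
    and "integrable lborel (\<lambda>x. f (t + c *\<^sub>R x)) \<longleftrightarrow> integrable lborel f"
proof -
  let ?D = "distr lborel borel (\<lambda>x::'a. t + c *\<^sub>R x)"
  have eq: "lborel = density ?D (\<lambda>_. ennreal (\<bar>c\<bar> ^ DIM('a)))" using lborel_affine[OF c, of t] by simp
  have "(\<integral>x. f x \<partial>lborel) = (\<integral>x. f x \<partial>density ?D (\<lambda>_. ennreal (\<bar>c\<bar> ^ DIM('a))))"
    using arg_cong[OF eq, of "\<lambda>M. integral\<^sup>L M f"] by simp
  also have "\<dots> = (\<integral>x. \<bar>c\<bar> ^ DIM('a) *\<^sub>R f x \<partial>?D)" by (rule integral_density) auto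
  also have "\<dots> = (\<integral>x. \<bar>c\<bar> ^ DIM('a) *\<^sub>R f (t + c *\<^sub>R x) \<partial>lborel)" by (rule integral_distr) auto
  finally show "(\<integral>x. f x \<partial>lborel) = \<bar>c\<bar> ^ DIM('a) * (\<integral>x. f (t + c *\<^sub>R x) \<partial>lborel)" by simp
  have "integrable lborel f \<longleftrightarrow> integrable (density ?D (\<lambda>_. ennreal (\<bar>c\<bar> ^ DIM('a)))) f"
    using arg_cong[OF eq, of "\<lambda>M. integrable M f"] by simp
  also have "\<dots> \<longleftrightarrow> integrable ?D (\<lambda>x. \<bar>c\<bar> ^ DIM('a) *\<^sub>R f x)" by (rule integrable_density) auto
  also have "\<dots> \<longleftrightarrow> integrable lborel (\<lambda>x. \<bar>c\<bar> ^ DIM('a) *\<^sub>R f (t + c *\<^sub>R x))" by (rule integrable_distr_eq) auto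
  also have "\<dots> \<longleftrightarrow> integrable lborel (\<lambda>x. f (t + c *\<^sub>R x))" using c by simp
  finally show "integrable lborel (\<lambda>x. f (t + c *\<^sub>R x)) \<longleftrightarrow> integrable lborel f" by simp
qed

lemma lborel_integral_reflect:
  fixes f :: "'a::euclidean_space \<Rightarrow> real"
  assumes "f \<in> borel_measurable borel"
  shows "(\<integral>x. f (t - x) \<partial>lborel) = (\<integral>x. f x \<partial>lborel)"
    and "integrable lborel (\<lambda>x. f (t - x)) \<longleftrightarrow> integrable lborel f"
  using lborel_integral_affine[OF assms, of "- 1" t] by simp_all

lemma lborel_integral_translate:
  fixes f :: "'a::euclidean_space \<Rightarrow> real"
  assumes "f \<in> borel_measurable borel"
  shows "(\<integral>x. f (t + x) \<partial>lborel) = (\<integral>x. f x \<partial>lborel)"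
  using lborel_integral_affine(1)[OF assms, of 1 t] by simp

lemma AE_lborel_translate:
  fixes P :: "'a::euclidean_space \<Rightarrow> bool"
  assumes "AE x in lborel. P x"
  shows "AE x in lborel. P (x - w)"
proof -
  have "AE x in distr lborel borel (\<lambda>x. - w + x). P x"
    using assms by (simp only: lborel_distr_plus)
  then show ?thesis using AE_distrD[of "\<lambda>x. - w + x" lborel borel P] by simp
qed

lemma integrable_prod_bounded:
  fixes a :: "'a::euclidean_space \<Rightarrow> real" and b :: "'b::euclidean_space \<Rightarrow> real"
  assumes a: "integrable lborel a" and b: "integrable lborel b"
    and [measurable]: "(\<lambda>(x, y). \<phi> x y) \<in> borel_measurable (borel \<Otimes>\<^sub>M borel)"
    and bound: "\<And>x y. \<bar>\<phi> x y\<bar> \<le> B"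
  shows "integrable (lborel \<Otimes>\<^sub>M lborel) (\<lambda>(x, y). a x * b y * \<phi> x y)"
proof -
  have [measurable]: "a \<in> borel_measurable borel" "b \<in> borel_measurable borel"
    using borel_measurable_integrable[OF a] borel_measurable_integrable[OF b] by simp_all
  have "integrable (lborel \<Otimes>\<^sub>M lborel) (\<lambda>(x, y). a x * b y)"
  proof (rule lborel_pair.Fubini_integrable)
    show "integrable lborel (\<lambda>x. \<integral>y. norm (case (x, y) of (x, y) \<Rightarrow> a x * b y) \<partial>lborel)"
      using a b by (simp add: abs_mult integrable_mult_left)
    show "AE x in lborel. integrable lborel (\<lambda>y. case (x, y) of (x, y) \<Rightarrow> a x * b y)"
      using b by simp
  qed measurable
  from integrable_mult_right[OF this, of B] show ?thesis
  proof (rule Bochner_Integration.integrable_bound)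
    have "\<bar>a x * b y * \<phi> x y\<bar> \<le> \<bar>B * (a x * b y)\<bar>" for x y
    proof -
      have "\<bar>a x * b y\<bar> * \<bar>\<phi> x y\<bar> \<le> \<bar>a x * b y\<bar> * \<bar>B\<bar>"
        using bound[of x y] by (intro mult_left_mono) auto
      then show ?thesis by (simp add: abs_mult mult_ac)
    qed
    then show "AE p in lborel \<Otimes>\<^sub>M lborel. norm (case p of (x, y) \<Rightarrow> a x * b y * \<phi> x y) \<le> norm (B * (case p of (x, y) \<Rightarrow> a x * b y))"
      by (intro AE_I2) (auto split: prod.splits)
  qed measurable
qed

text \<open>The common format of the exchanges of integrals that follow: two integrable weights and
  a bounded, jointly measurable factor.\<close>

lemma Fubini_bounded:
  fixes a :: "'a::euclidean_space \<Rightarrow> real" and b :: "'b::euclidean_space \<Rightarrow> real"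
  assumes "integrable lborel a" "integrable lborel b"
    and "(\<lambda>(x, y). \<phi> x y) \<in> borel_measurable (borel \<Otimes>\<^sub>M borel)" and "\<And>x y. \<bar>\<phi> x y\<bar> \<le> B"
  shows "(\<integral>x. a x * (\<integral>y. b y * \<phi> x y \<partial>lborel) \<partial>lborel) = (\<integral>y. b y * (\<integral>x. a x * \<phi> x y \<partial>lborel) \<partial>lborel)"
proof -
  have "(\<integral>y. (\<integral>x. a x * b y * \<phi> x y \<partial>lborel) \<partial>lborel) = (\<integral>x. (\<integral>y. a x * b y * \<phi> x y \<partial>lborel) \<partial>lborel)"
    by (rule lborel_pair.Fubini_integral) (rule integrable_prod_bounded[OF assms])
  moreover have "(\<integral>y. a x * b y * \<phi> x y \<partial>lborel) = a x * (\<integral>y. b y * \<phi> x y \<partial>lborel)" for x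
    by (simp add: mult.assoc)
  moreover have "(\<integral>x. a x * b y * \<phi> x y \<partial>lborel) = b y * (\<integral>x. a x * \<phi> x y \<partial>lborel)" for y
    by (simp add: mult.left_commute[of _ "b y"] mult.assoc mult.commute[of "a _" "b y"] flip: integral_mult_right_zero)
  ultimately show ?thesis by simp
qed

lemma gauss_integrable: "integrable lborel (\<lambda>x::'a::euclidean_space. exp (- (norm x)\<^sup>2))"
  using gauss_exp_integral[of "0 :: 'a"] by (simp add: has_bochner_integral_iff)

section \<open>Pairings of cosine transforms\<close>

text \<open>For even functions this is the Fourier transform; working with cosines keeps all
  integrals real.\<close>

definition fourier_cos :: "('a::euclidean_space \<Rightarrow> real) \<Rightarrow> 'a \<Rightarrow> real" where
  "fourier_cos f \<xi> = (\<integral>x. f x * cos (x \<bullet> \<xi>) \<partial>lborel)"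

lemma fourier_cos_measurable:
  assumes "integrable lborel f"
  shows "fourier_cos f \<in> borel_measurable borel"
proof -
  have [measurable]: "f \<in> borel_measurable borel" using borel_measurable_integrable[OF assms] by simp
  show ?thesis unfolding fourier_cos_def[abs_def] by measurable
qed

lemma integrable_mult_bounded:
  fixes f :: "'a::euclidean_space \<Rightarrow> real"
  assumes "integrable lborel f" and [measurable]: "c \<in> borel_measurable borel" and "\<And>x. \<bar>c x\<bar> \<le> B"
  shows "integrable lborel (\<lambda>x. f x * c x)"
proof -
  have [measurable]: "f \<in> borel_measurable borel" using borel_measurable_integrable[OF assms(1)] by simp
  from integrable_mult_right[OF assms(1), of B] show ?thesis
  proof (rule Bochner_Integration.integrable_bound)
    have "\<bar>f x * c x\<bar> \<le> \<bar>B * f x\<bar>" for x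
    proof -
      have "\<bar>f x\<bar> * \<bar>c x\<bar> \<le> \<bar>f x\<bar> * \<bar>B\<bar>" using assms(3)[of x] by (intro mult_left_mono) auto
      then show ?thesis by (simp add: abs_mult mult_ac)
    qed
    then show "AE x in lborel. norm (f x * c x) \<le> norm (B * f x)" by (intro AE_I2) simp
  qed measurable
qed

lemma fourier_cos_bounded:
  assumes "integrable lborel f"
  shows "\<bar>fourier_cos f \<xi>\<bar> \<le> (\<integral>x. \<bar>f x\<bar> \<partial>lborel)"
proof -
  have "integrable lborel (\<lambda>x. f x * cos (x \<bullet> \<xi>))"
    by (rule integrable_mult_bounded[OF assms, of _ 1]) auto
  have "\<bar>fourier_cos f \<xi>\<bar> \<le> (\<integral>x. \<bar>f x * cos (x \<bullet> \<xi>)\<bar> \<partial>lborel)"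
    unfolding fourier_cos_def by (rule integral_abs_bound)
  also have "\<dots> \<le> (\<integral>x. \<bar>f x\<bar> \<partial>lborel)"
  proof (rule integral_mono)
    show "\<bar>f x * cos (x \<bullet> \<xi>)\<bar> \<le> \<bar>f x\<bar>" for x by (simp add: abs_mult mult_left_le)
  qed (use assms \<open>integrable lborel (\<lambda>x. f x * cos (x \<bullet> \<xi>))\<close> in auto)
  finally show ?thesis .
qed

lemma gauss_fourier_scaled:
  fixes x :: "'a::euclidean_space"
  assumes "e > 0"
  shows "(\<integral>\<xi>. exp (- (norm (e *\<^sub>R \<xi>))\<^sup>2) * cos (x \<bullet> \<xi>) \<partial>lborel)
    = (1 / e) ^ DIM('a) * (sqrt pi ^ DIM('a) * exp (- (norm ((1 / e) *\<^sub>R x))\<^sup>2 / 4))"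
proof -
  have "(\<integral>\<xi>. exp (- (norm (e *\<^sub>R \<xi>))\<^sup>2) * cos (x \<bullet> \<xi>) \<partial>lborel)
     = \<bar>1 / e\<bar> ^ DIM('a) * (\<integral>\<xi>. exp (- (norm (e *\<^sub>R (0 + (1 / e) *\<^sub>R \<xi>)))\<^sup>2) * cos (x \<bullet> (0 + (1 / e) *\<^sub>R \<xi>)) \<partial>(lborel :: 'a measure))"
    by (rule lborel_integral_affine) (use assms in auto)
  also have "(\<integral>\<xi>. exp (- (norm (e *\<^sub>R (0 + (1 / e) *\<^sub>R \<xi>)))\<^sup>2) * cos (x \<bullet> (0 + (1 / e) *\<^sub>R \<xi>)) \<partial>(lborel :: 'a measure))
     = (\<integral>\<xi>. cos (\<xi> \<bullet> ((1 / e) *\<^sub>R x)) * exp (- (norm \<xi>)\<^sup>2) \<partial>(lborel :: 'a measure))"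
    using assms by (intro Bochner_Integration.integral_cong) (auto simp: inner_commute mult.commute)
  finally show ?thesis using assms by (simp only: gauss_fourier) simp
qed

text \<open>Gaussian regularisation turns the pairing into an integral of a product of Fourier transforms.\<close>

lemma regularised_pairing_nonneg:
  fixes K p :: "'a::euclidean_space \<Rightarrow> real"
  assumes K: "integrable lborel K" "AE \<xi> in lborel. 0 \<le> fourier_cos K \<xi>"
    and p: "integrable lborel p" "\<And>x. p (- x) = p x" "\<And>\<xi>. 0 \<le> fourier_cos p \<xi>"
    and e: "e > 0"
  shows "0 \<le> (\<integral>w. K w * (\<integral>v. p (w - e *\<^sub>R v) * (sqrt pi ^ DIM('a) * exp (- (norm v)\<^sup>2 / 4)) \<partial>lborel) \<partial>lborel)"
proof -
  define h where "h \<xi> = exp (- (norm (e *\<^sub>R \<xi>))\<^sup>2)" for \<xi> :: 'a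
  define \<gamma> where "\<gamma> x = (\<integral>\<xi>. h \<xi> * cos (x \<bullet> \<xi>) \<partial>lborel)" for x :: 'a
  have [measurable]: "p \<in> borel_measurable borel" "K \<in> borel_measurable borel"
    using borel_measurable_integrable[OF p(1)] borel_measurable_integrable[OF K(1)] by simp_all
  have [measurable]: "h \<in> borel_measurable borel" unfolding h_def[abs_def] by measurable
  have h: "integrable lborel h"
    using lborel_integral_affine(2)[of "\<lambda>x::'a. exp (- (norm x)\<^sup>2)" e 0] gauss_integrable e by (simp add: h_def[abs_def])
  note [measurable] = fourier_cos_measurable[OF p(1)]
  have hp: "integrable lborel (\<lambda>\<xi>. h \<xi> * fourier_cos p \<xi>)"
    by (rule integrable_mult_bounded[OF h _ fourier_cos_bounded[OF p(1)]]) measurable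
  have \<gamma>: "\<gamma> x = (1 / e) ^ DIM('a) * (sqrt pi ^ DIM('a) * exp (- (norm ((1 / e) *\<^sub>R x))\<^sup>2 / 4))" for x
    unfolding \<gamma>_def h_def by (rule gauss_fourier_scaled[OF e])
  have [measurable]: "\<gamma> \<in> borel_measurable borel" unfolding \<gamma>[abs_def] by measurable
  have \<gamma>b: "\<bar>\<gamma> x\<bar> \<le> (1 / e) ^ DIM('a) * sqrt pi ^ DIM('a)" for x
    unfolding \<gamma> using e by (simp add: abs_mult divide_le_eq mult_le_cancel_left1 power_abs)
  have inner: "(\<integral>\<xi>. (h \<xi> * fourier_cos p \<xi>) * cos (w \<bullet> \<xi>) \<partial>lborel)
      = (\<integral>v. p (w - e *\<^sub>R v) * (sqrt pi ^ DIM('a) * exp (- (norm v)\<^sup>2 / 4)) \<partial>lborel)" for w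
  proof -
    have "(\<integral>\<xi>. (h \<xi> * fourier_cos p \<xi>) * cos (w \<bullet> \<xi>) \<partial>lborel)
        = (\<integral>\<xi>. h \<xi> * (\<integral>u. p u * (cos (u \<bullet> \<xi>) * cos (w \<bullet> \<xi>)) \<partial>lborel) \<partial>lborel)"
      unfolding fourier_cos_def by (simp add: mult.assoc flip: integral_mult_left_zero)
    also have "\<dots> = (\<integral>u. p u * (\<integral>\<xi>. h \<xi> * (cos (u \<bullet> \<xi>) * cos (w \<bullet> \<xi>)) \<partial>lborel) \<partial>lborel)"
    proof (rule Fubini_bounded[OF h p(1), of _ 1])
      show "\<bar>cos (u \<bullet> \<xi>) * cos (w \<bullet> \<xi>)\<bar> \<le> 1" for \<xi> u :: 'a
        using mult_mono[of "\<bar>cos (u \<bullet> \<xi>)\<bar>" 1 "\<bar>cos (w \<bullet> \<xi>)\<bar>" 1] by (simp add: abs_mult)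
    qed measurable
    \<comment> \<open>The product of cosines splits into frequencies w - u and w + u; since p is
      even, both halves contribute the same.\<close>
    also have "\<dots> = (\<integral>u. p u * (1 / 2 * \<gamma> (w - u)) + p u * (1 / 2 * \<gamma> (w - (- u))) \<partial>lborel)"
    proof (rule Bochner_Integration.integral_cong[OF refl])
      fix u
      have c: "integrable lborel (\<lambda>\<xi>. h \<xi> * cos (x \<bullet> \<xi>))" for x
        by (rule integrable_mult_bounded[OF h, of _ 1]) auto
      have "(\<integral>\<xi>. h \<xi> * (cos (u \<bullet> \<xi>) * cos (w \<bullet> \<xi>)) \<partial>lborel)
         = (\<integral>\<xi>. 1 / 2 * (h \<xi> * cos ((w - u) \<bullet> \<xi>)) + 1 / 2 * (h \<xi> * cos ((w + u) \<bullet> \<xi>)) \<partial>lborel)"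
        by (intro Bochner_Integration.integral_cong refl) (simp add: inner_diff_left inner_add_left cos_add cos_diff algebra_simps)
      also have "\<dots> = 1 / 2 * \<gamma> (w - u) + 1 / 2 * \<gamma> (w + u)"
        unfolding \<gamma>_def by (subst Bochner_Integration.integral_add) (auto intro: c)
      finally show "p u * (\<integral>\<xi>. h \<xi> * (cos (u \<bullet> \<xi>) * cos (w \<bullet> \<xi>)) \<partial>lborel)
         = p u * (1 / 2 * \<gamma> (w - u)) + p u * (1 / 2 * \<gamma> (w - (- u)))" by (simp add: algebra_simps)
    qed
    also have "\<dots> = (\<integral>u. p u * (1 / 2 * \<gamma> (w - u)) \<partial>lborel) + (\<integral>u. p u * (1 / 2 * \<gamma> (w - (- u))) \<partial>lborel)"
    proof (rule Bochner_Integration.integral_add)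
      have b: "\<bar>1 / 2 * \<gamma> x\<bar> \<le> (1 / e) ^ DIM('a) * sqrt pi ^ DIM('a)" for x using \<gamma>b[of x] by (simp add: abs_mult)
      show "integrable lborel (\<lambda>u. p u * (1 / 2 * \<gamma> (w - u)))" "integrable lborel (\<lambda>u. p u * (1 / 2 * \<gamma> (w - (- u))))"
        by (rule integrable_mult_bounded[OF p(1) _ b], measurable)+
    qed
    also have "(\<integral>u. p u * (1 / 2 * \<gamma> (w - (- u))) \<partial>lborel) = (\<integral>u. p u * (1 / 2 * \<gamma> (w - u)) \<partial>lborel)"
      using lborel_integral_reflect(1)[of "\<lambda>u. p u * (1 / 2 * \<gamma> (w - u))" 0] by (simp add: p(2))
    also have "(\<integral>u. p u * (1 / 2 * \<gamma> (w - u)) \<partial>lborel) + (\<integral>u. p u * (1 / 2 * \<gamma> (w - u)) \<partial>lborel) = (\<integral>u. p u * \<gamma> (w - u) \<partial>lborel)"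
      by (simp flip: integral_mult_right_zero add: algebra_simps)
    also have "\<dots> = \<bar>- e\<bar> ^ DIM('a) * (\<integral>v. p (w + (- e) *\<^sub>R v) * \<gamma> (w - (w + (- e) *\<^sub>R v)) \<partial>lborel)"
      by (rule lborel_integral_affine) (use e in auto)
    also have "\<dots> = (\<integral>v. p (w - e *\<^sub>R v) * (sqrt pi ^ DIM('a) * exp (- (norm v)\<^sup>2 / 4)) \<partial>lborel)"
      unfolding \<gamma> using e by (simp add: power_one_over field_simps flip: integral_mult_right_zero)
    finally show ?thesis .
  qed
  have "0 \<le> (\<integral>\<xi>. (h \<xi> * fourier_cos p \<xi>) * fourier_cos K \<xi> \<partial>lborel)"
    by (rule integral_nonneg_AE) (use K(2) p(3) in \<open>auto elim!: eventually_mono simp: h_def\<close>)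
  also have "\<dots> = (\<integral>w. K w * (\<integral>\<xi>. (h \<xi> * fourier_cos p \<xi>) * cos (w \<bullet> \<xi>) \<partial>lborel) \<partial>lborel)"
    unfolding fourier_cos_def[of K] by (rule Fubini_bounded[OF hp K(1), of _ 1]) auto
  finally show ?thesis unfolding inner .
qed

text \<open>The regularised pairings are nonnegative and tend to the wanted integral times the mass
  I of the Gaussian, by dominated convergence inside and then outside. The regularisation takes the
  place of Fourier inversion, which would ask for integrable transforms.\<close>

lemma pairing_nonneg:
  fixes K p :: "'a::euclidean_space \<Rightarrow> real"
  assumes K: "integrable lborel K" "AE \<xi> in lborel. 0 \<le> fourier_cos K \<xi>"
    and p: "integrable lborel p" "\<And>x. p (- x) = p x" "\<And>\<xi>. 0 \<le> fourier_cos p \<xi>"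
    and cont: "continuous_on UNIV p" and bound: "\<And>x. \<bar>p x\<bar> \<le> B"
  shows "0 \<le> (\<integral>w. K w * p w \<partial>lborel)"
proof -
  define G where "G v = sqrt pi ^ DIM('a) * exp (- (norm v)\<^sup>2 / 4)" for v :: 'a
  define e where "e j = 1 / real (Suc j)" for j
  have [measurable]: "p \<in> borel_measurable borel" "K \<in> borel_measurable borel"
    using borel_measurable_integrable[OF p(1)] borel_measurable_integrable[OF K(1)] by simp_all
  have [measurable]: "G \<in> borel_measurable borel" unfolding G_def[abs_def] by measurable
  have G: "integrable lborel G"
  proof -
    have "integrable lborel (\<lambda>v::'a. exp (- (norm ((1 / 2) *\<^sub>R v))\<^sup>2))"
      using lborel_integral_affine(2)[of "\<lambda>x::'a. exp (- (norm x)\<^sup>2)" "1 / 2" 0] gauss_integrable by simp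
    from integrable_mult_right[OF this, of "sqrt pi ^ DIM('a)"] show ?thesis
      by (simp add: G_def[abs_def] power_divide)
  qed
  have Gpos: "G v > 0" for v by (simp add: G_def)
  have e0: "e j > 0" for j by (simp add: e_def)
  have "e \<longlonglongrightarrow> 0" unfolding e_def using LIMSEQ_inverse_real_of_nat by (simp add: inverse_eq_divide)
  define P where "P j w = (\<integral>v. p (w - e j *\<^sub>R v) * G v \<partial>lborel)" for j w
  have [measurable]: "P j \<in> borel_measurable borel" for j unfolding P_def[abs_def] by measurable
  define I where "I = (\<integral>v. G v \<partial>lborel)"
  have I: "I > 0"
  proof -
    have "I \<noteq> 0"
      unfolding I_def using integral_nonneg_eq_0_iff_AE[OF G] Gpos ae_filter_eq_bot_iff[of "lborel :: 'a measure"]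
      by (auto simp: less_imp_le less_imp_neq[THEN not_sym] trivial_limit_def)
    moreover have "I \<ge> 0" unfolding I_def by (rule integral_nonneg_AE) (use Gpos in \<open>auto intro: less_imp_le\<close>)
    ultimately show ?thesis by simp
  qed
  have Plim: "(\<lambda>j. P j w) \<longlonglongrightarrow> p w * I" for w
  proof -
    have "(\<lambda>j. P j w) \<longlonglongrightarrow> (\<integral>v. p w * G v \<partial>lborel)"
      unfolding P_def
    proof (rule integral_dominated_convergence)
      show "integrable lborel (\<lambda>v. B * G v)" using G by simp
      show "AE v in lborel. (\<lambda>j. p (w - e j *\<^sub>R v) * G v) \<longlonglongrightarrow> p w * G v"
      proof (intro AE_I2 tendsto_mult_right)
        fix v :: 'a
        have "(\<lambda>j. w - e j *\<^sub>R v) \<longlonglongrightarrow> w - 0 *\<^sub>R v" by (intro tendsto_intros \<open>e \<longlonglongrightarrow> 0\<close>)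
        then show "(\<lambda>j. p (w - e j *\<^sub>R v)) \<longlonglongrightarrow> p w"
          using cont by (auto intro: continuous_on_tendsto_compose[of UNIV p])
      qed
      show "AE v in lborel. norm (p (w - e j *\<^sub>R v) * G v) \<le> B * G v" for j
        using bound Gpos by (intro AE_I2) (simp add: abs_mult mult_right_mono less_imp_le)
    qed measurable
    then show ?thesis by (simp add: I_def)
  qed
  have Pbound: "\<bar>P j w\<bar> \<le> B * I" for j w
  proof -
    have int: "integrable lborel (\<lambda>v. G v * p (w - e j *\<^sub>R v))"
      by (rule integrable_mult_bounded[OF G _ bound]) measurable
    have "\<bar>P j w\<bar> \<le> (\<integral>v. \<bar>p (w - e j *\<^sub>R v) * G v\<bar> \<partial>lborel)" unfolding P_def by (rule integral_abs_bound)
    also have "\<dots> \<le> (\<integral>v. B * G v \<partial>lborel)"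
    proof (rule integral_mono)
      show "integrable lborel (\<lambda>v. \<bar>p (w - e j *\<^sub>R v) * G v\<bar>)"
        using integrable_abs[OF int] by (simp only: mult.commute)
      show "integrable lborel (\<lambda>v. B * G v)" using G by simp
      show "\<bar>p (w - e j *\<^sub>R v) * G v\<bar> \<le> B * G v" for v
        using mult_right_mono[OF bound[of "w - e j *\<^sub>R v"] less_imp_le[OF Gpos[of v]]] Gpos[of v] by (simp add: abs_mult)
    qed
    finally show ?thesis by (simp add: I_def)
  qed
  have "(\<lambda>j. \<integral>w. K w * P j w \<partial>lborel) \<longlonglongrightarrow> (\<integral>w. K w * (p w * I) \<partial>lborel)"
  proof (rule integral_dominated_convergence)
    show "integrable lborel (\<lambda>w. B * I * \<bar>K w\<bar>)" using K(1) by simp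
    show "AE w in lborel. norm (K w * P j w) \<le> B * I * \<bar>K w\<bar>" for j
      by (intro AE_I2 norm_mult_le_bound Pbound)
  qed (use Plim in \<open>auto intro!: tendsto_mult_left\<close>)
  moreover have "0 \<le> (\<integral>w. K w * P j w \<partial>lborel)" for j
    unfolding P_def G_def by (rule regularised_pairing_nonneg[OF K p e0])
  ultimately have "0 \<le> (\<integral>w. K w * (p w * I) \<partial>lborel)" by (blast intro: LIMSEQ_le_const)
  then show ?thesis using I by (simp add: zero_le_mult_iff flip: mult.assoc)
qed

lemma integrable_indicator_cball: "integrable lborel (indicator (cball (x::'a::euclidean_space) r) :: 'a \<Rightarrow> real)"
  using borel_integrable_compact[of "cball x r" "\<lambda>_. 1::real"] by simp

text \<open>The cosine transform of an autocorrelation is c^2 + s^2, the squared modulus of the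
  transform of g; the remaining properties make it admissible in
  \<open>pairing_nonneg\<close>.\<close>

lemma autocorrelation_properties:
  fixes g :: "'a::euclidean_space \<Rightarrow> real"
  assumes cont: "continuous_on UNIV g" and bound: "\<And>x. \<bar>g x\<bar> \<le> M" and supp: "\<And>x. norm x > r \<Longrightarrow> g x = 0"
  defines "p \<equiv> \<lambda>w. \<integral>x. g x * g (x - w) \<partial>lborel"
  shows "integrable lborel g" "integrable lborel p" "p (- w) = p w" "0 \<le> fourier_cos p \<xi>" "continuous_on UNIV p"
    "\<bar>p w\<bar> \<le> M * (\<integral>x. \<bar>g x\<bar> \<partial>lborel)"
proof -
  have [measurable]: "g \<in> borel_measurable borel" by (rule borel_measurable_continuous_onI[OF cont])
  have "g = (\<lambda>x. indicator (cball 0 r) x * g x)" using supp by (auto simp: fun_eq_iff indicator_def)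
  moreover have "integrable lborel (\<lambda>x. indicator (cball 0 r) x *\<^sub>R g x)"
    by (rule borel_integrable_compact) (auto intro: continuous_on_subset[OF cont])
  ultimately show g: "integrable lborel g" by simp
  have M: "M \<ge> 0" using bound[of 0] by linarith
  have bg: "\<bar>g (x - w)\<bar> \<le> M" for x w by (rule bound)
  have int: "integrable lborel (\<lambda>x. g x * g (x - w))" for w
    by (rule integrable_mult_bounded[OF g _ bg]) measurable
  show pb: "\<bar>p w\<bar> \<le> M * (\<integral>x. \<bar>g x\<bar> \<partial>lborel)" for w
  proof -
    have "\<bar>p w\<bar> \<le> (\<integral>x. \<bar>g x * g (x - w)\<bar> \<partial>lborel)" unfolding p_def by (rule integral_abs_bound)
    also have "\<dots> \<le> (\<integral>x. M * \<bar>g x\<bar> \<partial>lborel)"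
    proof (rule integral_mono)
      show "integrable lborel (\<lambda>x. \<bar>g x * g (x - w)\<bar>)" by (rule integrable_abs[OF int])
      show "integrable lborel (\<lambda>x. M * \<bar>g x\<bar>)" using g by simp
      show "\<bar>g x * g (x - w)\<bar> \<le> M * \<bar>g x\<bar>" for x
        using mult_left_mono[OF bg[of x w] abs_ge_zero[of "g x"]] by (simp add: abs_mult mult.commute)
    qed
    finally show ?thesis by simp
  qed
  show pc: "continuous_on UNIV p"
    unfolding continuous_on_sequentially comp_def
  proof (intro allI ballI impI, elim conjE)
    fix X :: "nat \<Rightarrow> 'a" and w assume X: "X \<longlonglongrightarrow> w"
    show "(\<lambda>j. p (X j)) \<longlonglongrightarrow> p w" unfolding p_def
    proof (rule integral_dominated_convergence)
      show "integrable lborel (\<lambda>x. M * \<bar>g x\<bar>)" using g by simp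
      show "AE x in lborel. (\<lambda>j. g x * g (x - X j)) \<longlonglongrightarrow> g x * g (x - w)"
        by (intro AE_I2 tendsto_mult_left continuous_on_tendsto_compose[OF cont] tendsto_intros X) auto
      show "AE x in lborel. norm (g x * g (x - X j)) \<le> M * \<bar>g x\<bar>" for j
        by (intro AE_I2 norm_mult_le_bound bg)
    qed measurable
  qed
  have p0: "p w = 0" if "norm w > 2 * r" for w
  proof -
    have "g x * g (x - w) = 0" for x
      using supp[of x] supp[of "x - w"] that norm_triangle_ineq4[of x "x - w"] by (cases "norm x > r") auto
    then have "(\<lambda>x. g x * g (x - w)) = (\<lambda>_. 0)" by (rule ext)
    then show ?thesis by (simp only: p_def integral_zero)
  qed
  have "p = (\<lambda>x. indicator (cball 0 (2 * r)) x * p x)" using p0 by (auto simp: fun_eq_iff indicator_def)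
  moreover have "integrable lborel (\<lambda>x. indicator (cball 0 (2 * r)) x *\<^sub>R p x)"
    by (rule borel_integrable_compact) (auto intro: continuous_on_subset[OF pc])
  ultimately show "integrable lborel p" by simp
  show "p (- w) = p w"
    using lborel_integral_translate[of "\<lambda>x. g x * g (x - w)" w] unfolding p_def by (simp add: mult.commute add.commute)
  show "0 \<le> fourier_cos p \<xi>"
  proof -
    define c s where "c = (\<integral>y. g y * cos (y \<bullet> \<xi>) \<partial>lborel)" and "s = (\<integral>y. g y * sin (y \<bullet> \<xi>) \<partial>lborel)"
    have ci: "integrable lborel (\<lambda>y. g y * cos (y \<bullet> \<xi>))" "integrable lborel (\<lambda>y. g y * sin (y \<bullet> \<xi>))"
      by (rule integrable_mult_bounded[OF g, of _ 1]; simp)+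
    \<comment> \<open>An integrable weight in w for the exchange of integrals. It may be inserted
      because g(x) and g(x - w) are both nonzero only if |w| \<le> 2r.\<close>
    define ind where "ind w = (indicator (cball 0 (2 * r)) w :: real)" for w :: 'a
    have ind: "integrable lborel ind" unfolding ind_def[abs_def] by (rule integrable_indicator_cball)
    have gi: "g x * (ind w * (g (x - w) * cos (w \<bullet> \<xi>))) = g x * (g (x - w) * cos (w \<bullet> \<xi>))" for x w
      using supp[of x] supp[of "x - w"] norm_triangle_ineq4[of x "x - w"]
      by (cases "norm x > r"; cases "norm (x - w) > r") (auto simp: ind_def indicator_def)
    have bgc: "\<bar>g (x - w) * cos (w \<bullet> \<xi>)\<bar> \<le> M" for x w
      using mult_mono[OF bg[of x w] abs_cos_le_one[of "w \<bullet> \<xi>"]] M by (simp add: abs_mult)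
    have "fourier_cos p \<xi> = (\<integral>w. ind w * (\<integral>x. g x * (g (x - w) * cos (w \<bullet> \<xi>)) \<partial>lborel) \<partial>lborel)"
      unfolding fourier_cos_def
    proof (rule Bochner_Integration.integral_cong[OF refl])
      fix w
      have "p w * cos (w \<bullet> \<xi>) = (\<integral>x. g x * (g (x - w) * cos (w \<bullet> \<xi>)) \<partial>lborel)"
        unfolding p_def by (simp add: mult.assoc flip: integral_mult_left_zero)
      also have "\<dots> = ind w * (\<integral>x. g x * (g (x - w) * cos (w \<bullet> \<xi>)) \<partial>lborel)"
      proof (cases "norm w > 2 * r")
        case True
        then show ?thesis using p0[OF True] \<open>p w * cos (w \<bullet> \<xi>) = _\<close> by (simp add: ind_def)
      qed (simp add: ind_def)
      finally show "p w * cos (w \<bullet> \<xi>) = ind w * (\<integral>x. g x * (g (x - w) * cos (w \<bullet> \<xi>)) \<partial>lborel)" .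
    qed
    also have "\<dots> = (\<integral>x. g x * (\<integral>w. ind w * (g (x - w) * cos (w \<bullet> \<xi>)) \<partial>lborel) \<partial>lborel)"
      by (rule Fubini_bounded[OF ind g _ bgc]) measurable
    also have "\<dots> = (\<integral>x. g x * (cos (x \<bullet> \<xi>) * c + sin (x \<bullet> \<xi>) * s) \<partial>lborel)"
    proof (rule Bochner_Integration.integral_cong[OF refl])
      fix x
      have "g x * (\<integral>w. ind w * (g (x - w) * cos (w \<bullet> \<xi>)) \<partial>lborel) = g x * (\<integral>w. g (x - w) * cos (w \<bullet> \<xi>) \<partial>lborel)"
        unfolding integral_mult_right_zero[symmetric] gi ..
      also have "(\<integral>w. g (x - w) * cos (w \<bullet> \<xi>) \<partial>lborel) = (\<integral>y. g y * cos ((x - y) \<bullet> \<xi>) \<partial>lborel)"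
        using lborel_integral_reflect(1)[of "\<lambda>w. g (x - w) * cos (w \<bullet> \<xi>)" x] by simp
      also have "\<dots> = (\<integral>y. cos (x \<bullet> \<xi>) * (g y * cos (y \<bullet> \<xi>)) + sin (x \<bullet> \<xi>) * (g y * sin (y \<bullet> \<xi>)) \<partial>lborel)"
        by (intro Bochner_Integration.integral_cong refl) (simp add: inner_diff_left cos_diff algebra_simps)
      also have "\<dots> = cos (x \<bullet> \<xi>) * c + sin (x \<bullet> \<xi>) * s"
        unfolding c_def s_def using ci by (subst Bochner_Integration.integral_add) auto
      finally show "g x * (\<integral>w. ind w * (g (x - w) * cos (w \<bullet> \<xi>)) \<partial>lborel) = g x * (cos (x \<bullet> \<xi>) * c + sin (x \<bullet> \<xi>) * s)" .
    qed
    also have "\<dots> = (\<integral>x. c * (g x * cos (x \<bullet> \<xi>)) + s * (g x * sin (x \<bullet> \<xi>)) \<partial>lborel)"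
      by (intro Bochner_Integration.integral_cong refl) (simp add: algebra_simps)
    also have "\<dots> = c * c + s * s"
      using ci by (subst Bochner_Integration.integral_add) (auto simp: c_def s_def)
    finally show ?thesis by simp
  qed
qed

section \<open>Quadratic forms of kernels\<close>

text \<open>A measurable function is an almost everywhere limit of continuous ones. Clipping at M
  and multiplying by a continuous cut-off equal to 1 on the ball of radius r keep the limit and add
  uniform bounds.\<close>

lemma continuous_approximation:
  fixes g :: "'a::euclidean_space \<Rightarrow> real"
  assumes [measurable]: "g \<in> borel_measurable borel" and bound: "\<And>x. \<bar>g x\<bar> \<le> M" and supp: "\<And>x. norm x > r \<Longrightarrow> g x = 0"
  obtains f where "\<And>j. continuous_on UNIV (f j)" "\<And>j x. \<bar>f j x\<bar> \<le> M" "\<And>j x. norm x > r + 1 \<Longrightarrow> f j x = 0"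
    "AE x in lborel. (\<lambda>j. f j x) \<longlonglongrightarrow> g x"
proof -
  have "g \<in> borel_measurable lebesgue" by (intro measurable_completion) simp
  then have "g measurable_on UNIV" by (rule lebesgue_measurable_imp_measurable_on_real) simp
  then obtain N h where N: "negligible N" and h: "\<And>j. continuous_on UNIV (h j)" "\<And>x. x \<notin> N \<Longrightarrow> (\<lambda>j. h j x) \<longlonglongrightarrow> g x"
    by (auto simp: measurable_on_def)
  have M: "M \<ge> 0" using bound[of 0] by linarith
  define cut where "cut x = max 0 (min 1 (r + 1 - norm x))" for x :: 'a
  define f where "f j x = max (- M) (min M (h j x)) * cut x" for j x
  have cut: "0 \<le> cut x" "cut x \<le> 1" for x by (auto simp: cut_def)
  show thesis
  proof (rule that[of f])
    show "continuous_on UNIV (f j)" for j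
      unfolding f_def[abs_def] cut_def by (intro continuous_intros h)
    show "\<bar>f j x\<bar> \<le> M" for j x
    proof -
      have "\<bar>max (- M) (min M (h j x))\<bar> * \<bar>cut x\<bar> \<le> M * 1" using cut[of x] M by (intro mult_mono) auto
      then show ?thesis by (simp add: f_def abs_mult)
    qed
    show "f j x = 0" if "norm x > r + 1" for j x using that by (simp add: f_def cut_def)
    have "AE x in lebesgue. x \<notin> N" using N by (simp add: negligible_iff_null_sets AE_not_in)
    then have "AE x in lborel. x \<notin> N" by (simp add: AE_completion_iff)
    then show "AE x in lborel. (\<lambda>j. f j x) \<longlonglongrightarrow> g x"
    proof eventually_elim
      case (elim x)
      have "(\<lambda>j. f j x) \<longlonglongrightarrow> max (- M) (min M (g x)) * cut x"
        unfolding f_def by (intro tendsto_intros h(2)[OF elim])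
      moreover have "max (- M) (min M (g x)) = g x" using bound[of x] by (auto simp: max_def min_def)
      moreover have "g x * cut x = g x" using supp[of x] by (cases "norm x > r") (auto simp: cut_def)
      ultimately show ?case by simp
    qed
  qed
qed

text \<open>Substituting w = x - y turns the bilinear form of the kernel into a pairing of K with
  the correlation of a and b.\<close>

lemma kernel_pairing_eq:
  fixes K a b :: "'a::euclidean_space \<Rightarrow> real"
  assumes K: "integrable lborel K" and a: "integrable lborel a"
    and [measurable]: "b \<in> borel_measurable borel" and bound: "\<And>x. \<bar>b x\<bar> \<le> M"
  shows "(\<integral>x. a x * (\<integral>y. K (x - y) * b y \<partial>lborel) \<partial>lborel) = (\<integral>w. K w * (\<integral>x. a x * b (x - w) \<partial>lborel) \<partial>lborel)"
proof -
  have [measurable]: "K \<in> borel_measurable borel" using borel_measurable_integrable[OF K] by simp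
  have bb: "\<bar>b (x - w)\<bar> \<le> M" for x w by (rule bound)
  have "(\<integral>y. K (x - y) * b y \<partial>lborel) = (\<integral>w. K w * b (x - w) \<partial>lborel)" for x
    using lborel_integral_reflect(1)[of "\<lambda>w. K w * b (x - w)" x] by simp
  then have "(\<integral>x. a x * (\<integral>y. K (x - y) * b y \<partial>lborel) \<partial>lborel) = (\<integral>x. a x * (\<integral>w. K w * b (x - w) \<partial>lborel) \<partial>lborel)"
    by simp
  also have "\<dots> = (\<integral>w. K w * (\<integral>x. a x * b (x - w) \<partial>lborel) \<partial>lborel)"
    by (rule Fubini_bounded[OF K a _ bb, symmetric]) measurable
  finally show ?thesis .
qed

text \<open>For continuous functions the form is the pairing of K with an autocorrelation. For
  measurable g the autocorrelations of approximants converge at every w, because translates of null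
  sets are null, and dominated convergence transfers the sign.\<close>

lemma positive_definite_kernel:
  fixes K g :: "'a::euclidean_space \<Rightarrow> real"
  assumes K: "integrable lborel K" "AE \<xi> in lborel. 0 \<le> fourier_cos K \<xi>"
    and [measurable]: "g \<in> borel_measurable borel" and bound: "\<And>x. \<bar>g x\<bar> \<le> M" and supp: "\<And>x. norm x > r \<Longrightarrow> g x = 0"
  shows "0 \<le> (\<integral>x. g x * (\<integral>y. K (x - y) * g y \<partial>lborel) \<partial>lborel)"
proof -
  obtain f where f: "\<And>j. continuous_on UNIV (f j)" "\<And>j x. \<bar>f j x\<bar> \<le> M" "\<And>j x. norm x > r + 1 \<Longrightarrow> f j x = 0"
    "AE x in lborel. (\<lambda>j. f j x) \<longlonglongrightarrow> g x"
    using continuous_approximation[OF assms(3) bound supp] by blast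
  have [measurable]: "K \<in> borel_measurable borel" using borel_measurable_integrable[OF K(1)] by simp
  have [measurable]: "f j \<in> borel_measurable borel" for j by (rule borel_measurable_continuous_onI[OF f(1)])
  have M: "M \<ge> 0" using bound[of 0] by linarith
  define ind where "ind x = (indicator (cball 0 (r + 1)) x :: real)" for x :: 'a
  have ind: "integrable lborel ind" unfolding ind_def[abs_def] by (rule integrable_indicator_cball)
  have [measurable]: "ind \<in> borel_measurable borel" using borel_measurable_integrable[OF ind] by simp
  define p where "p w = (\<integral>x. g x * g (x - w) \<partial>lborel)" for w
  define P where "P j w = (\<integral>x. f j x * f j (x - w) \<partial>lborel)" for j w
  have [measurable]: "p \<in> borel_measurable borel" "P j \<in> borel_measurable borel" for j
    unfolding p_def[abs_def] P_def[abs_def] by measurable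
  have fb: "norm (f j x * f j (x - w)) \<le> M * M * ind x" for j x w
    using f(3)[of x j] mult_mono[OF f(2)[of j x] f(2)[of j "x - w"]] M
    by (cases "norm x > r + 1") (auto simp: ind_def abs_mult)
  have "(\<lambda>j. P j w) \<longlonglongrightarrow> p w" for w
    unfolding P_def p_def
  proof (rule integral_dominated_convergence)
    show "integrable lborel (\<lambda>x. M * M * ind x)" using ind by simp
    show "AE x in lborel. (\<lambda>j. f j x * f j (x - w)) \<longlonglongrightarrow> g x * g (x - w)"
      using f(4) AE_lborel_translate[OF f(4), of w] by eventually_elim (rule tendsto_mult)
  qed (use fb in auto)
  moreover have Pb: "\<bar>P j w\<bar> \<le> M * M * (\<integral>x. ind x \<partial>lborel)" for j w
  proof -
    have i: "integrable lborel (\<lambda>x. M * M * ind x)" using ind by simp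
    have "integrable lborel (\<lambda>x. f j x * f j (x - w))"
    proof (rule Bochner_Integration.integrable_bound[OF i])
      show "AE x in lborel. norm (f j x * f j (x - w)) \<le> norm (M * M * ind x)"
        by (intro AE_I2 order_trans[OF fb]) simp
    qed measurable
    then have "norm (P j w) \<le> (\<integral>x. M * M * ind x \<partial>lborel)"
      unfolding P_def by (intro Bochner_Integration.integral_norm_bound_integral[OF _ i] fb)
    then show ?thesis by simp
  qed
  ultimately have "(\<lambda>j. \<integral>w. K w * P j w \<partial>lborel) \<longlonglongrightarrow> (\<integral>w. K w * p w \<partial>lborel)"
  proof (intro integral_dominated_convergence[where w = "\<lambda>w. M * M * (\<integral>x. ind x \<partial>lborel) * \<bar>K w\<bar>"])
    show "AE w in lborel. norm (K w * P j w) \<le> M * M * (\<integral>x. ind x \<partial>lborel) * \<bar>K w\<bar>" for j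
      by (intro AE_I2 norm_mult_le_bound Pb)
  qed (use K(1) in \<open>auto intro!: tendsto_mult_left\<close>)
  moreover have "0 \<le> (\<integral>w. K w * P j w \<partial>lborel)" for j
  proof (rule pairing_nonneg[OF K, of "P j" "M * (\<integral>x. \<bar>f j x\<bar> \<partial>lborel)"])
    note props = autocorrelation_properties[of "f j" M "r + 1", OF f(1) f(2) f(3), folded P_def]
    show "integrable lborel (P j)" by (rule props(2))
    show "P j (- x) = P j x" for x by (rule props(3))
    show "0 \<le> fourier_cos (P j) x" for x
      using autocorrelation_properties(4)[of "f j" M "r + 1" x, OF f(1) f(2) f(3)] by (simp add: P_def[abs_def])
    show "continuous_on UNIV (P j)" by (rule props(5))
    show "\<bar>P j x\<bar> \<le> M * (\<integral>x. \<bar>f j x\<bar> \<partial>lborel)" for x by (rule props(6))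
  qed
  ultimately have nonneg: "0 \<le> (\<integral>w. K w * p w \<partial>lborel)" by (blast intro: LIMSEQ_le_const)
  have g: "integrable lborel g"
  proof (rule Bochner_Integration.integrable_bound)
    show "integrable lborel (\<lambda>x. M * ind x)" using ind by simp
    show "AE x in lborel. norm (g x) \<le> norm (M * ind x)"
      using bound supp M by (intro AE_I2) (force simp: ind_def indicator_def)
  qed simp
  show ?thesis
    using nonneg unfolding p_def kernel_pairing_eq[OF K(1) g assms(3) bound] .
qed

section \<open>The abstract a priori estimate\<close>

text \<open>An even kernel gives a symmetric form; in the complex pairing this removes the imaginary
  part of the kernel.\<close>

lemma kernel_pairing_symmetric:
  fixes K a b :: "'a::euclidean_space \<Rightarrow> real"
  assumes K: "integrable lborel K" "\<And>x. K (- x) = K x"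
    and a: "integrable lborel a" "\<And>x. \<bar>a x\<bar> \<le> M" and b: "integrable lborel b" "\<And>x. \<bar>b x\<bar> \<le> M"
  shows "(\<integral>x. a x * (\<integral>y. K (x - y) * b y \<partial>lborel) \<partial>lborel) = (\<integral>x. b x * (\<integral>y. K (x - y) * a y \<partial>lborel) \<partial>lborel)"
proof -
  have [measurable]: "a \<in> borel_measurable borel" "b \<in> borel_measurable borel" "K \<in> borel_measurable borel"
    using borel_measurable_integrable[OF a(1)] borel_measurable_integrable[OF b(1)] borel_measurable_integrable[OF K(1)] by simp_all
  have "(\<integral>x. a x * b (x - w) \<partial>lborel) = (\<integral>x. b x * a (x - (- w)) \<partial>lborel)" for w
    using lborel_integral_translate[of "\<lambda>x. a x * b (x - w)" w] by (simp add: mult.commute add.commute)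
  then have "(\<integral>w. K w * (\<integral>x. a x * b (x - w) \<partial>lborel) \<partial>lborel) = (\<integral>w. K (0 - w) * (\<integral>x. b x * a (x - (0 - w)) \<partial>lborel) \<partial>lborel)"
    using K(2) by simp
  also have "\<dots> = (\<integral>w. K w * (\<integral>x. b x * a (x - w) \<partial>lborel) \<partial>lborel)"
    by (rule lborel_integral_reflect(1)) measurable
  finally show ?thesis
    by (simp only: kernel_pairing_eq[OF K(1) a(1) _ b(2)] kernel_pairing_eq[OF K(1) b(1) _ a(2)] measurable_lborel1 \<open>a \<in> borel_measurable borel\<close> \<open>b \<in> borel_measurable borel\<close>)
qed

lemma kernel_integrable_mult:
  fixes K b :: "'a::euclidean_space \<Rightarrow> real"
  assumes K: "integrable lborel K" and b: "b \<in> borel_measurable borel" "\<And>x. \<bar>b x\<bar> \<le> M"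
  shows "integrable lborel (\<lambda>y. K (x - y) * b y)"
    and "\<bar>\<integral>y. K (x - y) * b y \<partial>lborel\<bar> \<le> M * (\<integral>y. \<bar>K y\<bar> \<partial>lborel)"
proof -
  have [measurable]: "K \<in> borel_measurable borel" using borel_measurable_integrable[OF K] by simp
  have Kx: "integrable lborel (\<lambda>y. K (x - y))" using lborel_integral_reflect(2)[of K x] K by simp
  show i: "integrable lborel (\<lambda>y. K (x - y) * b y)" by (rule integrable_mult_bounded[OF Kx b])
  have "norm (\<integral>y. K (x - y) * b y \<partial>lborel) \<le> (\<integral>y. M * \<bar>K (x - y)\<bar> \<partial>lborel)"
    by (intro Bochner_Integration.integral_norm_bound_integral i norm_mult_le_bound b) (use Kx in simp)
  also have "\<dots> = M * (\<integral>y. \<bar>K y\<bar> \<partial>lborel)"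
    using lborel_integral_reflect(1)[of "\<lambda>y. \<bar>K y\<bar>" x] by simp
  finally show "\<bar>\<integral>y. K (x - y) * b y \<partial>lborel\<bar> \<le> M * (\<integral>y. \<bar>K y\<bar> \<partial>lborel)" by simp
qed

lemma integrable_bounded_support:
  fixes g :: "'a::euclidean_space \<Rightarrow> real"
  assumes "S \<in> sets lborel" "emeasure lborel S < \<infinity>" "g \<in> borel_measurable borel"
    and "\<And>x. \<bar>g x\<bar> \<le> B * indicator S x"
  shows "integrable lborel g"
proof (rule Bochner_Integration.integrable_bound)
  show "integrable lborel (\<lambda>x. B * indicator S x)"
    by (rule integrable_mult_right) (use assms(1,2) in \<open>simp add: integrable_indicator_iff\<close>)
  show "AE x in lborel. norm (g x) \<le> norm (B * indicator S x)"
    by (intro AE_I2) (use assms(4) in \<open>force intro: order_trans[OF _ abs_ge_self]\<close>)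
qed (use assms(3) in simp)

text \<open>With f = a + i b the real part is the form of A at a, plus that at b, plus a difference
  of two mixed terms with B that cancel by symmetry.\<close>

lemma complex_pairing_nonneg:
  fixes A B :: "'a::euclidean_space \<Rightarrow> real" and f :: "'a \<Rightarrow> complex"
  assumes A: "integrable lborel A" "AE \<xi> in lborel. 0 \<le> fourier_cos A \<xi>"
    and B: "integrable lborel B" "\<And>x. B (- x) = B x"
    and [measurable]: "f \<in> borel_measurable borel" and bound: "\<And>x. norm (f x) \<le> M" and supp: "\<And>x. norm x > r \<Longrightarrow> f x = 0"
  shows "0 \<le> (\<integral>x. Re (cnj (f x) * (\<integral>y. Complex (A (x - y)) (B (x - y)) * f y \<partial>lborel)) \<partial>lborel)"
proof -
  define a b where "a x = Re (f x)" and "b x = Im (f x)" for x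
  have [measurable]: "a \<in> borel_measurable borel" "b \<in> borel_measurable borel"
    unfolding a_def[abs_def] b_def[abs_def] by measurable
  have [measurable]: "A \<in> borel_measurable borel" "B \<in> borel_measurable borel"
    using borel_measurable_integrable[OF A(1)] borel_measurable_integrable[OF B(1)] by simp_all
  have bd: "\<bar>a x\<bar> \<le> M" "\<bar>b x\<bar> \<le> M" for x
    using abs_Re_le_cmod[of "f x"] abs_Im_le_cmod[of "f x"] bound[of x] by (auto simp: a_def b_def)
  have sp: "a x = 0" "b x = 0" if "norm x > r" for x using supp[OF that] by (simp_all add: a_def b_def)
  have "\<bar>a x\<bar> \<le> M * indicator (cball 0 r) x" "\<bar>b x\<bar> \<le> M * indicator (cball 0 r) x" for x
    using bd[of x] sp[of x] by (auto simp: indicator_def)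
  note abb = this
  have ab: "integrable lborel a" "integrable lborel b"
    by (rule integrable_bounded_support[OF _ emeasure_lborel_cball_finite _ abb(1)]
        integrable_bounded_support[OF _ emeasure_lborel_cball_finite _ abb(2)]; simp)+
  define cv where "cv K g x = (\<integral>y. K (x - y) * g y \<partial>lborel)" for K g :: "'a \<Rightarrow> real" and x
  have int: "integrable lborel (\<lambda>x. g x * cv K g' x)"
    if "integrable lborel g" "integrable lborel K" "integrable lborel g'" "\<And>x. \<bar>g' x\<bar> \<le> M" for g g' K
  proof -
    have [measurable]: "g' \<in> borel_measurable borel" "K \<in> borel_measurable borel"
      using borel_measurable_integrable[OF that(3)] borel_measurable_integrable[OF that(2)] by simp_all
    show ?thesis
    proof (rule integrable_mult_bounded[OF that(1)])
      show "cv K g' \<in> borel_measurable borel" unfolding cv_def[abs_def] by measurable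
      show "\<bar>cv K g' x\<bar> \<le> M * (\<integral>y. \<bar>K y\<bar> \<partial>lborel)" for x
        unfolding cv_def by (rule kernel_integrable_mult(2)[OF that(2) _ that(4)]) simp
    qed
  qed
  have inner: "(\<integral>y. Complex (A (x - y)) (B (x - y)) * f y \<partial>lborel) = Complex (cv A a x - cv B b x) (cv A b x + cv B a x)" for x
  proof -
    note i = kernel_integrable_mult(1)[of A a M x, OF A(1) _ bd(1)] kernel_integrable_mult(1)[of A b M x, OF A(1) _ bd(2)]
      kernel_integrable_mult(1)[of B a M x, OF B(1) _ bd(1)] kernel_integrable_mult(1)[of B b M x, OF B(1) _ bd(2)]
    have e: "Complex (A (x - y)) (B (x - y)) * f y
      = of_real (A (x - y) * a y - B (x - y) * b y) + \<i> * of_real (A (x - y) * b y + B (x - y) * a y)" for y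
      by (simp add: complex_eq_iff a_def b_def)
    have "(\<integral>y. Complex (A (x - y)) (B (x - y)) * f y \<partial>lborel)
      = of_real (\<integral>y. A (x - y) * a y - B (x - y) * b y \<partial>lborel) + \<i> * of_real (\<integral>y. A (x - y) * b y + B (x - y) * a y \<partial>lborel)"
      unfolding e using i
      by (subst Bochner_Integration.integral_add)
        (auto simp del: of_real_add of_real_diff of_real_mult intro!: integrable_of_real integrable_mult_right)
    then show ?thesis
      using i by (simp add: cv_def Complex_eq)
  qed
  have "Re (cnj (f x) * (\<integral>y. Complex (A (x - y)) (B (x - y)) * f y \<partial>lborel))
     = (a x * cv A a x + b x * cv A b x) + (b x * cv B a x - a x * cv B b x)" for x
    unfolding inner by (simp add: a_def b_def algebra_simps)
  then have "(\<integral>x. Re (cnj (f x) * (\<integral>y. Complex (A (x - y)) (B (x - y)) * f y \<partial>lborel)) \<partial>lborel)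
     = ((\<integral>x. a x * cv A a x \<partial>lborel) + (\<integral>x. b x * cv A b x \<partial>lborel)) + ((\<integral>x. b x * cv B a x \<partial>lborel) - (\<integral>x. a x * cv B b x \<partial>lborel))"
    using int[OF ab(1) A(1) ab(1) bd(1)] int[OF ab(2) A(1) ab(2) bd(2)] int[OF ab(2) B(1) ab(1) bd(1)] int[OF ab(1) B(1) ab(2) bd(2)]
    by (simp add: Bochner_Integration.integral_add Bochner_Integration.integral_diff)
  moreover have "(\<integral>x. b x * cv B a x \<partial>lborel) = (\<integral>x. a x * cv B b x \<partial>lborel)"
    unfolding cv_def by (rule kernel_pairing_symmetric[OF B ab(2) bd(2) ab(1) bd(1)])
  moreover have "0 \<le> (\<integral>x. a x * cv A a x \<partial>lborel)" "0 \<le> (\<integral>x. b x * cv A b x \<partial>lborel)"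
    unfolding cv_def by (rule positive_definite_kernel[OF A _ bd(1) sp(1)] positive_definite_kernel[OF A _ bd(2) sp(2)]; simp)+
  ultimately show ?thesis by simp
qed

section \<open>Elementary inequalities and the pointwise estimate\<close>

text \<open>Young's inequality with constants 1: if x \<ge> t^(p/q), powers of t are traded for
  powers of x, otherwise x is traded for t.\<close>

lemma young_powr:
  fixes x t :: real
  assumes "x \<ge> 0" "t \<ge> 0" "q > 1" "p > 0"
  shows "x * t powr (p - p / q) \<le> x powr q + t powr p"
proof (cases "t powr (p / q) \<le> x")
  case True
  have "t powr (p - p / q) = (t powr (p / q)) powr (q - 1)"
    using assms by (simp add: powr_powr right_diff_distrib)
  also have "\<dots> \<le> x powr (q - 1)" using True assms by (intro powr_mono2) auto
  finally have "x * t powr (p - p / q) \<le> x * x powr (q - 1)" using assms by (intro mult_left_mono) auto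
  also have "\<dots> = x powr q" using assms powr_add[of x 1 "q - 1"] by (cases "x = 0") auto
  finally show ?thesis by (simp add: add_increasing2)
next
  case False
  then have "x * t powr (p - p / q) \<le> t powr (p / q) * t powr (p - p / q)" by (intro mult_right_mono) auto
  also have "\<dots> = t powr p" by (simp flip: powr_add)
  finally show ?thesis by (simp add: add_increasing)
qed

text \<open>Cut at t = 2a: above it half of t^p absorbs the left side, below it t is at most
  2a.\<close>

lemma absorb_powr:
  fixes a t :: real
  assumes "a \<ge> 0" "t \<ge> 0" "p > 1"
  shows "a * t powr (p - 1) \<le> t powr p / 2 + 2 powr (p - 1) * a powr p"
proof (cases "2 * a \<le> t")
  case True
  have "(2 * a) * t powr (p - 1) \<le> t * t powr (p - 1)" using True by (intro mult_right_mono) auto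
  also have "\<dots> = t powr p" using assms powr_add[of t 1 "p - 1"] by (cases "t = 0") auto
  finally show ?thesis using assms by (simp add: add_increasing2)
next
  case False
  then have "a * t powr (p - 1) \<le> a * (2 * a) powr (p - 1)" using assms by (intro mult_left_mono powr_mono2) auto
  also have "\<dots> = 2 powr (p - 1) * (a * a powr (p - 1))" using assms by (simp add: powr_mult)
  also have "a * a powr (p - 1) = a powr p" using assms powr_add[of a 1 "p - 1"] by (cases "a = 0") auto
  finally show ?thesis by (simp add: add_increasing)
qed

text \<open>The bound on |\<Phi>|^q separates an integrable part h, which carries the singularity,
  from a constant c that is integrated over S only. Testing the equation with f bounds the integral
  I of |Q||u|^p, and I enters the estimate of the convolution, so that M appears only to the power
  p/q - 1.\<close>

lemma a_priori_estimate:
  fixes \<Phi> u \<phi> :: "'a::euclidean_space \<Rightarrow> complex" and h Q :: "'a \<Rightarrow> real"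
  assumes [measurable]: "\<Phi> \<in> borel_measurable borel"
    and h: "integrable lborel h" "\<And>x. h x \<ge> 0" and c: "c \<ge> 0" "\<And>x. norm (\<Phi> x) powr q \<le> h x + c"
    and pq: "p > 2" "q > 1" "q < p"
    and S: "S \<in> sets lborel" "emeasure lborel S < \<infinity>"
    and [measurable]: "Q \<in> borel_measurable borel" and Q: "\<And>x. Q x \<le> 0" "\<And>x. \<bar>Q x\<bar> \<le> b * indicator S x" and b: "b \<ge> 0"
    and [measurable]: "u \<in> borel_measurable borel" and u: "\<And>x. norm (u x) \<le> M"
    and [measurable]: "\<phi> \<in> borel_measurable borel" and \<phi>: "\<And>x. norm (\<phi> x) \<le> a"
  defines "f \<equiv> \<lambda>x. of_real (Q x * norm (u x) powr (p - 2)) * u x"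
  assumes eq: "AE x in lborel. u x = (\<integral>y. \<Phi> (x - y) * f y \<partial>lborel) + \<phi> x"
    and pos: "0 \<le> (\<integral>x. Re (cnj (f x) * (\<integral>y. \<Phi> (x - y) * f y \<partial>lborel)) \<partial>lborel)"
  shows "AE x in lborel. norm (u x) \<le> a + M powr (p / q - 1) *
     (b * ((\<integral>x. h x \<partial>lborel) + c * measure lborel S) + 2 powr p * a powr p * b * measure lborel S)"
proof -
  define t where "t x = norm (u x)" for x
  define s where "s = measure lborel S"
  define I where "I = (\<integral>x. \<bar>Q x\<bar> * t x powr p \<partial>lborel)"
  have [measurable]: "t \<in> borel_measurable borel" unfolding t_def[abs_def] by measurable
  have [measurable]: "f \<in> borel_measurable borel" unfolding f_def by measurable
  have [measurable]: "S \<in> sets borel" using S(1) by simp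
  have [measurable]: "cnj \<in> borel_measurable borel"
    by (intro borel_measurable_continuous_onI continuous_intros)
  have t: "0 \<le> t x" "t x \<le> M" for x using u by (auto simp: t_def)
  have M: "M \<ge> 0" using t[of 0] by linarith
  have a: "a \<ge> 0" using \<phi>[of 0] norm_ge_zero[of "\<phi> 0"] by linarith
  have nf: "norm (f x) = \<bar>Q x\<bar> * t x powr (p - 1)" for x
    using powr_add[of "t x" "p - 2" 1] by (cases "u x = 0") (auto simp: f_def t_def norm_mult abs_mult)
  have cfu: "Re (cnj (f x) * u x) = - (\<bar>Q x\<bar> * t x powr p)" for x
  proof -
    have "cnj (f x) * u x = of_real (Q x * t x powr (p - 2)) * (u x * cnj (u x))" by (simp add: f_def t_def mult_ac)
    also have "\<dots> = of_real (Q x * (t x powr (p - 2) * (t x)\<^sup>2))"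
      unfolding t_def complex_norm_square[symmetric] by (simp add: mult.assoc)
    also have "t x powr (p - 2) * (t x)\<^sup>2 = t x powr p"
      using t(1)[of x] powr_add[of "t x" "p - 2" 2] by (cases "t x = 0") auto
    finally show ?thesis using Q(1)[of x] by simp
  qed
  have Qt: "\<bar>\<bar>Q x\<bar> * t x powr e\<bar> \<le> (b * M powr e) * indicator S x" if "e \<ge> 0" for x e
  proof -
    have "\<bar>Q x\<bar> * t x powr e \<le> b * indicator S x * M powr e"
      using t[of x] b that Q(2)[of x] by (intro mult_mono powr_mono2) auto
    then show ?thesis by (simp add: mult_ac)
  qed
  have iQt: "integrable lborel (\<lambda>x. \<bar>Q x\<bar> * t x powr e)" if "e \<ge> 0" for e
    by (rule integrable_bounded_support[OF S _ Qt[OF that]]) measurable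
  have iS: "integrable lborel (\<lambda>x. B * indicator S x :: real)" for B
    by (rule integrable_mult_right) (use S in \<open>simp add: integrable_indicator_iff\<close>)
  have I0: "I \<ge> 0" unfolding I_def by (intro integral_nonneg_AE AE_I2) simp
  have cfp: "\<bar>Re (cnj (f x) * \<phi> x)\<bar> \<le> a * (\<bar>Q x\<bar> * t x powr (p - 1))" for x
  proof -
    have "\<bar>Re (cnj (f x) * \<phi> x)\<bar> \<le> norm (f x) * norm (\<phi> x)"
      using abs_Re_le_cmod[of "cnj (f x) * \<phi> x"] by (simp add: norm_mult)
    also have "\<dots> \<le> norm (f x) * a" using \<phi>[of x] by (intro mult_left_mono) auto
    finally show ?thesis by (simp only: nf mult.commute)
  qed
  have ifp: "integrable lborel (\<lambda>x. Re (cnj (f x) * \<phi> x))"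
    by (rule Bochner_Integration.integrable_bound[of _ "\<lambda>x. a * (\<bar>Q x\<bar> * t x powr (p - 1))"])
      (use iQt[of "p - 1"] pq a cfp in \<open>auto intro!: AE_I2 intro: order_trans[OF _ abs_ge_self]\<close>)
  \<comment> \<open>As cnj f times u has real part -|Q||u|^p, the sign of the pairing bounds I by
    minus the integral of Re(cnj f \<phi>); half of I is then absorbed.\<close>
  have "I \<le> 2 powr p * a powr p * b * s"
  proof -
    have "0 \<le> (\<integral>x. - (\<bar>Q x\<bar> * t x powr p) - Re (cnj (f x) * \<phi> x) \<partial>lborel)"
    proof (rule order_trans[OF pos eq_refl], rule integral_cong_AE)
      show "AE x in lborel. Re (cnj (f x) * (\<integral>y. \<Phi> (x - y) * f y \<partial>lborel)) = - (\<bar>Q x\<bar> * t x powr p) - Re (cnj (f x) * \<phi> x)"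
        using eq
      proof eventually_elim
        case (elim x)
        then have "(\<integral>y. \<Phi> (x - y) * f y \<partial>lborel) = u x - \<phi> x" by (simp add: algebra_simps)
        then show ?case by (simp only: right_diff_distrib minus_complex.sel cfu)
      qed
    qed measurable
    also have "\<dots> = - I - (\<integral>x. Re (cnj (f x) * \<phi> x) \<partial>lborel)"
      using iQt[of p] pq ifp unfolding I_def by (subst Bochner_Integration.integral_diff) auto
    finally have "I \<le> norm (\<integral>x. Re (cnj (f x) * \<phi> x) \<partial>lborel)" by simp
    also have "\<dots> \<le> (\<integral>x. 1 / 2 * (\<bar>Q x\<bar> * t x powr p) + (2 powr (p - 1) * a powr p * b) * indicator S x \<partial>lborel)"
    proof (rule Bochner_Integration.integral_norm_bound_integral[OF ifp])
      show "integrable lborel (\<lambda>x. 1 / 2 * (\<bar>Q x\<bar> * t x powr p) + (2 powr (p - 1) * a powr p * b) * indicator S x)"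
        using iQt[of p] iS pq by (intro Bochner_Integration.integrable_add integrable_mult_right) auto
      fix x
      have "a * (\<bar>Q x\<bar> * t x powr (p - 1)) \<le> \<bar>Q x\<bar> * (t x powr p / 2 + 2 powr (p - 1) * a powr p)"
        using mult_left_mono[OF absorb_powr[OF a t(1)[of x], of p] abs_ge_zero[of "Q x"]] pq by (simp add: mult_ac)
      also have "\<dots> = 1 / 2 * (\<bar>Q x\<bar> * t x powr p) + \<bar>Q x\<bar> * (2 powr (p - 1) * a powr p)" by (simp add: algebra_simps)
      also have "\<bar>Q x\<bar> * (2 powr (p - 1) * a powr p) \<le> (b * indicator S x) * (2 powr (p - 1) * a powr p)"
        using Q(2)[of x] by (intro mult_right_mono) auto
      finally show "norm (Re (cnj (f x) * \<phi> x)) \<le> 1 / 2 * (\<bar>Q x\<bar> * t x powr p) + (2 powr (p - 1) * a powr p * b) * indicator S x"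
        using cfp[of x] by (simp add: mult_ac)
    qed
    also have "\<dots> = 1 / 2 * I + 2 powr (p - 1) * a powr p * b * s"
      using iQt[of p] iS pq S unfolding I_def s_def by (subst Bochner_Integration.integral_add) auto
    finally have "I \<le> 2 * (2 powr (p - 1) * a powr p * b * s)" by simp
    also have "2 * (2 powr (p - 1) * a powr p * b * s) = 2 powr p * a powr p * b * s"
      using powr_add[of "2::real" 1 "p - 1"] by simp
    finally show ?thesis .
  qed
  have main: "norm (\<integral>y. \<Phi> (x - y) * f y \<partial>lborel) \<le> M powr (p / q - 1) * (b * ((\<integral>x. h x \<partial>lborel) + c * s) + I)" for x
  proof -
    define g where "g y = M powr (p / q - 1) * ((b * h (x - y) + (b * c) * indicator S y) + \<bar>Q y\<bar> * t y powr p)" for y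
    have [measurable]: "h \<in> borel_measurable borel" using borel_measurable_integrable[OF h(1)] by simp
    have hx: "integrable lborel (\<lambda>y. h (x - y))" "(\<integral>y. h (x - y) \<partial>lborel) = (\<integral>x. h x \<partial>lborel)"
      using lborel_integral_reflect[of h x] h(1) by simp_all
    have g: "integrable lborel g"
      unfolding g_def[abs_def] using hx(1) iS iQt[of p] pq
      by (intro integrable_mult_right Bochner_Integration.integrable_add) auto
    have le: "norm (\<Phi> (x - y) * f y) \<le> g y" for y
    proof -
      \<comment> \<open>Only t^(p/q - 1), with nonnegative exponent as q < p, is estimated by the
        sup norm; the remaining power goes into Young's inequality.\<close>
      have "t y powr (p - 1) = t y powr (p / q - 1) * t y powr (p - p / q)"
        by (simp flip: powr_add)
      also have "\<dots> \<le> M powr (p / q - 1) * t y powr (p - p / q)"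
        using t[of y] pq by (intro mult_right_mono powr_mono2) auto
      finally have "norm (\<Phi> (x - y)) * t y powr (p - 1) \<le> norm (\<Phi> (x - y)) * (M powr (p / q - 1) * t y powr (p - p / q))"
        by (intro mult_left_mono) auto
      also have "\<dots> = M powr (p / q - 1) * (norm (\<Phi> (x - y)) * t y powr (p - p / q))" by simp
      also have "\<dots> \<le> M powr (p / q - 1) * ((h (x - y) + c) + t y powr p)"
        using young_powr[of "norm (\<Phi> (x - y))" "t y" q p] t(1)[of y] pq c(2)[of "x - y"] by (intro mult_left_mono) auto
      finally have "\<bar>Q y\<bar> * (norm (\<Phi> (x - y)) * t y powr (p - 1)) \<le> \<bar>Q y\<bar> * (M powr (p / q - 1) * ((h (x - y) + c) + t y powr p))"
        by (intro mult_left_mono) auto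
      also have "\<dots> = M powr (p / q - 1) * (\<bar>Q y\<bar> * (h (x - y) + c) + \<bar>Q y\<bar> * t y powr p)" by (simp add: algebra_simps)
      also have "\<dots> \<le> g y"
        unfolding g_def
      proof (intro mult_left_mono add_right_mono)
        have "\<bar>Q y\<bar> * (h (x - y) + c) \<le> (b * indicator S y) * (h (x - y) + c)"
          using Q(2)[of y] h(2)[of "x - y"] c(1) by (intro mult_right_mono) auto
        also have "\<dots> \<le> b * h (x - y) + (b * c) * indicator S y"
          using b h(2)[of "x - y"] by (auto simp: indicator_def algebra_simps)
        finally show "\<bar>Q y\<bar> * (h (x - y) + c) \<le> b * h (x - y) + (b * c) * indicator S y" .
      qed simp
      finally show ?thesis by (simp add: norm_mult nf mult_ac)
    qed
    have "integrable lborel (\<lambda>y. \<Phi> (x - y) * f y)"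
      by (rule Bochner_Integration.integrable_bound[OF g])
        (use le in \<open>auto intro!: AE_I2 simp: order_trans[OF _ abs_ge_self]\<close>)
    then have "norm (\<integral>y. \<Phi> (x - y) * f y \<partial>lborel) \<le> (\<integral>y. g y \<partial>lborel)"
      by (rule Bochner_Integration.integral_norm_bound_integral[OF _ g le])
    also have "\<dots> = M powr (p / q - 1) * (b * ((\<integral>x. h x \<partial>lborel) + c * s) + I)"
    proof -
      have "(\<integral>y. (b * h (x - y) + (b * c) * indicator S y) + \<bar>Q y\<bar> * t y powr p \<partial>lborel)
        = (\<integral>y. b * h (x - y) + (b * c) * indicator S y \<partial>lborel) + I"
        unfolding I_def using hx(1) iS iQt[of p] pq by (intro Bochner_Integration.integral_add Bochner_Integration.integrable_add) auto
      also have "(\<integral>y. b * h (x - y) + (b * c) * indicator S y \<partial>lborel) = b * (\<integral>x. h x \<partial>lborel) + (b * c) * s"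
        using hx iS S by (subst Bochner_Integration.integral_add) (auto simp: s_def)
      finally have "(\<integral>y. (b * h (x - y) + (b * c) * indicator S y) + \<bar>Q y\<bar> * t y powr p \<partial>lborel)
        = b * ((\<integral>x. h x \<partial>lborel) + c * s) + I" by (simp only: distrib_left mult.assoc)
      then show ?thesis unfolding g_def[abs_def] integral_mult_right_zero by (simp only:)
    qed
    finally show ?thesis .
  qed
  show ?thesis
    using eq
  proof eventually_elim
    case (elim x)
    have "norm (u x) \<le> norm (\<integral>y. \<Phi> (x - y) * f y \<partial>lborel) + norm (\<phi> x)"
      by (subst elim) (rule norm_triangle_ineq)
    also have "\<dots> \<le> M powr (p / q - 1) * (b * ((\<integral>x. h x \<partial>lborel) + c * s) + I) + a"
      by (intro add_mono main \<phi>)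
    also have "M powr (p / q - 1) * (b * ((\<integral>x. h x \<partial>lborel) + c * s) + I)
      \<le> M powr (p / q - 1) * (b * ((\<integral>x. h x \<partial>lborel) + c * s) + 2 powr p * a powr p * b * s)"
      using \<open>I \<le> _\<close> by (intro mult_left_mono) auto
    finally show ?case by (simp add: s_def)
  qed
qed

text \<open>Either M \<le> 2a, or the nonlinear term carries at least half of M and division by
  M^\<alpha> leaves M^(1-\<alpha>) \<le> 2L(1 + a^p). The power \<gamma> produces a^(p\<gamma>),
  which 1 + a^d dominates for every d \<ge> p\<gamma>.\<close>

lemma sublinear_absorption:
  fixes a M E L \<alpha> \<gamma> d p :: real
  assumes M: "M \<ge> 0" "M \<le> a + M powr \<alpha> * (L * (1 + a powr p))" and a: "a \<ge> 0" and \<alpha>: "0 \<le> \<alpha>" "\<alpha> < 1" and L: "L \<ge> 0" and p: "p \<ge> 1"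
    and \<gamma>: "\<gamma> = 1 / (1 - \<alpha>)" and d: "d \<ge> p * \<gamma>"
  shows "M \<le> (2 + 2 * (4 * L) powr \<gamma>) * (1 + a powr d)"
proof -
  have \<gamma>1: "\<gamma> \<ge> 1" using \<alpha> by (simp add: \<gamma>)
  have d1: "d \<ge> 1" using d mult_mono[OF p \<gamma>1] p by simp
  have ad: "a powr e \<le> 1 + a powr d" if "0 \<le> e" "e \<le> d" for e
  proof (cases "a \<le> 1")
    case True
    then have "a powr e \<le> 1 powr e" using a that by (intro powr_mono2) auto
    then show ?thesis by (simp add: add_increasing2)
  next
    case False
    then have "a powr e \<le> a powr d" using that by (intro powr_mono) auto
    then show ?thesis by simp
  qed
  have "a \<le> 1 + a powr d" using ad[of 1] d1 a by simp
  show ?thesis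
  proof (cases "M \<le> 2 * a")
    case True
    also have "2 * a \<le> 2 * (1 + a powr d)" using \<open>a \<le> 1 + a powr d\<close> by simp
    also have "\<dots> \<le> (2 + 2 * (4 * L) powr \<gamma>) * (1 + a powr d)" by (intro mult_right_mono) (auto intro: add_nonneg_nonneg)
    finally show ?thesis .
  next
    case False
    then have M0: "M > 0" using a by linarith
    define K where "K = 2 * (L * (1 + a powr p))"
    have K: "M \<le> M powr \<alpha> * K" using M(2) False by (simp add: K_def)
    have "M powr (1 - \<alpha>) * M powr \<alpha> = M" using M0 by (simp flip: powr_add)
    then have "M powr (1 - \<alpha>) * M powr \<alpha> \<le> K * M powr \<alpha>" using K by (simp add: mult.commute)
    then have "M powr (1 - \<alpha>) \<le> K" using M0 by simp
    then have "(M powr (1 - \<alpha>)) powr \<gamma> \<le> K powr \<gamma>" using \<gamma>1 by (intro powr_mono2) auto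
    then have "M \<le> K powr \<gamma>" using M0 \<alpha> by (simp add: powr_powr \<gamma>)
    also have "\<dots> \<le> (4 * L * max 1 (a powr p)) powr \<gamma>"
    proof (rule powr_mono2)
      have "L * (1 + a powr p) \<le> L * (2 * max 1 (a powr p))" using L by (intro mult_left_mono) auto
      then show "K \<le> 4 * L * max 1 (a powr p)" by (simp add: K_def)
    qed (use \<gamma>1 L in \<open>auto simp: K_def intro!: mult_nonneg_nonneg add_nonneg_nonneg\<close>)
    also have "\<dots> = (4 * L) powr \<gamma> * (max 1 (a powr p)) powr \<gamma>" by (rule powr_mult)
    also have "\<dots> \<le> (4 * L) powr \<gamma> * (2 * (1 + a powr d))"
    proof (intro mult_left_mono)
      have "(a powr p) powr \<gamma> \<le> 1 + a powr d" using ad[of "p * \<gamma>"] d p \<gamma>1 by (simp add: powr_powr)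
      then show "(max 1 (a powr p)) powr \<gamma> \<le> 2 * (1 + a powr d)"
      proof -
        have "1 * (1 + a powr d) \<le> 2 * (1 + a powr d)" by (intro mult_right_mono) (auto intro: add_nonneg_nonneg)
        then show ?thesis
          using \<open>(a powr p) powr \<gamma> \<le> _\<close> by (auto simp: max_def intro: order_trans)
      qed
    qed simp
    also have "\<dots> = (2 * (4 * L) powr \<gamma>) * (1 + a powr d)" by simp
    also have "\<dots> \<le> (2 + 2 * (4 * L) powr \<gamma>) * (1 + a powr d)" by (intro mult_right_mono) (auto intro: add_nonneg_nonneg)
    finally show ?thesis .
  qed
qed

section \<open>Bounds for the fundamental solution\<close>

lemma continuous_bounded_at_ends:
  fixes f :: "real \<Rightarrow> real"
  assumes cont: "continuous_on {0<..} f" and lim: "(f \<longlongrightarrow> c) (at_right 0)" and X: "X > 0" "\<And>x. x \<ge> X \<Longrightarrow> \<bar>f x\<bar> \<le> D"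
  obtains C where "C > 0" "\<And>x. x > 0 \<Longrightarrow> \<bar>f x\<bar> \<le> C"
proof -
  have "continuous_on {0..X} (\<lambda>x. if x = 0 then c else f x)"
    by (rule continuous_on_subset[OF continuous_on_extend_0[OF cont lim]]) auto
  then have "compact ((\<lambda>x. if x = 0 then c else f x) ` {0..X})" by (rule compact_continuous_image) simp
  then have "bounded ((\<lambda>x. if x = 0 then c else f x) ` {0..X})" by (rule compact_imp_bounded)
  then obtain E where E: "\<forall>y\<in>(\<lambda>x. if x = 0 then c else f x) ` {0..X}. norm y \<le> E"
    unfolding bounded_iff by (elim exE)
  show thesis
  proof (rule that[of "max 1 (max D E)"])
    fix x :: real assume "x > 0"
    then show "\<bar>f x\<bar> \<le> max 1 (max D E)" using E[rule_format, OF imageI, of x] X(2)[of x] by (cases "x \<le> X") auto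
  qed simp
qed

lemma square_plus_le: "t * t + t \<le> 2 * (t * t + 1)" for t :: real
  using zero_le_square[of "2 * t - 1"] by (simp add: algebra_simps)

text \<open>The quotient by x^(-\<nu>) + 1 is continuous with a limit at 0, and from 2\<nu> + 1 on,
  where the potential is at least 1/2, the energy bounds it.\<close>

lemma cylinder_bound:
  assumes \<nu>: "\<nu> = real n / 2" "n \<ge> 1"
    and cont: "continuous_on {0<..} (C \<nu>)" and lim: "((\<lambda>x. x powr \<nu> * C \<nu> x) \<longlongrightarrow> c) (at_right 0)"
    and energy: "\<And>x. x > 0 \<Longrightarrow> osc_energy C \<nu> x \<le> A"
  obtains D where "D > 0" "\<And>x. x > 0 \<Longrightarrow> \<bar>C \<nu> x\<bar> \<le> D * (x powr - \<nu> + 1)"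
proof -
  let ?f = "\<lambda>x. C \<nu> x / (x powr - \<nu> + 1)"
  have pos: "x powr - \<nu> + 1 \<ge> 1" for x :: real by simp
  have ne: "x powr - \<nu> + 1 \<noteq> 0" for x :: real using pos[of x] by linarith
  have cf: "continuous_on {0<..} ?f"
    by (intro continuous_intros cont) (use ne in auto)
  have lf: "(?f \<longlongrightarrow> c / (1 + 0)) (at_right 0)"
  proof (rule Lim_transform_eventually)
    have "((\<lambda>x. x powr \<nu>) \<longlongrightarrow> 0 powr \<nu>) (at_right (0::real))"
      by (intro tendsto_powr2 tendsto_intros) (use \<nu> in \<open>auto simp: eventually_at_right_field intro!: exI[of _ 1]\<close>)
    then have z: "((\<lambda>x. x powr \<nu>) \<longlongrightarrow> 0) (at_right (0::real))" by simp
    show "((\<lambda>x. (x powr \<nu> * C \<nu> x) / (1 + x powr \<nu>)) \<longlongrightarrow> c / (1 + 0)) (at_right 0)"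
      by (intro tendsto_intros lim z) simp
    show "\<forall>\<^sub>F x in at_right 0. (x powr \<nu> * C \<nu> x) / (1 + x powr \<nu>) = ?f x"
    proof (rule eventually_mono[OF eventually_at_right_less[of 0]])
      fix x :: real assume "0 < x"
      then show "(x powr \<nu> * C \<nu> x) / (1 + x powr \<nu>) = ?f x"
        using powr_gt_zero[of x \<nu>] by (simp add: powr_minus field_simps add_pos_pos)
    qed
  qed
  have x0: "2 * \<nu> + 1 > 0" using \<nu> by simp
  have bf: "\<bar>?f x\<bar> \<le> sqrt (2 * \<bar>A\<bar>)" if x: "x \<ge> 2 * \<nu> + 1" for x
  proof -
    have "\<nu> > 0" using \<nu> by simp
    have x1: "x \<ge> 1" using x \<open>\<nu> > 0\<close> by linarith
    have "(2 * \<nu>)\<^sup>2 \<le> x\<^sup>2" using x \<open>\<nu> > 0\<close> by (intro power_mono) auto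
    moreover have "(2 * \<nu>)\<^sup>2 = 4 * \<nu>\<^sup>2" by (simp add: power_mult_distrib)
    ultimately have "4 * \<nu>\<^sup>2 \<le> 1 + 2 * x\<^sup>2" using zero_le_power2[of x] by linarith
    then have "(\<nu>\<^sup>2 - 1 / 4) / x\<^sup>2 \<le> 1 / 2" using x1 by (simp add: field_simps)
    then have "osc_potential \<nu> x \<ge> 1 / 2" by (simp add: osc_potential_def)
    then have "1 / 2 * (osc C \<nu> x)\<^sup>2 \<le> osc_potential \<nu> x * (osc C \<nu> x)\<^sup>2" by (intro mult_right_mono) auto
    also have "\<dots> \<le> osc_energy C \<nu> x" by (simp add: osc_energy_def)
    also have "\<dots> \<le> \<bar>A\<bar>" using energy[of x] x1 by linarith
    finally have "x * (C \<nu> x)\<^sup>2 \<le> 2 * \<bar>A\<bar>" using x1 by (simp add: osc_def power_mult_distrib)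
    moreover have "1 * (C \<nu> x)\<^sup>2 \<le> x * (C \<nu> x)\<^sup>2" using x1 by (intro mult_right_mono) auto
    ultimately have "\<bar>C \<nu> x\<bar> \<le> sqrt (2 * \<bar>A\<bar>)" by (intro real_le_rsqrt) simp
    moreover have "\<bar>?f x\<bar> \<le> \<bar>C \<nu> x\<bar>"
    proof -
      have p: "x powr - \<nu> + 1 > 0" using pos[of x] by linarith
      then show ?thesis
        using mult_left_mono[OF pos[of x] abs_ge_zero[of "C \<nu> x"]] by (simp add: abs_divide pos_divide_le_eq)
    qed
    ultimately show ?thesis by linarith
  qed
  show thesis
  proof (rule continuous_bounded_at_ends[OF cf lf x0 bf])
    fix D :: real assume D: "D > 0" "\<And>x. x > 0 \<Longrightarrow> \<bar>?f x\<bar> \<le> D"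
    show thesis
    proof (rule that[OF D(1)])
      fix x :: real assume "x > 0"
      have p: "x powr - \<nu> + 1 > 0" using pos[of x] by linarith
      show "\<bar>C \<nu> x\<bar> \<le> D * (x powr - \<nu> + 1)"
        using D(2)[OF \<open>x > 0\<close>] p by (simp add: abs_divide pos_divide_le_eq)
    qed
  qed
qed

lemma hankel1_bound:
  assumes \<nu>: "\<nu> = real n / 2" "n \<ge> 1"
  obtains D where "D > 0" "\<And>x. x > 0 \<Longrightarrow> norm (hankel1 \<nu> x) \<le> D * (x powr - \<nu> + 1)"
proof -
  obtain A B where A: "\<And>x. x > 0 \<Longrightarrow> osc_energy bessel_J \<nu> x \<le> A" and B: "\<And>x. x > 0 \<Longrightarrow> osc_energy bessel_Y \<nu> x \<le> B"
    using osc_energy_bounds[OF \<nu>] by metis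
  obtain c where c: "((\<lambda>x. x powr \<nu> * bessel_Y \<nu> x) \<longlongrightarrow> - c) (at_right 0)" using bessel_Y_at_0[OF \<nu>] .
  have "((\<lambda>x. x powr (2 * \<nu>) * (x powr - \<nu> * bessel_J \<nu> x)) \<longlongrightarrow> 0 powr (2 * \<nu>) * (2 powr - \<nu> * rGamma (\<nu> + 1))) (at_right 0)"
    by (intro tendsto_mult bessel_J_at_0 tendsto_powr2 tendsto_intros)
      (use \<nu> in \<open>auto simp: eventually_at_right_field intro!: exI[of _ 1]\<close>)
  then have J0: "((\<lambda>x. x powr \<nu> * bessel_J \<nu> x) \<longlongrightarrow> 0 powr (2 * \<nu>) * (2 powr - \<nu> * rGamma (\<nu> + 1))) (at_right 0)"
    by (simp add: powr_add[symmetric] flip: mult.assoc)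
  obtain D1 where D1: "D1 > 0" "\<And>x. x > 0 \<Longrightarrow> \<bar>bessel_J \<nu> x\<bar> \<le> D1 * (x powr - \<nu> + 1)"
    using cylinder_bound[OF \<nu> bessel_J_continuous J0 A] by blast
  obtain D2 where D2: "D2 > 0" "\<And>x. x > 0 \<Longrightarrow> \<bar>bessel_Y \<nu> x\<bar> \<le> D2 * (x powr - \<nu> + 1)"
    using cylinder_bound[OF \<nu> bessel_Y_continuous[OF \<nu>(1)] c B] by blast
  show thesis
  proof (rule that[of "D1 + D2"])
    fix x :: real assume "x > 0"
    then show "norm (hankel1 \<nu> x) \<le> (D1 + D2) * (x powr - \<nu> + 1)"
      using cmod_le[of "hankel1 \<nu> x"] D1(2)[of x] D2(2)[of x] by (simp add: hankel1_def distrib_right)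
  qed (use D1 D2 in simp)
qed

section \<open>Size and integrability of the fundamental solution\<close>

text \<open>Layer cake again: on the unit ball, off the origin, |x|^(-s) is 1 plus the integral of s
  r^(-s-1) from |x| to 1. The volumes of the balls leave the integral of r^(N-s-1) over [0, 1],
  finite for s < N.\<close>

lemma integrable_norm_powr_ball:
  fixes s :: real
  assumes s: "0 < s" "s < DIM('a::euclidean_space)"
  shows "integrable lborel (\<lambda>x::'a. indicator (cball 0 1) x * norm x powr - s)"
proof -
  let ?w = "\<lambda>r. ennreal (s * r powr (- s - 1)) * indicator {0<..1} r"
  let ?V = "unit_ball_vol (real DIM('a))"
  have inner: "ennreal (indicator (cball 0 1) x * norm x powr - s)
     \<le> indicator (cball 0 1) x + (\<integral>\<^sup>+r. ?w r * indicator {norm x..} r \<partial>lborel)" for x :: 'a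
  proof (cases "x \<noteq> 0 \<and> norm x \<le> 1")
    case True
    then have pos: "r > 0" if "norm x \<le> r" for r
      using that by (meson norm_le_zero_iff not_le order_trans)
    have "(\<integral>\<^sup>+r. ?w r * indicator {norm x..} r \<partial>lborel) = (\<integral>\<^sup>+r. ennreal (s * r powr (- s - 1)) * indicator {norm x..1} r \<partial>lborel)"
      using pos by (intro nn_integral_cong) (auto simp: indicator_def)
    also have "\<dots> = ennreal (- (1 powr - s) - - (norm x powr - s))"
    proof (rule nn_integral_FTC_Icc)
      fix r assume "r \<in> {norm x..1}"
      then show "((\<lambda>r. - (r powr - s)) has_real_derivative s * r powr (- s - 1)) (at r)"
        using pos[of r] by (auto intro!: derivative_eq_intros)
    qed (use True s in auto)
    finally have "(\<integral>\<^sup>+r. ?w r * indicator {norm x..} r \<partial>lborel) = ennreal (norm x powr - s - 1)" by simp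
    moreover have "norm x powr - s \<ge> 1" using True s powr_mono2'[of "- s" "norm x" 1] by simp
    ultimately show ?thesis using True ennreal_plus[of 1 "norm x powr - s - 1"] by simp
  qed auto
  have vol: "(\<integral>\<^sup>+x. 1 * indicator (cball 0 r) x \<partial>(lborel :: 'a measure)) = ennreal (?V * r ^ DIM('a))" if "r \<ge> 0" for r
    using that emeasure_cball[of r "0 :: 'a"] by simp
  have "(\<integral>\<^sup>+x. 1 * (\<integral>\<^sup>+r. ?w r * indicator {norm x..} r \<partial>lborel) \<partial>(lborel :: 'a measure))
     = (\<integral>\<^sup>+r. ?w r * (\<integral>\<^sup>+x. 1 * indicator (cball 0 r) x \<partial>(lborel :: 'a measure)) \<partial>lborel)"
    by (rule layer_cake_nn) measurable
  also have "\<dots> = (\<integral>\<^sup>+r. ennreal (?V * s) * ennreal (indicator {0..1} r * r powr (real DIM('a) - s - 1)) \<partial>lborel)"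
  proof (intro nn_integral_cong)
    fix r :: real
    show "?w r * (\<integral>\<^sup>+x. 1 * indicator (cball 0 r) x \<partial>(lborel :: 'a measure))
       = ennreal (?V * s) * ennreal (indicator {0..1} r * r powr (real DIM('a) - s - 1))"
    proof (cases "0 < r \<and> r \<le> 1")
      case True
      have "r powr (real DIM('a) - s - 1) = r powr (real DIM('a) + (- s - 1))" by (simp add: algebra_simps)
      also have "\<dots> = r ^ DIM('a) * r powr (- s - 1)" using True by (simp only: powr_add powr_realpow)
      finally have e: "r powr (real DIM('a) - s - 1) = r ^ DIM('a) * r powr (- s - 1)" .
      have "s * r powr (- s - 1) * (?V * r ^ DIM('a)) = (?V * s) * (r ^ DIM('a) * r powr (- s - 1))" by (simp only: mult_ac)
      then show ?thesis using True s vol[of r] unfolding e by (simp add: ennreal_mult[symmetric])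
    next
      case False
      then show ?thesis by (cases "r = 0") (auto simp: indicator_def)
    qed
  qed
  also have "\<dots> = ennreal (?V * s) * (\<integral>\<^sup>+r. ennreal (indicator {0..1} r * r powr (real DIM('a) - s - 1)) \<partial>lborel)"
    by (rule nn_integral_cmult) measurable
  also have "(\<integral>\<^sup>+r. ennreal (indicator {0..1} r * r powr (real DIM('a) - s - 1)) \<partial>lborel) = ennreal (1 powr (real DIM('a) - s - 1 + 1) / (real DIM('a) - s - 1 + 1))"
  proof (rule nn_integral_has_integral_lborel)
    have "((\<lambda>r. r powr (real DIM('a) - s - 1)) has_integral 1 powr (real DIM('a) - s - 1 + 1) / (real DIM('a) - s - 1 + 1)) {0..1}"
      by (rule has_integral_powr_from_0) (use s in auto)
    moreover
    have ind: "indicator {0..1} r * r powr (real DIM('a) - s - 1) = (if r \<in> {0..1} then r powr (real DIM('a) - s - 1) else 0)" for r :: real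
      by simp
    ultimately show "((\<lambda>r. indicator {0..1} r * r powr (real DIM('a) - s - 1)) has_integral 1 powr (real DIM('a) - s - 1 + 1) / (real DIM('a) - s - 1 + 1)) UNIV"
      unfolding ind has_integral_restrict_UNIV by blast
  qed auto
  finally have fin: "(\<integral>\<^sup>+x. (\<integral>\<^sup>+r. ?w r * indicator {norm x..} r \<partial>lborel) \<partial>(lborel :: 'a measure)) < \<infinity>"
    by (simp add: ennreal_mult_less_top)
  have ms: "(\<lambda>x::'a. \<integral>\<^sup>+r. ?w r * indicator {norm x..} r \<partial>lborel) \<in> borel_measurable lborel"
  proof -
    have "indicator {norm x..} r = (indicator {0..} (r - norm x) :: ennreal)" for x :: 'a and r :: real by (auto simp: indicator_def)
    then show ?thesis by simp
  qed
  show ?thesis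
  proof (rule integrableI_nonneg)
    have "(\<integral>\<^sup>+x. ennreal (indicator (cball 0 1) x * norm x powr - s) \<partial>(lborel :: 'a measure))
       \<le> (\<integral>\<^sup>+x. indicator (cball 0 1) x + (\<integral>\<^sup>+r. ?w r * indicator {norm x..} r \<partial>lborel) \<partial>(lborel :: 'a measure))"
      by (intro nn_integral_mono inner)
    also have "\<dots> = emeasure lborel (cball 0 1 :: 'a set) + (\<integral>\<^sup>+x. (\<integral>\<^sup>+r. ?w r * indicator {norm x..} r \<partial>lborel) \<partial>(lborel :: 'a measure))"
    proof (subst nn_integral_add[OF _ ms])
      show "(indicator (cball 0 1) :: 'a \<Rightarrow> ennreal) \<in> borel_measurable lborel"
        by (rule borel_measurable_indicator) simp
    qed simp
    also have "\<dots> < \<infinity>" using fin emeasure_lborel_cball_finite[of "0 :: 'a" 1] by simp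
    finally show "(\<integral>\<^sup>+x. ennreal (indicator (cball 0 1) x * norm x powr - s) \<partial>(lborel :: 'a measure)) < \<infinity>" .
    show "(\<lambda>x::'a. indicator (cball 0 1) x * norm x powr - s) \<in> borel_measurable lborel"
      by (intro borel_measurable_times borel_measurable_indicator) (simp, measurable)
  qed simp
qed

lemma helmholtz_Phi_even: "helmholtz_Phi k (- x) = helmholtz_Phi k x"
  by (simp add: helmholtz_Phi_def)

text \<open>Division by zero yields 0 and \<open>0 powr\<close> is 0, so this dummy value agrees
  with that of \<open>profile\<close> at 0.\<close>

lemma helmholtz_Phi_0: "helmholtz_Phi k (0 :: real ^ 'n) = 0"
  by (simp add: helmholtz_Phi_def)

context helmholtz_kernel
begin

context
  assumes dim: "CARD('n::finite) = n + 2"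
begin

lemma helmholtz_Phi_eq:
  "helmholtz_Phi k (x :: real ^ 'n) = \<i> / 4 * of_real ((k / (2 * pi * norm x)) powr \<nu>) * hankel1 \<nu> (k * norm x)"
  by (simp add: helmholtz_Phi_def Let_def dim \<nu>_def)

lemma helmholtz_Phi_measurable: "(helmholtz_Phi k :: real ^ 'n \<Rightarrow> complex) \<in> borel_measurable borel"
proof -
  have [measurable]: "(\<lambda>r. indicator {0<..} r *\<^sub>R bessel_J \<nu> r) \<in> borel_measurable borel"
    "(\<lambda>r. indicator {0<..} r *\<^sub>R bessel_Y \<nu> r) \<in> borel_measurable borel"
    by (rule borel_measurable_continuous_on_indicator[OF _ bessel_J_continuous]
        borel_measurable_continuous_on_indicator[OF _ bessel_Y_continuous[OF \<nu>_def]]; simp)+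
  have eq: "helmholtz_Phi k x = \<i> / 4 * of_real ((k / (2 * pi * norm x)) powr \<nu>) *
      (of_real (indicator {0<..} (k * norm x) *\<^sub>R bessel_J \<nu> (k * norm x)) + \<i> * of_real (indicator {0<..} (k * norm x) *\<^sub>R bessel_Y \<nu> (k * norm x)))" for x :: "real ^ 'n"
    using k unfolding helmholtz_Phi_eq by (cases "x = 0") (simp_all add: hankel1_def Complex_eq)
  show ?thesis unfolding eq[abs_def] by measurable
qed

text \<open>On the sphere |x| = R both sides vanish, so the closed ball is covered, as a non-strict
  bound on the diameter requires.\<close>

lemma Re_helmholtz_Phi:
  assumes "norm x \<le> R"
  shows "Re (helmholtz_Phi k (x :: real ^ 'n)) = (k / (2 * pi)) powr \<nu> / 4 * profile (norm x)"
proof (cases "x = 0")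
  case False
  have "(k / (2 * pi * norm x)) powr \<nu> = (k / (2 * pi)) powr \<nu> * norm x powr - \<nu>"
    using False k by (simp add: powr_divide powr_mult powr_minus field_simps)
  moreover have "k * R = z" "bessel_Y \<nu> z = 0" by (rule kR, rule Y_z)
  ultimately show ?thesis
    using assms False by (cases "norm x = R") (simp_all add: helmholtz_Phi_eq hankel1_def profile_def)
qed (simp add: helmholtz_Phi_0 profile_def)

text \<open>Two factors |x|^(-\<nu>), one from the prefactor and one from the Hankel function, give
  the singularity |x|^(-n) with n = N - 2.\<close>

lemma helmholtz_Phi_bound:
  obtains D where "D > 0" "\<And>x :: real ^ 'n. norm (helmholtz_Phi k x) \<le> D * (norm x powr - real n + 1)"
proof -
  obtain D where D: "D > 0" "\<And>x. x > 0 \<Longrightarrow> norm (hankel1 \<nu> x) \<le> D * (x powr - \<nu> + 1)"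
    using hankel1_bound[OF \<nu>_def n] by blast
  define E where "E = (k / (2 * pi)) powr \<nu> / 4 * D"
  have E: "E > 0" using k D by (simp add: E_def)
  define M where "M = max 1 (k powr - \<nu>)"
  show thesis
  proof (rule that[of "2 * E * M"])
    fix x :: "real ^ 'n"
    show "norm (helmholtz_Phi k x) \<le> 2 * E * M * (norm x powr - real n + 1)"
    proof (cases "x = 0")
      case True
      then show ?thesis using E by (simp add: helmholtz_Phi_0 M_def)
    next
      case False
      define t where "t = norm x powr - \<nu>"
      have t: "t > 0" using False by (simp add: t_def)
      have tt: "norm x powr - real n = t * t"
        using False by (simp add: t_def \<nu>_def powr_add[symmetric])
      have f: "(k / (2 * pi * norm x)) powr \<nu> = (k / (2 * pi)) powr \<nu> * t"
        using False k by (simp add: powr_divide powr_mult powr_minus field_simps t_def)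
      have "norm (helmholtz_Phi k x) = (k / (2 * pi)) powr \<nu> / 4 * t * norm (hankel1 \<nu> (k * norm x))"
        unfolding helmholtz_Phi_eq f using t by (simp add: norm_mult)
      also have "\<dots> \<le> (k / (2 * pi)) powr \<nu> / 4 * t * (D * ((k * norm x) powr - \<nu> + 1))"
        using D(2)[of "k * norm x"] k False t by (intro mult_left_mono) auto
      also have "\<dots> = E * t * (k powr - \<nu> * t + 1)" using k by (simp add: E_def t_def powr_mult)
      also have "\<dots> \<le> E * t * (M * t + M)"
        using E t by (intro mult_left_mono add_mono mult_right_mono) (auto simp: M_def)
      also have "\<dots> = E * M * (t * t + t)" by (simp add: algebra_simps)
      also have "\<dots> \<le> E * M * (2 * (t * t + 1))"
      proof (intro mult_left_mono)
        show "t * t + t \<le> 2 * (t * t + 1)" by (rule square_plus_le)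
      qed (use E in \<open>simp add: M_def\<close>)
      finally show ?thesis by (simp add: tt algebra_simps)
    qed
  qed (use E in \<open>simp add: M_def\<close>)
qed

text \<open>On the unit ball the singularity |x|^(-qn) is integrable because qn < N; outside it the
  constant suffices.\<close>

lemma helmholtz_Phi_powr_bound:
  assumes q: "q > 0" "q * real n < real n + 2"
  obtains h :: "real ^ 'n \<Rightarrow> real" and c where "integrable lborel h" "\<And>x. h x \<ge> 0" "c \<ge> 0"
    "\<And>x. norm (helmholtz_Phi k x) powr q \<le> h x + c"
proof -
  obtain D where D: "D > 0" "\<And>x :: real ^ 'n. norm (helmholtz_Phi k x) \<le> D * (norm x powr - real n + 1)"
    using helmholtz_Phi_bound by blast
  define h where "h x = (2 * D) powr q * (indicator (cball 0 1) x * norm x powr - (q * real n))" for x :: "real ^ 'n"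
  show thesis
  proof (rule that[of h "(2 * D) powr q"])
    have "integrable lborel (\<lambda>x :: real ^ 'n. indicator (cball 0 1) x * norm x powr - (q * real n))"
      by (rule integrable_norm_powr_ball) (use q n dim in auto)
    then show "integrable lborel h" by (simp add: h_def[abs_def])
    show "h x \<ge> 0" for x by (simp add: h_def)
    fix x :: "real ^ 'n"
    show "norm (helmholtz_Phi k x) powr q \<le> h x + (2 * D) powr q"
    proof (cases "x = 0")
      case False
      define a where "a = norm x powr - real n"
      have a: "a > 0" using False by (simp add: a_def)
      show ?thesis
      proof (cases "norm x \<le> 1")
        case True
        then have "a \<ge> 1" using False powr_mono2'[of "- real n" "norm x" 1] by (simp add: a_def)
        then have "D * (a + 1) \<le> 2 * D * a" using D(1) by (simp add: algebra_simps)
        then have "norm (helmholtz_Phi k x) \<le> 2 * D * a" using D(2)[of x] by (simp add: a_def)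
        then have "norm (helmholtz_Phi k x) powr q \<le> (2 * D * a) powr q" using q by (intro powr_mono2) auto
        also have "\<dots> = h x"
          using True by (simp add: powr_mult h_def a_def powr_powr mult.commute)
        finally show ?thesis by (simp add: add_increasing2)
      next
        case f: False
        then have "a \<le> 1" using powr_mono2'[of "- real n" 1 "norm x"] by (simp add: a_def)
        then have "D * (a + 1) \<le> 2 * D" using D(1) by (simp add: algebra_simps)
        then have "norm (helmholtz_Phi k x) \<le> 2 * D" using D(2)[of x] by (simp add: a_def)
        then have "norm (helmholtz_Phi k x) powr q \<le> (2 * D) powr q" using q by (intro powr_mono2) auto
        then show ?thesis using f by (simp add: h_def)
      qed
    qed (use q in \<open>simp add: helmholtz_Phi_0 h_def\<close>)
  qed simp
qed

text \<open>The sign of the transform is known off the origin and the sphere |\<xi>| = k, which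
  together form a null set.\<close>

lemma Re_helmholtz_Phi_fourier:
  "integrable lborel (\<lambda>x :: real ^ 'n. (k / (2 * pi)) powr \<nu> / 4 * profile (norm x))"
  "AE \<xi> :: real ^ 'n in lborel. 0 \<le> fourier_cos (\<lambda>x. (k / (2 * pi)) powr \<nu> / 4 * profile (norm x)) \<xi>"
proof -
  have d: "DIM(real ^ 'n) = n + 2" using dim by simp
  show "integrable lborel (\<lambda>x :: real ^ 'n. (k / (2 * pi)) powr \<nu> / 4 * profile (norm x))"
    by (rule integrable_mult_right) (rule kernel_integrable(1)[OF d])
  have "sphere (0 :: real ^ 'n) k \<in> null_sets lebesgue"
    using negligible_sphere by (simp only: negligible_iff_null_sets)
  then have "AE \<xi> :: real ^ 'n in lebesgue. \<xi> \<notin> sphere 0 k" by (rule AE_not_in)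
  then have "AE \<xi> :: real ^ 'n in lborel. \<xi> \<notin> sphere 0 k" by (simp add: AE_completion_iff)
  then show "AE \<xi> :: real ^ 'n in lborel. 0 \<le> fourier_cos (\<lambda>x. (k / (2 * pi)) powr \<nu> / 4 * profile (norm x)) \<xi>"
    using AE_lborel_singleton[of "0 :: real ^ 'n"]
  proof eventually_elim
    case (elim \<xi>)
    then have "0 \<le> (\<integral>x. profile (norm x) * cos (x \<bullet> \<xi>) \<partial>(lborel :: (real ^ 'n) measure))"
      by (intro kernel_fourier_nonneg[OF d]) auto
    then show ?case by (simp add: fourier_cos_def mult.assoc)
  qed
qed

end

end

section \<open>Essential suprema and the main estimate\<close>

text \<open>The essential supremum is finite by membership, and a negative one would make a false
  statement hold almost everywhere. Hence \<open>real_of_ereal\<close> in \<open>Linf_norm\<close>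
  loses nothing.\<close>

lemma Linf_esssup:
  fixes f :: "'a::euclidean_space \<Rightarrow> 'b::real_normed_vector"
  assumes "f \<in> Linf"
  shows "esssup lebesgue (\<lambda>x. ereal (norm (f x))) = ereal (Linf_norm f)" "0 \<le> Linf_norm f"
    and "AE x in lborel. norm (f x) \<le> Linf_norm f"
proof -
  let ?e = "esssup lebesgue (\<lambda>x. ereal (norm (f x)))"
  have ae: "AE x in lborel. ereal (norm (f x)) \<le> ?e"
    using esssup_AE[of "\<lambda>x. ereal (norm (f x))" lebesgue] by (simp only: AE_completion_iff)
  have "0 \<le> ?e"
  proof (rule ccontr)
    assume "\<not> 0 \<le> ?e"
    have "AE x :: 'a in lborel. False"
      using ae
    proof eventually_elim
      case (elim x)
      have "0 \<le> ereal (norm (f x))" by simp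
      then show ?case using elim \<open>\<not> 0 \<le> ?e\<close> order_trans by blast
    qed
    then show False using ae_filter_eq_bot_iff[of "lborel :: 'a measure"] by (auto simp: trivial_limit_def)
  qed
  moreover have "?e < \<infinity>" using assms by (simp add: Linf_def)
  ultimately obtain e where e: "?e = ereal e" "e \<ge> 0" by (cases ?e) auto
  then show "?e = ereal (Linf_norm f)" "0 \<le> Linf_norm f" by (simp_all add: Linf_norm_def)
  then show "AE x in lborel. norm (f x) \<le> Linf_norm f" using ae by simp
qed

lemma Linf_norm_le:
  fixes f :: "'a::euclidean_space \<Rightarrow> 'b::real_normed_vector"
  assumes f: "f \<in> Linf" and "AE x in lborel. norm (f x) \<le> c"
  shows "Linf_norm f \<le> c"
proof -
  have [measurable]: "f \<in> borel_measurable lebesgue" using f by (simp add: Linf_def)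
  have "esssup lebesgue (\<lambda>x. ereal (norm (f x))) \<le> ereal c"
    by (rule esssup_I) (use assms(2) in \<open>simp_all add: AE_completion_iff\<close>)
  then show ?thesis by (simp add: Linf_esssup(1)[OF f])
qed

text \<open>Convolutions are handled with Borel functions that are bounded everywhere; values
  exceeding the norm occur on a null set and are reset to 0.\<close>

lemma Linf_real_representative:
  fixes f :: "'a::euclidean_space \<Rightarrow> real"
  assumes f: "f \<in> Linf"
  obtains g where "g \<in> borel_measurable borel" "\<And>x. norm (g x) \<le> Linf_norm f" "AE x in lborel. f x = g x"
proof -
  have "f \<in> borel_measurable (completion lborel)" using f by (simp add: Linf_def)
  then obtain g where [measurable]: "g \<in> borel_measurable borel" and g: "AE x in lborel. f x = g x"
    using completion_ex_borel_measurable_real[of f lborel] by auto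
  show thesis
  proof (rule that[of "\<lambda>x. if norm (g x) \<le> Linf_norm f then g x else 0"])
    show "AE x in lborel. f x = (if norm (g x) \<le> Linf_norm f then g x else 0)"
      using g Linf_esssup(3)[OF f] by eventually_elim simp
  qed (use Linf_esssup(2)[OF f] in auto)
qed

lemma Linf_complex_representative:
  fixes f :: "'a::euclidean_space \<Rightarrow> complex"
  assumes f: "f \<in> Linf"
  obtains g where "g \<in> borel_measurable borel" "\<And>x. norm (g x) \<le> Linf_norm f" "AE x in lborel. f x = g x"
proof -
  have [measurable]: "f \<in> borel_measurable (completion lborel)" using f by (simp add: Linf_def)
  have re: "(\<lambda>x. Re (f x)) \<in> borel_measurable (completion lborel)" and im: "(\<lambda>x. Im (f x)) \<in> borel_measurable (completion lborel)"
    by measurable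
  obtain a where [measurable]: "a \<in> borel_measurable lborel" and a: "AE x in lborel. Re (f x) = a x"
    using completion_ex_borel_measurable_real[OF re] by blast
  obtain b where [measurable]: "b \<in> borel_measurable lborel" and b: "AE x in lborel. Im (f x) = b x"
    using completion_ex_borel_measurable_real[OF im] by blast
  define g where "g x = of_real (a x) + \<i> * of_real (b x)" for x
  have "g \<in> borel_measurable lborel" unfolding g_def[abs_def] by measurable
  then have [measurable]: "g \<in> borel_measurable borel" by simp
  have g: "AE x in lborel. f x = g x"
    using a b by eventually_elim (simp add: g_def complex_eq_iff)
  show thesis
  proof (rule that[of "\<lambda>x. if norm (g x) \<le> Linf_norm f then g x else 0"])
    show "AE x in lborel. f x = (if norm (g x) \<le> Linf_norm f then g x else 0)"
      using g Linf_esssup(3)[OF f] by eventually_elim simp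
  qed (use Linf_esssup(2)[OF f] in auto)
qed

text \<open>The union in the definition may be uncountable; by Lindelof's theorem countably many of
  its members already cover it.\<close>

lemma AE_zero_off_ess_support: "AE x in lborel. x \<notin> ess_support Q \<longrightarrow> Q x = 0"
proof -
  define \<F> where "\<F> = {U. open U \<and> (AE x in lebesgue. x \<in> U \<longrightarrow> Q x = 0)}"
  obtain \<G> where G: "\<G> \<subseteq> \<F>" "countable \<G>" "\<Union>\<G> = \<Union>\<F>"
    using Lindelof[of \<F>] by (auto simp: \<F>_def)
  have "AE x in lebesgue. \<forall>U\<in>\<G>. x \<in> U \<longrightarrow> Q x = 0"
    using G(1,2) by (intro AE_ball_countable') (auto simp: \<F>_def)
  then have "AE x in lborel. \<forall>U\<in>\<G>. x \<in> U \<longrightarrow> Q x = 0" by (simp only: AE_completion_iff)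
  then show ?thesis
  proof eventually_elim
    case (elim x)
    have "x \<notin> ess_support Q \<Longrightarrow> x \<in> \<Union>\<G>" unfolding G(3) by (auto simp: ess_support_def \<F>_def)
    then show ?case using elim by blast
  qed
qed

section \<open>Application to the Helmholtz equation\<close>

text \<open>Differences of points of S have norm at most R, so \<Phi>_k may be replaced by the cut
  kernel A + iB. Cutting the imaginary part too makes B integrable, as
  \<open>complex_pairing_nonneg\<close> demands.\<close>

lemma (in helmholtz_kernel) helmholtz_pairing_nonneg:
  fixes f :: "real ^ 'n \<Rightarrow> complex"
  assumes dim: "CARD('n::finite) = n + 2"
    and [measurable]: "f \<in> borel_measurable borel" and bound: "\<And>x. norm (f x) \<le> M"
    and supp: "\<And>x. x \<notin> S \<Longrightarrow> f x = 0" and S: "bounded S" "diameter S \<le> R"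
  shows "0 \<le> (\<integral>x. Re (cnj (f x) * (\<integral>y. helmholtz_Phi k (x - y) * f y \<partial>lborel)) \<partial>lborel)"
proof -
  define A where "A x = (k / (2 * pi)) powr \<nu> / 4 * profile (norm x)" for x :: "real ^ 'n"
  define B where "B x = indicator (cball 0 R) x * Im (helmholtz_Phi k x)" for x :: "real ^ 'n"
  have [measurable]: "(helmholtz_Phi k :: real ^ 'n \<Rightarrow> complex) \<in> borel_measurable borel"
    by (rule helmholtz_Phi_measurable[OF dim])
  have [measurable]: "cball (0 :: real ^ 'n) R \<in> sets borel" by simp
  have "(1::real) * real n < real n + 2" by simp
  with helmholtz_Phi_powr_bound[OF dim, of 1] obtain h :: "real ^ 'n \<Rightarrow> real" and c where
    h: "integrable lborel h" "\<And>x. h x \<ge> 0" "c \<ge> 0" "\<And>x. norm (helmholtz_Phi k x) powr 1 \<le> h x + c" by auto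
  have B: "integrable lborel B"
  proof (rule Bochner_Integration.integrable_bound)
    show "integrable lborel (\<lambda>x. h x + c * indicator (cball 0 R) x)"
      by (intro Bochner_Integration.integrable_add h integrable_mult_right integrable_indicator_cball)
    have "\<bar>B x\<bar> \<le> h x + c * indicator (cball 0 R) x" for x
      using h(2,4)[of x] abs_Im_le_cmod[of "helmholtz_Phi k x"] by (auto simp: B_def indicator_def)
    then show "AE x in lborel. norm (B x) \<le> norm (h x + c * indicator (cball 0 R) x)"
      by (intro AE_I2) (auto intro: order_trans[OF _ abs_ge_self])
    show "B \<in> borel_measurable lborel" unfolding B_def[abs_def] by measurable
  qed
  obtain r where r: "\<And>x. x \<in> S \<Longrightarrow> norm x \<le> r" using S(1) by (auto simp: bounded_iff)
  have nonneg: "0 \<le> (\<integral>x. Re (cnj (f x) * (\<integral>y. Complex (A (x - y)) (B (x - y)) * f y \<partial>lborel)) \<partial>lborel)"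
  proof (rule complex_pairing_nonneg[OF _ _ B])
    show "integrable lborel A" "AE \<xi> in lborel. 0 \<le> fourier_cos A \<xi>"
      unfolding A_def[abs_def] by (rule Re_helmholtz_Phi_fourier[OF dim])+
    show "B (- x) = B x" for x by (simp add: B_def helmholtz_Phi_even indicator_def)
    show "norm (f x) \<le> M" for x by (rule bound)
    show "f x = 0" if "norm x > r" for x using that r[of x] supp[of x] by force
  qed simp
  have inner: "(\<integral>y. Complex (A (x - y)) (B (x - y)) * f y \<partial>lborel) = (\<integral>y. helmholtz_Phi k (x - y) * f y \<partial>lborel)" if "x \<in> S" for x
  proof (intro Bochner_Integration.integral_cong refl)
    fix y
    show "Complex (A (x - y)) (B (x - y)) * f y = helmholtz_Phi k (x - y) * f y"
    proof (cases "y \<in> S")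
      case True
      then have "norm (x - y) \<le> R" using diameter_bounded_bound[OF S(1) that True] S(2) by (simp add: dist_norm)
      then show ?thesis
        using Re_helmholtz_Phi[OF dim, of "x - y"] by (simp add: A_def B_def complex_eq_iff)
    qed (simp add: supp)
  qed
  have "Re (cnj (f x) * (\<integral>y. Complex (A (x - y)) (B (x - y)) * f y \<partial>lborel))
    = Re (cnj (f x) * (\<integral>y. helmholtz_Phi k (x - y) * f y \<partial>lborel))" for x
    by (cases "x \<in> S") (simp_all add: inner supp)
  then show ?thesis using nonneg by (simp only:)
qed

text \<open>The abstract estimate works with Borel functions and pointwise bounds; changing Q,
  \<phi> and u on null sets affects neither the convolution nor the norms.\<close>

lemma (in helmholtz_kernel) helmholtz_sup_norm_estimate:
  fixes Q :: "real ^ 'n \<Rightarrow> real" and \<phi> u :: "real ^ 'n \<Rightarrow> complex"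
  assumes dim: "CARD('n::finite) = n + 2" and pq: "p > 2" "q > 1" "q < p"
    and h: "integrable lborel h" "\<And>x. h x \<ge> 0" "c \<ge> 0" "\<And>x :: real ^ 'n. norm (helmholtz_Phi k x) powr q \<le> h x + c"
    and Q: "Q \<in> Linf" "AE x in lebesgue. Q x \<le> 0" and S: "compact (ess_support Q)" "diameter (ess_support Q) \<le> R"
    and \<phi>: "\<phi> \<in> Linf" and u: "u \<in> Linf"
    and eq: "AE x in lebesgue. u x = helmholtz_R k (\<lambda>y. of_real (Q y * norm (u y) powr (p - 2)) * u y) x + \<phi> x"
  defines "s \<equiv> measure lebesgue (ess_support Q)"
  shows "Linf_norm u \<le> Linf_norm \<phi> + Linf_norm u powr (p / q - 1) *
    (Linf_norm Q * ((\<integral>x. h x \<partial>lborel) + c * s) + 2 powr p * Linf_norm \<phi> powr p * Linf_norm Q * s)"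
proof -
  define S where "S = ess_support Q"
  have cS: "compact S" and dS: "diameter S \<le> R" using S by (simp_all add: S_def)
  have [measurable]: "S \<in> sets borel" using cS by (simp add: borel_compact)
  have fS: "emeasure lborel S < \<infinity>" using emeasure_compact_finite[OF cS] by simp
  obtain Q0 where [measurable]: "Q0 \<in> borel_measurable borel" and Q0: "\<And>x. norm (Q0 x) \<le> Linf_norm Q" "AE x in lborel. Q x = Q0 x"
    using Linf_real_representative[OF Q(1)] by blast
  obtain \<phi>0 where [measurable]: "\<phi>0 \<in> borel_measurable borel" and \<phi>0: "\<And>x. norm (\<phi>0 x) \<le> Linf_norm \<phi>" "AE x in lborel. \<phi> x = \<phi>0 x"
    using Linf_complex_representative[OF \<phi>] by blast
  obtain u0 where [measurable]: "u0 \<in> borel_measurable borel" and u0: "\<And>x. norm (u0 x) \<le> Linf_norm u" "AE x in lborel. u x = u0 x"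
    using Linf_complex_representative[OF u] by blast
  \<comment> \<open>The indicator and the minimum with 0 make the support and the sign condition
    hold everywhere.\<close>
  define Q1 where "Q1 x = indicator S x * min 0 (Q0 x)" for x
  have [measurable]: "Q1 \<in> borel_measurable borel" unfolding Q1_def[abs_def] by measurable
  have Q1: "Q1 x \<le> 0" "\<bar>Q1 x\<bar> \<le> Linf_norm Q * indicator S x" for x
    using Q0(1)[of x] by (auto simp: Q1_def indicator_def min_def)
  have "AE x in lborel. Q x \<le> 0" using Q(2) by (simp only: AE_completion_iff)
  with Q0(2) AE_zero_off_ess_support[of Q] have Q1e: "AE x in lborel. Q x = Q1 x"
    by eventually_elim (auto simp: Q1_def indicator_def S_def)
  define f where "f x = of_real (Q x * norm (u x) powr (p - 2)) * u x" for x
  define f1 where "f1 x = of_real (Q1 x * norm (u0 x) powr (p - 2)) * u0 x" for x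
  have [measurable]: "f1 \<in> borel_measurable borel" unfolding f1_def[abs_def] by measurable
  have fe: "AE x in lborel. f x = f1 x"
    using Q1e u0(2) by eventually_elim (simp add: f_def f1_def)
  have f1b: "norm (f1 x) \<le> Linf_norm Q * Linf_norm u powr (p - 2) * Linf_norm u" for x
  proof -
    have "\<bar>Q1 x\<bar> \<le> Linf_norm Q" using Q1(2)[of x] Linf_esssup(2)[OF Q(1)] by (cases "x \<in> S") auto
    then have "\<bar>Q1 x\<bar> * norm (u0 x) powr (p - 2) * norm (u0 x) \<le> Linf_norm Q * Linf_norm u powr (p - 2) * Linf_norm u"
      using u0(1)[of x] pq Linf_esssup(2)[OF Q(1)] by (intro mult_mono powr_mono2) auto
    then show ?thesis by (simp add: f1_def norm_mult abs_mult)
  qed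
  have f10: "f1 x = 0" if "x \<notin> S" for x using that by (simp add: f1_def Q1_def)
  note [measurable] = helmholtz_Phi_measurable[OF dim]
  have R_eq: "helmholtz_R k f x = (\<integral>y. helmholtz_Phi k (x - y) * f1 y \<partial>lborel)" for x
  proof -
    have [measurable]: "Q \<in> borel_measurable lebesgue" "u \<in> borel_measurable lebesgue"
      using Q(1) u by (simp_all add: Linf_def)
    have Px: "(\<lambda>y. helmholtz_Phi k (x - y)) \<in> borel_measurable lebesgue"
      by (intro measurable_completion) measurable
    have f: "f \<in> borel_measurable lebesgue" unfolding f_def[abs_def] by measurable
    have f1: "f1 \<in> borel_measurable lebesgue" by (intro measurable_completion) measurable
    have "helmholtz_R k f x = (\<integral>y. helmholtz_Phi k (x - y) * f1 y \<partial>lebesgue)"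
      unfolding helmholtz_R_def
    proof (rule integral_cong_AE)
      show "AE y in lebesgue. helmholtz_Phi k (x - y) * f y = helmholtz_Phi k (x - y) * f1 y"
        unfolding AE_completion_iff using fe by eventually_elim simp
    qed (intro borel_measurable_times Px f f1)+
    also have "\<dots> = (\<integral>y. helmholtz_Phi k (x - y) * f1 y \<partial>lborel)"
      by (rule integral_completion) measurable
    finally show ?thesis .
  qed
  have eq1: "AE x in lborel. u0 x = (\<integral>y. helmholtz_Phi k (x - y) * f1 y \<partial>lborel) + \<phi>0 x"
  proof -
    have "AE x in lborel. u x = helmholtz_R k f x + \<phi> x"
      using eq unfolding AE_completion_iff f_def[abs_def] .
    then show ?thesis using u0(2) \<phi>0(2) by eventually_elim (simp add: R_eq)
  qed
  have pos: "0 \<le> (\<integral>x. Re (cnj (f1 x) * (\<integral>y. helmholtz_Phi k (x - y) * f1 y \<partial>lborel)) \<partial>lborel)"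
    by (rule helmholtz_pairing_nonneg[OF dim _ f1b f10 compact_imp_bounded[OF cS] dS]) measurable
  have "AE x in lborel. norm (u0 x) \<le> Linf_norm \<phi> + Linf_norm u powr (p / q - 1) *
     (Linf_norm Q * ((\<integral>x. h x \<partial>lborel) + c * measure lborel S) + 2 powr p * Linf_norm \<phi> powr p * Linf_norm Q * measure lborel S)"
    by (rule a_priori_estimate[where \<Phi> = "helmholtz_Phi k" and Q = Q1 and u = u0 and \<phi> = \<phi>0,
          OF _ h(1,2,3,4) pq _ fS _ Q1 Linf_esssup(2)[OF Q(1)] _ u0(1) _ \<phi>0(1) eq1[unfolded f1_def] pos[unfolded f1_def]])
      (simp_all add: helmholtz_Phi_measurable[OF dim])
  moreover have "measure lborel S = s"
    unfolding s_def S_def[symmetric] by (rule measure_completion[symmetric]) simp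
  ultimately have e: "AE x in lborel. norm (u0 x) \<le> Linf_norm \<phi> + Linf_norm u powr (p / q - 1) *
     (Linf_norm Q * ((\<integral>x. h x \<partial>lborel) + c * s) + 2 powr p * Linf_norm \<phi> powr p * Linf_norm Q * s)"
    by simp
  show ?thesis
    by (rule Linf_norm_le[OF u]) (use e u0(2) in \<open>eventually_elim, simp\<close>)
qed

text \<open>The order of quantifiers expresses the dependence of the constants: \<open>m\<close> and
  \<open>C\<close> are fixed before Q, \<phi> and u, and \<open>C\<close> sees Q only through two
  numbers.\<close>

theorem proposition5p2:
  fixes k p :: real
  assumes "CARD('n::finite) \<ge> 3"
    and "k > 0"
    and "2 < p" and "p < 2 * real CARD('n) / (real CARD('n) - 2)"
  shows "\<exists>(m::nat) (C :: real \<Rightarrow> real \<Rightarrow> real).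
    (\<forall>a b. C a b > 0) \<and>
    (\<forall>(Q :: real ^ 'n \<Rightarrow> real) (\<phi> :: real ^ 'n \<Rightarrow> complex).
       Q \<in> Linf \<and> compact (ess_support Q) \<and> \<not> (AE x in lebesgue. Q x = 0) \<and> \<phi> \<in> Linf \<and>
       (AE x in lebesgue. Q x \<le> 0) \<and>
       diameter (ess_support Q) \<le> bessel_Y_first_zero ((real CARD('n) - 2) / 2) / k \<longrightarrow>
       (\<forall>u \<in> Linf.
          (AE x in lebesgue.
             u x = helmholtz_R k (\<lambda>y. of_real (Q y * norm (u y) powr (p - 2)) * u y) x + \<phi> x) \<longrightarrow>
          Linf_norm u \<le> C (Linf_norm Q) (measure lebesgue (ess_support Q))
                          * (1 + Linf_norm \<phi> powr ((p - 1) ^ m))))"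
proof -
  define n where "n = CARD('n) - 2"
  have dim: "CARD('n) = n + 2" and n1: "n \<ge> 1" using assms(1) by (simp_all add: n_def)
  interpret helmholtz_kernel n k using n1 assms(2) by unfold_locales
  have diam: "bessel_Y_first_zero ((real CARD('n) - 2) / 2) / k = R"
    by (simp add: R_def z_def \<nu>_def dim)
  define w where "w = (real n + 2) / real n"
  \<comment> \<open>The midpoint of p/2 and min(p, w). Subcriticality of p says exactly that p/2 <
    w.\<close>
  define q where "q = p / 4 + min p w / 2"
  have "p / 2 < w" using assms(4) n1 by (simp add: dim w_def field_simps)
  then have q: "p / 2 < q" "q < p" "q < w" using assms(3) unfolding q_def by (auto simp: min_def)
  have q1: "q > 1" "q * real n < real n + 2" using q assms(3) n1 by (auto simp: w_def field_simps)
  obtain h :: "real ^ 'n \<Rightarrow> real" and c where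
    h: "integrable lborel h" "\<And>x. h x \<ge> 0" "c \<ge> 0" "\<And>x. norm (helmholtz_Phi k x) powr q \<le> h x + c"
    using helmholtz_Phi_powr_bound[OF dim _ q1(2)] q1(1) by auto
  define \<gamma> where "\<gamma> = 1 / (1 - (p / q - 1))"
  have \<alpha>: "0 \<le> p / q - 1" "p / q - 1 < 1" using q q1 by (auto simp: field_simps)
  \<comment> \<open>As p - 1 > 1, some power of it exceeds p\<gamma>; the exponent of the claim
    arises by rounding up, not from m rounds of an iteration.\<close>
  obtain m where m: "p * \<gamma> < (p - 1) ^ m" using real_arch_pow[of "p - 1" "p * \<gamma>"] assms(3) by auto
  define H where "H = (\<integral>x. h x \<partial>lborel)"
  have H: "H \<ge> 0" unfolding H_def using h(2) by simp
  \<comment> \<open>The constant of \<open>sublinear_absorption\<close> for the \<open>L\<close>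
    below. It is positive for all real arguments since \<open>powr\<close> takes no negative
    values.\<close>
  define C where "C b s = 2 + 2 * (4 * (b * (H + c * s + 2 powr p * s))) powr \<gamma>" for b s :: real
  show ?thesis
  proof (intro exI[of _ m] exI[of _ C] conjI allI impI ballI; (elim conjE)?)
    show "C b s > 0" for b s unfolding C_def by (intro add_pos_nonneg) auto
    fix Q :: "real ^ 'n \<Rightarrow> real" and \<phi> u :: "real ^ 'n \<Rightarrow> complex"
    assume Q: "Q \<in> Linf" "compact (ess_support Q)" "AE x in lebesgue. Q x \<le> 0"
      and d: "diameter (ess_support Q) \<le> bessel_Y_first_zero ((real CARD('n) - 2) / 2) / k"
      and \<phi>: "\<phi> \<in> Linf" and u: "u \<in> Linf"
      and eq: "AE x in lebesgue. u x = helmholtz_R k (\<lambda>y. of_real (Q y * norm (u y) powr (p - 2)) * u y) x + \<phi> x"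
    define a b M s where "a = Linf_norm \<phi>" and "b = Linf_norm Q" and "M = Linf_norm u" and "s = measure lebesgue (ess_support Q)"
    have nn: "a \<ge> 0" "b \<ge> 0" "M \<ge> 0" "s \<ge> 0"
      using Linf_esssup(2)[OF \<phi>] Linf_esssup(2)[OF Q(1)] Linf_esssup(2)[OF u] by (simp_all add: a_def b_def M_def s_def)
    define L where "L = b * (H + c * s + 2 powr p * s)"
    have L: "L \<ge> 0" using nn H h(3) by (simp add: L_def)
    have "M \<le> a + M powr (p / q - 1) * (b * (H + c * s) + 2 powr p * a powr p * b * s)"
      using helmholtz_sup_norm_estimate[OF dim assms(3) q1(1) q(2) h Q(1,3,2) d[unfolded diam] \<phi> u eq]
      by (simp only: a_def b_def M_def s_def H_def)
    also have "\<dots> \<le> a + M powr (p / q - 1) * (L * (1 + a powr p))"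
    proof (intro add_left_mono mult_left_mono)
      have "L * (1 + a powr p) = b * (H + c * s) + 2 powr p * a powr p * b * s + (b * (H + c * s) * a powr p + b * (2 powr p * s))"
        by (simp add: L_def algebra_simps)
      moreover have "0 \<le> b * (H + c * s) * a powr p + b * (2 powr p * s)"
        using nn H h(3) by (intro add_nonneg_nonneg mult_nonneg_nonneg) auto
      ultimately show "b * (H + c * s) + 2 powr p * a powr p * b * s \<le> L * (1 + a powr p)" by linarith
    qed simp
    finally have "M \<le> (2 + 2 * (4 * L) powr \<gamma>) * (1 + a powr ((p - 1) ^ m))"
      by (rule sublinear_absorption[OF nn(3) _ nn(1) \<alpha> L _ \<gamma>_def]) (use assms(3) m in auto)
    then show "Linf_norm u \<le> C (Linf_norm Q) (measure lebesgue (ess_support Q)) * (1 + Linf_norm \<phi> powr ((p - 1) ^ m))"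
      by (simp only: C_def L_def a_def b_def M_def s_def)
  qed
qed

end
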